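(* If $d<3\alpha$ and the correlation length condition (CL) holds then \[\mathbb{P}_{\beta_c}(|K|\geq n) \asymp n^{-(d-\alpha)/(d+\alpha)} \qquad \text{ and } \qquad \mathbb{E}_{\beta_c}|K \cap B_r|^p \asymp_p r^{\alpha+(p-1)\frac{d+\alpha}{2}}\] for every $n,r\geq 1$ and integer $p\geq 1$. In particular, the exponents $\delta$ and $d_f$ are well-defined and given by $\delta=(d+\alpha)/(d-\alpha)$ and $d_f=(d+\alpha)/2$ respectively.
   Context: Setting: fix an integer $d\geq 1$, a real $\alpha>0$, a norm $\|\cdot\|$ on $\mathbb{R}^d$, and a kernel of the form $J(x,y)=\mathbf{1}(x\neq y)J(\|x-y\|)$ for $x,y\in\mathbb{Z}^d$, where $J:(0,\infty)\to(0,\infty)$ is decreasing and differentiable, tends to $0$ at infinity (so that $J(x,y)\sim \mathrm{const.}\,\|x-y\|^{-d-\alpha}$), and satisfies $|J'(r)|=C(1+\delta_r)r^{-d-\alpha-1}$ for some constant $C>0$ and some measurable error function $r\mapsto\delta_r$ with $\delta_r\to0$ as $r\to\infty$ and $\int_{r_0}^\infty \frac{|\delta_r|}{r}\,dr<\infty$ for some $r_0<\infty$. Long-range percolation with parameter $\beta\ge 0$ is the random graph on $\mathbb{Z}^d$ in which each pair of distinct vertices $x,y$ is joined by an (open) edge independently with probability $1-e^{-\beta J(x,y)}$; $\mathbb{P}_\beta,\mathbb{E}_\beta$ denote its law and expectation. The critical point is $\beta_c=\inf\{\beta\ge0:\mathbb{P}_\beta(\text{there is an infinite cluster})>0\}$,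 where clusters are connected components. $K$ denotes the cluster of the origin, and $B_r=\{x\in\mathbb{Z}^d:\|x\|\leq r\}$. Cut-off measures: for $r>0$ let $J_r(x,y)=\mathbf{1}(x\neq y,\|x-y\|\le r)\int_{\|x-y\|}^r|J'(s)|\,ds$, and let $\mathbb{P}_{\beta,r},\mathbb{E}_{\beta,r}$ denote the law and expectation of long-range percolation with kernel $J_r$ at parameter $\beta$. $\beta_c$ always denotes the critical point of the original kernel $J$. For $p>0$ define the $L^p$ radius of gyration $\xi_p(\beta_c,r)=\left[\mathbb{E}_{\beta_c,r}\left[\sum_{x\in K}\|x\|_2^p\right]/\mathbb{E}_{\beta_c,r}|K|\right]^{1/p}$. Condition (CL): $\beta_c<\infty$ and for each $p>0$ there exists a constant $C_p<\infty$ such that $\xi_p(\beta_c,r)\le C_p r$ for every $r\ge1$. (The case $\alpha=d$ is not excluded; there $\delta$ is read as $\infty$, i.e. $1/\delta=0$.) The exponents $\delta$ and $d_f$ are defined (if they exist) by $\mathbb{P}_{\beta_c}(|K|\ge n)=n^{-1/\delta\pm o(1)}$ as $n\to\infty$ and $\mathbb{E}_{\beta_c}|K\cap B_r|^2/\mathbb{E}_{\beta_c}|K\cap B_r|=r^{d_f\pm o(1)}$ as $r\to\infty$. The notation $\asymp$ means equality up to positive multiplicative constants depending only on $d$, $\alpha$, and the kernel $J$ (including the norm); $\asymp_p$ means that the constants may additionally depend on $p$. *)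

theory Defs
  imports "HOL-Probability.Probability"
begin

section \<open>Long-range percolation for a general symmetric kernel\<close>

text \<open>
  A configuration is a set of open edges, given by its indicator on unordered pairs of
  distinct vertices.
\<close>

definition edges :: "'v set set" where
  "edges = {e. \<exists>x y. x \<noteq> y \<and> e = {x, y}}"

text \<open>The value of a kernel on an unordered pair; it is only meaningful for symmetric kernels.\<close>

definition edge_weight :: "('v \<Rightarrow> 'v \<Rightarrow> real) \<Rightarrow> 'v set \<Rightarrow> real" where
  "edge_weight k e = (THE w. \<exists>x y. e = {x, y} \<and> w = k x y)"

lemma edge_weight_eq:
  assumes "\<And>x y. k x y = k y x"
  shows "edge_weight k {x, y} = k x y"
  unfolding edge_weight_def
  by (rule the_equality) (use assms in \<open>auto simp: doubleton_eq_iff\<close>)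

definition percolation :: "('v \<Rightarrow> 'v \<Rightarrow> real) \<Rightarrow> real \<Rightarrow> ('v set \<Rightarrow> bool) measure" where
  "percolation k \<beta> =
     PiM edges (\<lambda>e. measure_pmf (bernoulli_pmf (1 - exp (- \<beta> * edge_weight k e))))"

definition open_adj :: "('v set \<Rightarrow> bool) \<Rightarrow> 'v \<Rightarrow> 'v \<Rightarrow> bool" where
  "open_adj \<omega> x y \<longleftrightarrow> x \<noteq> y \<and> \<omega> {x, y}"

definition cluster :: "('v set \<Rightarrow> bool) \<Rightarrow> 'v \<Rightarrow> 'v set" where
  "cluster \<omega> x = {y. (open_adj \<omega>)\<^sup>*\<^sup>* x y}"

text \<open>The number of elements, with value \<open>\<infinity>\<close> for infinite sets.\<close>

definition size_of :: "'v set \<Rightarrow> ennreal" where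
  "size_of A = emeasure (count_space UNIV) A"

text \<open>The value is \<open>\<infinity>\<close> if there is no percolation at any parameter.\<close>

definition critical_point :: "('v \<Rightarrow> 'v \<Rightarrow> real) \<Rightarrow> ereal" where
  "critical_point k =
     Inf (ereal ` {\<beta>. 0 \<le> \<beta> \<and> \<P>(\<omega> in percolation k \<beta>. \<exists>x. infinite (cluster \<omega> x)) > 0})"

section \<open>Kernels on the integer lattice\<close>

text \<open>Vertices are elements of \<open>int ^ 'd\<close>, and the dimension is \<open>CARD('d)\<close>.\<close>

definition real_vec :: "int ^ 'd \<Rightarrow> real ^ 'd" where
  "real_vec x = (\<chi> i. real_of_int (x $ i))"

definition is_norm :: "('a::real_vector \<Rightarrow> real) \<Rightarrow> bool" where
  "is_norm N \<longleftrightarrow>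
     (\<forall>x. 0 \<le> N x) \<and> (\<forall>x. N x = 0 \<longleftrightarrow> x = 0) \<and>
     (\<forall>c x. N (c *\<^sub>R x) = \<bar>c\<bar> * N x) \<and>
     (\<forall>x y. N (x + y) \<le> N x + N y)"

definition admissible_profile :: "nat \<Rightarrow> real \<Rightarrow> (real \<Rightarrow> real) \<Rightarrow> bool" where
  "admissible_profile d \<alpha> J \<longleftrightarrow>
     (\<forall>r>0. J r > 0) \<and>
     antimono_on {0<..} J \<and>
     (\<forall>r>0. J differentiable (at r)) \<and>
     (J \<longlongrightarrow> 0) at_top \<and>
     (\<exists>C>0. \<exists>\<delta>.
        set_borel_measurable borel {0<..} \<delta> \<and>
        (\<delta> \<longlongrightarrow> 0) at_top \<and>
        (\<exists>r\<^sub>0>0. set_integrable lborel {r\<^sub>0..} (\<lambda>r. \<bar>\<delta> r\<bar> / r)) \<and>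
        (\<forall>r>0. \<bar>deriv J r\<bar> = C * (1 + \<delta> r) * r powr (- real d - \<alpha> - 1)))"

definition lattice_kernel ::
  "(real ^ 'd \<Rightarrow> real) \<Rightarrow> (real \<Rightarrow> real) \<Rightarrow> int ^ 'd \<Rightarrow> int ^ 'd \<Rightarrow> real" where
  "lattice_kernel N J x y = (if x \<noteq> y then J (N (real_vec (x - y))) else 0)"

definition cutoff_kernel ::
  "(real ^ 'd \<Rightarrow> real) \<Rightarrow> (real \<Rightarrow> real) \<Rightarrow> real \<Rightarrow> int ^ 'd \<Rightarrow> int ^ 'd \<Rightarrow> real" where
  "cutoff_kernel N J r x y =
     (if x \<noteq> y \<and> N (real_vec (x - y)) \<le> r
      then set_lebesgue_integral lborel {N (real_vec (x - y))..r} (\<lambda>s. \<bar>deriv J s\<bar>)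
      else 0)"

definition lattice_ball :: "(real ^ 'd \<Rightarrow> real) \<Rightarrow> real \<Rightarrow> (int ^ 'd) set" where
  "lattice_ball N r = {x. N (real_vec x) \<le> r}"

section \<open>The critical and cut-off measures\<close>

abbreviation beta_crit :: "(real ^ 'd \<Rightarrow> real) \<Rightarrow> (real \<Rightarrow> real) \<Rightarrow> ereal" where
  "beta_crit N J \<equiv> critical_point (lattice_kernel N J)"

definition critical_law ::
  "(real ^ 'd \<Rightarrow> real) \<Rightarrow> (real \<Rightarrow> real) \<Rightarrow> ((int ^ 'd) set \<Rightarrow> bool) measure" where
  "critical_law N J = percolation (lattice_kernel N J) (real_of_ereal (beta_crit N J))"

definition cutoff_law ::
  "(real ^ 'd \<Rightarrow> real) \<Rightarrow> (real \<Rightarrow> real) \<Rightarrow> real \<Rightarrow> ((int ^ 'd) set \<Rightarrow> bool) measure" where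
  "cutoff_law N J r = percolation (cutoff_kernel N J r) (real_of_ereal (beta_crit N J))"

definition gyration_moment ::
  "(real ^ 'd \<Rightarrow> real) \<Rightarrow> (real \<Rightarrow> real) \<Rightarrow> real \<Rightarrow> real \<Rightarrow> ennreal" where
  "gyration_moment N J p r =
     (\<integral>\<^sup>+ \<omega>. (\<integral>\<^sup>+ x. ennreal (norm (real_vec x) powr p) \<partial>count_space (cluster \<omega> 0))
        \<partial>cutoff_law N J r)"

text \<open>
  The radius of gyration at the critical point of the original kernel; \<open>norm\<close> is the Euclidean
  norm. An infinite numerator gives the value \<open>\<infinity>\<close>, because \<open>\<infinity> / \<infinity> = 0\<close> in \<open>ennreal\<close>.
  The denominator is at least 1, and it is infinite only if the numerator is.
\<close>

definition gyration_radius ::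
  "(real ^ 'd \<Rightarrow> real) \<Rightarrow> (real \<Rightarrow> real) \<Rightarrow> real \<Rightarrow> real \<Rightarrow> ennreal" where
  "gyration_radius N J p r =
     (if gyration_moment N J p r = \<infinity> then \<infinity>
      else ennreal (enn2real (gyration_moment N J p r /
             (\<integral>\<^sup>+ \<omega>. size_of (cluster \<omega> 0) \<partial>cutoff_law N J r)) powr (1 / p)))"

definition correlation_length_condition ::
  "(real ^ 'd \<Rightarrow> real) \<Rightarrow> (real \<Rightarrow> real) \<Rightarrow> bool" where
  "correlation_length_condition N J \<longleftrightarrow>
     beta_crit N J < \<infinity> \<and>
     (\<forall>p>0. \<exists>C. \<forall>r\<ge>1. gyration_radius N J p r \<le> ennreal (C * r))"

definition cluster_tail :: "(real ^ 'd \<Rightarrow> real) \<Rightarrow> (real \<Rightarrow> real) \<Rightarrow> nat \<Rightarrow> real" where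
  "cluster_tail N J n = \<P>(\<omega> in critical_law N J. of_nat n \<le> size_of (cluster \<omega> 0))"

definition ball_moment ::
  "(real ^ 'd \<Rightarrow> real) \<Rightarrow> (real \<Rightarrow> real) \<Rightarrow> nat \<Rightarrow> real \<Rightarrow> real" where
  "ball_moment N J p r =
     (\<integral> \<omega>. real (card (cluster \<omega> 0 \<inter> lattice_ball N r)) ^ p \<partial>critical_law N J)"

section \<open>Asymptotic comparison and critical exponents\<close>

definition comparable_on :: "'a set \<Rightarrow> ('a \<Rightarrow> real) \<Rightarrow> ('a \<Rightarrow> real) \<Rightarrow> bool" where
  "comparable_on S f g \<longleftrightarrow>
     (\<exists>c>0. \<exists>C>0. \<forall>x\<in>S. c * g x \<le> f x \<and> f x \<le> C * g x)"

text \<open>The exponent \<open>\<delta> = \<infinity>\<close> is allowed, with \<open>1 / \<infinity> = 0\<close>.\<close>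

definition is_delta_exponent ::
  "(real ^ 'd \<Rightarrow> real) \<Rightarrow> (real \<Rightarrow> real) \<Rightarrow> ereal \<Rightarrow> bool" where
  "is_delta_exponent N J \<delta> \<longleftrightarrow>
     0 < \<delta> \<and>
     (\<exists>\<epsilon>. \<epsilon> \<longlonglongrightarrow> 0 \<and>
        (\<forall>\<^sub>F n in sequentially.
           cluster_tail N J n = real n powr (- real_of_ereal (1 / \<delta>) + \<epsilon> n)))"

definition is_fractal_dimension ::
  "(real ^ 'd \<Rightarrow> real) \<Rightarrow> (real \<Rightarrow> real) \<Rightarrow> real \<Rightarrow> bool" where
  "is_fractal_dimension N J s \<longleftrightarrow>
     (\<exists>\<epsilon>. (\<epsilon> \<longlongrightarrow> 0) at_top \<and>
        (\<forall>\<^sub>F r in at_top.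
           ball_moment N J 2 r / ball_moment N J 1 r = r powr (s + \<epsilon> r)))"

end

(*
  For a cluster K write M_r(h) = E(1 - exp(-h|K|)) for the magnetization of the model cut off at
  range r, and t_r for the total weight at the critical point of the part of J that the cut-off
  removes, so that t_r is of order r^(-alpha).

  Sprinkling the edges removed by the cut-off bounds M_R(h) by M_r(h + (t_r - t_R) M_R(h)) for r < R.
  In the other direction the integral of M_r is controlled, through a Hamilton-Jacobi inequality in
  the cut-off parameter, by h^2/(2 t_r) plus an error governed by the mean volume of the cluster in
  a ball. That mean volume is at most of order r^alpha: otherwise typical large clusters in disjoint
  balls would be joined at a larger scale, and the normalized volume would stay large along a
  diverging sequence of scales, contradicting sharpness below the critical point. For d < 3 alpha the
  error is negligible, and descending through the scales yields M_r(h) <= h/(2 t_r) for all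
  h >= const r^(-(d+alpha)/2). This is the upper bound on the cluster tail; a bootstrap based on the
  BK inequality turns it into the moment bounds.

  For the lower bounds, criticality forces the mean cluster size at cut-off r to be at least 1/t_r.
  By (CL) this mean is carried by a ball of radius O(r), and by the upper bound for M_r it is carried
  by clusters of size at least const r^((d+alpha)/2); the second moment then gives the tail.
*)
theory Submission
 imports Defs
begin

section \<open>Expectations over random subsets of a finite set\<close>

text \<open>All estimates are proved on finite graphs, uniformly in the graph, and reach the
  percolation measure by monotone limits. Since weights add under independent superposition,
  derivatives in the kernel become exact sprinkling steps. The Hamilton-Jacobi inequality concerns
  I(b), the integral of M over fields in [0, b]: when clusters of sizes a and c merge, the sum over
  vertices of the matching functional grows by (1 - exp(-b a)) (1 - exp(-b c)). FKG bounds the mean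
  of this product below by M^2 minus the probability that the two ends are already connected; that
  probability is the volume error. The obstacle is criticality itself: the volume bound is proved by
  contradiction with a finite mean cluster size, which sharpness supplies only below
  \<open>bc\<close>. Hence it is proved for \<beta> < \<open>bc\<close> with constants uniform in
  \<beta>, and passed to \<open>bc\<close> by continuity on each finite graph. The condition d < 3
  \<alpha> is an exponent count: descending from range r to r / l raises a violating field by a
  factor of order l^(2 \<alpha>), while the field threshold rises by l^((d + \<alpha>) / 2).\<close>

text \<open>Each \<open>e \<in> E\<close> is present independently with probability \<open>1 - exp (- k e)\<close>.\<close>

definition expct :: "('e \<Rightarrow> real) \<Rightarrow> 'e set \<Rightarrow> ('e set \<Rightarrow> real) \<Rightarrow> real" where
 "expct k E f = (\<Sum>A\<in>Pow E. (\<Prod>e\<in>A. 1 - exp (- k e)) * (\<Prod>e\<in>E - A. exp (- k e)) * f A)"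

lemma expct_empty [simp]: "expct k {} f = f {}"
 by (simp add: expct_def)

lemma expct_insert:
 assumes "finite E" "e \<notin> E"
 shows "expct k (insert e E) f =
  exp (- k e) * expct k E f + (1 - exp (- k e)) * expct k E (\<lambda>A. f (insert e A))"
proof -
 let ?w = "\<lambda>F A. (\<Prod>e\<in>A. 1 - exp (- k e)) * (\<Prod>e\<in>F - A. exp (- k e))"
 have inj: "inj_on (insert e) (Pow E)"
  using assms by (auto simp: inj_on_def)
 have 1: "?w (insert e E) A = exp (- k e) * ?w E A" if "A \<subseteq> E" for A
 proof -
  have "insert e E - A = insert e (E - A)" "e \<notin> E - A" "finite (E - A)"
   using assms that by auto
  then show ?thesis by simp
 qed
 have 2: "?w (insert e E) (insert e A) = (1 - exp (- k e)) * ?w E A" if "A \<subseteq> E" for A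
 proof -
  have "insert e E - insert e A = E - A" "e \<notin> A" "finite A"
   using assms that finite_subset by auto
  then show ?thesis by simp
 qed
 have "expct k (insert e E) f =
   (\<Sum>A\<in>Pow E. ?w (insert e E) A * f A) + (\<Sum>A\<in>insert e ` Pow E. ?w (insert e E) A * f A)"
  unfolding expct_def Pow_insert
  by (rule sum.union_disjoint) (use assms in auto)
 also have "(\<Sum>A\<in>insert e ` Pow E. ?w (insert e E) A * f A) =
   (\<Sum>A\<in>Pow E. ?w (insert e E) (insert e A) * f (insert e A))"
  by (subst sum.reindex[OF inj]) simp
 also have "\<dots> = (1 - exp (- k e)) * expct k E (\<lambda>A. f (insert e A))"
  unfolding expct_def sum_distrib_left
  by (rule sum.cong[OF refl]) (use 2 in \<open>auto simp: mult.assoc\<close>)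
 also have "(\<Sum>A\<in>Pow E. ?w (insert e E) A * f A) = exp (- k e) * expct k E f"
  unfolding expct_def sum_distrib_left
  by (rule sum.cong[OF refl]) (use 1 in \<open>auto simp: mult.assoc\<close>)
 finally show ?thesis .
qed

lemma expct_cong: "(\<And>A. A \<subseteq> E \<Longrightarrow> f A = g A) \<Longrightarrow> expct k E f = expct k E g"
 unfolding expct_def by (rule sum.cong) auto

lemma expct_weight_cong: "(\<And>e. e \<in> E \<Longrightarrow> k e = k' e) \<Longrightarrow> expct k E f = expct k' E f"
 unfolding expct_def by (intro sum.cong arg_cong2[where f=times] prod.cong) auto

lemma expct_const [simp]: "finite E \<Longrightarrow> expct k E (\<lambda>_. c) = c"
 by (induction E rule: finite_induct) (auto simp: expct_insert algebra_simps)

lemma expct_add: "expct k E (\<lambda>A. f A + g A) = expct k E f + expct k E g"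
 unfolding expct_def by (simp add: algebra_simps sum.distrib)

lemma expct_diff: "expct k E (\<lambda>A. f A - g A) = expct k E f - expct k E g"
 unfolding expct_def by (simp add: algebra_simps sum_subtractf)

lemma expct_cmult: "expct k E (\<lambda>A. c * f A) = c * expct k E f"
 unfolding expct_def sum_distrib_left by (simp add: algebra_simps)

lemma expct_multc: "expct k E (\<lambda>A. f A * c) = expct k E f * c"
 unfolding expct_def sum_distrib_right by (simp add: algebra_simps)

lemma expct_sum: "expct k E (\<lambda>A. \<Sum>x\<in>X. f x A) = (\<Sum>x\<in>X. expct k E (f x))"
 unfolding expct_def sum_distrib_left by (rule sum.swap)

lemma expct_mono:
 assumes "\<And>e. 0 \<le> k e" "\<And>A. A \<subseteq> E \<Longrightarrow> f A \<le> g A"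
 shows "expct k E f \<le> expct k E g"
 unfolding expct_def
 by (intro sum_mono mult_left_mono mult_nonneg_nonneg prod_nonneg) (use assms in auto)

lemma expct_nonneg:
 assumes "\<And>e. 0 \<le> k e" "\<And>A. A \<subseteq> E \<Longrightarrow> 0 \<le> f A"
 shows "0 \<le> expct k E f"
 unfolding expct_def
 by (intro sum_nonneg mult_nonneg_nonneg prod_nonneg) (use assms in auto)

lemma expct_le_const:
 assumes "\<And>e. 0 \<le> k e" "finite E" "\<And>A. A \<subseteq> E \<Longrightarrow> f A \<le> c"
 shows "expct k E f \<le> c"
 using expct_mono[of k E f "\<lambda>_. c"] assms by simp

lemma expct_swap:
 "expct k E (\<lambda>A. expct k' F (\<lambda>B. f A B)) = expct k' F (\<lambda>B. expct k E (\<lambda>A. f A B))"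
 unfolding expct_def sum_distrib_left
 by (subst sum.swap) (simp add: algebra_simps)

lemma expct_Un:
 assumes "finite E" "finite F" "E \<inter> F = {}"
 shows "expct k (E \<union> F) f = expct k E (\<lambda>A. expct k F (\<lambda>B. f (A \<union> B)))"
 using assms(1,3)
proof (induction E arbitrary: f rule: finite_induct)
 case (insert e E)
 have "expct k (insert e E \<union> F) f = expct k (insert e (E \<union> F)) f" by simp
 also have "\<dots> = exp (- k e) * expct k (E \<union> F) f + (1 - exp (- k e)) * expct k (E \<union> F) (\<lambda>A. f (insert e A))"
  by (rule expct_insert) (use insert assms in auto)
 finally show ?case using insert by (simp add: expct_insert)
qed simp

text \<open>An edge is closed in the union of two independent configurations with the product of the
  probabilities \<open>exp (- k e)\<close> and \<open>exp (- k' e)\<close>. Raising a kernel is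
  therefore the same as sprinkling independent extra edges.\<close>

lemma expct_add_weight:
 assumes "finite E"
 shows "expct (\<lambda>e. k e + k' e) E f = expct k E (\<lambda>A. expct k' E (\<lambda>B. f (A \<union> B)))"
 using assms
proof (induction E arbitrary: f rule: finite_induct)
 case (insert e E)
 define a b where "a = exp (- k e)" and "b = exp (- k' e)"
 have ab: "exp (- (k e + k' e)) = a * b"
  by (simp add: a_def b_def exp_add[symmetric])
 show ?case
  unfolding expct_insert[OF insert.hyps(1,2)] insert.IH ab a_def[symmetric] b_def[symmetric]
  by (simp add: expct_add expct_cmult expct_diff algebra_simps)
qed simp

lemma expct_restrict:
 assumes "finite E" "E \<subseteq> F" "finite F"
 shows "expct k F (\<lambda>A. f (A \<inter> E)) = expct k E f"
proof -
 have "expct k F (\<lambda>A. f (A \<inter> E)) = expct k (E \<union> (F - E)) (\<lambda>A. f (A \<inter> E))"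
  using assms by (simp add: Un_absorb1)
 also have "\<dots> = expct k E (\<lambda>A. expct k (F - E) (\<lambda>B. f ((A \<union> B) \<inter> E)))"
  by (rule expct_Un) (use assms in auto)
 also have "\<dots> = expct k E (\<lambda>A. expct k (F - E) (\<lambda>B. f A))"
  by (intro expct_cong arg_cong[where f=f]) auto
 finally show ?thesis using assms by simp
qed

lemma expct_reindex:
 assumes "finite E" "inj_on T E"
 shows "expct k (T ` E) f = expct (\<lambda>e. k (T e)) E (\<lambda>A. f (T ` A))"
 using assms
 by (induction E arbitrary: f rule: finite_induct) (auto simp: expct_insert)

section \<open>Positive association of increasing functionals\<close>

definition increasing_on :: "'e set \<Rightarrow> ('e set \<Rightarrow> real) \<Rightarrow> bool" where
 "increasing_on E f \<longleftrightarrow> (\<forall>A B. A \<subseteq> B \<longrightarrow> B \<subseteq> E \<longrightarrow> f A \<le> f B)"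

lemma increasing_onD: "increasing_on E f \<Longrightarrow> A \<subseteq> B \<Longrightarrow> B \<subseteq> E \<Longrightarrow> f A \<le> f B"
 by (simp add: increasing_on_def)

lemma increasing_on_subset: "increasing_on E f \<Longrightarrow> F \<subseteq> E \<Longrightarrow> increasing_on F f"
 unfolding increasing_on_def by blast

lemma increasing_on_insert:
 assumes "increasing_on (insert e E) f"
 shows "increasing_on E (\<lambda>A. f (insert e A))"
 unfolding increasing_on_def
proof (intro allI impI)
 fix A B assume "A \<subseteq> B" "B \<subseteq> E"
 then have "insert e A \<subseteq> insert e B" "insert e B \<subseteq> insert e E" by auto
 then show "f (insert e A) \<le> f (insert e B)" by (rule increasing_onD[OF assms])
qed

lemma expct_mono_set:
 assumes "\<And>e. 0 \<le> k e" "increasing_on F f" "finite F" "E \<subseteq> F"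
 shows "expct k E f \<le> expct k F f"
proof -
 have "finite E" using assms finite_subset by auto
 then have "expct k E f = expct k F (\<lambda>A. f (A \<inter> E))"
  using assms by (simp add: expct_restrict)
 also have "\<dots> \<le> expct k F f"
  by (rule expct_mono[OF assms(1) increasing_onD[OF assms(2)]]) auto
 finally show ?thesis .
qed

lemma expct_mono_weight:
 assumes "\<And>e. 0 \<le> k e" "\<And>e. e \<in> E \<Longrightarrow> k e \<le> k' e" "increasing_on E f" "finite E"
 shows "expct k E f \<le> expct k' E f"
proof -
 let ?d = "\<lambda>e. if e \<in> E then k' e - k e else 0"
 have "expct k E f = expct k E (\<lambda>A. expct ?d E (\<lambda>B. f A))"
  using assms by simp
 also have "\<dots> \<le> expct k E (\<lambda>A. expct ?d E (\<lambda>B. f (A \<union> B)))"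
  by (rule expct_mono[OF assms(1) expct_mono])
    (use assms in \<open>auto intro!: increasing_onD[OF assms(3)]\<close>)
 also have "\<dots> = expct k' E f"
  by (subst expct_add_weight[symmetric]) (auto simp: assms intro: expct_weight_cong)
 finally show ?thesis .
qed

lemma expct_Cauchy_Schwarz:
 assumes "\<And>e. 0 \<le> k e"
 shows "(expct k E (\<lambda>A. f A * g A))\<^sup>2 \<le> expct k E (\<lambda>A. (f A)\<^sup>2) * expct k E (\<lambda>A. (g A)\<^sup>2)"
proof -
 define w where "w A = (\<Prod>e\<in>A. 1 - exp (- k e)) * (\<Prod>e\<in>E - A. exp (- k e))" for A
 have w: "w A \<ge> 0" for A
  unfolding w_def by (intro mult_nonneg_nonneg prod_nonneg) (use assms in auto)
 have "(\<Sum>A\<in>Pow E. (sqrt (w A) * f A) * (sqrt (w A) * g A))\<^sup>2 \<le>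
   (\<Sum>A\<in>Pow E. (sqrt (w A) * f A)\<^sup>2) * (\<Sum>A\<in>Pow E. (sqrt (w A) * g A)\<^sup>2)"
  by (rule Cauchy_Schwarz_ineq_sum)
 moreover have "(sqrt (w A) * f A) * (sqrt (w A) * g A) = w A * (f A * g A)" for A
  using w[of A] by (simp add: algebra_simps flip: real_sqrt_mult)
 ultimately show ?thesis
  using w by (simp add: expct_def power_mult_distrib flip: w_def)
qed

text \<open>Induction over edges: conditioning on one edge leaves, besides the inductive bound, the
  covariance of two increasing functions of a single bit, which is
  \<open>?p * (1 - ?p) * ((f1 - f0) * (g1 - g0))\<close> and nonnegative.\<close>

lemma expct_FKG:
 assumes "\<And>e. 0 \<le> k e" "finite E" "increasing_on E f" "increasing_on E g"
 shows "expct k E f * expct k E g \<le> expct k E (\<lambda>A. f A * g A)"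
 using assms(2-)
proof (induction E arbitrary: f g rule: finite_induct)
 case (insert e E)
 let ?p = "exp (- k e)"
 have p: "0 \<le> ?p" "?p \<le> 1" using assms(1) by auto
 note inc = insert.prems[THEN increasing_on_insert]
 have sub: "increasing_on E f" "increasing_on E g"
  using insert.prems increasing_on_subset[of "insert e E" _ E] by auto
 define f0 g0 f1 g1 where
  "f0 = expct k E f" and "g0 = expct k E g" and
  "f1 = expct k E (\<lambda>A. f (insert e A))" and "g1 = expct k E (\<lambda>A. g (insert e A))"
 have "f0 \<le> f1" "g0 \<le> g1"
  unfolding f0_def f1_def g0_def g1_def
  by (rule expct_mono[OF assms(1)], rule increasing_onD, rule insert.prems, auto)+
 then have *: "0 \<le> ?p * (1 - ?p) * ((f1 - f0) * (g1 - g0))"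
  using p by (intro mult_nonneg_nonneg) auto
 have "expct k (insert e E) f * expct k (insert e E) g =
   (?p * f0 + (1 - ?p) * f1) * (?p * g0 + (1 - ?p) * g1)"
  using insert.hyps by (simp add: expct_insert f0_def f1_def g0_def g1_def)
 also have "\<dots> = ?p * (f0 * g0) + (1 - ?p) * (f1 * g1) - ?p * (1 - ?p) * ((f1 - f0) * (g1 - g0))"
  by algebra
 also have "\<dots> \<le> ?p * (f0 * g0) + (1 - ?p) * (f1 * g1)" using * by simp
 also have "\<dots> \<le> ?p * expct k E (\<lambda>A. f A * g A) + (1 - ?p) * expct k E (\<lambda>A. f (insert e A) * g (insert e A))"
  unfolding f0_def f1_def g0_def g1_def
  by (intro add_mono mult_left_mono insert.IH[OF sub] insert.IH[OF inc]) (use p in auto)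
 finally show ?case using insert.hyps by (simp add: expct_insert)
qed simp

lemma expct_FKG_prod:
 assumes "\<And>e. 0 \<le> k e" "finite E" "finite X"
  and "\<And>x A B. x \<in> X \<Longrightarrow> A \<subseteq> B \<Longrightarrow> B \<subseteq> E \<Longrightarrow> f x B \<le> f x A" "\<And>x A. x \<in> X \<Longrightarrow> 0 \<le> f x A"
 shows "(\<Prod>x\<in>X. expct k E (f x)) \<le> expct k E (\<lambda>A. \<Prod>x\<in>X. f x A)"
 using assms(3-)
proof (induction X rule: finite_induct)
 case empty
 then show ?case using assms(2) by simp
next
 case (insert x X)
 have pos: "\<And>y A. y \<in> X \<Longrightarrow> 0 \<le> f y A" and posx: "\<And>A. 0 \<le> f x A"
  using insert.prems(2) by blast+
 have anti: "\<And>y A B. y \<in> X \<Longrightarrow> A \<subseteq> B \<Longrightarrow> B \<subseteq> E \<Longrightarrow> f y B \<le> f y A"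
  and antix: "\<And>A B. A \<subseteq> B \<Longrightarrow> B \<subseteq> E \<Longrightarrow> f x B \<le> f x A"
  using insert.prems(1) by blast+
 have "increasing_on E (\<lambda>A. - f x A)"
  unfolding increasing_on_def neg_le_iff_le by (blast intro: antix)

 moreover have "increasing_on E (\<lambda>A. - (\<Prod>x\<in>X. f x A))"
  unfolding increasing_on_def
  unfolding neg_le_iff_le by (blast intro: prod_mono pos anti)
 ultimately have "expct k E (\<lambda>A. - f x A) * expct k E (\<lambda>A. - (\<Prod>x\<in>X. f x A))
   \<le> expct k E (\<lambda>A. (- f x A) * (- (\<Prod>x\<in>X. f x A)))"
  by (intro expct_FKG assms)
 then have *: "expct k E (f x) * expct k E (\<lambda>A. \<Prod>x\<in>X. f x A) \<le> expct k E (\<lambda>A. f x A * (\<Prod>x\<in>X. f x A))"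
  using expct_cmult[of k E "-1"] by simp
 have "(\<Prod>x\<in>insert x X. expct k E (f x)) = expct k E (f x) * (\<Prod>x\<in>X. expct k E (f x))"
  using insert.hyps by simp
 also have "\<dots> \<le> expct k E (f x) * expct k E (\<lambda>A. \<Prod>x\<in>X. f x A)"
  by (rule mult_left_mono[OF insert.IH[OF anti pos] expct_nonneg[OF assms(1) posx]])
 finally show ?case using * insert.hyps by simp
qed

section \<open>Disjoint occurrence and the van den Berg-Kesten inequality\<close>

abbreviation prb :: "('e \<Rightarrow> real) \<Rightarrow> 'e set \<Rightarrow> ('e set \<Rightarrow> bool) \<Rightarrow> real" where
 "prb k E P \<equiv> expct k E (\<lambda>A. of_bool (P A))"

definition up_closed :: "('e set \<Rightarrow> bool) \<Rightarrow> bool" where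
 "up_closed P \<longleftrightarrow> (\<forall>A B. A \<subseteq> B \<longrightarrow> P A \<longrightarrow> P B)"

lemma up_closedD: "up_closed P \<Longrightarrow> P A \<Longrightarrow> A \<subseteq> B \<Longrightarrow> P B"
 unfolding up_closed_def by blast

lemma up_closed_insert: "up_closed P \<Longrightarrow> up_closed (\<lambda>A. P (insert e A))"
proof (unfold up_closed_def, intro allI impI)
 fix A B
 assume "\<forall>A B. A \<subseteq> B \<longrightarrow> P A \<longrightarrow> P B" "A \<subseteq> B" "P (insert e A)"
 moreover have "insert e A \<subseteq> insert e B" using \<open>A \<subseteq> B\<close> by auto
 ultimately show "P (insert e B)" by blast
qed

lemma increasing_of_bool [intro]: "up_closed P \<Longrightarrow> increasing_on E (\<lambda>A. of_bool (P A))"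
 unfolding increasing_on_def using up_closedD[of P] by (auto simp: of_bool_def)

text \<open>The witnesses consist of open edges only. For up-closed events this is the usual notion:
  the edges of \<open>I\<close>, with all others closed, already force \<open>P\<close>.\<close>

definition disjoint_occ :: "('e set \<Rightarrow> bool) \<Rightarrow> ('e set \<Rightarrow> bool) \<Rightarrow> 'e set \<Rightarrow> bool" where
 "disjoint_occ P Q A \<longleftrightarrow> (\<exists>I J. I \<inter> J = {} \<and> I \<union> J \<subseteq> A \<and> P I \<and> Q J)"

lemma disjoint_occ_insert:
 assumes "e \<notin> A" "disjoint_occ P Q (insert e A)"
 shows "disjoint_occ (\<lambda>I. P (insert e I)) Q A \<or> disjoint_occ P (\<lambda>J. Q (insert e J)) A \<or> disjoint_occ P Q A"
proof -
 obtain I J where IJ: "I \<inter> J = {}" "I \<union> J \<subseteq> insert e A" "P I" "Q J"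
  using assms unfolding disjoint_occ_def by blast
 consider "e \<in> I" "e \<notin> J" | "e \<in> J" "e \<notin> I" | "e \<notin> I" "e \<notin> J" using IJ by auto
 then show ?thesis
 proof cases
  case 1
  then have "disjoint_occ (\<lambda>I. P (insert e I)) Q A"
   unfolding disjoint_occ_def using IJ
   by (intro exI[of _ "I - {e}"] exI[of _ J]) (auto simp: insert_absorb)
  then show ?thesis by simp
 next
  case 2
  then have "disjoint_occ P (\<lambda>J. Q (insert e J)) A"
   unfolding disjoint_occ_def using IJ
   by (intro exI[of _ I] exI[of _ "J - {e}"]) (auto simp: insert_absorb)
  then show ?thesis by simp
 next
  case 3
  then have "disjoint_occ P Q A"
   unfolding disjoint_occ_def using IJ
   by (intro exI[of _ I] exI[of _ J]) auto
  then show ?thesis by simp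
 qed
qed

lemma disjoint_occ_mono:
 "disjoint_occ P Q A \<Longrightarrow> (\<And>I. P I \<Longrightarrow> P' I) \<Longrightarrow> (\<And>I. Q I \<Longrightarrow> Q' I) \<Longrightarrow> disjoint_occ P' Q' A"
 unfolding disjoint_occ_def by blast

text \<open>
 Induction over \<open>E\<close>: giving the two events their own independent copies of an edge can only
 increase the probability of disjoint occurrence.
\<close>

lemma expct_BK:
 assumes "\<And>e. 0 \<le> k e" "finite E" "up_closed P" "up_closed Q"
 shows "prb k E (disjoint_occ P Q) \<le> prb k E P * prb k E Q"
 using assms(2-)
proof (induction E arbitrary: P Q rule: finite_induct)
 case empty
 then show ?case by (auto simp: disjoint_occ_def)
next
 case (insert e E)
 define q where "q = exp (- k e)"
 have q: "0 \<le> q" "q \<le> 1" using assms(1)[of e] by (auto simp: q_def)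
 let ?P = "\<lambda>I. P (insert e I)" and ?Q = "\<lambda>I. Q (insert e I)"
 have up: "up_closed ?P" "up_closed ?Q"
  using up_closed_insert[OF insert.prems(1), of e] up_closed_insert[OF insert.prems(2), of e] by auto
 have imp: "P I \<Longrightarrow> ?P I" "Q I \<Longrightarrow> ?Q I" for I
  using insert.prems up_closedD by blast+
 \<comment> \<open>On the right the two events see independent copies of \<open>e\<close>. If
   \<open>e\<close> is needed on the left, it serves only one of the events, so one mixed term and
   the last term survive; their weights \<open>q * (1 - q)\<close> and
   \<open>(1 - q) * (1 - q)\<close> add up to \<open>1 - q\<close>.\<close>
 have pt: "q * of_bool (disjoint_occ P Q A) + (1 - q) * of_bool (disjoint_occ P Q (insert e A)) \<le>
   q * q * of_bool (disjoint_occ P Q A) + q * (1 - q) * of_bool (disjoint_occ P ?Q A)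
   + (1 - q) * q * of_bool (disjoint_occ ?P Q A) + (1 - q) * (1 - q) * (of_bool (disjoint_occ ?P ?Q A) :: real)"
  if "A \<subseteq> E" for A
 proof -
  have e: "e \<notin> A" using that insert by auto
  have i1: "disjoint_occ P Q A \<Longrightarrow> disjoint_occ P ?Q A" "disjoint_occ P Q A \<Longrightarrow> disjoint_occ ?P Q A"
   "disjoint_occ P ?Q A \<Longrightarrow> disjoint_occ ?P ?Q A" "disjoint_occ ?P Q A \<Longrightarrow> disjoint_occ ?P ?Q A"
   using imp by (auto elim!: disjoint_occ_mono)
  have qq: "0 \<le> q * (1 - q)" using q by simp
  show ?thesis
  proof (cases "disjoint_occ P Q A")
   case True
   then have "disjoint_occ P ?Q A" "disjoint_occ ?P Q A" "disjoint_occ ?P ?Q A"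
    using i1 by auto
   moreover have "(of_bool (disjoint_occ P Q (insert e A)) :: real) \<le> 1" by simp
   ultimately show ?thesis using True q
    by (simp add: algebra_simps mult_left_le)
  next
   case False
   show ?thesis
   proof (cases "disjoint_occ P Q (insert e A)")
    case True
    then consider "disjoint_occ P ?Q A" | "disjoint_occ ?P Q A"
     using disjoint_occ_insert[OF e] False by blast
    then show ?thesis
    proof cases
     case 1
     then have "disjoint_occ ?P ?Q A" using i1 by auto
     then show ?thesis using 1 False True qq by (auto simp: algebra_simps)
    next
     case 2
     then have "disjoint_occ ?P ?Q A" using i1 by auto
     then show ?thesis using 2 False True qq by (auto simp: algebra_simps)
    qed
   qed (use False q qq in simp)
  qed
 qed
 have "prb k (insert e E) (disjoint_occ P Q) =
   expct k E (\<lambda>A. q * of_bool (disjoint_occ P Q A) + (1 - q) * of_bool (disjoint_occ P Q (insert e A)))"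
  using insert.hyps by (simp add: expct_insert expct_add expct_cmult q_def)
 also have "\<dots> \<le> expct k E (\<lambda>A. q * q * of_bool (disjoint_occ P Q A) + q * (1 - q) * of_bool (disjoint_occ P ?Q A)
   + (1 - q) * q * of_bool (disjoint_occ ?P Q A) + (1 - q) * (1 - q) * of_bool (disjoint_occ ?P ?Q A))"
  by (intro expct_mono assms pt)
 also have "\<dots> = q * q * prb k E (disjoint_occ P Q) + q * (1 - q) * prb k E (disjoint_occ P ?Q)
   + (1 - q) * q * prb k E (disjoint_occ ?P Q) + (1 - q) * (1 - q) * prb k E (disjoint_occ ?P ?Q)"
  by (simp only: expct_add expct_cmult)
 also have "\<dots> \<le> q * q * (prb k E P * prb k E Q) + q * (1 - q) * (prb k E P * prb k E ?Q)
   + (1 - q) * q * (prb k E ?P * prb k E Q) + (1 - q) * (1 - q) * (prb k E ?P * prb k E ?Q)"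
  using q by (intro add_mono mult_left_mono insert.IH insert.prems up mult_nonneg_nonneg) auto
 also have "\<dots> = (q * prb k E P + (1 - q) * prb k E ?P) * (q * prb k E Q + (1 - q) * prb k E ?Q)"
  by algebra
 also have "\<dots> = prb k (insert e E) P * prb k (insert e E) Q"
  using insert.hyps by (simp add: expct_insert q_def)
 finally show ?case .
qed

text \<open>Edgewise this is convexity of \<open>exp\<close> between 0 and \<open>- k e\<close>. In
  the sprinkling argument \<open>m e\<close> is the chance that the far end of \<open>e\<close>
  meets the ghost, so the right-hand side is an avoidance probability.\<close>

lemma expct_prod_ge:
 assumes "finite E" "\<And>e. e \<in> E \<Longrightarrow> 0 \<le> k e" "\<And>e. e \<in> E \<Longrightarrow> 0 \<le> m e" "\<And>e. e \<in> E \<Longrightarrow> m e \<le> 1"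
 shows "exp (- (\<Sum>e\<in>E. k e * m e)) \<le> expct k E (\<lambda>A. \<Prod>e\<in>A. 1 - m e)"
 using assms
proof (induction E rule: finite_induct)
 case (insert e E)
 have "exp ((1 - m e) *\<^sub>R 0 + m e *\<^sub>R (- k e)) \<le> (1 - m e) * exp (0::real) + m e * exp (- k e)"
  by (rule convex_onD[OF exp_convex]) (use insert in auto)
 then have 1: "exp (- (k e * m e)) \<le> exp (- k e) + (1 - exp (- k e)) * (1 - m e)"
  by (simp add: algebra_simps)
 have "expct k (insert e E) (\<lambda>A. \<Prod>e\<in>A. 1 - m e) =
   exp (- k e) * expct k E (\<lambda>A. \<Prod>e\<in>A. 1 - m e) + (1 - exp (- k e)) * expct k E (\<lambda>A. (1 - m e) * (\<Prod>e\<in>A. 1 - m e))"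
  unfolding expct_insert[OF insert.hyps(1,2)]
  by (intro arg_cong2[where f="(+)"] arg_cong2[where f=times] refl expct_cong, subst prod.insert)
    (use insert.hyps finite_subset in auto)
 also have "\<dots> = (exp (- k e) + (1 - exp (- k e)) * (1 - m e)) * expct k E (\<lambda>A. \<Prod>e\<in>A. 1 - m e)"
  unfolding expct_cmult by (simp add: algebra_simps)
 also have "\<dots> \<ge> exp (- (k e * m e)) * exp (- (\<Sum>e\<in>E. k e * m e))"
 proof (rule mult_mono[OF 1])
  show "0 \<le> exp (- k e) + (1 - exp (- k e)) * (1 - m e)"
   using 1 exp_gt_zero[of "- (k e * m e)"] by linarith
 qed (use insert in auto)
 finally show ?case
  using insert.hyps by (simp add: exp_add[symmetric] algebra_simps)
qed simp

section \<open>Clusters of finite edge sets\<close>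

definition conn :: "'v set set \<Rightarrow> 'v \<Rightarrow> 'v \<Rightarrow> bool" where
 "conn W = (\<lambda>x y. x \<noteq> y \<and> {x, y} \<in> W)\<^sup>*\<^sup>*"

definition clus :: "'v set set \<Rightarrow> 'v \<Rightarrow> 'v set" where
 "clus W x = {y. conn W x y}"

abbreviation csize :: "'v set set \<Rightarrow> 'v \<Rightarrow> real" where
 "csize W x \<equiv> real (card (clus W x))"

abbreviation csize_in :: "'v set set \<Rightarrow> 'v \<Rightarrow> 'v set \<Rightarrow> real" where
 "csize_in W x A \<equiv> real (card (clus W x \<inter> A))"

lemma conn_refl [simp, intro]: "conn W x x"
 by (simp add: conn_def)

lemma conn_trans [trans]: "conn W x y \<Longrightarrow> conn W y z \<Longrightarrow> conn W x z"
 by (simp add: conn_def)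

lemma conn_step: "conn W x y \<Longrightarrow> {y, z} \<in> W \<Longrightarrow> conn W x z"
 unfolding conn_def by (cases "y = z") (auto intro: rtranclp.rtrancl_into_rtrancl)

lemma conn_edge: "{x, y} \<in> W \<Longrightarrow> conn W x y"
 using conn_step[of W x x y] by simp

lemma conn_induct [consumes 1, case_names refl step]:
 assumes "conn W x y" "P x"
  "\<And>u v. conn W x u \<Longrightarrow> u \<noteq> v \<Longrightarrow> {u, v} \<in> W \<Longrightarrow> P u \<Longrightarrow> P v"
 shows "P y"
 using assms(1) unfolding conn_def
 by (induction rule: rtranclp_induct) (use assms in \<open>auto simp: conn_def\<close>)

lemma conn_sym: "conn W x y \<Longrightarrow> conn W y x"
proof (induction rule: conn_induct)
 case (step u v)
 then show ?case by (metis conn_edge conn_trans insert_commute)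
qed simp

lemma conn_commute: "conn W x y \<longleftrightarrow> conn W y x"
 by (rule iffI; erule conn_sym)

lemma conn_mono: "conn W x y \<Longrightarrow> W \<subseteq> W' \<Longrightarrow> conn W' x y"
 by (induction rule: conn_induct) (simp, meson conn_step subsetD)

lemma clus_mono: "W \<subseteq> W' \<Longrightarrow> clus W x \<subseteq> clus W' x"
 by (auto simp: clus_def dest: conn_mono)

lemma in_clus_self [simp, intro]: "x \<in> clus W x"
 by (simp add: clus_def)

lemma clus_eq: "conn W x y \<Longrightarrow> clus W x = clus W y"
 using conn_trans[of W] conn_sym[of W] unfolding clus_def by blast

lemma clus_disjoint: "\<not> conn W x y \<Longrightarrow> clus W x \<inter> clus W y = {}"
 using conn_trans[of W] conn_sym[of W] unfolding clus_def by blast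

lemma clus_closed: "u \<in> clus W x \<Longrightarrow> {u, v} \<in> W \<Longrightarrow> v \<in> clus W x"
 by (simp add: clus_def conn_step[of W x u v])

lemma clus_subsetI:
 assumes "x \<in> S" "\<And>u v. u \<in> S \<Longrightarrow> u \<noteq> v \<Longrightarrow> {u, v} \<in> W \<Longrightarrow> v \<in> S"
 shows "clus W x \<subseteq> S"
proof
 fix y assume "y \<in> clus W x"
 then have "conn W x y" by (simp add: clus_def)
 then show "y \<in> S" by (induction rule: conn_induct) (use assms in auto)
qed

lemma clus_subset_insert: "clus W x \<subseteq> insert x (\<Union>{e \<in> W. finite e})"
 by (rule clus_subsetI) auto

lemma finite_clus [simp, intro]: "finite W \<Longrightarrow> finite (clus W x)"
 by (rule finite_subset[OF clus_subset_insert]) auto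

lemma card_clus_pos [simp]: "finite W \<Longrightarrow> 0 < card (clus W x)"
 by (subst card_gt_0_iff) auto

lemma card_clus_mono: "W \<subseteq> W' \<Longrightarrow> finite W' \<Longrightarrow> card (clus W x) \<le> card (clus W' x)"
 by (intro card_mono clus_mono finite_clus)

section \<open>Exploration of clusters and what it leaves fresh\<close>

definition off :: "'v set \<Rightarrow> 'v set set \<Rightarrow> 'v set set" where
 "off S W = {e \<in> W. e \<inter> S = {}}"

definition reach :: "'v set \<Rightarrow> 'v set set \<Rightarrow> 'v set" where
 "reach R W = (\<Union>x\<in>R. clus W x)"

lemma reach_singleton [simp]: "reach {x} W = clus W x"
 by (simp add: reach_def)

lemma off_subset: "off S W \<subseteq> W" by (auto simp: off_def)

lemma off_Un: "off S (W \<union> W') = off S W \<union> off S W'" by (auto simp: off_def)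

text \<open>By hypothesis every edge of \<open>W\<close> touches \<open>S\<close>, while
  \<open>off S W'\<close> adds only edges avoiding \<open>S\<close>. Whether the exploration from
  \<open>R\<close> ends exactly at \<open>S\<close> is decided by the touching edges; this is the
  independence behind \<open>expct_explore\<close>.\<close>

lemma reach_determined:
 assumes "off S W = {}"
 shows "reach R (W \<union> off S W') = S \<longleftrightarrow> reach R W = S"
proof -
 have closed: "v \<in> S" if "u \<in> S" "{u, v} \<in> W \<union> off S W'" "reach R W = S" for u v
  using that by (auto simp: off_def reach_def intro: clus_closed)
 have W: "{u, v} \<in> W" if "u \<in> S" "{u, v} \<in> W \<union> off S W'" for u v
  using that by (auto simp: off_def)
 show ?thesis
 proof
  assume *: "reach R W = S"
  have "clus (W \<union> off S W') x \<subseteq> S" if "x \<in> R" for x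
   by (rule clus_subsetI) (use that * closed in \<open>auto simp: reach_def\<close>)
  moreover have "clus W x \<subseteq> clus (W \<union> off S W') x" for x by (rule clus_mono) auto
  ultimately show "reach R (W \<union> off S W') = S" using * unfolding reach_def by fast
 next
  assume *: "reach R (W \<union> off S W') = S"
  have **: "conn W x y" if x: "x \<in> R" and "conn (W \<union> off S W') x y" for x y
   using that(2)
  proof (induction rule: conn_induct)
   case (step u v)
   have "u \<in> S" using step(1) x * by (auto simp: reach_def clus_def)
   then show ?case using W step conn_step by fast
  qed simp
  have "S \<subseteq> reach R W"
  proof
   fix y assume "y \<in> S"
   then obtain x where "x \<in> R" "conn (W \<union> off S W') x y"
    using * by (auto simp: reach_def clus_def)
   then show "y \<in> reach R W" using **[of x y] by (auto simp: reach_def clus_def)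
  qed
  moreover have "reach R W \<subseteq> reach R (W \<union> off S W')"
   unfolding reach_def using clus_mono[of W "W \<union> off S W'"] by fast
  ultimately show "reach R W = S" using * by auto
 qed
qed

text \<open>
 Exploration: conditionally on the vertices reached from the root set, the configuration
 away from them is fresh.
\<close>

lemma expct_explore:
 assumes "finite E"
 shows "expct k E (\<lambda>W. \<Phi> (reach R W) (off (reach R W) W)) =
  expct k E (\<lambda>W. expct k E (\<lambda>W'. \<Phi> (reach R W) (off (reach R W) W')))"
proof -
 let ?X = "reach R ` Pow E"
 have finX: "finite ?X" using assms by simp
 have split: "expct k E (\<lambda>W. of_bool (reach R W = S) * \<Phi> S (off S W)) =
   prb k E (\<lambda>W. reach R W = S) * expct k E (\<lambda>W'. \<Phi> S (off S W'))" for S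
 proof -
  define E2 where "E2 = off S E"
  define E1 where "E1 = E - E2"
  have E: "E = E1 \<union> E2" "E1 \<inter> E2 = {}" "finite E1" "finite E2"
   using assms off_subset[of S E] unfolding E1_def E2_def by (auto intro: finite_subset)
  have o1: "off S A = {}" if "A \<subseteq> E1" for A using that by (auto simp: E1_def E2_def off_def)
  have o2: "off S B = B" if "B \<subseteq> E2" for B using that by (auto simp: E2_def off_def)
  have r: "reach R (A \<union> B) = S \<longleftrightarrow> reach R A = S" if "A \<subseteq> E1" "B \<subseteq> E2" for A B
   using reach_determined[OF o1[OF that(1)], of R B] o2[OF that(2)] by simp
  have "expct k E (\<lambda>W. of_bool (reach R W = S) * \<Phi> S (off S W)) =
    expct k E1 (\<lambda>A. expct k E2 (\<lambda>B. of_bool (reach R A = S) * \<Phi> S B))"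
   unfolding E(1) expct_Un[OF E(3,4,2)]
   by (intro expct_cong) (auto simp: r off_Un o1 o2)
  also have "\<dots> = prb k E1 (\<lambda>A. reach R A = S) * expct k E2 (\<lambda>B. \<Phi> S B)"
   by (simp add: expct_cmult expct_multc)
  also have "prb k E1 (\<lambda>A. reach R A = S) = prb k E (\<lambda>W. reach R W = S)"
  proof -
   have "prb k E (\<lambda>W. reach R W = S) = expct k E1 (\<lambda>A. expct k E2 (\<lambda>B. of_bool (reach R A = S)))"
    unfolding E(1) expct_Un[OF E(3,4,2)] by (intro expct_cong) (auto simp: r)
   then show ?thesis using E by simp
  qed
  also have "expct k E2 (\<lambda>B. \<Phi> S B) = expct k E (\<lambda>W'. \<Phi> S (off S W'))"
  proof -
   have "expct k E (\<lambda>W'. \<Phi> S (off S W')) = expct k E (\<lambda>W'. \<Phi> S (W' \<inter> E2))"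
    by (intro expct_cong arg_cong[where f="\<Phi> S"]) (auto simp: off_def E2_def)
   then show ?thesis using expct_restrict[of E2 E] E by simp
  qed
  finally show ?thesis .
 qed
 have "expct k E (\<lambda>W. \<Phi> (reach R W) (off (reach R W) W)) =
   expct k E (\<lambda>W. \<Sum>S\<in>?X. of_bool (reach R W = S) * \<Phi> S (off S W))"
 proof (rule expct_cong)
  fix W assume "W \<subseteq> E"
  then have "(\<Sum>S\<in>?X. of_bool (reach R W = S) * \<Phi> S (off S W)) =
    (\<Sum>S\<in>{reach R W}. of_bool (reach R W = S) * \<Phi> S (off S W))"
   by (intro sum.mono_neutral_right finX) auto
  then show "\<Phi> (reach R W) (off (reach R W) W) = (\<Sum>S\<in>?X. of_bool (reach R W = S) * \<Phi> S (off S W))"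
   by simp
 qed
 also have "\<dots> = expct k E (\<lambda>W. \<Sum>S\<in>?X. of_bool (reach R W = S) * expct k E (\<lambda>W'. \<Phi> S (off S W')))"
  unfolding expct_sum split by (simp add: expct_multc)
 also have "\<dots> = expct k E (\<lambda>W. expct k E (\<lambda>W'. \<Phi> (reach R W) (off (reach R W) W')))"
 proof (rule expct_cong)
  fix W assume "W \<subseteq> E"
  then have "(\<Sum>S\<in>?X. of_bool (reach R W = S) * expct k E (\<lambda>W'. \<Phi> S (off S W'))) =
    (\<Sum>S\<in>{reach R W}. of_bool (reach R W = S) * expct k E (\<lambda>W'. \<Phi> S (off S W')))"
   by (intro sum.mono_neutral_right finX) auto
  then show "(\<Sum>S\<in>?X. of_bool (reach R W = S) * expct k E (\<lambda>W'. \<Phi> S (off S W'))) =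
   expct k E (\<lambda>W'. \<Phi> (reach R W) (off (reach R W) W'))" by simp
 qed
 finally show ?thesis .
qed

definition bdry :: "'v set set \<Rightarrow> 'v set \<Rightarrow> 'v set set" where
 "bdry E S = {e \<in> E. e \<inter> S \<noteq> {} \<and> \<not> e \<subseteq> S}"

lemma bdry_subset: "bdry E S \<subseteq> E" by (auto simp: bdry_def)

lemma finite_bdry [simp, intro]: "finite E \<Longrightarrow> finite (bdry E S)"
 using bdry_subset finite_subset by metis

definition far_end :: "'v set \<Rightarrow> 'v set \<Rightarrow> 'v" where
 "far_end S e = (SOME y. y \<in> e \<and> y \<notin> S)"

lemma far_end_eq: "u \<in> S \<Longrightarrow> v \<notin> S \<Longrightarrow> far_end S {u, v} = v"
 unfolding far_end_def by (rule some_equality) auto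

text \<open>A path that ends outside the old cluster \<open>S\<close> leaves it for the last time
  through a boundary edge opened in \<open>B\<close>, and from then on uses only edges avoiding
  \<open>S\<close>.\<close>

lemma clus_Un_subset:
 assumes "W \<union> B \<subseteq> E" and S: "S = clus W x"
 shows "clus (W \<union> B) x \<subseteq> S \<union> (\<Union>e\<in>B \<inter> bdry E S. clus (off S (W \<union> B)) (far_end S e))"
proof (rule clus_subsetI)
 fix u v
 assume u: "u \<in> S \<union> (\<Union>e\<in>B \<inter> bdry E S. clus (off S (W \<union> B)) (far_end S e))"
  and uv: "u \<noteq> v" "{u, v} \<in> W \<union> B"
 show "v \<in> S \<union> (\<Union>e\<in>B \<inter> bdry E S. clus (off S (W \<union> B)) (far_end S e))"
 proof (cases "v \<in> S")
  case v: False
  show ?thesis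
  proof (cases "u \<in> S")
   case True
   then have "{u, v} \<notin> W" using v S clus_closed by metis
   then have "{u, v} \<in> B \<inter> bdry E S" using True v uv assms by (auto simp: bdry_def)
   then show ?thesis using far_end_eq[OF True v] by (metis UnI2 UN_I in_clus_self)
  next
   case False
   then obtain e where "e \<in> B \<inter> bdry E S" "u \<in> clus (off S (W \<union> B)) (far_end S e)"
    using u by auto
   moreover have "{u, v} \<in> off S (W \<union> B)" using uv v False by (auto simp: off_def)
   ultimately have "v \<in> clus (off S (W \<union> B)) (far_end S e)" by (blast intro: clus_closed)
   then show ?thesis using \<open>e \<in> B \<inter> bdry E S\<close> by blast
  qed
 qed auto
qed (use S in auto)

text \<open>The probability that the cluster of \<open>x\<close> avoids a ghost field of intensity \<open>h\<close>.\<close>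

definition lap :: "real \<Rightarrow> 'v \<Rightarrow> 'v set set \<Rightarrow> real" where
 "lap h x W = exp (- (h * csize W x))"

lemma lap_bounds: "0 \<le> lap h x W" "h \<ge> 0 \<Longrightarrow> lap h x W \<le> 1"
 by (auto simp: lap_def)

lemma lap_antimono: "W \<subseteq> W' \<Longrightarrow> finite W' \<Longrightarrow> h \<ge> 0 \<Longrightarrow> lap h x W' \<le> lap h x W"
 unfolding lap_def by (auto intro!: mult_left_mono card_clus_mono)

text \<open>
 Sprinkling edges of weight \<open>\<kappa>\<close> onto a configuration of weight \<open>k\<close>: every sprinkled boundary
 edge of the old cluster leads to the ghost with probability at most \<open>\<mu>\<close>, and the
 corresponding avoidance events are positively correlated.
\<close>

lemma sprinkle_ghost:
 assumes E: "finite E" and k: "\<And>e. 0 \<le> k e" and \<kappa>: "\<And>e. 0 \<le> \<kappa> e" and h: "h \<ge> 0"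
  and \<mu>: "\<And>y. 1 - expct (\<lambda>e. k e + \<kappa> e) E (lap h y) \<le> \<mu>"
 shows "expct k E (\<lambda>W. exp (- (h * card (clus W x)) - \<mu> * (\<Sum>e\<in>bdry E (clus W x). \<kappa> e)))
  \<le> expct (\<lambda>e. k e + \<kappa> e) E (lap h x)"
proof -
 let ?k' = "\<lambda>e. k e + \<kappa> e"
 have k': "\<And>e. 0 \<le> ?k' e" using k \<kappa> by auto
 have fin: "finite A" if "A \<subseteq> E" for A using that E finite_subset by auto
 \<comment> \<open>Intersecting with the finite \<open>E\<close> makes monotonicity hold for
   arbitrary sets; an infinite cluster would have \<open>card\<close> 0 and break it.\<close>
 define lapE where "lapE y = (\<lambda>W. lap h y (W \<inter> E))" for y :: 'a
 have lapE: "A \<subseteq> B \<Longrightarrow> lapE y B \<le> lapE y A" "0 \<le> lapE y A" "lapE y A \<le> 1" for y A B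
  unfolding lapE_def using E h by (auto intro!: lap_antimono lap_bounds)
 \<comment> \<open>Lower bound for ghost avoidance after sprinkling, given the old cluster
   \<open>S\<close> and the configuration \<open>W'\<close> off \<open>S\<close>: the vertices of
   \<open>S\<close> avoid the ghost, and so does the cluster, computed off \<open>S\<close>, of the
   far end of each sprinkled boundary edge.\<close>
 define \<Phi> where "\<Phi> S W' = expct \<kappa> E (\<lambda>B. exp (- (h * card S)) *
   (\<Prod>e\<in>B \<inter> bdry E S. lapE (far_end S e) (W' \<union> off S B)))" for S W'
 have step1: "\<Phi> (clus W x) (off (clus W x) W) \<le> expct \<kappa> E (\<lambda>B. lap h x (W \<union> B))"
  if W: "W \<subseteq> E" for W
  unfolding \<Phi>_def
 proof (rule expct_mono[OF \<kappa>])
  fix B assume B: "B \<subseteq> E"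
  define S where "S = clus W x"
  let ?c = "\<lambda>e. clus (off S (W \<union> B)) (far_end S e)"
  have "finite (off S (W \<union> B))" using W B off_subset[of S "W \<union> B"] by (intro fin) auto
  then have finc: "finite (?c e)" for e by auto
  have "card (clus (W \<union> B) x) \<le> card (S \<union> (\<Union>e\<in>B \<inter> bdry E S. ?c e))"
   using clus_Un_subset[of W B E S x] W B E finc fin
   by (intro card_mono) (auto simp: S_def)
  also have "\<dots> \<le> card S + card (\<Union>e\<in>B \<inter> bdry E S. ?c e)" by (rule card_Un_le)
  also have "card (\<Union>e\<in>B \<inter> bdry E S. ?c e) \<le> (\<Sum>e\<in>B \<inter> bdry E S. card (?c e))"
   using E by (intro card_UN_le) auto
  finally have "csize (W \<union> B) x \<le> card S + (\<Sum>e\<in>B \<inter> bdry E S. real (card (?c e)))"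
   by (simp flip: of_nat_sum of_nat_add)
  then have "h * card (clus (W \<union> B) x) \<le> h * card S + (\<Sum>e\<in>B \<inter> bdry E S. h * card (?c e))"
   using h by (simp flip: sum_distrib_left distrib_left add: mult_left_mono)
  then have "exp (- (h * card S) + (\<Sum>e\<in>B \<inter> bdry E S. - (h * card (?c e)))) \<le> lap h x (W \<union> B)"
   by (simp add: lap_def sum_negf)
  then have "exp (- (h * card S)) * (\<Prod>e\<in>B \<inter> bdry E S. exp (- (h * card (?c e)))) \<le> lap h x (W \<union> B)"
   using E unfolding exp_add by (subst (asm) exp_sum) auto
  moreover have "lapE (far_end S e) (off S W \<union> off S B) = exp (- (h * card (?c e)))" for e
   using W B by (auto simp: lapE_def lap_def off_def intro!: arg_cong[where f="\<lambda>A. card (clus A _)"])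
  ultimately show "exp (- (h * card (clus W x))) *
   (\<Prod>e\<in>B \<inter> bdry E (clus W x). lapE (far_end (clus W x) e) (off (clus W x) W \<union> off (clus W x) B))
   \<le> lap h x (W \<union> B)"
   by (simp add: S_def[symmetric])
 qed
 have step2: "exp (- (h * card S) - \<mu> * (\<Sum>e\<in>bdry E S. \<kappa> e)) \<le> expct k E (\<lambda>W'. \<Phi> S (off S W'))" for S
 proof -
  define D where "D = bdry E S"
  define E1 where "E1 = E - off S E"
  define E2 where "E2 = off S E"
  have Es: "E = E1 \<union> E2" "E1 \<inter> E2 = {}" "finite E1" "finite E2"
   using E off_subset[of S E] unfolding E1_def E2_def by (auto intro: finite_subset)
  have D: "D \<subseteq> E1" "finite D" using E by (auto simp: D_def E1_def bdry_def off_def)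
  define m where "m e = 1 - expct ?k' E (lap h (far_end S e))" for e
  have m: "0 \<le> m e" "m e \<le> 1" "m e \<le> \<mu>" for e
   using expct_le_const[of ?k' E "lap h (far_end S e)" 1, OF k' E lap_bounds(2)[OF h]]
    expct_nonneg[of ?k' E "lap h (far_end S e)", OF k' lap_bounds(1)]
    \<mu>[of "far_end S e"] unfolding m_def by linarith+
  have inner: "(\<Prod>e\<in>B. 1 - m e) \<le>
    expct k E (\<lambda>W'. expct \<kappa> E2 (\<lambda>B2. \<Prod>e\<in>B. lapE (far_end S e) (off S W' \<union> B2)))" (is "_ \<le> ?R")
   if "B \<subseteq> D" for B
  proof -
   have finB: "finite B" using that D finite_subset by auto
   have "?R = expct k E (\<lambda>W'. expct \<kappa> E (\<lambda>B2. \<Prod>e\<in>B. lapE (far_end S e) (off S (W' \<union> B2))))"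
   proof (rule expct_cong)
    fix W' assume "W' \<subseteq> E"
    have "expct \<kappa> E (\<lambda>B2. \<Prod>e\<in>B. lapE (far_end S e) (off S (W' \<union> B2))) =
      expct \<kappa> E (\<lambda>B2. \<Prod>e\<in>B. lapE (far_end S e) (off S W' \<union> (B2 \<inter> E2)))"
     by (intro expct_cong prod.cong arg_cong[where f="lapE _"]) (auto simp: off_def E2_def)
    also have "\<dots> = expct \<kappa> E2 (\<lambda>B2. \<Prod>e\<in>B. lapE (far_end S e) (off S W' \<union> B2))"
     using Es by (intro expct_restrict) auto
    finally show "expct \<kappa> E2 (\<lambda>B2. \<Prod>e\<in>B. lapE (far_end S e) (off S W' \<union> B2)) =
      expct \<kappa> E (\<lambda>B2. \<Prod>e\<in>B. lapE (far_end S e) (off S (W' \<union> B2)))" by simp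
   qed
   also have "\<dots> = expct ?k' E (\<lambda>C. \<Prod>e\<in>B. lapE (far_end S e) (off S C))"
    using E by (simp add: expct_add_weight)
   \<comment> \<open>Avoidance from the various far ends is decreasing in the combined
     configuration, so FKG factorizes it. Deleting the edges at \<open>S\<close> only shrinks
     clusters, hence the bound by \<open>m e\<close> from the whole graph still applies.\<close>
   also have "\<dots> \<ge> (\<Prod>e\<in>B. expct ?k' E (\<lambda>C. lapE (far_end S e) (off S C)))"
    by (rule expct_FKG_prod[OF k' E finB lapE(1) lapE(2)]) (auto simp: off_def)
   also have "(\<Prod>e\<in>B. 1 - m e) \<le> (\<Prod>e\<in>B. expct ?k' E (\<lambda>C. lapE (far_end S e) (off S C)))"
   proof (rule prod_mono)
    fix e
    have "expct ?k' E (lap h (far_end S e)) = expct ?k' E (lapE (far_end S e))"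
     by (rule expct_cong) (auto simp: lapE_def Int_absorb2)
    also have "\<dots> \<le> expct ?k' E (\<lambda>C. lapE (far_end S e) (off S C))"
     by (rule expct_mono[OF k']) (use lapE off_subset in metis)
    finally show "0 \<le> 1 - m e \<and> 1 - m e \<le> expct ?k' E (\<lambda>C. lapE (far_end S e) (off S C))"
     using m(2)[of e] by (simp add: m_def)
   qed
   finally show ?thesis .
  qed
  have "exp (- (h * card S) - \<mu> * (\<Sum>e\<in>D. \<kappa> e)) \<le> exp (- (h * card S)) * exp (- (\<Sum>e\<in>D. \<kappa> e * m e))"
  proof -
   have "(\<Sum>e\<in>D. \<kappa> e * m e) \<le> (\<Sum>e\<in>D. \<kappa> e * \<mu>)"
    by (intro sum_mono mult_left_mono m \<kappa>)
   then show ?thesis by (simp add: exp_add[symmetric] sum_distrib_left mult.commute)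
  qed
  also have "exp (- (\<Sum>e\<in>D. \<kappa> e * m e)) \<le> expct \<kappa> D (\<lambda>B. \<Prod>e\<in>B. 1 - m e)"
   by (rule expct_prod_ge) (use D m \<kappa> in auto)
  also have "\<dots> \<le> expct \<kappa> D (\<lambda>B. expct k E (\<lambda>W'. expct \<kappa> E2 (\<lambda>B2. \<Prod>e\<in>B. lapE (far_end S e) (off S W' \<union> B2))))"
   by (rule expct_mono[OF \<kappa>]) (use inner in auto)
  also have "\<dots> = expct \<kappa> E1 (\<lambda>B. expct k E (\<lambda>W'. expct \<kappa> E2 (\<lambda>B2. \<Prod>e\<in>B \<inter> D. lapE (far_end S e) (off S W' \<union> B2))))"
   by (rule expct_restrict[OF D(2) D(1) Es(3), symmetric])
  also have "\<dots> = expct k E (\<lambda>W'. expct \<kappa> E1 (\<lambda>B. expct \<kappa> E2 (\<lambda>B2. \<Prod>e\<in>B \<inter> D. lapE (far_end S e) (off S W' \<union> B2))))"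
   by (rule expct_swap[of \<kappa> E1 k E])
  also have "\<dots> = expct k E (\<lambda>W'. expct \<kappa> E (\<lambda>B. \<Prod>e\<in>B \<inter> D. lapE (far_end S e) (off S W' \<union> off S B)))"
  proof (rule expct_cong)
   fix W'
   have "expct \<kappa> E (\<lambda>B. \<Prod>e\<in>B \<inter> D. lapE (far_end S e) (off S W' \<union> off S B)) =
    expct \<kappa> E1 (\<lambda>B. expct \<kappa> E2 (\<lambda>B2. \<Prod>e\<in>(B \<union> B2) \<inter> D. lapE (far_end S e) (off S W' \<union> off S (B \<union> B2))))"
    unfolding Es(1) by (rule expct_Un[OF Es(3,4,2)])
   also have "\<dots> = expct \<kappa> E1 (\<lambda>B. expct \<kappa> E2 (\<lambda>B2. \<Prod>e\<in>B \<inter> D. lapE (far_end S e) (off S W' \<union> B2)))"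
   proof (intro expct_cong)
    fix B B2 assume "B \<subseteq> E1" "B2 \<subseteq> E2"
    then have "B2 \<inter> D = {}" "off S B = {}" "off S B2 = B2"
     using Es(2) D(1) by (auto simp: off_def E1_def E2_def)
    then have "(B \<union> B2) \<inter> D = B \<inter> D" "off S (B \<union> B2) = B2"
     by (auto simp: off_Un)
    then show "(\<Prod>e\<in>(B \<union> B2) \<inter> D. lapE (far_end S e) (off S W' \<union> off S (B \<union> B2))) =
      (\<Prod>e\<in>B \<inter> D. lapE (far_end S e) (off S W' \<union> B2))" by simp
   qed
   finally show "expct \<kappa> E1 (\<lambda>B. expct \<kappa> E2 (\<lambda>B2. \<Prod>e\<in>B \<inter> D. lapE (far_end S e) (off S W' \<union> B2))) =
    expct \<kappa> E (\<lambda>B. \<Prod>e\<in>B \<inter> D. lapE (far_end S e) (off S W' \<union> off S B))" by simp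
  qed
  finally show ?thesis
   unfolding \<Phi>_def expct_cmult D_def by simp
 qed
 have "expct k E (\<lambda>W. exp (- (h * card (clus W x)) - \<mu> * (\<Sum>e\<in>bdry E (clus W x). \<kappa> e)))
   \<le> expct k E (\<lambda>W. expct k E (\<lambda>W'. \<Phi> (clus W x) (off (clus W x) W')))"
  by (rule expct_mono[OF k step2])
 also have "\<dots> = expct k E (\<lambda>W. \<Phi> (clus W x) (off (clus W x) W))"
  using expct_explore[OF E, of k \<Phi> "{x}"] by simp
 also have "\<dots> \<le> expct k E (\<lambda>W. expct \<kappa> E (\<lambda>B. lap h x (W \<union> B)))"
  by (rule expct_mono[OF k step1])
 also have "\<dots> = expct ?k' E (lap h x)"
  using E by (simp add: expct_add_weight)
 finally show ?thesis .
qed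

text \<open>Among the configurations on \<open>D\<close> only those with exactly one open edge are
  kept; the edge \<open>e\<close> alone has probability at least
  \<open>\<kappa> e * exp (- (\<Sum>e\<in>D. \<kappa> e))\<close>. The others contribute
  nonnegatively because \<open>f\<close> is increasing.\<close>

lemma expct_first_order:
 assumes E: "finite E" and D: "D \<subseteq> E" and k: "\<And>e. 0 \<le> \<kappa> e" and f: "increasing_on E (\<lambda>B. f (W \<union> B))"
 shows "f W + (\<Sum>e\<in>D. \<kappa> e * (f (insert e W) - f W)) * exp (- (\<Sum>e\<in>D. \<kappa> e))
  \<le> expct \<kappa> E (\<lambda>B. f (W \<union> B))"
proof -
 have finD: "finite D" using E D finite_subset by auto
 define g where "g B = f (W \<union> B) - f W" for B
 define w where "w A = (\<Prod>e\<in>A. 1 - exp (- \<kappa> e)) * (\<Prod>e\<in>D - A. exp (- \<kappa> e))" for A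
 have w: "w A \<ge> 0" for A
  unfolding w_def by (intro mult_nonneg_nonneg prod_nonneg) (use k in auto)
 have g: "g B \<ge> 0" if "B \<subseteq> E" for B
  unfolding g_def using increasing_onD[OF f, of "{}" B] that by auto
 have w1: "\<kappa> e * exp (- (\<Sum>e\<in>D. \<kappa> e)) \<le> w {e}" if "e \<in> D" for e
 proof -
  have "1 + \<kappa> e \<le> exp (\<kappa> e)" by (rule exp_ge_add_one_self)
  then have "\<kappa> e * exp (- \<kappa> e) \<le> 1 - exp (- \<kappa> e)" by (simp add: exp_minus field_simps)
  moreover have "exp (- (\<Sum>e\<in>D. \<kappa> e)) = exp (- \<kappa> e) * (\<Prod>e\<in>D - {e}. exp (- \<kappa> e))"
   using finD that by (simp add: exp_sum[symmetric] exp_add[symmetric] sum.remove[of D e] sum_negf)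
  ultimately show ?thesis
   unfolding w_def by (simp add: mult.assoc[symmetric] mult_right_mono prod_nonneg)
 qed
 have "(\<Sum>e\<in>D. \<kappa> e * (f (insert e W) - f W)) * exp (- (\<Sum>e\<in>D. \<kappa> e)) =
   (\<Sum>e\<in>D. (\<kappa> e * exp (- (\<Sum>e\<in>D. \<kappa> e))) * g {e})"
  unfolding sum_distrib_right g_def by (intro sum.cong) auto
 also have "\<dots> \<le> (\<Sum>e\<in>D. w {e} * g {e})"
  by (intro sum_mono mult_right_mono w1 g) (use D in auto)
 also have "\<dots> = (\<Sum>A\<in>(\<lambda>e. {e}) ` D. w A * g A)"
  by (subst sum.reindex) auto
 also have "\<dots> \<le> (\<Sum>A\<in>Pow D. w A * g A)"
 proof (rule sum_mono2)
  fix A assume "A \<in> Pow D - (\<lambda>e. {e}) ` D"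
  then show "0 \<le> w A * g A" using w g[of A] D by auto
 qed (use finD in auto)
 also have "\<dots> = expct \<kappa> D g" by (simp add: expct_def w_def)
 also have "\<dots> \<le> expct \<kappa> E g"
 proof (intro expct_mono_set k E D)
  show "increasing_on E g"
   unfolding g_def[abs_def] increasing_on_def
   using increasing_onD[OF f] by auto
 qed
 also have "\<dots> = expct \<kappa> E (\<lambda>B. f (W \<union> B)) - f W"
  using E unfolding g_def[abs_def] by (simp add: expct_diff)
 finally show ?thesis by simp
qed

text \<open>
 \<open>ghost_free b n = \<integral>\<^sub>0\<^sup>b (1 - e\<^sup>-\<^sup>s\<^sup>n) ds\<close>; summed over the vertices of a cluster of size \<open>n\<close>
 it gives \<open>b n - 1 + e\<^sup>-\<^sup>b\<^sup>n\<close>, which increases by a product when two clusters merge.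
\<close>

definition ghost_free :: "real \<Rightarrow> nat \<Rightarrow> real" where
 "ghost_free b n = b - (1 - exp (- (b * n))) / n"

lemma one_minus_exp_le: "1 - exp (- (x::real)) \<le> x"
 using exp_ge_add_one_self[of "- x"] by linarith

lemma ghost_free_bounds:
 assumes "b \<ge> 0"
 shows "0 \<le> ghost_free b n" "ghost_free b n \<le> b"
 using one_minus_exp_le[of "b * n"] assms
 by (auto simp: ghost_free_def divide_simps)

lemma one_minus_exp_div_antimono:
 fixes x y :: real
 assumes "0 < x" "x \<le> y"
 shows "(1 - exp (- y)) / y \<le> (1 - exp (- x)) / x"
proof -
 have "exp ((1 - x / y) *\<^sub>R 0 + (x / y) *\<^sub>R (- y)) \<le> (1 - x / y) * exp 0 + (x / y) * exp (- y)"
  by (rule convex_onD[OF exp_convex]) (use assms in auto)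
 then have "exp (- x) \<le> 1 - x / y + x / y * exp (- y)" using assms by simp
 then have "x / y * (1 - exp (- y)) \<le> 1 - exp (- x)" by (simp add: algebra_simps)
 then show ?thesis using assms by (simp add: field_simps)
qed

lemma ghost_free_mono:
 assumes "b \<ge> 0" "m \<le> n" "m > 0"
 shows "ghost_free b m \<le> ghost_free b n"
proof (cases "b = 0")
 case False
 have "b * ((1 - exp (- (b * n))) / (b * n)) \<le> b * ((1 - exp (- (b * m))) / (b * m))"
  using assms False by (intro mult_left_mono one_minus_exp_div_antimono) auto
 then show ?thesis using assms False by (simp add: ghost_free_def)
qed (simp add: ghost_free_def)

lemma ghost_free_diff_le:
 assumes "b \<ge> 0" "m > 0"
 shows "ghost_free b n - ghost_free b m \<le> 1 / m"
proof -
 have "ghost_free b n \<le> b" using ghost_free_bounds assms by auto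
 moreover have "b - ghost_free b m \<le> 1 / m"
  using assms by (auto simp: ghost_free_def divide_simps)
 ultimately show ?thesis by linarith
qed

lemma mult_ghost_free: "n > 0 \<Longrightarrow> n * ghost_free b n = b * n - 1 + exp (- (b * n))"
 by (simp add: ghost_free_def field_simps)

lemma clus_insert_edge:
 assumes "\<not> conn W u v"
 shows "clus (insert {u, v} W) x =
  (if x \<in> clus W u \<union> clus W v then clus W u \<union> clus W v else clus W x)"
proof -
 have sub: "clus W x \<subseteq> clus (insert {u, v} W) x" for x by (rule clus_mono) auto
 have "conn (insert {u, v} W) u v" by (rule conn_edge) simp
 then have uv: "clus (insert {u, v} W) u = clus (insert {u, v} W) v" by (rule clus_eq)
 show ?thesis
 proof (cases "x \<in> clus W u \<union> clus W v")
  case True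
  have "clus (insert {u, v} W) x \<subseteq> clus W u \<union> clus W v"
  proof (rule clus_subsetI)
   fix a b assume "a \<in> clus W u \<union> clus W v" "a \<noteq> b" "{a, b} \<in> insert {u, v} W"
   then show "b \<in> clus W u \<union> clus W v"
    by (auto simp: doubleton_eq_iff dest: clus_closed)
  qed (use True in auto)
  moreover have "clus (insert {u, v} W) x = clus (insert {u, v} W) u"
  proof -
   have "conn (insert {u, v} W) u x"
    using True sub[of u] sub[of v] uv by (auto simp: clus_def)
   then show ?thesis by (simp add: clus_eq)
  qed
  ultimately show ?thesis using True sub[of u] sub[of v] uv by auto
 next
  case False
  have "clus (insert {u, v} W) x \<subseteq> clus W x"
  proof (rule clus_subsetI)
   fix a b assume *: "a \<in> clus W x" "a \<noteq> b" "{a, b} \<in> insert {u, v} W"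
   have "{a, b} \<noteq> {u, v}"
   proof
    assume "{a, b} = {u, v}"
    then have "conn W x u \<or> conn W x v" using * by (auto simp: doubleton_eq_iff clus_def)
    then show False using False conn_sym[of W x] by (auto simp: clus_def)
   qed
   then show "b \<in> clus W x" using * clus_closed[of a W x b] by auto
  qed simp
  then show ?thesis using False sub[of x] by auto
 qed
qed

text \<open>Summed over one cluster of size n, \<open>ghost_free\<close> gives b n - 1 + exp(-b n).
  When clusters merge the linear parts cancel and a product remains; this is the origin of the
  square of the magnetization in the merging inequality.\<close>

lemma sum_ghost_free_insert:
 assumes fin: "finite W" "finite V" and V: "clus W u \<subseteq> V" "clus W v \<subseteq> V"
 shows "(\<Sum>x\<in>V. ghost_free b (card (clus (insert {u, v} W) x)) - ghost_free b (card (clus W x))) =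
  of_bool (\<not> conn W u v) * ((1 - lap b u W) * (1 - lap b v W))"
proof (cases "conn W u v")
 case True
 have "clus (insert {u, v} W) x = clus W x" for x
 proof
  show "clus (insert {u, v} W) x \<subseteq> clus W x"
  proof (rule clus_subsetI)
   fix a b assume "a \<in> clus W x" "a \<noteq> b" "{a, b} \<in> insert {u, v} W"
   then show "b \<in> clus W x"
    using True conn_sym[OF True] conn_trans[of W x a b]
    by (auto simp: doubleton_eq_iff clus_def intro: conn_trans conn_step)
  qed simp
 qed (rule clus_mono, auto)
 then show ?thesis using True by simp
next
 case False
 let ?A = "clus W u" and ?C = "clus W v"
 let ?a = "card ?A" and ?c = "card ?C"
 have dis: "?A \<inter> ?C = {}" using clus_disjoint[OF False] .
 have finA: "finite ?A" "finite ?C" using fin by auto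
 have pos: "?a > 0" "?c > 0" using fin by auto
 have cx: "x \<in> ?A \<Longrightarrow> card (clus W x) = ?a" "x \<in> ?C \<Longrightarrow> card (clus W x) = ?c" for x
  using clus_eq[of W u x] clus_eq[of W v x] by (simp_all add: clus_def)
 have cx': "x \<in> ?A \<union> ?C \<Longrightarrow> card (clus (insert {u, v} W) x) = ?a + ?c" for x
  using clus_insert_edge[OF False, of x] card_Un_disjoint[OF finA dis] by simp
 have "(\<Sum>x\<in>V. ghost_free b (card (clus (insert {u, v} W) x)) - ghost_free b (card (clus W x))) =
   (\<Sum>x\<in>?A \<union> ?C. ghost_free b (card (clus (insert {u, v} W) x)) - ghost_free b (card (clus W x)))"
  by (rule sum.mono_neutral_right) (use fin V in \<open>auto simp: clus_insert_edge[OF False]\<close>)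
 also have "\<dots> = (\<Sum>x\<in>?A. ghost_free b (?a + ?c) - ghost_free b ?a) + (\<Sum>x\<in>?C. ghost_free b (?a + ?c) - ghost_free b ?c)"
  unfolding sum.union_disjoint[OF finA dis]
 proof (intro arg_cong2[where f="(+)"] sum.cong refl)
  fix x assume "x \<in> ?A"
  then show "ghost_free b (card (clus (insert {u, v} W) x)) - ghost_free b (card (clus W x)) =
   ghost_free b (?a + ?c) - ghost_free b ?a"
   by (subst cx(1), assumption, subst cx') auto
 next
  fix x assume "x \<in> ?C"
  then show "ghost_free b (card (clus (insert {u, v} W) x)) - ghost_free b (card (clus W x)) =
   ghost_free b (?a + ?c) - ghost_free b ?c"
   by (subst cx(2), assumption, subst cx') auto
 qed
 also have "\<dots> = (?a + ?c) * ghost_free b (?a + ?c) - ?a * ghost_free b ?a - ?c * ghost_free b ?c"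
  by (simp add: algebra_simps)
 also have "\<dots> = 1 + exp (- (b * (?a + ?c))) - exp (- (b * ?a)) - exp (- (b * ?c))"
  using pos by (simp only: mult_ghost_free[of "?a + ?c"] mult_ghost_free[of ?a] mult_ghost_free[of ?c] add_pos_pos)
   (simp add: algebra_simps)
 also have "\<dots> = (1 - lap b u W) * (1 - lap b v W)"
  by (simp add: lap_def exp_add[symmetric] algebra_simps)
 finally show ?thesis using False by simp
qed

section \<open>Tightness of the largest cluster\<close>

lemma conn_in_component:
 assumes "conn W x y"
 shows "conn {e \<in> W. e \<subseteq> clus W x} x y"
 using assms
proof (induction rule: conn_induct)
 case (step u v)
 have "{u, v} \<subseteq> clus W x" using step(1) conn_step[OF step(1) step(3)] by (auto simp: clus_def)
 then show ?case using conn_step[OF step(4)] step(3) by auto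
qed simp

lemma conn_outside:
 assumes "conn W x y" "\<not> conn W x z"
 shows "conn {e \<in> W. \<not> e \<subseteq> clus W z} x y"
 using assms(1)
proof (induction rule: conn_induct)
 case (step u v)
 have "u \<notin> clus W z"
  using step(1) assms(2) by (auto simp: clus_def dest: conn_sym conn_trans)
 then show ?case using conn_step[OF step(4)] step(3) by auto
qed simp

text \<open>
 A cluster of size at least \<open>3m\<close> splits at a vertex into two edge-disjoint connected pieces of
 size at least \<open>m\<close>: take a piece of size at least \<open>m\<close> with the fewest edges among those attached
 to the rest at a single vertex; its size is below \<open>2m\<close>.
\<close>

lemma clus_split:
 assumes fin: "finite W" and m: "1 \<le> m" and big: "3 * m \<le> card (clus W x \<inter> L)"
 shows "\<exists>I J y z. I \<inter> J = {} \<and> I \<union> J \<subseteq> W \<and> m \<le> card (clus I y \<inter> L) \<and> m \<le> card (clus J z \<inter> L)"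
proof -
 \<comment> \<open>The edge-disjoint sets \<open>I\<close> and \<open>W - I\<close>, both explored
   from \<open>w\<close>, still cover the cluster of \<open>x\<close>. So if the piece in
   \<open>I\<close> is not too large, the one in \<open>W - I\<close> must be large.\<close>
 define sep where "sep I w \<longleftrightarrow> I \<subseteq> W \<and> m \<le> card (clus I w \<inter> L) \<and> clus W x \<subseteq> clus I w \<union> clus (W - I) w" for I w
 have "sep W x" using big m by (auto simp: sep_def)
 then have ex: "\<exists>p. sep (fst p) (snd p)" by auto
 define p where "p = (ARG_MIN (\<lambda>p. card (fst p)) p. sep (fst p) (snd p))"
 obtain I w where p: "p = (I, w)" by fastforce
 have sepI: "sep I w" and min: "\<And>I' w'. sep I' w' \<Longrightarrow> card I \<le> card I'"
  using arg_min_natI[of "\<lambda>p. sep (fst p) (snd p)" _ "\<lambda>p. card (fst p)"]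
   arg_min_nat_le[of "\<lambda>p. sep (fst p) (snd p)" _ "\<lambda>p. card (fst p)"] ex p
  unfolding p_def[symmetric] by fastforce+
 have IW: "I \<subseteq> W" and Im: "m \<le> card (clus I w \<inter> L)" and cov: "clus W x \<subseteq> clus I w \<union> clus (W - I) w"
  using sepI by (auto simp: sep_def)
 have finI: "finite I" using IW fin finite_subset by auto
 have fc: "finite (clus A a)" if "A \<subseteq> W" for A a using that fin finite_subset by (metis finite_clus)
 have smaller: "\<not> sep I' w'" if "I' \<subset> I" for I' w'
  using min[of I' w'] psubset_card_mono[OF finI that] by auto
 \<comment> \<open>Remove an edge of \<open>I\<close> at \<open>w\<close>. If its ends stay
   connected, the smaller set still satisfies \<open>sep\<close>. Otherwise the piece falls into two
   parts, and a part of size \<open>m\<close> would itself satisfy \<open>sep\<close> with fewer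
   edges; so both parts are below \<open>m\<close>.\<close>
 have le: "card (clus I w \<inter> L) \<le> 2 * m"
 proof (cases "\<exists>v. v \<noteq> w \<and> {w, v} \<in> I")
  case False
  have "clus I w \<subseteq> {w}" by (rule clus_subsetI) (use False in auto)
  then have "card (clus I w \<inter> L) \<le> card {w}" by (intro card_mono) auto
  then show ?thesis using m by simp
 next
  case True
  then obtain v where v: "v \<noteq> w" "{w, v} \<in> I" by auto
  define I0 where "I0 = I - {{w, v}}"
  have I: "I = insert {w, v} I0" using v by (auto simp: I0_def)
  have I0: "I0 \<subset> I" using v by (auto simp: I0_def)
  have wv: "\<not> conn I0 w v"
  proof
   assume c: "conn I0 w v"
   have "clus I w \<subseteq> clus I0 w"
   proof (rule clus_subsetI)
    fix a b assume "a \<in> clus I0 w" "a \<noteq> b" "{a, b} \<in> I"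
    then show "b \<in> clus I0 w" using c
     by (auto simp: I doubleton_eq_iff clus_def intro: conn_step)
   qed simp
   then have eq: "clus I w = clus I0 w" using clus_mono[of I0 I w] I0 by auto
   have "clus (W - I) w \<subseteq> clus (W - I0) w" using I0 by (intro clus_mono) auto
   then have "sep I0 w" using sepI eq I0 unfolding sep_def by auto
   then show False using smaller[OF I0] by auto
  qed
  have cI: "clus I w = clus I0 w \<union> clus I0 v"
   unfolding I using clus_insert_edge[OF wv, of w] by simp
  define Iv where "Iv = {e \<in> I0. e \<subseteq> clus I0 v}"
  define Iw where "Iw = {e \<in> I0. \<not> e \<subseteq> clus I0 v}"
  have sub: "Iv \<subset> I" "Iw \<subset> I" using I0 by (auto simp: Iv_def Iw_def)
  have cv: "clus I0 v \<subseteq> clus Iv v"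
   using conn_in_component[of I0 v] by (auto simp: Iv_def clus_def)
  have cw: "clus I0 w \<subseteq> clus Iw w"
   using conn_outside[of I0 w _ v] wv by (auto simp: Iw_def clus_def)
  have WIv: "Iw \<subseteq> W - Iv" "Iv \<subseteq> W - Iw" using I0 IW by (auto simp: Iv_def Iw_def)
  have edge: "conn (W - Iv) v w" "conn (W - Iw) w v"
   using v IW by (auto intro!: conn_edge simp: Iv_def Iw_def I0_def insert_commute)
  have small_v: "card (clus I0 v \<inter> L) < m"
  proof (rule ccontr)
   assume "\<not> card (clus I0 v \<inter> L) < m"
   moreover have "card (clus I0 v \<inter> L) \<le> card (clus Iv v \<inter> L)"
    using cv sub IW by (intro card_mono finite_Int disjI1 fc) auto
   moreover have "clus W x \<subseteq> clus Iv v \<union> clus (W - Iv) v"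
   proof -
    have "clus I0 w \<subseteq> clus (W - Iv) w"
     using cw clus_mono[OF WIv(1)] by (rule subset_trans)
    moreover have "clus (W - I) w \<subseteq> clus (W - Iv) w"
     using sub by (intro clus_mono) auto
    ultimately show ?thesis using cov cI cv clus_eq[OF edge(1)] by blast
   qed
   ultimately have "sep Iv v" using sub IW by (auto simp: sep_def)
   then show False using smaller sub by auto
  qed
  have small_w: "card (clus I0 w \<inter> L) < m"
  proof (rule ccontr)
   assume "\<not> card (clus I0 w \<inter> L) < m"
   moreover have "card (clus I0 w \<inter> L) \<le> card (clus Iw w \<inter> L)"
    using cw sub IW by (intro card_mono finite_Int disjI1 fc) auto
   moreover have "clus W x \<subseteq> clus Iw w \<union> clus (W - Iw) w"
   proof -
    have "clus I0 v \<subseteq> clus (W - Iw) v"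
     using cv clus_mono[OF WIv(2)] by (rule subset_trans)
    moreover have "clus (W - I) w \<subseteq> clus (W - Iw) w"
     using sub by (intro clus_mono) auto
    ultimately show ?thesis using cov cI cw clus_eq[OF edge(2)] by blast
   qed
   ultimately have "sep Iw w" using sub IW by (auto simp: sep_def)
   then show False using smaller sub by auto
  qed
  have "card (clus I w \<inter> L) \<le> card (clus I0 w \<inter> L) + card (clus I0 v \<inter> L)"
   unfolding cI Int_Un_distrib2 by (rule card_Un_le)
  then show ?thesis using small_v small_w by linarith
 qed
 have "card (clus W x \<inter> L) \<le> card ((clus I w \<inter> L) \<union> (clus (W - I) w \<inter> L))"
  using cov IW by (intro card_mono finite_UnI finite_Int disjI1 fc) auto
 also have "\<dots> \<le> card (clus I w \<inter> L) + card (clus (W - I) w \<inter> L)" by (rule card_Un_le)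
 finally have "m \<le> card (clus (W - I) w \<inter> L)" using le big by linarith
 then show ?thesis using Im IW by (intro exI[of _ I] exI[of _ "W - I"] exI[of _ w]) auto
qed

definition has_clus :: "'v set \<Rightarrow> nat \<Rightarrow> 'v set set \<Rightarrow> bool" where
 "has_clus L m W \<longleftrightarrow> (\<exists>x. m \<le> card (clus W x \<inter> L))"

lemma card_clus_Int_mono:
 "finite L \<Longrightarrow> W \<subseteq> W' \<Longrightarrow> card (clus W x \<inter> L) \<le> card (clus W' x \<inter> L)"
 using clus_mono[of W W' x] by (intro card_mono) auto

lemma up_closed_has_clus: "finite L \<Longrightarrow> up_closed (has_clus L m)"
 unfolding up_closed_def has_clus_def
 using card_clus_Int_mono[of L] order_trans by blast

lemma prb_nonneg: "(\<And>e. 0 \<le> k e) \<Longrightarrow> 0 \<le> prb k E P"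
 by (rule expct_nonneg) auto

lemma prb_mono: "(\<And>e. 0 \<le> k e) \<Longrightarrow> (\<And>W. W \<subseteq> E \<Longrightarrow> P W \<Longrightarrow> Q W) \<Longrightarrow> prb k E P \<le> prb k E Q"
 by (rule expct_mono) auto

text \<open>By \<open>clus_split\<close> one cluster of size \<open>3 * m\<close> contains two
  edge-disjoint ones of size \<open>m\<close>, and BK squares the probability.\<close>

lemma prb_has_clus_triple:
 assumes k: "\<And>e. 0 \<le> k e" and E: "finite E" and L: "finite L" and m: "1 \<le> m"
 shows "prb k E (has_clus L (3 * m)) \<le> (prb k E (has_clus L m))\<^sup>2"
proof -
 have "prb k E (has_clus L (3 * m)) \<le> prb k E (disjoint_occ (has_clus L m) (has_clus L m))"
 proof (rule prb_mono[OF k])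
  fix W assume "W \<subseteq> E" "has_clus L (3 * m) W"
  then obtain x where x: "3 * m \<le> card (clus W x \<inter> L)" "finite W"
   using finite_subset[of W E] E unfolding has_clus_def by blast
  obtain I J y z where "I \<inter> J = {}" "I \<union> J \<subseteq> W" "m \<le> card (clus I y \<inter> L)" "m \<le> card (clus J z \<inter> L)"
   using clus_split[OF x(2) m x(1)] by (elim exE conjE)
  then show "disjoint_occ (has_clus L m) (has_clus L m) W"
   unfolding disjoint_occ_def by (intro exI[of _ I] exI[of _ J]) (auto simp: has_clus_def)
 qed
 also have "\<dots> \<le> prb k E (has_clus L m) * prb k E (has_clus L m)"
  by (rule expct_BK[OF k E up_closed_has_clus[OF L] up_closed_has_clus[OF L]])
 finally show ?thesis by (simp add: power2_eq_square)
qed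

text \<open>Every tripling of the size squares the probability, so beyond a median-like size
  \<open>m\<close> the largest cluster has a doubly exponential tail in the number of triplings, on
  any finite graph.\<close>

lemma prb_has_clus_power:
 assumes k: "\<And>e. 0 \<le> k e" and E: "finite E" and L: "finite L" and m: "1 \<le> m"
  and half: "prb k E (has_clus L m) \<le> 1 / 2"
 shows "prb k E (has_clus L (3 ^ j * m)) \<le> (1 / 2) ^ (2 ^ j)"
proof (induction j)
 case (Suc j)
 have "prb k E (has_clus L (3 ^ Suc j * m)) \<le> (prb k E (has_clus L (3 ^ j * m)))\<^sup>2"
  using prb_has_clus_triple[of k E L "3 ^ j * m", OF k E L] m by (simp add: mult.assoc)
 also have "\<dots> \<le> ((1 / 2) ^ (2 ^ j))\<^sup>2"
  by (intro power_mono Suc prb_nonneg k)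
 finally show ?case by (simp add: power_mult[symmetric] mult.commute)
qed (use half in simp)

lemma n_less_three: "(j::nat) < 3 ^ j"
 by (induction j) auto

section \<open>Moments of the largest cluster and of the number of vertices in large
  clusters\<close>

definition largest :: "'v set \<Rightarrow> 'v set set \<Rightarrow> nat" where
 "largest L W = Max (insert 0 ((\<lambda>x. card (clus W x \<inter> L)) ` L))"

lemma largest_ge: "finite L \<Longrightarrow> x \<in> L \<Longrightarrow> card (clus W x \<inter> L) \<le> largest L W"
 unfolding largest_def by (intro Max_ge) auto

lemma has_clus_largest:
 assumes "finite L" "0 < m" "m \<le> largest L W"
 shows "has_clus L m W"
proof -
 have "largest L W \<in> insert 0 ((\<lambda>x. card (clus W x \<inter> L)) ` L)"
  unfolding largest_def by (rule Max_in) (use assms in auto)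
 then obtain x where "largest L W = card (clus W x \<inter> L)" using assms by auto
 then show ?thesis using assms by (auto simp: has_clus_def)
qed

lemma largest_le_card: "finite L \<Longrightarrow> largest L W \<le> card L"
 unfolding largest_def by (auto intro!: card_mono)

text \<open>Between sizes \<open>3 ^ j * m\<close> and \<open>3 ^ (j + 1) * m\<close> the power
  \<open>q\<close> costs \<open>3 ^ (q * (j + 1))\<close>, and the probability is at most
  \<open>(1 / 2) ^ (2 ^ j)\<close>. The leading 1 covers sizes below \<open>m\<close>.\<close>

definition tail_const :: "nat \<Rightarrow> real" where
 "tail_const q = 1 + (\<Sum>j. 3 ^ (q * (j + 1)) * (1 / 2) ^ (2 ^ j))"

lemma summable_tail_const: "summable (\<lambda>j. 3 ^ (q * (j + 1)) * (1 / 2 :: real) ^ (2 ^ j))"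
proof (rule summable_ratio_test[of "1 / 2" "2 * q + 1"])
 fix j assume j: "j \<ge> 2 * q + 1"
 have "2 * q + 1 \<le> 2 ^ j" using j less_exp[of j] by linarith
 then have "(1 / 2 :: real) ^ (2 ^ j) \<le> (1 / 2) ^ (2 * q + 1)"
  by (intro power_decreasing) auto
 also have "\<dots> = (1 / 4) ^ q * (1 / 2)" by (simp add: power_mult power_one_over power2_eq_square)
 finally have "3 ^ q * (1 / 2 :: real) ^ (2 ^ j) \<le> 3 ^ q * ((1 / 4) ^ q * (1 / 2))"
  by (rule mult_left_mono) simp
 also have "\<dots> = (3 / 4) ^ q * (1 / 2)" by (simp add: power_divide)
 also have "\<dots> \<le> 1 * (1 / 2)" by (intro mult_right_mono power_le_one) auto
 finally have *: "3 ^ q * (1 / 2 :: real) ^ (2 ^ j) \<le> 1 / 2" by simp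
 have "3 ^ (q * (Suc j + 1)) * (1 / 2 :: real) ^ (2 ^ Suc j) =
   (3 ^ q * (1 / 2) ^ (2 ^ j)) * (3 ^ (q * (j + 1)) * (1 / 2) ^ (2 ^ j))"
  by (simp add: power_add power_mult power2_eq_square algebra_simps mult_2)
 also have "\<dots> \<le> 1 / 2 * (3 ^ (q * (j + 1)) * (1 / 2) ^ (2 ^ j))"
  by (intro mult_right_mono *) auto
 finally show "norm (3 ^ (q * (Suc j + 1)) * (1 / 2 :: real) ^ (2 ^ Suc j)) \<le>
   1 / 2 * norm (3 ^ (q * (j + 1)) * (1 / 2 :: real) ^ (2 ^ j))" by simp
qed simp

lemma tail_const_ge_1: "tail_const q \<ge> 1"
 unfolding tail_const_def using suminf_nonneg[OF summable_tail_const[of q]] by simp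

lemma expct_largest_power:
 assumes k: "\<And>e. 0 \<le> k e" and E: "finite E" and L: "finite L" and m: "1 \<le> m"
  and half: "prb k E (has_clus L m) \<le> 1 / 2"
 shows "expct k E (\<lambda>W. real (largest L W) ^ q) \<le> tail_const q * real m ^ q"
proof -
 define N where "N = card L"
 have pt: "real (largest L W) ^ q \<le> real m ^ q + (\<Sum>j<N. real (3 ^ (j + 1) * m) ^ q * of_bool (has_clus L (3 ^ j * m) W))" for W
 proof (cases "largest L W < m")
  case True
  then have "real (largest L W) ^ q \<le> real m ^ q" by (intro power_mono) auto
  then show ?thesis by (intro order_trans[OF _ add_increasing2]) (auto intro: sum_nonneg)
 next
  case False
  define j where "j = (GREATEST j. 3 ^ j * m \<le> largest L W)"
  have bound: "i \<le> N" if "3 ^ i * m \<le> largest L W" for i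
  proof -
   have "i < 3 ^ i" by (rule n_less_three)
   also have "3 ^ i \<le> 3 ^ i * m" using m by simp
   finally show ?thesis using that largest_le_card[OF L, of W] by (simp add: N_def)
  qed
  have j: "3 ^ j * m \<le> largest L W"
   unfolding j_def by (rule GreatestI_nat[of _ 0 N]) (use False bound in auto)
  have j': "largest L W < 3 ^ (j + 1) * m"
  proof (rule ccontr)
   assume "\<not> ?thesis"
   then have "j + 1 \<le> j" unfolding j_def
    by (intro Greatest_le_nat[of _ _ N]) (use bound in \<open>auto simp: j_def\<close>)
   then show False by simp
  qed
  have "j < 3 ^ j" by (rule n_less_three)
  also have "\<dots> \<le> 3 ^ j * m" using m by simp
  finally have jN: "j < N" using j largest_le_card[OF L, of W] by (simp add: N_def)
  have hc: "has_clus L (3 ^ j * m) W" by (rule has_clus_largest[OF L _ j]) (use m in auto)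
  have "real (largest L W) ^ q \<le> real (3 ^ (j + 1) * m) ^ q * of_bool (has_clus L (3 ^ j * m) W)"
   using j' hc by (auto intro!: power_mono simp del: of_nat_mult of_nat_power)
  also have "\<dots> \<le> (\<Sum>j<N. real (3 ^ (j + 1) * m) ^ q * of_bool (has_clus L (3 ^ j * m) W))"
   by (rule member_le_sum) (use jN in auto)
  finally show ?thesis by (simp add: add_increasing)
 qed
 have "expct k E (\<lambda>W. real (largest L W) ^ q) \<le>
   expct k E (\<lambda>W. real m ^ q + (\<Sum>j<N. real (3 ^ (j + 1) * m) ^ q * of_bool (has_clus L (3 ^ j * m) W)))"
  by (rule expct_mono[OF k pt])
 also have "\<dots> = real m ^ q + (\<Sum>j<N. real (3 ^ (j + 1) * m) ^ q * prb k E (has_clus L (3 ^ j * m)))"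
  using E by (simp add: expct_add expct_sum expct_cmult del: sum_of_bool_mult_eq sum_mult_of_bool_eq)
 also have "\<dots> \<le> real m ^ q + (\<Sum>j<N. real (3 ^ (j + 1) * m) ^ q * (1 / 2) ^ (2 ^ j))"
  by (intro add_left_mono sum_mono mult_left_mono prb_has_clus_power[OF k E L m half]) auto
 also have "\<dots> = real m ^ q * (1 + (\<Sum>j<N. 3 ^ (q * (j + 1)) * (1 / 2) ^ (2 ^ j)))"
  by (simp add: algebra_simps sum_distrib_left power_mult_distrib flip: power_mult power_add power_Suc)
 also have "\<dots> \<le> real m ^ q * tail_const q"
  unfolding tail_const_def
  by (intro mult_left_mono add_left_mono sum_le_suminf summable_tail_const) auto
 finally show ?thesis by (simp add: mult.commute)
qed

definition big_count :: "'v set \<Rightarrow> real \<Rightarrow> 'v set set \<Rightarrow> real" where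
 "big_count L n W = (\<Sum>x\<in>L. of_bool (n \<le> card (clus W x \<inter> L)))"

text \<open>Two vertices in large clusters lie either in different clusters, which is a disjoint
  occurrence and yields the squared mean by BK, or in the same one, which leaves at most
  \<open>largest L W\<close> choices for the second vertex.\<close>

lemma expct_big_count_square:
 assumes k: "\<And>e. 0 \<le> k e" and E: "finite E" and L: "finite L"
 shows "expct k E (\<lambda>W. (big_count L n W)\<^sup>2) \<le>
  (expct k E (big_count L n))\<^sup>2 + expct k E (\<lambda>W. largest L W * big_count L n W)"
proof -
 define good where "good x W \<longleftrightarrow> n \<le> card (clus W x \<inter> L)" for x W
 have up: "up_closed (good x)" for x
  unfolding up_closed_def good_def
 proof (intro allI impI)
  fix A B assume "A \<subseteq> B" "n \<le> card (clus A x \<inter> L)"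
  then show "n \<le> card (clus B x \<inter> L)" using card_clus_Int_mono[OF L, of A B x] by linarith
 qed
 have dis: "disjoint_occ (good x) (good y) W" if "good x W" "good y W" "\<not> conn W x y" for x y W
 proof -
  let ?I = "{e \<in> W. e \<subseteq> clus W x}" and ?J = "{e \<in> W. \<not> e \<subseteq> clus W x}"
  have "clus W x \<subseteq> clus ?I x" using conn_in_component[of W x] by (auto simp: clus_def)
  then have "card (clus W x \<inter> L) \<le> card (clus ?I x \<inter> L)" using L by (intro card_mono) auto
  moreover have "clus W y \<subseteq> clus ?J y"
   using conn_outside[of W y _ x] that(3) conn_sym[of W y x] by (auto simp: clus_def)
  then have "card (clus W y \<inter> L) \<le> card (clus ?J y \<inter> L)" using L by (intro card_mono) auto
  ultimately have "good x ?I" "good y ?J" using that by (auto simp: good_def)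
  then show ?thesis unfolding disjoint_occ_def by (intro exI[of _ ?I] exI[of _ ?J]) auto
 qed
 have N: "big_count L n W = (\<Sum>x\<in>L. of_bool (good x W))" for W
  by (simp add: big_count_def good_def)
 have pt: "(big_count L n W)\<^sup>2 \<le> (\<Sum>x\<in>L. \<Sum>y\<in>L. of_bool (disjoint_occ (good x) (good y) W)) + largest L W * big_count L n W" for W
 proof -
  have "(big_count L n W)\<^sup>2 = (\<Sum>x\<in>L. \<Sum>y\<in>L. of_bool (good x W) * of_bool (good y W))"
   by (simp add: N power2_eq_square sum_product)
  also have "\<dots> \<le> (\<Sum>x\<in>L. \<Sum>y\<in>L. of_bool (disjoint_occ (good x) (good y) W) + of_bool (good x W) * of_bool (conn W x y))"
   by (intro sum_mono) (use dis in auto)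
  also have "\<dots> = (\<Sum>x\<in>L. \<Sum>y\<in>L. of_bool (disjoint_occ (good x) (good y) W)) +
    (\<Sum>x\<in>L. of_bool (good x W) * (\<Sum>y\<in>L. of_bool (conn W x y)))"
   by (simp add: sum.distrib sum_distrib_left)
  also have "(\<Sum>x\<in>L. of_bool (good x W) * (\<Sum>y\<in>L. of_bool (conn W x y))) \<le> (\<Sum>x\<in>L. of_bool (good x W) * real (largest L W))"
  proof (intro sum_mono mult_left_mono)
   fix x assume x: "x \<in> L"
   have "(\<Sum>y\<in>L. of_bool (conn W x y)) = real (card {y \<in> L. conn W x y})"
    using L by (simp add: of_bool_def sum.If_cases Int_def)
   also have "{y \<in> L. conn W x y} = clus W x \<inter> L" by (auto simp: clus_def)
   finally show "(\<Sum>y\<in>L. of_bool (conn W x y)) \<le> real (largest L W)"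
    using largest_ge[OF L x, of W] by simp
  qed auto
  also have "\<dots> = largest L W * big_count L n W" by (simp add: N sum_distrib_left mult.commute)
  finally show ?thesis by simp
 qed
 have "expct k E (\<lambda>W. (big_count L n W)\<^sup>2) \<le>
  expct k E (\<lambda>W. (\<Sum>x\<in>L. \<Sum>y\<in>L. of_bool (disjoint_occ (good x) (good y) W)) + largest L W * big_count L n W)"
  by (rule expct_mono[OF k pt])
 also have "\<dots> = (\<Sum>x\<in>L. \<Sum>y\<in>L. prb k E (disjoint_occ (good x) (good y))) + expct k E (\<lambda>W. largest L W * big_count L n W)"
  by (simp add: expct_add expct_sum)
 also have "(\<Sum>x\<in>L. \<Sum>y\<in>L. prb k E (disjoint_occ (good x) (good y))) \<le> (\<Sum>x\<in>L. \<Sum>y\<in>L. prb k E (good x) * prb k E (good y))"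
  by (intro sum_mono expct_BK k E up)
 also have "\<dots> = (expct k E (big_count L n))\<^sup>2"
  by (simp add: N[abs_def] expct_sum power2_eq_square sum_product)
 finally show ?thesis by simp
qed

lemma quadratic_bound:
 fixes z :: real
 assumes "z\<^sup>2 \<le> g\<^sup>2 + b * z" "0 \<le> g" "0 \<le> b" "0 \<le> z"
 shows "z \<le> g + b"
proof (rule ccontr)
 assume "\<not> ?thesis"
 then have z: "g + b < z" by simp
 have "g * g \<le> g * z" using z assms by (intro mult_left_mono) auto
 then have "g\<^sup>2 + b * z \<le> (g + b) * z" by (simp add: power2_eq_square algebra_simps)
 also have "\<dots> < z * z" using z assms by (intro mult_strict_right_mono) auto
 finally show False using assms by (simp add: power2_eq_square)
qed

definition moment_const :: "nat \<Rightarrow> real" where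
 "moment_const p = sqrt (tail_const (2 * p)) * (1 + sqrt (tail_const 2))"

lemma moment_const_pos: "moment_const p > 0"
 unfolding moment_const_def using tail_const_ge_1[of "2 * p"] tail_const_ge_1[of 2]
 by (intro mult_pos_pos add_pos_nonneg) auto

text \<open>Vertices in clusters below size \<open>n\<close> are charged to the truncated mean; each
  of the others contributes at most the power \<open>p\<close> of \<open>largest L W\<close>.
  Cauchy-Schwarz separates the latter from the number of such vertices, whose second moment again
  involves the largest cluster; this gives a quadratic inequality for its root mean square
  \<open>z\<close>.\<close>

lemma expct_cluster_moment:
 fixes n g :: real and m p :: nat
 assumes k: "\<And>e. 0 \<le> k e" and E: "finite E" and L: "finite L" and m: "1 \<le> m" and p: "1 \<le> p"
  and half: "prb k E (has_clus L m) \<le> 1 / 2" and n: "n > 0"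
  and g: "expct k E (big_count L n) \<le> g"
 shows "(\<Sum>x\<in>L. expct k E (\<lambda>W. csize_in W x L ^ p)) \<le>
  n ^ (p - 1) * (\<Sum>x\<in>L. expct k E (\<lambda>W. min (csize_in W x L) n)) + moment_const p * real m ^ p * (g + m)"
proof -
 let ?N = "big_count L n"
 have N0: "?N W \<ge> 0" for W unfolding big_count_def by (rule sum_nonneg) auto
 have EN: "0 \<le> expct k E ?N" by (rule expct_nonneg[OF k N0])
 define z where "z = sqrt (expct k E (\<lambda>W. (?N W)\<^sup>2))"
 have z2: "z\<^sup>2 = expct k E (\<lambda>W. (?N W)\<^sup>2)" and z0: "z \<ge> 0"
  unfolding z_def by (auto intro!: expct_nonneg k)
 have CS: "expct k E (\<lambda>W. real (largest L W) ^ q * ?N W) \<le> sqrt (tail_const (2 * q)) * real m ^ q * z" for q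
 proof -
  have "(expct k E (\<lambda>W. real (largest L W) ^ q * ?N W))\<^sup>2 \<le>
    expct k E (\<lambda>W. (real (largest L W) ^ q)\<^sup>2) * z\<^sup>2"
   unfolding z2 by (rule expct_Cauchy_Schwarz[OF k])
  also have "\<dots> \<le> (tail_const (2 * q) * real m ^ (2 * q)) * z\<^sup>2"
   using expct_largest_power[OF k E L m half, of "2 * q"]
   by (intro mult_right_mono) (auto simp: power_mult[symmetric] mult.commute)
  also have "\<dots> = (sqrt (tail_const (2 * q)) * real m ^ q * z)\<^sup>2"
   using tail_const_ge_1[of "2 * q"] by (simp add: power_mult_distrib power_mult[symmetric] mult.commute)
  finally show ?thesis
   by (rule power2_le_imp_le) (use z0 tail_const_ge_1[of "2 * q"] in auto)
 qed
 have "z\<^sup>2 \<le> (expct k E ?N)\<^sup>2 + (sqrt (tail_const 2) * m) * z"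
  using expct_big_count_square[of k E L n, OF k E L] CS[of 1] unfolding z2 by simp
 then have "z \<le> expct k E ?N + sqrt (tail_const 2) * m"
  by (rule quadratic_bound) (use EN z0 tail_const_ge_1[of 2] in auto)
 then have z: "z \<le> (1 + sqrt (tail_const 2)) * (g + m)"
 proof -
  have "expct k E ?N + sqrt (tail_const 2) * m \<le> g + sqrt (tail_const 2) * m" using g by simp
  also have "\<dots> \<le> (1 + sqrt (tail_const 2)) * (g + m)"
   using EN g tail_const_ge_1[of 2] by (simp add: algebra_simps)
  finally show ?thesis using \<open>z \<le> expct k E ?N + sqrt (tail_const 2) * m\<close> by linarith
 qed
 have pt: "(\<Sum>x\<in>L. csize_in W x L ^ p) \<le>
   (\<Sum>x\<in>L. n ^ (p - 1) * min (csize_in W x L) n) + real (largest L W) ^ p * ?N W" for W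
 proof -
  have "csize_in W x L ^ p \<le> n ^ (p - 1) * min (csize_in W x L) n
    + real (largest L W) ^ p * of_bool (n \<le> card (clus W x \<inter> L))" if x: "x \<in> L" for x
  proof (cases "n \<le> card (clus W x \<inter> L)")
   case True
   have "csize_in W x L ^ p \<le> real (largest L W) ^ p"
    using largest_ge[OF L x, of W] by (intro power_mono) auto
   moreover have "0 \<le> n ^ (p - 1) * n" using n by simp
   ultimately show ?thesis using True by simp
  next
   case False
   have "csize_in W x L ^ p = csize_in W x L ^ (p - 1) * card (clus W x \<inter> L)"
    using p by (simp add: power_eq_if[of _ p])
   also have "\<dots> \<le> n ^ (p - 1) * card (clus W x \<inter> L)"
    using False by (intro mult_right_mono power_mono) auto
   finally show ?thesis using False by simp
  qed
  then have "(\<Sum>x\<in>L. csize_in W x L ^ p) \<le> (\<Sum>x\<in>L. n ^ (p - 1) * min (csize_in W x L) n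
    + real (largest L W) ^ p * of_bool (n \<le> card (clus W x \<inter> L)))"
   by (rule sum_mono)
  then show ?thesis by (simp add: sum.distrib big_count_def sum_distrib_left)
 qed
 have "(\<Sum>x\<in>L. expct k E (\<lambda>W. csize_in W x L ^ p)) \<le>
   n ^ (p - 1) * (\<Sum>x\<in>L. expct k E (\<lambda>W. min (csize_in W x L) n)) + expct k E (\<lambda>W. real (largest L W) ^ p * ?N W)"
  using expct_mono[of k E, OF k pt] by (simp add: expct_add expct_sum expct_cmult sum_distrib_left)
 also have "expct k E (\<lambda>W. real (largest L W) ^ p * ?N W) \<le> sqrt (tail_const (2 * p)) * real m ^ p * ((1 + sqrt (tail_const 2)) * (g + m))"
  using CS[of p] z by (rule order_trans[OF _ mult_left_mono]) (use tail_const_ge_1[of "2 * p"] in auto)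
 also have "\<dots> = moment_const p * real m ^ p * (g + m)"
  by (simp add: moment_const_def)
 finally show ?thesis by simp
qed

section \<open>Translation-invariant kernels\<close>

definition kernel_fn :: "('v::ab_group_add \<Rightarrow> real) \<Rightarrow> bool" where
 "kernel_fn c \<longleftrightarrow> (\<forall>x. 0 \<le> c x) \<and> (\<forall>x. c (- x) = c x) \<and> c 0 = 0"

lemma kernel_fn_nonneg: "kernel_fn c \<Longrightarrow> 0 \<le> c x"
 and kernel_fn_minus: "kernel_fn c \<Longrightarrow> c (- x) = c x"
 and kernel_fn_0: "kernel_fn c \<Longrightarrow> c 0 = 0"
 by (auto simp: kernel_fn_def)

lemma kernel_fn_commute: "kernel_fn c \<Longrightarrow> c (x - y) = c (y - x)"
 using kernel_fn_minus[of c "x - y"] by simp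

text \<open>The value 0 off \<open>edges\<close> makes the weight nonnegative on every set, the form
  in which the finite-graph lemmas ask for it.\<close>

definition wt :: "('v::ab_group_add \<Rightarrow> real) \<Rightarrow> 'v set \<Rightarrow> real" where
 "wt c e = (if e \<in> edges then edge_weight (\<lambda>x y. c (x - y)) e else 0)"

abbreviation expw :: "('v::ab_group_add \<Rightarrow> real) \<Rightarrow> 'v set set \<Rightarrow> ('v set set \<Rightarrow> real) \<Rightarrow> real" where
 "expw c \<equiv> expct (wt c)"

abbreviation prw :: "('v::ab_group_add \<Rightarrow> real) \<Rightarrow> 'v set set \<Rightarrow> ('v set set \<Rightarrow> bool) \<Rightarrow> real" where
 "prw c E P \<equiv> prb (wt c) E P"

abbreviation vol :: "'v::ab_group_add set \<Rightarrow> 'v set set \<Rightarrow> real" where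
 "vol A W \<equiv> csize_in W 0 A"

abbreviation csize0 :: "'v::ab_group_add set set \<Rightarrow> real" where
 "csize0 W \<equiv> csize W 0"

lemma edges_pair: "x \<noteq> y \<Longrightarrow> {x, y} \<in> edges"
 by (auto simp: edges_def)

lemma edges_cases:
 assumes "e \<in> edges"
 obtains x y where "x \<noteq> y" "e = {x, y}"
 using assms by (auto simp: edges_def)

lemma wt_pair: "kernel_fn c \<Longrightarrow> wt c {x, y} = c (x - y)"
proof (cases "x = y")
 case True
 assume "kernel_fn c"
 moreover have "{x, y} \<notin> edges" using True by (auto simp: edges_def)
 ultimately show ?thesis using True by (simp add: wt_def kernel_fn_0)
next
 case False
 assume "kernel_fn c"
 then show ?thesis using False
  by (simp add: wt_def edges_pair edge_weight_eq kernel_fn_commute[of c])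
qed

lemma wt_nonneg: "kernel_fn c \<Longrightarrow> 0 \<le> wt c e"
proof (cases "e \<in> edges")
 case True
 assume "kernel_fn c"
 then show ?thesis using True by (elim edges_cases) (simp add: wt_pair kernel_fn_nonneg)
qed (simp add: wt_def)

lemma kernel_fn_add: "kernel_fn c \<Longrightarrow> kernel_fn c' \<Longrightarrow> kernel_fn (\<lambda>x. c x + c' x)"
 by (auto simp: kernel_fn_def)

lemma kernel_fn_cmult: "kernel_fn c \<Longrightarrow> 0 \<le> a \<Longrightarrow> kernel_fn (\<lambda>x. a * c x)"
 by (auto simp: kernel_fn_def)

lemma wt_add:
 assumes "kernel_fn c" "kernel_fn c'"
 shows "wt (\<lambda>x. c x + c' x) e = wt c e + wt c' e"
proof (cases "e \<in> edges")
 case True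
 then show ?thesis
  by (elim edges_cases) (simp add: wt_pair kernel_fn_add assms)
qed (simp add: wt_def)

lemma wt_cmult:
 assumes "kernel_fn c" "0 \<le> a"
 shows "wt (\<lambda>x. a * c x) e = a * wt c e"
proof (cases "e \<in> edges")
 case True
 then show ?thesis
  by (elim edges_cases) (simp add: wt_pair kernel_fn_cmult assms)
qed (simp add: wt_def)

lemma wt_mono:
 assumes "kernel_fn c" "kernel_fn c'" "\<And>x. c x \<le> c' x"
 shows "wt c e \<le> wt c' e"
proof (cases "e \<in> edges")
 case True
 then show ?thesis
  by (elim edges_cases) (simp add: wt_pair assms)
qed (simp add: wt_def)

definition shift :: "'v::ab_group_add \<Rightarrow> 'v set set \<Rightarrow> 'v set set" where
 "shift z W = (\<lambda>e. (\<lambda>v. v + z) ` e) ` W"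

lemma shift_shift: "shift y (shift z W) = shift (z + y) W"
 by (auto simp: shift_def image_image add.assoc)

lemma shift_0 [simp]: "shift 0 W = W"
 by (simp add: shift_def)

lemma shift_inverse [simp]: "shift (- z) (shift z W) = W" "shift z (shift (- z) W) = W"
 by (simp_all add: shift_shift)

lemma clus_shift_subset: "(\<lambda>v. v + z) ` clus W x \<subseteq> clus (shift z W) (x + z)"
proof -
 have "clus W x \<subseteq> {v. v + z \<in> clus (shift z W) (x + z)}"
 proof (rule clus_subsetI)
  fix u v assume uv: "u \<in> {v. v + z \<in> clus (shift z W) (x + z)}" "{u, v} \<in> W"
  then have "(\<lambda>v. v + z) ` {u, v} \<in> shift z W" unfolding shift_def by (rule_tac imageI)
  then have "{u + z, v + z} \<in> shift z W" by simp
  then show "v \<in> {v. v + z \<in> clus (shift z W) (x + z)}"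
   using uv(1) clus_closed[of "u + z" "shift z W" "x + z" "v + z"] by simp
 qed auto
 then show ?thesis by auto
qed

lemma clus_shift: "clus (shift z W) (x + z) = (\<lambda>v. v + z) ` clus W x"
proof
 show "clus (shift z W) (x + z) \<subseteq> (\<lambda>v. v + z) ` clus W x"
 proof
  fix y assume "y \<in> clus (shift z W) (x + z)"
  then have "y + (- z) \<in> clus (shift (- z) (shift z W)) (x + z + (- z))"
   using clus_shift_subset[of "- z" "shift z W" "x + z"] by (meson imageI subsetD)
  then have "y - z \<in> clus W x" by simp
  then show "y \<in> (\<lambda>v. v + z) ` clus W x" by (rule rev_image_eqI) simp
 qed
qed (rule clus_shift_subset)

lemma card_clus_shift: "card (clus (shift z W) (x + z)) = card (clus W x)"
 unfolding clus_shift by (rule card_image) (simp add: inj_on_def)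

lemma inj_image_shift: "inj (\<lambda>e. (\<lambda>v::'v::ab_group_add. v + z) ` e)"
 by (rule inj_image_eq_iff[THEN iffD1, THEN injI]) (auto simp: inj_def)

lemma wt_shift:
 assumes "kernel_fn c"
 shows "wt c ((\<lambda>v. v + z) ` e) = wt c e"
proof (cases "e \<in> edges")
 case True
 then obtain x y where "x \<noteq> y" "e = {x, y}" by (rule edges_cases)
 then show ?thesis using assms by (simp add: wt_pair)
next
 case False
 have "(\<lambda>v. v + z) ` e \<notin> edges"
 proof
  assume "(\<lambda>v. v + z) ` e \<in> edges"
  then obtain x y where xy: "x \<noteq> y" "(\<lambda>v. v + z) ` e = {x, y}" by (rule edges_cases)
  then have "(\<lambda>v. v - z) ` ((\<lambda>v. v + z) ` e) = {x - z, y - z}" by simp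
  then have "e = {x - z, y - z}" by (simp add: image_image)
  then show False using False edges_pair[of "x - z" "y - z"] xy(1) by auto
 qed
 then show ?thesis using False by (simp add: wt_def)
qed

lemma expct_shift:
 assumes "kernel_fn c" "finite E"
 shows "expw c (shift z E) f = expw c E (\<lambda>W. f (shift z W))"
 unfolding shift_def
 using expct_reindex[OF assms(2), of "\<lambda>e. (\<lambda>v. v + z) ` e" "wt c" f] inj_image_shift[of z]
 by (auto simp: wt_shift[OF assms(1)] intro: inj_on_subset)

definition fins :: "'v set set set" where
 "fins = {E. finite E \<and> E \<subseteq> edges}"

lemma finsD: "E \<in> fins \<Longrightarrow> finite E" by (simp add: fins_def)

lemma empty_fins [simp]: "{} \<in> fins" by (simp add: fins_def)

lemma Un_fins: "E \<in> fins \<Longrightarrow> F \<in> fins \<Longrightarrow> E \<union> F \<in> fins" by (auto simp: fins_def)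

lemma UN_fins: "finite X \<Longrightarrow> (\<And>x. x \<in> X \<Longrightarrow> E x \<in> fins) \<Longrightarrow> (\<Union>x\<in>X. E x) \<in> fins"
 by (auto simp: fins_def)

lemma shift_fins: "E \<in> fins \<Longrightarrow> shift z E \<in> fins"
proof -
 assume E: "E \<in> fins"
 have "(\<lambda>v. v + z) ` e \<in> edges" if "e \<in> edges" for e
  using that by (elim edges_cases) (simp add: edges_pair)
 then show ?thesis using E by (auto simp: fins_def shift_def)
qed

lemma finite_Union_fins: "E \<in> fins \<Longrightarrow> finite (\<Union>E)"
 by (auto simp: fins_def edges_def)

text \<open>Infinite-volume expectations of increasing functionals, as suprema over finite graphs.\<close>

definition lim_exp :: "('v::ab_group_add \<Rightarrow> real) \<Rightarrow> ('v set set \<Rightarrow> real) \<Rightarrow> real" where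
 "lim_exp c f = (SUP E\<in>fins. expw c E f)"

lemma lim_exp_upper:
 assumes "kernel_fn c" "\<And>W. f W \<le> B" "E \<in> fins"
 shows "expw c E f \<le> lim_exp c f"
 unfolding lim_exp_def
proof (rule cSUP_upper[OF assms(3)])
 show "bdd_above ((\<lambda>E. expw c E f) ` fins)"
  using assms by (intro bdd_aboveI[of _ B]) (auto intro!: expct_le_const wt_nonneg finsD)
qed

lemma lim_exp_least: "(\<And>E. E \<in> fins \<Longrightarrow> expw c E f \<le> B) \<Longrightarrow> lim_exp c f \<le> B"
 unfolding lim_exp_def by (rule cSUP_least) (use empty_fins in blast)+

lemma lim_exp_approx:
 assumes "kernel_fn c" "\<And>W. f W \<le> B" "\<epsilon> > 0"
 obtains E where "E \<in> fins" "lim_exp c f - \<epsilon> < expw c E f"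
proof -
 have "\<exists>E\<in>fins. lim_exp c f - \<epsilon> < expw c E f"
 proof (rule ccontr)
  assume "\<not> ?thesis"
  then have "lim_exp c f \<le> lim_exp c f - \<epsilon>" by (intro lim_exp_least) (auto simp: not_less)
  then show False using assms by simp
 qed
 then show ?thesis using that by blast
qed

definition ghost_prob :: "('v::ab_group_add \<Rightarrow> real) \<Rightarrow> real \<Rightarrow> real" where
 "ghost_prob c h = lim_exp c (\<lambda>W. 1 - lap h 0 W)"

definition ghost_int :: "('v::ab_group_add \<Rightarrow> real) \<Rightarrow> real \<Rightarrow> real" where
 "ghost_int c b = lim_exp c (\<lambda>W. ghost_free b (card (clus W 0)))"

lemma expct_card_shift:
 assumes "kernel_fn c" "E \<in> fins"
 shows "expw c (shift x E) (\<lambda>W. F (card (clus W (y + x)))) = expw c E (\<lambda>W. F (card (clus W y)))"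
 using expct_shift[OF assms(1) finsD[OF assms(2)]] by (simp add: card_clus_shift)

lemma expct_card_root:
 assumes "kernel_fn c" "E \<in> fins"
 shows "expw c E (\<lambda>W. F (card (clus W x))) = expw c (shift (- x) E) (\<lambda>W. F (card (clus W 0)))"
 using expct_card_shift[OF assms(1) shift_fins[OF assms(2), of "- x"], of x F 0] by simp

lemma ghost_prob_upper:
 assumes c: "kernel_fn c" and E: "E \<in> fins"
 shows "1 - expw c E (lap h x) \<le> ghost_prob c h"
proof -
 have "1 - expw c E (lap h x) = expw c E (\<lambda>W. 1 - lap h x W)"
  using finsD[OF E] by (simp add: expct_diff)
 also have "\<dots> = expw c (shift (- x) E) (\<lambda>W. 1 - lap h 0 W)"
  unfolding lap_def using expct_card_root[OF c E, of "\<lambda>n. 1 - exp (- (h * real n))"] by simp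
 also have "\<dots> \<le> ghost_prob c h"
  unfolding ghost_prob_def by (rule lim_exp_upper[OF c _ shift_fins[OF E], of _ 1]) (auto simp: lap_def)
 finally show ?thesis .
qed

lemma ghost_int_upper:
 assumes c: "kernel_fn c" and E: "E \<in> fins" and b: "b \<ge> 0"
 shows "expw c E (\<lambda>W. ghost_free b (card (clus W x))) \<le> ghost_int c b"
 unfolding expct_card_root[OF c E] ghost_int_def
 by (rule lim_exp_upper[OF c _ shift_fins[OF E], of _ b]) (use ghost_free_bounds[OF b] in auto)

lemma ghost_prob_least:
 assumes "\<And>E. E \<in> fins \<Longrightarrow> 1 - expw c E (lap h 0) \<le> B"
 shows "ghost_prob c h \<le> B"
 unfolding ghost_prob_def
 by (rule lim_exp_least) (use assms in \<open>simp add: expct_diff finsD\<close>)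

lemma ghost_prob_approx:
 assumes "kernel_fn c" "\<epsilon> > 0"
 obtains E where "E \<in> fins" "ghost_prob c h - \<epsilon> < 1 - expw c E (lap h 0)"
proof -
 obtain E where E: "E \<in> fins" "ghost_prob c h - \<epsilon> < expw c E (\<lambda>W. 1 - lap h 0 W)"
  unfolding ghost_prob_def
  by (rule lim_exp_approx[OF assms(1), of "\<lambda>W. 1 - lap h 0 W" 1 \<epsilon>]) (use assms in \<open>auto simp: lap_def\<close>)
 then show ?thesis using that[of E] by (simp add: expct_diff finsD)
qed

lemma ghost_prob_bounds:
 assumes "kernel_fn c" "h \<ge> 0"
 shows "0 \<le> ghost_prob c h" "ghost_prob c h \<le> 1"
proof -
 have "0 \<le> 1 - expw c {} (lap h 0)" using assms by (simp add: lap_bounds)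
 also have "\<dots> \<le> ghost_prob c h" by (rule ghost_prob_upper) (use assms in auto)
 finally show "0 \<le> ghost_prob c h" .
 show "ghost_prob c h \<le> 1"
  by (rule ghost_prob_least) (use assms in \<open>auto intro!: expct_nonneg wt_nonneg lap_bounds\<close>)
qed

lemma ghost_prob_mono:
 assumes "kernel_fn c" "h \<le> h'"
 shows "ghost_prob c h \<le> ghost_prob c h'"
proof (rule ghost_prob_least)
 fix E :: "'a set set" assume E: "E \<in> fins"
 have "expw c E (lap h' 0) \<le> expw c E (lap h 0)"
  by (intro expct_mono wt_nonneg assms) (auto simp: lap_def assms mult_right_mono)
 then show "1 - expw c E (lap h 0) \<le> ghost_prob c h'"
  using ghost_prob_upper[OF assms(1) E, of h' 0] by linarith
qed

lemma sum_bdry_le: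
 assumes c: "kernel_fn c" and E: "E \<in> fins" and S: "finite S"
  and \<Delta>: "\<And>Y. finite Y \<Longrightarrow> sum c Y \<le> \<Delta>"
 shows "(\<Sum>e\<in>bdry E S. wt c e) \<le> \<Delta> * card S"
proof -
 define V where "V = \<Union>E"
 have V: "finite V" unfolding V_def using E by (rule finite_Union_fins)
 have "bdry E S \<subseteq> (\<lambda>(x, y). {x, y}) ` (S \<times> V)"
 proof
  fix e assume e: "e \<in> bdry E S"
  then have "e \<in> edges" using E by (auto simp: bdry_def fins_def)
  then obtain x y where xy: "x \<noteq> y" "e = {x, y}" by (rule edges_cases)
  then have "(x \<in> S \<or> y \<in> S) \<and> {x, y} \<subseteq> V" using e by (auto simp: bdry_def V_def)
  then have "(x, y) \<in> S \<times> V \<or> (y, x) \<in> S \<times> V" by auto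
  then show "e \<in> (\<lambda>(x, y). {x, y}) ` (S \<times> V)"
  proof
   assume "(x, y) \<in> S \<times> V" then show ?thesis using xy by (auto intro!: rev_image_eqI)
  next
   assume "(y, x) \<in> S \<times> V" then show ?thesis using xy by (auto intro!: rev_image_eqI)
  qed
 qed
 then have "(\<Sum>e\<in>bdry E S. wt c e) \<le> (\<Sum>e\<in>(\<lambda>(x, y). {x, y}) ` (S \<times> V). wt c e)"
  by (intro sum_mono2) (use S V wt_nonneg[OF c] in auto)
 also have "\<dots> \<le> (\<Sum>p\<in>S \<times> V. wt c ((\<lambda>(x, y). {x, y}) p))"
  using S V wt_nonneg[OF c] by (intro order_trans[OF sum_image_le]) (auto simp: o_def)
 also have "\<dots> = (\<Sum>x\<in>S. \<Sum>y\<in>V. c (x - y))"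
  by (simp add: sum.cartesian_product[symmetric] wt_pair[OF c] case_prod_unfold sum.cartesian_product)
 also have "\<dots> \<le> (\<Sum>x\<in>S. \<Delta>)"
 proof (rule sum_mono)
  fix x
  have "(\<Sum>y\<in>V. c (x - y)) = sum c ((\<lambda>y. x - y) ` V)"
   by (subst sum.reindex) (auto simp: inj_on_def)
  also have "\<dots> \<le> \<Delta>" using V by (intro \<Delta>) auto
  finally show "(\<Sum>y\<in>V. c (x - y)) \<le> \<Delta>" .
 qed
 finally show ?thesis by (simp add: mult.commute)
qed

text \<open>The sprinkled edges at the old cluster weigh at most \<open>\<Delta>\<close> per vertex,
  and each leads to the ghost with probability at most the new magnetization. For the old model this
  acts like an additional field.\<close>

theorem ghost_prob_sprinkle:
 assumes c: "kernel_fn c" and \<kappa>: "kernel_fn \<kappa>" and h: "h \<ge> 0"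
  and \<Delta>: "\<And>Y. finite Y \<Longrightarrow> sum \<kappa> Y \<le> \<Delta>"
 shows "ghost_prob (\<lambda>x. c x + \<kappa> x) h \<le> ghost_prob c (h + \<Delta> * ghost_prob (\<lambda>x. c x + \<kappa> x) h)"
proof (rule ghost_prob_least)
 fix E :: "'a set set" assume E: "E \<in> fins"
 let ?c' = "\<lambda>x. c x + \<kappa> x"
 let ?\<mu> = "ghost_prob ?c' h"
 have c': "kernel_fn ?c'" by (rule kernel_fn_add[OF c \<kappa>])
 have \<mu>: "0 \<le> ?\<mu>" using ghost_prob_bounds[OF c' h] by simp
 have weq: "wt ?c' = (\<lambda>e. wt c e + wt \<kappa> e)" using wt_add[OF c \<kappa>] by auto
 have "1 - expw c E (lap (h + \<Delta> * ?\<mu>) 0) \<le> ghost_prob c (h + \<Delta> * ?\<mu>)"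
  by (rule ghost_prob_upper[OF c E])
 moreover have "expw c E (lap (h + \<Delta> * ?\<mu>) 0) \<le>
   expw c E (\<lambda>W. exp (- (h * card (clus W 0)) - ?\<mu> * (\<Sum>e\<in>bdry E (clus W 0). wt \<kappa> e)))"
 proof (rule expct_mono[OF wt_nonneg[OF c]])
  fix W assume "W \<subseteq> E"
  then have "finite (clus W 0)" using finsD[OF E] finite_subset by auto
  then have "(\<Sum>e\<in>bdry E (clus W 0). wt \<kappa> e) \<le> \<Delta> * card (clus W 0)"
   by (intro sum_bdry_le \<kappa> E \<Delta>)
  then have "?\<mu> * (\<Sum>e\<in>bdry E (clus W 0). wt \<kappa> e) \<le> ?\<mu> * (\<Delta> * card (clus W 0))"
   using \<mu> by (rule mult_left_mono)
  then show "lap (h + \<Delta> * ?\<mu>) 0 W \<le> exp (- (h * card (clus W 0)) - ?\<mu> * (\<Sum>e\<in>bdry E (clus W 0). wt \<kappa> e))"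
   by (simp add: lap_def algebra_simps)
 qed
 moreover have "\<dots> \<le> expct (\<lambda>e. wt c e + wt \<kappa> e) E (lap h 0)"
 proof (rule sprinkle_ghost[OF finsD[OF E] wt_nonneg[OF c] wt_nonneg[OF \<kappa>] h])
  fix y
  show "1 - expct (\<lambda>e. wt c e + wt \<kappa> e) E (lap h y) \<le> ?\<mu>"
   using ghost_prob_upper[OF c' E, of h y] by (simp add: weq)
 qed
 ultimately show "1 - expw ?c' E (lap h 0) \<le> ghost_prob c (h + \<Delta> * ?\<mu>)"
  by (simp add: weq)
qed

section \<open>Merging lower bound\<close>

lemma card_int_box:
 "card {x :: int ^ 'd. \<forall>i. a \<le> x $ i \<and> x $ i < b} = nat (b - a) ^ CARD('d)"
proof -
 have "bij_betw (\<lambda>f. \<chi> i. f i) (PiE (UNIV :: 'd set) (\<lambda>_. {a..<b})) {x. \<forall>i. a \<le> x $ i \<and> x $ i < b}"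
  unfolding bij_betw_def
 proof
  show "inj_on (\<lambda>f. \<chi> i. f i) (PiE (UNIV :: 'd set) (\<lambda>_. {a..<b}))"
   by (auto simp: inj_on_def vec_eq_iff fun_eq_iff)
  show "(\<lambda>f. \<chi> i. f i) ` PiE (UNIV :: 'd set) (\<lambda>_. {a..<b}) = {x. \<forall>i. a \<le> x $ i \<and> x $ i < b}"
  proof
   show "{x. \<forall>i. a \<le> x $ i \<and> x $ i < b} \<subseteq> (\<lambda>f. \<chi> i. f i) ` PiE (UNIV :: 'd set) (\<lambda>_. {a..<b})"
   proof
    fix x :: "int ^ 'd" assume "x \<in> {x. \<forall>i. a \<le> x $ i \<and> x $ i < b}"
    then show "x \<in> (\<lambda>f. \<chi> i. f i) ` PiE (UNIV :: 'd set) (\<lambda>_. {a..<b})"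
     by (intro image_eqI[of _ _ "\<lambda>i. x $ i"]) (auto simp: vec_eq_iff)
   qed
  qed (auto simp: PiE_def)
 qed
 then have "card {x :: int ^ 'd. \<forall>i. a \<le> x $ i \<and> x $ i < b} = card (PiE (UNIV :: 'd set) (\<lambda>_. {a..<b}))"
  by (simp add: bij_betw_same_card)
 also have "\<dots> = nat (b - a) ^ CARD('d)"
  by (simp add: card_PiE)
 finally show ?thesis .
qed

lemma finite_int_box: "finite {x :: int ^ 'd. \<forall>i. a \<le> x $ i \<and> x $ i < b}"
proof (cases "a < b")
 case True
 then show ?thesis by (intro card_ge_0_finite) (simp add: card_int_box)
next
 case False
 then have "{x :: int ^ 'd. \<forall>i. a \<le> x $ i \<and> x $ i < b} = {}" by force
 then show ?thesis by (simp only: finite.emptyI)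
qed

text \<open>An open edge changes the functional at all roots of two clusters at once, so gains have
  to be counted per vertex of a finite box. All but a small fraction of the roots of a large box see
  copies of a given finite pattern inside it.\<close>

lemma folner:
 fixes U :: "(int ^ 'd) set" and \<epsilon> :: real
 assumes U: "finite U" and \<epsilon>: "\<epsilon> > 0"
 obtains L where "finite L" "L \<noteq> {}" "(1 - \<epsilon>) * card L \<le> card {x \<in> L. \<forall>u\<in>U. u + x \<in> L}"
proof -
 define R where "R = Max (insert 0 ((\<lambda>(u, i). \<bar>u $ i\<bar>) ` (U \<times> (UNIV :: 'd set))))"
 have fin: "finite (insert 0 ((\<lambda>(u, i). \<bar>u $ i\<bar>) ` (U \<times> (UNIV :: 'd set))))" using U by auto
 have R0: "R \<ge> 0" unfolding R_def using fin by (intro Max_ge) auto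
 have R: "\<bar>u $ i\<bar> \<le> R" if "u \<in> U" for u i
  unfolding R_def using fin that by (intro Max_ge) auto
 have "(\<lambda>n. ((real n - 2 * R) / real n) ^ CARD('d)) \<longlonglongrightarrow> 1 ^ CARD('d)"
 proof (intro tendsto_power)
  have "(\<lambda>n. 1 - 2 * R / real n) \<longlonglongrightarrow> 1 - 0"
   by (intro tendsto_diff tendsto_const lim_const_over_n)
  moreover have "\<forall>\<^sub>F n in sequentially. 1 - 2 * R / real n = (real n - 2 * R) / real n"
   using eventually_gt_at_top[of 0] by eventually_elim (simp add: field_simps)
  ultimately show "(\<lambda>n. (real n - 2 * R) / real n) \<longlonglongrightarrow> 1"
   by (simp add: filterlim_cong)
 qed
 then have "\<forall>\<^sub>F n in sequentially. 1 - \<epsilon> < ((real n - 2 * R) / real n) ^ CARD('d)"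
  using \<epsilon> by (intro order_tendstoD(1)) auto
 then have "\<forall>\<^sub>F n in sequentially. 1 - \<epsilon> < ((real n - 2 * R) / real n) ^ CARD('d) \<and> n > nat (2 * R)"
  using eventually_gt_at_top[of "nat (2 * R)"] by eventually_elim simp
 then obtain n where n: "1 - \<epsilon> < ((real n - 2 * R) / real n) ^ CARD('d)" "n > nat (2 * R)"
  by (auto simp: eventually_sequentially)
 have n0: "n > 0" "int n > 2 * R" using n(2) R0 by auto
 define L where "L = {x :: int ^ 'd. \<forall>i. 0 \<le> x $ i \<and> x $ i < int n}"
 have cL: "card L = n ^ CARD('d)" unfolding L_def card_int_box by simp
 have "{x :: int ^ 'd. \<forall>i. R \<le> x $ i \<and> x $ i < int n - R} \<subseteq> {x \<in> L. \<forall>u\<in>U. u + x \<in> L}"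
 proof
  fix x :: "int ^ 'd" assume x: "x \<in> {x. \<forall>i. R \<le> x $ i \<and> x $ i < int n - R}"
  have "x \<in> L"
   unfolding L_def
  proof (intro CollectI allI)
   fix i
   have "R \<le> x $ i \<and> x $ i < int n - R" using x by blast
   then show "0 \<le> x $ i \<and> x $ i < int n" using R0 by linarith
  qed
  moreover have "u + x \<in> L" if "u \<in> U" for u
   unfolding L_def
  proof (intro CollectI allI)
   fix i
   have "R \<le> x $ i \<and> x $ i < int n - R" using x by blast
   then show "0 \<le> (u + x) $ i \<and> (u + x) $ i < int n" using R[OF that, of i] by (simp add: abs_le_iff)
  qed
  ultimately show "x \<in> {x \<in> L. \<forall>u\<in>U. u + x \<in> L}" by auto
 qed
 then have "card {x :: int ^ 'd. \<forall>i. R \<le> x $ i \<and> x $ i < int n - R} \<le> card {x \<in> L. \<forall>u\<in>U. u + x \<in> L}"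
  by (intro card_mono) (auto simp: L_def finite_int_box)
 then have "nat (int n - 2 * R) ^ CARD('d) \<le> card {x \<in> L. \<forall>u\<in>U. u + x \<in> L}"
  by (simp add: card_int_box)
 then have "real (nat (int n - 2 * R)) ^ CARD('d) \<le> card {x \<in> L. \<forall>u\<in>U. u + x \<in> L}"
  unfolding of_nat_power[symmetric] of_nat_le_iff .
 moreover have Rn: "real (nat (int n - 2 * R)) = real n - 2 * R"
  using n0(2) by (subst of_nat_nat) auto
 ultimately have "(real n - 2 * R) ^ CARD('d) \<le> card {x \<in> L. \<forall>u\<in>U. u + x \<in> L}"
  by (simp only: Rn)
 moreover have "(1 - \<epsilon>) * card L \<le> (real n - 2 * R) ^ CARD('d)"
 proof -
  have "(1 - \<epsilon>) * real n ^ CARD('d) \<le> ((real n - 2 * R) / real n) ^ CARD('d) * real n ^ CARD('d)"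
   using n(1) by (intro mult_right_mono) auto
  also have "\<dots> = (real n - 2 * R) ^ CARD('d)" using n0 by (simp add: power_divide)
  finally show ?thesis by (simp add: cL)
 qed
 moreover have "finite L" "L \<noteq> {}"
  using cL n0 by (auto simp: L_def finite_int_box intro!: exI[of _ 0])
 ultimately show ?thesis using that[of L] by linarith
qed

definition pairs :: "'v set \<Rightarrow> 'v set set" where
 "pairs L = {e \<in> edges. e \<subseteq> L}"

lemma pairs_eq_image: "pairs L = (\<lambda>(x, y). {x, y}) ` {p \<in> L \<times> L. fst p \<noteq> snd p}"
 by (force simp: pairs_def edges_def)

lemma pairs_fins: "finite L \<Longrightarrow> pairs L \<in> fins"
 by (auto simp: fins_def pairs_eq_image) (auto simp: edges_def)

lemma clus_pairs_subset: "W \<subseteq> pairs L \<Longrightarrow> x \<in> L \<Longrightarrow> clus W x \<subseteq> L"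
 by (rule clus_subsetI) (auto simp: pairs_def)

text \<open>Each unordered pair comes from two ordered ones. The resulting factor 1/2 is the one in
  front of \<open>\<Delta>\<close> in the merging inequality.\<close>

lemma sum_pairs:
 fixes a :: "'v::ab_group_add \<Rightarrow> 'v \<Rightarrow> real"
 assumes L: "finite L" and c: "kernel_fn \<kappa>" and sym: "\<And>x y. a x y = a y x"
  and f: "\<And>x y. x \<in> L \<Longrightarrow> y \<in> L \<Longrightarrow> x \<noteq> y \<Longrightarrow> f {x, y} = a x y"
 shows "(\<Sum>e\<in>pairs L. wt \<kappa> e * f e) = (1 / 2) * (\<Sum>x\<in>L. \<Sum>y\<in>L. \<kappa> (y - x) * a x y)"
proof -
 let ?D = "{p \<in> L \<times> L. fst p \<noteq> snd p}"
 let ?g = "\<lambda>(x, y). {x, y}"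
 have fibre: "(\<Sum>p\<in>{p \<in> ?D. ?g p = e}. wt \<kappa> e * f e) = 2 * (wt \<kappa> e * f e)" if e: "e \<in> pairs L" for e
 proof -
  obtain x y where xy: "x \<noteq> y" "e = {x, y}" "x \<in> L" "y \<in> L"
   using e by (auto simp: pairs_def edges_def)
  then have "{p \<in> ?D. ?g p = e} = {(x, y), (y, x)}" by (auto simp: doubleton_eq_iff)
  then show ?thesis using xy by simp
 qed
 have "(\<Sum>x\<in>L. \<Sum>y\<in>L. \<kappa> (y - x) * a x y) = (\<Sum>p\<in>L \<times> L. \<kappa> (snd p - fst p) * a (fst p) (snd p))"
  by (simp add: sum.cartesian_product case_prod_unfold)
 also have "\<dots> = (\<Sum>p\<in>?D. \<kappa> (snd p - fst p) * a (fst p) (snd p))"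
  by (rule sum.mono_neutral_right) (use L c in \<open>auto simp: kernel_fn_0\<close>)
 also have "\<dots> = (\<Sum>p\<in>?D. wt \<kappa> (?g p) * f (?g p))"
  by (rule sum.cong) (use c f in \<open>auto simp: wt_pair kernel_fn_commute\<close>)
 also have "\<dots> = (\<Sum>e\<in>?g ` ?D. \<Sum>p\<in>{p \<in> ?D. ?g p = e}. wt \<kappa> (?g p) * f (?g p))"
  by (rule sum.image_gen) (use L in auto)
 also have "\<dots> = (\<Sum>e\<in>pairs L. \<Sum>p\<in>{p \<in> ?D. ?g p = e}. wt \<kappa> e * f e)"
  unfolding pairs_eq_image by (intro sum.cong refl) auto
 also have "\<dots> = (\<Sum>e\<in>pairs L. 2 * (wt \<kappa> e * f e))"
  by (rule sum.cong[OF refl fibre])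
 finally show ?thesis by (simp add: sum_distrib_left[symmetric])
qed

lemma clus_insert_unchanged:
 assumes "e \<in> edges" "e \<inter> clus W x = {} \<or> e \<subseteq> clus W x"
 shows "clus (insert e W) x = clus W x"
proof
 show "clus (insert e W) x \<subseteq> clus W x"
 proof (rule clus_subsetI)
  fix u v assume "u \<in> clus W x" "u \<noteq> v" "{u, v} \<in> insert e W"
  then show "v \<in> clus W x" using assms clus_closed[of u W x v] by auto
 qed simp
qed (rule clus_mono, auto)

lemma ghost_free_increasing:
 assumes "b \<ge> 0" "finite E"
 shows "increasing_on E (\<lambda>W. ghost_free b (card (clus W x)))"
 unfolding increasing_on_def
proof (intro allI impI)
 fix A B :: "'a set set" assume AB: "A \<subseteq> B" "B \<subseteq> E"
 then have "finite B" using assms(2) finite_subset[of B E] by simp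
 then have "finite A" using AB(1) finite_subset[of A B] by simp
 then show "ghost_free b (card (clus A x)) \<le> ghost_free b (card (clus B x))"
  using AB \<open>finite B\<close> by (intro ghost_free_mono assms card_clus_mono) auto
qed

text \<open>
 First-order effect on one root: opening exactly one boundary edge of the cluster of \<open>x\<close>.
\<close>

lemma ghost_free_root_step:
 assumes c: "kernel_fn c" and \<kappa>: "kernel_fn \<kappa>" and E: "E \<in> fins" and b: "b \<ge> 0" and \<delta>: "\<delta> \<ge> 0"
  and \<Delta>: "\<And>Y. finite Y \<Longrightarrow> sum \<kappa> Y \<le> \<Delta>"
 shows "expw c E (\<lambda>W. ghost_free b (card (clus W x)) +
   \<delta> * (\<Sum>e\<in>E. wt \<kappa> e * (ghost_free b (card (clus (insert e W) x)) - ghost_free b (card (clus W x))))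
   - \<delta>\<^sup>2 * \<Delta>\<^sup>2 * card (clus W x))
  \<le> expw (\<lambda>x. c x + \<delta> * \<kappa> x) E (\<lambda>W. ghost_free b (card (clus W x)))"
proof -
 let ?F = "\<lambda>W. ghost_free b (card (clus W x))"
 have finE: "finite E" using E by (rule finsD)
 have \<delta>\<kappa>: "kernel_fn (\<lambda>x. \<delta> * \<kappa> x)" by (rule kernel_fn_cmult[OF \<kappa> \<delta>])
 have weq: "wt (\<lambda>x. c x + \<delta> * \<kappa> x) = (\<lambda>e. wt c e + \<delta> * wt \<kappa> e)"
  using wt_add[OF c \<delta>\<kappa>] wt_cmult[OF \<kappa> \<delta>] by auto
 have \<Delta>0: "\<Delta> \<ge> 0" using \<Delta>[of "{}"] by simp
 have k0: "\<And>e. 0 \<le> \<delta> * wt \<kappa> e" using \<delta> wt_nonneg[OF \<kappa>] by simp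
 have "?F W + \<delta> * (\<Sum>e\<in>E. wt \<kappa> e * (?F (insert e W) - ?F W)) - \<delta>\<^sup>2 * \<Delta>\<^sup>2 * card (clus W x)
   \<le> expct (\<lambda>e. \<delta> * wt \<kappa> e) E (\<lambda>B. ?F (W \<union> B))" if W: "W \<subseteq> E" for W
 proof -
  define K where "K = clus W x"
  define D where "D = bdry E K"
  define s where "s = (\<Sum>e\<in>D. wt \<kappa> e)"
  define S where "S = (\<Sum>e\<in>D. wt \<kappa> e * (?F (insert e W) - ?F W))"
  have finW: "finite W" using W finE finite_subset by auto
  have K: "finite K" "0 < card K" using finW by (auto simp: K_def)
  have sK: "0 \<le> s" "s \<le> \<Delta> * card K"
   unfolding s_def D_def using sum_bdry_le[OF \<kappa> E K(1) \<Delta>] wt_nonneg[OF \<kappa>] by (auto intro: sum_nonneg)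
  \<comment> \<open>One new edge changes \<open>?F\<close> by at most 1/|K|, which cancels the
    growth of the boundary weight with |K|: the first-order gain \<open>S\<close> is at most
    \<open>\<Delta>\<close>. The second-order loss is then linear in |K|, so a bound on the mean
    cluster size suffices.\<close>
  have diff: "0 \<le> ?F (insert e W) - ?F W" "?F (insert e W) - ?F W \<le> 1 / card K" for e
   unfolding K_def using finW b
   by (auto intro!: ghost_free_mono card_clus_mono ghost_free_diff_le)
  have S: "0 \<le> S" "S \<le> \<Delta>"
  proof -
   show "0 \<le> S" unfolding S_def by (intro sum_nonneg mult_nonneg_nonneg wt_nonneg[OF \<kappa>] diff)
   have "S \<le> (\<Sum>e\<in>D. wt \<kappa> e * (1 / card K))"
    unfolding S_def by (intro sum_mono mult_left_mono wt_nonneg[OF \<kappa>] diff)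
   also have "\<dots> = s / card K" by (simp add: s_def sum_divide_distrib)
   also have "\<dots> \<le> \<Delta>" using sK K by (simp add: field_simps)
   finally show "S \<le> \<Delta>" .
  qed
  have ES: "(\<Sum>e\<in>E. wt \<kappa> e * (?F (insert e W) - ?F W)) = S"
   unfolding S_def
  proof (rule sum.mono_neutral_right)
   show "\<forall>e\<in>E - D. wt \<kappa> e * (?F (insert e W) - ?F W) = 0"
    using E clus_insert_unchanged[of _ W x] by (auto simp: D_def bdry_def K_def fins_def)
  qed (use finE in \<open>auto simp: D_def bdry_def\<close>)
  have inc: "increasing_on E (\<lambda>B. ?F (W \<union> B))"
   unfolding increasing_on_def
  proof (intro allI impI)
   fix A B assume "A \<subseteq> B" "B \<subseteq> E"
   then show "?F (W \<union> A) \<le> ?F (W \<union> B)"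
    using W by (intro increasing_onD[OF ghost_free_increasing[OF b finE]]) auto
  qed
  have "?F W + \<delta> * S * exp (- (\<delta> * s)) \<le> expct (\<lambda>e. \<delta> * wt \<kappa> e) E (\<lambda>B. ?F (W \<union> B))"
   using expct_first_order[OF finE _ k0 inc, of D] bdry_subset[of E K]
   by (simp add: D_def S_def s_def sum_distrib_left mult.assoc)
  moreover have "\<delta> * S * (1 - \<delta> * s) \<le> \<delta> * S * exp (- (\<delta> * s))"
   using S \<delta> exp_ge_add_one_self[of "- (\<delta> * s)"] by (intro mult_left_mono) auto
  moreover have "\<delta> * S * (\<delta> * s) \<le> \<delta> * \<Delta> * (\<delta> * (\<Delta> * card K))"
   using S \<delta> sK \<Delta>0 by (intro mult_mono) auto
  ultimately show ?thesis
   unfolding ES by (simp add: K_def[symmetric] algebra_simps power2_eq_square)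
 qed
 then have "expw c E (\<lambda>W. ?F W + \<delta> * (\<Sum>e\<in>E. wt \<kappa> e * (?F (insert e W) - ?F W)) - \<delta>\<^sup>2 * \<Delta>\<^sup>2 * card (clus W x))
   \<le> expw c E (\<lambda>W. expct (\<lambda>e. \<delta> * wt \<kappa> e) E (\<lambda>B. ?F (W \<union> B)))"
  by (rule expct_mono[OF wt_nonneg[OF c]])
 also have "\<dots> = expw (\<lambda>x. c x + \<delta> * \<kappa> x) E ?F"
  unfolding weq using finE by (rule expct_add_weight[symmetric])
 finally show ?thesis .
qed

lemma expct_root_bound:
 assumes "kernel_fn c" "E \<in> fins" "\<And>E. E \<in> fins \<Longrightarrow> expw c E csize0 \<le> ch"
 shows "expw c E (\<lambda>W. csize W x) \<le> ch"
 unfolding expct_card_root[OF assms(1,2), of real] by (rule assms(3)[OF shift_fins[OF assms(2)]])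

lemma expct_root_ball_bound:
 assumes c: "kernel_fn c" and E: "E \<in> fins" and R: "finite R"
  and X: "\<And>E. E \<in> fins \<Longrightarrow> expw c E (vol R) \<le> X"
 shows "expw c E (\<lambda>W. real (card (clus W x \<inter> (\<lambda>r. r + x) ` R))) \<le> X"
proof -
 have E': "shift (- x) E \<in> fins" by (rule shift_fins[OF E])
 have "expw c E (\<lambda>W. real (card (clus W x \<inter> (\<lambda>r. r + x) ` R))) =
   expw c (shift x (shift (- x) E)) (\<lambda>W. real (card (clus W x \<inter> (\<lambda>r. r + x) ` R)))" by simp
 also have "\<dots> = expw c (shift (- x) E) (\<lambda>W. real (card (clus (shift x W) (0 + x) \<inter> (\<lambda>r. r + x) ` R)))"
  using expct_shift[OF c finsD[OF E'], of x] by simp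
 also have "\<dots> = expw c (shift (- x) E) (vol R)"
  unfolding clus_shift
  by (subst image_Int[symmetric]) (auto simp: inj_def card_image inj_on_def)
 also have "\<dots> \<le> X" by (rule X[OF E'])
 finally show ?thesis .
qed

text \<open>Sums \<open>ghost_free_root_step\<close> over the roots of a box. Exchanging the sums
  over roots and edges turns the gain of an edge into a product of ghost events at its ends.
  \<open>\<rho>\<close> is the common tolerance for approximating the suprema by \<open>W1\<close>
  and \<open>W2\<close> and for the boundary of the box.\<close>

lemma merge_step_aux:
 fixes c \<kappa> :: "int ^ 'd \<Rightarrow> real"
 assumes c: "kernel_fn c" and \<kappa>: "kernel_fn \<kappa>" and R: "finite R" and supp: "\<And>x. x \<notin> R \<Longrightarrow> \<kappa> x = 0"
  and km: "\<And>x. \<kappa> x \<le> km" and \<Delta>: "\<Delta> = sum \<kappa> R" and b: "b \<ge> 0" and \<delta>: "\<delta> \<ge> 0"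
  and X: "\<And>E. E \<in> fins \<Longrightarrow> expw c E (vol R) \<le> X"
  and ch: "\<And>E. E \<in> fins \<Longrightarrow> expw c E csize0 \<le> ch"
  and \<rho>: "0 < \<rho>" "\<rho> < 1"
 shows "(1 - \<rho>) * ghost_int c b - \<rho> + \<delta> / 2 * ((1 - \<rho>) * (\<Delta> * (ghost_prob c b)\<^sup>2) - 2 * \<rho> * \<Delta> - km * X) - \<delta>\<^sup>2 * \<Delta>\<^sup>2 * ch
  \<le> ghost_int (\<lambda>x. c x + \<delta> * \<kappa> x) b"
proof -
 let ?c' = "\<lambda>x. c x + \<delta> * \<kappa> x"
 let ?M = "ghost_prob c b" and ?I = "ghost_int c b"
 let ?F = "\<lambda>x W. ghost_free b (card (clus W x))"
 have c': "kernel_fn ?c'" by (intro kernel_fn_add c kernel_fn_cmult \<kappa> \<delta>)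
 have km0: "km \<ge> 0" using km[of 0] \<kappa> by (simp add: kernel_fn_0)
 have \<Delta>0: "\<Delta> \<ge> 0" unfolding \<Delta> by (intro sum_nonneg kernel_fn_nonneg \<kappa>)
 have \<Delta>Y: "sum \<kappa> Y \<le> \<Delta>" if "finite Y" for Y
 proof -
  have "sum \<kappa> Y = sum \<kappa> (Y \<inter> R)" using that supp by (intro sum.mono_neutral_right) auto
  also have "\<dots> \<le> \<Delta>" unfolding \<Delta> using R by (intro sum_mono2) (auto simp: kernel_fn_nonneg[OF \<kappa>])
  finally show ?thesis .
 qed
 have M01: "0 \<le> ?M" "?M \<le> 1" using ghost_prob_bounds[OF c b] by auto
 obtain W1 where W1: "W1 \<in> fins" "?M - \<rho> < 1 - expw c W1 (lap b 0)"
  by (rule ghost_prob_approx[OF c \<rho>(1)])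
 obtain W2 where W2: "W2 \<in> fins" "?I - \<rho> < expw c W2 (?F 0)"
  unfolding ghost_int_def
  by (rule lim_exp_approx[OF c, of "?F 0" b \<rho>]) (use ghost_free_bounds[OF b] \<rho> in auto)
 define U where "U = insert 0 (\<Union>W1 \<union> \<Union>W2)"
 have U: "finite U" unfolding U_def using finite_Union_fins W1 W2 by auto
 \<comment> \<open>Shifts by the range \<open>R\<close> are included because both ends x and x + r
   of an edge must see copies of the finite graphs \<open>W1\<close> and \<open>W2\<close> inside
   \<open>L\<close>.\<close>
 define U' where "U' = (\<lambda>(u, r). u + r) ` (U \<times> insert 0 R)"
 have U': "finite U'" unfolding U'_def using U R by auto
 obtain L where L: "finite L" "L \<noteq> {}" "(1 - \<rho>) * card L \<le> card {x \<in> L. \<forall>u\<in>U'. u + x \<in> L}"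
  by (rule folner[OF U' \<rho>(1)])
 define L0 where "L0 = {x \<in> L. \<forall>u\<in>U'. u + x \<in> L}"
 have L0: "L0 \<subseteq> L" "finite L0" using L by (auto simp: L0_def)
 have cL: "real (card L) > 0" using L by (simp add: card_gt_0_iff)
 define E where "E = pairs L"
 have E: "E \<in> fins" unfolding E_def by (rule pairs_fins[OF L(1)])
 have finE: "finite E" using E by (rule finsD)
 have inner: "x + r \<in> L" "\<And>u. u \<in> U \<Longrightarrow> u + (x + r) \<in> L" if "x \<in> L0" "r \<in> insert 0 R" for x r
 proof -
  have *: "u + r \<in> U'" if "u \<in> U" for u
   unfolding U'_def using that \<open>r \<in> insert 0 R\<close> by (auto intro!: image_eqI[of _ _ "(u, r)"])
  then have **: "u + r + x \<in> L" if "u \<in> U" for u using that \<open>x \<in> L0\<close> by (auto simp: L0_def)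
  then show "\<And>u. u \<in> U \<Longrightarrow> u + (x + r) \<in> L" by (simp add: algebra_simps)
  have "(0::int ^ 'd) \<in> U" by (simp add: U_def)
  from **[OF this] show "x + r \<in> L" by (simp add: algebra_simps)
 qed
 have sub: "shift z W \<subseteq> E" if "W \<in> fins" "\<Union>W \<subseteq> U" "\<And>u. u \<in> U \<Longrightarrow> u + z \<in> L" for z W
  using shift_fins[OF that(1), of z] that(2,3) by (fastforce simp: E_def pairs_def fins_def shift_def)
 define m where "m x = 1 - expw c E (lap b x)" for x
 have m01: "0 \<le> m x" "m x \<le> 1" for x
  unfolding m_def using expct_le_const[of "wt c" E "lap b x" 1] expct_nonneg[of "wt c" E "lap b x"]
   lap_bounds[of b x] wt_nonneg[OF c] finE b by auto
 have m_ge: "?M - \<rho> \<le> m (x + r)" if "x \<in> L0" "r \<in> insert 0 R" for x r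
 proof -
  have s: "shift (x + r) W1 \<subseteq> E" by (rule sub) (use W1 inner(2)[OF that] in \<open>auto simp: U_def\<close>)
  have "expw c E (\<lambda>W. - lap b (x + r) W) \<ge> expw c (shift (x + r) W1) (\<lambda>W. - lap b (x + r) W)"
   using finE b s by (intro expct_mono_set wt_nonneg[OF c])
    (auto simp: increasing_on_def intro!: lap_antimono finite_subset[OF _ finE])
  moreover have "expw c (shift (x + r) W1) (\<lambda>W. - lap b (x + r) W) = expw c W1 (\<lambda>W. - lap b 0 W)"
   unfolding lap_def using expct_card_shift[OF c W1(1), of "x + r" "\<lambda>n. - exp (- (b * real n))" 0] by simp
  ultimately have "expw c E (lap b (x + r)) \<le> expw c W1 (lap b 0)"
   using expct_cmult[of "wt c" _ "-1"] by simp
  then show ?thesis using W1(2) by (simp add: m_def)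
 qed
 have I_ge: "?I - \<rho> \<le> expw c E (?F x)" if "x \<in> L0" for x
 proof -
  have s: "shift x W2 \<subseteq> E"
   by (rule sub) (use W2 inner(2)[OF that, of 0] in \<open>auto simp: U_def\<close>)
  have "expw c W2 (?F 0) = expw c (shift x W2) (?F x)"
   using expct_card_shift[OF c W2(1), of x "ghost_free b" 0] by simp
  also have "\<dots> \<le> expw c E (?F x)"
   using finE b s by (intro expct_mono_set wt_nonneg[OF c] ghost_free_increasing) auto
  finally show ?thesis using W2(2) by simp
 qed
 \<comment> \<open>FKG gives the product of the means. On the event that \<open>u\<close> and
   \<open>v\<close> are already connected the new edge gains nothing; the product is at most 1, so
   this costs at most the connection probability.\<close>
 have cross: "m u * m v - prw c E (\<lambda>W. conn W u v) \<le>
   expw c E (\<lambda>W. of_bool (\<not> conn W u v) * ((1 - lap b u W) * (1 - lap b v W)))" for u v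
 proof -
  have inc: "increasing_on E (\<lambda>W. 1 - lap b u W)" for u
   unfolding increasing_on_def using b finE by (auto intro!: lap_antimono finite_subset[OF _ finE])
  have mu: "m u = expw c E (\<lambda>W. 1 - lap b u W)" for u
   using finE by (simp add: m_def expct_diff)
  have "m u * m v \<le> expw c E (\<lambda>W. (1 - lap b u W) * (1 - lap b v W))"
   unfolding mu by (intro expct_FKG wt_nonneg[OF c] finE inc)
  also have "\<dots> \<le> expw c E (\<lambda>W. of_bool (\<not> conn W u v) * ((1 - lap b u W) * (1 - lap b v W)) + of_bool (conn W u v))"
  proof (intro expct_mono wt_nonneg[OF c])
   fix W
   have "(1 - lap b u W) * (1 - lap b v W) \<le> 1"
    using lap_bounds[of b u W] lap_bounds[of b v W] b by (intro mult_le_one) auto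
   then show "(1 - lap b u W) * (1 - lap b v W) \<le> of_bool (\<not> conn W u v) * ((1 - lap b u W) * (1 - lap b v W)) + of_bool (conn W u v)"
    by simp
  qed
  finally show ?thesis by (simp add: expct_add)
 qed
 define G where "G W e = (\<Sum>x\<in>L. ?F x (insert e W) - ?F x W)" for W e
 have G: "G W {u, v} = of_bool (\<not> conn W u v) * ((1 - lap b u W) * (1 - lap b v W))"
  if "W \<subseteq> E" "u \<in> L" "v \<in> L" for W u v
  unfolding G_def
 proof (rule sum_ghost_free_insert)
  show "finite W" using that(1) finE by (rule finite_subset)
 qed (use that clus_pairs_subset[of W L] L(1) in \<open>auto simp: E_def\<close>)
 define a where "a u v = expw c E (\<lambda>W. of_bool (\<not> conn W u v) * ((1 - lap b u W) * (1 - lap b v W)))" for u v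
 have a_sym: "a u v = a v u" for u v unfolding a_def by (simp add: conn_commute mult.commute)
 \<comment> \<open>The weights are at most \<open>km\<close> and vanish off \<open>R\<close>, so the
   connection probabilities add up to at most \<open>km\<close> times the mean volume of the cluster
   in a translate of \<open>R\<close>.\<close>
 have prob_sum: "(\<Sum>y\<in>L. \<kappa> (y - x) * prw c E (\<lambda>W. conn W x y)) \<le> km * X" for x
 proof -
  have "(\<Sum>y\<in>L. \<kappa> (y - x) * prw c E (\<lambda>W. conn W x y)) =
    (\<Sum>y\<in>L \<inter> (\<lambda>r. r + x) ` R. \<kappa> (y - x) * prw c E (\<lambda>W. conn W x y))"
  proof (rule sum.mono_neutral_right)
   show "\<forall>y\<in>L - L \<inter> (\<lambda>r. r + x) ` R. \<kappa> (y - x) * prw c E (\<lambda>W. conn W x y) = 0"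
   proof
    fix y assume "y \<in> L - L \<inter> (\<lambda>r. r + x) ` R"
    then have "y - x \<notin> R" by (auto simp: image_iff)
    then show "\<kappa> (y - x) * prw c E (\<lambda>W. conn W x y) = 0" by (simp add: supp)
   qed
  qed (use L in auto)
  also have "\<dots> \<le> (\<Sum>y\<in>L \<inter> (\<lambda>r. r + x) ` R. km * prw c E (\<lambda>W. conn W x y))"
   by (intro sum_mono mult_right_mono km prb_nonneg wt_nonneg[OF c])
  also have "\<dots> = km * expw c E (\<lambda>W. \<Sum>y\<in>L \<inter> (\<lambda>r. r + x) ` R. of_bool (conn W x y))"
   by (simp only: expct_sum sum_distrib_left)
  also have "\<dots> \<le> km * expw c E (\<lambda>W. real (card (clus W x \<inter> (\<lambda>r. r + x) ` R)))"
  proof (intro mult_left_mono expct_mono wt_nonneg[OF c] km0)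
   fix W
   have "(\<Sum>y\<in>L \<inter> (\<lambda>r. r + x) ` R. of_bool (conn W x y)) = real (card {y \<in> L \<inter> (\<lambda>r. r + x) ` R. conn W x y})"
    using L by (simp add: of_bool_def sum.If_cases Int_def)
   also have "\<dots> \<le> real (card (clus W x \<inter> (\<lambda>r. r + x) ` R))"
    using R by (intro of_nat_mono card_mono) (auto simp: clus_def)
   finally show "(\<Sum>y\<in>L \<inter> (\<lambda>r. r + x) ` R. of_bool (conn W x y)) \<le> real (card (clus W x \<inter> (\<lambda>r. r + x) ` R))" .
  qed
  also have "\<dots> \<le> km * X" by (intro mult_left_mono km0 expct_root_ball_bound[OF c E R X])
  finally show ?thesis .
 qed
 have M2: "?M\<^sup>2 - 2 * \<rho> \<le> m u * m v" if "?M - \<rho> \<le> m u" "?M - \<rho> \<le> m v" for u v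
 proof (cases "?M \<ge> \<rho>")
  case True
  have "(?M - \<rho>) * (?M - \<rho>) \<le> m u * m v" using that True m01 by (intro mult_mono) auto
  moreover have "?M\<^sup>2 - 2 * \<rho> \<le> (?M - \<rho>) * (?M - \<rho>)"
  proof -
   have "2 * \<rho> * ?M \<le> 2 * \<rho> * 1" using M01 \<rho> by (intro mult_left_mono) auto
   moreover have "(?M - \<rho>) * (?M - \<rho>) = ?M\<^sup>2 - 2 * \<rho> * ?M + \<rho> * \<rho>"
    by (simp add: power2_eq_square algebra_simps)
   ultimately show ?thesis using mult_nonneg_nonneg[of \<rho> \<rho>] \<rho> by linarith
  qed
  ultimately show ?thesis by linarith
 next
  case False
  have "?M * ?M \<le> \<rho> * 1" using False M01 by (intro mult_mono) auto
  then have "?M\<^sup>2 - 2 * \<rho> \<le> 0" using \<rho> by (simp add: power2_eq_square)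
  also have "0 \<le> m u * m v" using m01 by simp
  finally show ?thesis .
 qed
 have main_sum: "card L0 * (\<Delta> * (?M\<^sup>2 - 2 * \<rho>)) - card L * (km * X) \<le> (\<Sum>x\<in>L. \<Sum>y\<in>L. \<kappa> (y - x) * a x y)"
 proof -
  have mm: "card L0 * (\<Delta> * (?M\<^sup>2 - 2 * \<rho>)) \<le> (\<Sum>x\<in>L. \<Sum>y\<in>L. \<kappa> (y - x) * (m x * m y))"
  proof -
   have "card L0 * (\<Delta> * (?M\<^sup>2 - 2 * \<rho>)) = (\<Sum>x\<in>L0. \<Sum>r\<in>R. \<kappa> r * (?M\<^sup>2 - 2 * \<rho>))"
    by (simp add: \<Delta> sum_distrib_right)
   also have "\<dots> \<le> (\<Sum>x\<in>L0. \<Sum>r\<in>R. \<kappa> r * (m x * m (x + r)))"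
    using m_ge[of _ 0] m_ge by (intro sum_mono mult_left_mono kernel_fn_nonneg[OF \<kappa>] M2) auto
   also have "\<dots> \<le> (\<Sum>x\<in>L0. \<Sum>y\<in>L. \<kappa> (y - x) * (m x * m y))"
   proof (rule sum_mono)
    fix x assume x: "x \<in> L0"
    have "(\<Sum>r\<in>R. \<kappa> r * (m x * m (x + r))) = (\<Sum>y\<in>(\<lambda>r. x + r) ` R. \<kappa> (y - x) * (m x * m y))"
     by (subst sum.reindex) (auto simp: inj_on_def)
    also have "\<dots> \<le> (\<Sum>y\<in>L. \<kappa> (y - x) * (m x * m y))"
     using inner(1)[OF x] L m01 by (intro sum_mono2) (auto intro!: mult_nonneg_nonneg kernel_fn_nonneg[OF \<kappa>])
    finally show "(\<Sum>r\<in>R. \<kappa> r * (m x * m (x + r))) \<le> (\<Sum>y\<in>L. \<kappa> (y - x) * (m x * m y))" .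
   qed
   also have "\<dots> \<le> (\<Sum>x\<in>L. \<Sum>y\<in>L. \<kappa> (y - x) * (m x * m y))"
    using L0 L m01 by (intro sum_mono2) (auto intro!: sum_nonneg mult_nonneg_nonneg kernel_fn_nonneg[OF \<kappa>])
   finally show ?thesis .
  qed
  have "(\<Sum>x\<in>L. \<Sum>y\<in>L. \<kappa> (y - x) * (m x * m y)) - (\<Sum>x\<in>L. \<Sum>y\<in>L. \<kappa> (y - x) * prw c E (\<lambda>W. conn W x y))
    = (\<Sum>x\<in>L. \<Sum>y\<in>L. \<kappa> (y - x) * (m x * m y - prw c E (\<lambda>W. conn W x y)))"
   by (simp add: sum_subtractf algebra_simps)
  also have "\<dots> \<le> (\<Sum>x\<in>L. \<Sum>y\<in>L. \<kappa> (y - x) * a x y)"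
   unfolding a_def by (intro sum_mono mult_left_mono cross kernel_fn_nonneg[OF \<kappa>])
  finally show ?thesis
   using mm sum_mono[of L "\<lambda>x. \<Sum>y\<in>L. \<kappa> (y - x) * prw c E (\<lambda>W. conn W x y)" "\<lambda>x. km * X", OF prob_sum]
   by simp
 qed
 have "(\<Sum>x\<in>L. expw c E (\<lambda>W. ?F x W + \<delta> * (\<Sum>e\<in>E. wt \<kappa> e * (?F x (insert e W) - ?F x W)) - \<delta>\<^sup>2 * \<Delta>\<^sup>2 * card (clus W x)))
   \<le> (\<Sum>x\<in>L. expw ?c' E (?F x))"
  by (intro sum_mono ghost_free_root_step c \<kappa> E b \<delta> \<Delta>Y)
 also have "\<dots> \<le> (\<Sum>x\<in>L. ghost_int ?c' b)" by (intro sum_mono ghost_int_upper c' E b)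
 also have "\<dots> = card L * ghost_int ?c' b" by simp
 also have "(\<Sum>x\<in>L. expw c E (\<lambda>W. ?F x W + \<delta> * (\<Sum>e\<in>E. wt \<kappa> e * (?F x (insert e W) - ?F x W)) - \<delta>\<^sup>2 * \<Delta>\<^sup>2 * card (clus W x))) =
   (\<Sum>x\<in>L. expw c E (?F x)) + \<delta> * expw c E (\<lambda>W. \<Sum>e\<in>E. wt \<kappa> e * G W e)
   - \<delta>\<^sup>2 * \<Delta>\<^sup>2 * (\<Sum>x\<in>L. expw c E (\<lambda>W. csize W x))"
 proof -
  have "(\<Sum>e\<in>E. wt \<kappa> e * G W e) = (\<Sum>x\<in>L. \<Sum>e\<in>E. wt \<kappa> e * (?F x (insert e W) - ?F x W))" for W
   unfolding G_def sum_distrib_left by (rule sum.swap)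
  then show ?thesis
   by (simp only: expct_add expct_diff expct_cmult expct_sum sum.distrib sum_subtractf sum_distrib_left)
 qed
 also have "expw c E (\<lambda>W. \<Sum>e\<in>E. wt \<kappa> e * G W e) = (\<Sum>e\<in>pairs L. wt \<kappa> e * expw c E (\<lambda>W. G W e))"
  by (simp add: expct_sum expct_cmult E_def)
 also have "\<dots> = 1 / 2 * (\<Sum>x\<in>L. \<Sum>y\<in>L. \<kappa> (y - x) * a x y)"
 proof (rule sum_pairs[OF L(1) \<kappa> a_sym])
  fix x y assume "x \<in> L" "y \<in> L" "x \<noteq> y"
  then show "expw c E (\<lambda>W. G W {x, y}) = a x y"
   unfolding a_def by (intro expct_cong G)
 qed
 finally have fin: "(\<Sum>x\<in>L. expw c E (?F x)) + \<delta> * (1 / 2 * (\<Sum>x\<in>L. \<Sum>y\<in>L. \<kappa> (y - x) * a x y))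
   - \<delta>\<^sup>2 * \<Delta>\<^sup>2 * (\<Sum>x\<in>L. expw c E (\<lambda>W. csize W x)) \<le> card L * ghost_int ?c' b" .
 have t1: "card L * ((1 - \<rho>) * ?I - \<rho>) \<le> (\<Sum>x\<in>L. expw c E (?F x))"
 proof -
  have I0: "0 \<le> ?I"
   using ghost_int_upper[OF c empty_fins b, of 0] ghost_free_bounds[OF b]
   by (metis expct_empty order_trans)
  have "card L * ((1 - \<rho>) * ?I - \<rho>) = ((1 - \<rho>) * card L) * ?I - \<rho> * card L"
   by (simp add: algebra_simps)
  also have "\<dots> \<le> card L0 * ?I - \<rho> * card L0"
  proof -
   have "((1 - \<rho>) * card L) * ?I \<le> card L0 * ?I"
    using L(3) I0 by (intro mult_right_mono) (auto simp: L0_def)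
   moreover have "\<rho> * card L0 \<le> \<rho> * card L"
    using \<rho> L0 L by (intro mult_left_mono of_nat_mono card_mono) auto
   ultimately show ?thesis by linarith
  qed
  also have "\<dots> = (\<Sum>x\<in>L0. ?I - \<rho>)" by (simp add: algebra_simps)
  also have "\<dots> \<le> (\<Sum>x\<in>L0. expw c E (?F x))" by (intro sum_mono I_ge)
  also have "\<dots> \<le> (\<Sum>x\<in>L. expw c E (?F x))"
   using L L0 b by (intro sum_mono2) (auto intro!: expct_nonneg wt_nonneg[OF c] ghost_free_bounds)
  finally show ?thesis .
 qed
 have t2: "card L * ((1 - \<rho>) * (\<Delta> * ?M\<^sup>2) - 2 * \<rho> * \<Delta> - km * X) \<le> (\<Sum>x\<in>L. \<Sum>y\<in>L. \<kappa> (y - x) * a x y)"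
 proof -
  have "((1 - \<rho>) * card L) * (\<Delta> * ?M\<^sup>2) \<le> card L0 * (\<Delta> * ?M\<^sup>2)"
   using L(3) \<Delta>0 by (intro mult_right_mono) (auto simp: L0_def)
  moreover have "card L0 * (2 * \<rho> * \<Delta>) \<le> card L * (2 * \<rho> * \<Delta>)"
   using L0 L \<rho> \<Delta>0 by (intro mult_right_mono of_nat_mono card_mono) auto
  ultimately show ?thesis using main_sum by (simp add: algebra_simps)
 qed
 have t3: "(\<Sum>x\<in>L. expw c E (\<lambda>W. csize W x)) \<le> card L * ch"
  using sum_mono[of L "\<lambda>x. expw c E (\<lambda>W. csize W x)" "\<lambda>_. ch"]
   expct_root_bound[OF c E ch] by simp
 have "card L * ((1 - \<rho>) * ?I - \<rho>) + \<delta> * (1 / 2 * (card L * ((1 - \<rho>) * (\<Delta> * ?M\<^sup>2) - 2 * \<rho> * \<Delta> - km * X)))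
   - \<delta>\<^sup>2 * \<Delta>\<^sup>2 * (card L * ch) \<le> card L * ghost_int ?c' b"
 proof -
  have "\<delta> * (1 / 2 * (card L * ((1 - \<rho>) * (\<Delta> * ?M\<^sup>2) - 2 * \<rho> * \<Delta> - km * X))) \<le>
   \<delta> * (1 / 2 * (\<Sum>x\<in>L. \<Sum>y\<in>L. \<kappa> (y - x) * a x y))"
   using t2 \<delta> by (intro mult_left_mono) auto
  moreover have "\<delta>\<^sup>2 * \<Delta>\<^sup>2 * (\<Sum>x\<in>L. expw c E (\<lambda>W. csize W x)) \<le> \<delta>\<^sup>2 * \<Delta>\<^sup>2 * (card L * ch)"
   using t3 by (intro mult_left_mono) auto
  ultimately show ?thesis using fin t1 by linarith
 qed
 then have "card L * ((1 - \<rho>) * ?I - \<rho> + \<delta> / 2 * ((1 - \<rho>) * (\<Delta> * ?M\<^sup>2) - 2 * \<rho> * \<Delta> - km * X) - \<delta>\<^sup>2 * \<Delta>\<^sup>2 * ch)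
   \<le> card L * ghost_int ?c' b"
  by (simp add: algebra_simps)
 then show ?thesis using cL by (simp add: mult_le_cancel_left_pos)
qed

lemma le_of_scaled_error:
 fixes A B C :: real
 assumes "\<And>\<rho>. 0 < \<rho> \<Longrightarrow> \<rho> < 1 \<Longrightarrow> A \<le> B + \<rho> * C"
 shows "A \<le> B"
proof (rule ccontr)
 assume "\<not> A \<le> B"
 define \<rho> where "\<rho> = min (1 / 2) ((A - B) / (2 * (\<bar>C\<bar> + 1)))"
 have \<rho>: "0 < \<rho>" "\<rho> < 1" using \<open>\<not> A \<le> B\<close> by (auto simp: \<rho>_def)
 have "\<rho> * C \<le> \<rho> * (\<bar>C\<bar> + 1)" using \<rho> by (intro mult_left_mono) auto
 also have "\<dots> \<le> (A - B) / (2 * (\<bar>C\<bar> + 1)) * (\<bar>C\<bar> + 1)"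
  by (intro mult_right_mono) (auto simp: \<rho>_def)
 also have "\<dots> = (A - B) / 2" by (simp add: field_simps)
 finally show False using assms[OF \<rho>] \<open>\<not> A \<le> B\<close> by (simp add: field_simps)
qed

lemma merge_step:
 fixes c \<kappa> :: "int ^ 'd \<Rightarrow> real"
 assumes c: "kernel_fn c" and \<kappa>: "kernel_fn \<kappa>" and R: "finite R" and supp: "\<And>x. x \<notin> R \<Longrightarrow> \<kappa> x = 0"
  and km: "\<And>x. \<kappa> x \<le> km" and \<Delta>: "\<Delta> = sum \<kappa> R" and b: "b \<ge> 0" and \<delta>: "\<delta> \<ge> 0"
  and X: "\<And>E. E \<in> fins \<Longrightarrow> expw c E (vol R) \<le> X"
  and ch: "\<And>E. E \<in> fins \<Longrightarrow> expw c E csize0 \<le> ch"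
 shows "ghost_int c b + \<delta> / 2 * (\<Delta> * (ghost_prob c b)\<^sup>2 - km * X) - \<delta>\<^sup>2 * \<Delta>\<^sup>2 * ch
  \<le> ghost_int (\<lambda>x. c x + \<delta> * \<kappa> x) b"
proof (rule le_of_scaled_error)
 fix \<rho> :: real assume \<rho>: "0 < \<rho>" "\<rho> < 1"
 show "ghost_int c b + \<delta> / 2 * (\<Delta> * (ghost_prob c b)\<^sup>2 - km * X) - \<delta>\<^sup>2 * \<Delta>\<^sup>2 * ch \<le>
  ghost_int (\<lambda>x. c x + \<delta> * \<kappa> x) b + \<rho> * (ghost_int c b + 1 + \<delta> / 2 * (\<Delta> * (ghost_prob c b)\<^sup>2 + 2 * \<Delta>))"
  using merge_step_aux[OF c \<kappa> R supp km \<Delta> b \<delta> X ch \<rho>] by (simp add: algebra_simps)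
qed

section \<open>Integrating the merging inequality\<close>

lemma exp_diff_bounds:
 fixes a b :: real and n :: nat
 assumes "0 \<le> a" "a \<le> b"
 shows "(b - a) * n * exp (- (b * n)) \<le> exp (- (a * n)) - exp (- (b * n))"
  and "exp (- (a * n)) - exp (- (b * n)) \<le> (b - a) * n"
proof -
 have "exp (- (a * n)) = exp (- (b * n)) * exp ((b - a) * n)"
  by (simp add: exp_add[symmetric] algebra_simps)
 moreover have "exp (- (b * n)) * (1 + (b - a) * n) \<le> exp (- (b * n)) * exp ((b - a) * n)"
  by (intro mult_left_mono exp_ge_add_one_self) auto
 ultimately show "(b - a) * n * exp (- (b * n)) \<le> exp (- (a * n)) - exp (- (b * n))"
  by (simp add: algebra_simps)
 have "exp (- (b * n)) = exp (- (a * n)) * exp (- ((b - a) * n))"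
  by (simp add: exp_add[symmetric] algebra_simps)
 then have "exp (- (a * n)) - exp (- (b * n)) = exp (- (a * n)) * (1 - exp (- ((b - a) * n)))"
  by (simp add: algebra_simps)
 also have "\<dots> \<le> 1 * ((b - a) * n)"
  using assms by (intro mult_mono one_minus_exp_le) auto
 finally show "exp (- (a * n)) - exp (- (b * n)) \<le> (b - a) * n" by simp
qed

lemma ghost_int_le_add:
 assumes c: "kernel_fn c" and b: "0 \<le> a" "a \<le> b"
 shows "ghost_int c b \<le> ghost_int c a + (b - a) * ghost_prob c b"
 unfolding ghost_int_def[of c b]
proof (rule lim_exp_least)
 fix E :: "'a set set" assume E: "E \<in> fins"
 have "ghost_free b (card (clus W 0)) \<le> ghost_free a (card (clus W 0)) + (b - a) * (1 - lap b 0 W)" if "W \<subseteq> E" for W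
 proof -
  have n: "card (clus W 0) > 0" using that finsD[OF E] finite_subset by (intro card_clus_pos) blast
  have "(b - a) * exp (- (b * card (clus W 0))) \<le> (exp (- (a * card (clus W 0))) - exp (- (b * card (clus W 0)))) / card (clus W 0)"
   using exp_diff_bounds(1)[OF b, of "card (clus W 0)"] n by (simp add: field_simps)
  then show ?thesis by (simp add: ghost_free_def lap_def diff_divide_distrib algebra_simps)
 qed
 then have "expw c E (\<lambda>W. ghost_free b (card (clus W 0))) \<le>
   expw c E (\<lambda>W. ghost_free a (card (clus W 0)) + (b - a) * (1 - lap b 0 W))"
  by (rule expct_mono[OF wt_nonneg[OF c]])
 also have "\<dots> = expw c E (\<lambda>W. ghost_free a (card (clus W 0))) + (b - a) * (1 - expw c E (lap b 0))"
  using finsD[OF E] by (simp add: expct_add expct_cmult expct_diff)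
 also have "\<dots> \<le> ghost_int c a + (b - a) * ghost_prob c b"
  by (intro add_mono mult_left_mono ghost_int_upper ghost_prob_upper c E b) (use b in auto)
 finally show "expw c E (\<lambda>W. ghost_free b (card (clus W 0))) \<le> ghost_int c a + (b - a) * ghost_prob c b" .
qed

lemma ghost_prob_le_add:
 assumes c: "kernel_fn c" and b: "0 \<le> a" "a \<le> b"
  and ch: "\<And>E. E \<in> fins \<Longrightarrow> expw c E csize0 \<le> ch"
 shows "ghost_prob c b \<le> ghost_prob c a + (b - a) * ch"
proof (rule ghost_prob_least)
 fix E :: "'a set set" assume E: "E \<in> fins"
 have "expw c E (lap a 0) \<le> expw c E (\<lambda>W. lap b 0 W + (b - a) * card (clus W 0))"
  using exp_diff_bounds(2)[OF b] by (intro expct_mono wt_nonneg[OF c]) (simp add: lap_def algebra_simps)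
 also have "\<dots> = expw c E (lap b 0) + (b - a) * expw c E csize0"
  by (simp add: expct_add expct_cmult)
 also have "(b - a) * expw c E csize0 \<le> (b - a) * ch"
  using b by (intro mult_left_mono ch E) auto
 finally show "1 - expw c E (lap b 0) \<le> ghost_prob c a + (b - a) * ch"
  using ghost_prob_upper[OF c E, of a 0] by linarith
qed

lemma ghost_int_0 [simp]: "ghost_int c 0 = 0"
proof -
 have "expw c E (\<lambda>W. ghost_free 0 (card (clus W 0))) = 0" if "E \<in> fins" for E
  using finsD[OF that] by (simp add: ghost_free_def)
 then show ?thesis
  unfolding ghost_int_def lim_exp_def
 proof (subst SUP_cong[OF refl, of _ _ "\<lambda>_. 0"])
  show "(SUP E\<in>(fins :: 'a set set set). 0) = (0::real)"
   by (rule cSUP_const) (use empty_fins in blast)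
 qed
qed

lemma expct_kernel_mono:
 assumes "kernel_fn c" "kernel_fn c'" "\<And>x. c x \<le> c' x" "E \<in> fins" "increasing_on E f"
 shows "expw c E f \<le> expw c' E f"
 by (intro expct_mono_weight wt_nonneg wt_mono assms finsD[OF assms(4)])

lemma increasing_on_card_clus:
 "finite E \<Longrightarrow> increasing_on E (\<lambda>W. csize W x)"
 unfolding increasing_on_def by (auto intro!: card_clus_mono finite_subset[of _ E])

lemma increasing_on_card_clus_Int:
 "finite R \<Longrightarrow> increasing_on E (\<lambda>W. csize_in W x R)"
 unfolding increasing_on_def by (auto intro!: card_clus_Int_mono)

text \<open>
 The function \<open>I\<^sub>t(b)\<close> = \<^term>\<open>ghost_int (\<lambda>x. c x + t * \<kappa> x) b\<close>, whose derivative in \<open>b\<close> is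
 \<^const>\<open>ghost_prob\<close>, is a supersolution of
 \<open>\<partial>\<^sub>t I = \<Delta>/2 (\<partial>\<^sub>b I)\<^sup>2 - km X / 2\<close>. Following the line \<open>b(t) = b(1 - t)\<close> down to \<open>I\<^sub>1(0) = 0\<close>
 bounds \<open>I\<^sub>0(b)\<close>.
\<close>

theorem ghost_int_bound:
 fixes c \<kappa> :: "int ^ 'd \<Rightarrow> real"
 assumes c: "kernel_fn c" and \<kappa>: "kernel_fn \<kappa>" and R: "finite R" and supp: "\<And>x. x \<notin> R \<Longrightarrow> \<kappa> x = 0"
  and km: "\<And>x. \<kappa> x \<le> km" and \<Delta>: "\<Delta> = sum \<kappa> R" "\<Delta> > 0" and b: "b \<ge> 0"
  and X: "\<And>E. E \<in> fins \<Longrightarrow> expw (\<lambda>x. c x + \<kappa> x) E (vol R) \<le> X"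
  and ch: "\<And>E. E \<in> fins \<Longrightarrow> expw (\<lambda>x. c x + \<kappa> x) E csize0 \<le> ch"
 shows "ghost_int c b \<le> b\<^sup>2 / (2 * \<Delta>) + km * X / 2"
proof -
 define k where "k t = (\<lambda>x. c x + t * \<kappa> x)" for t
 have k: "kernel_fn (k t)" if "0 \<le> t" for t
  unfolding k_def by (intro kernel_fn_add c kernel_fn_cmult \<kappa> that)
 have k1: "k 1 = (\<lambda>x. c x + \<kappa> x)" by (simp add: k_def)
 have kle: "k t x \<le> k 1 x" if "t \<le> 1" for t x
  unfolding k_def using mult_right_mono[OF that kernel_fn_nonneg[OF \<kappa>], of x] by simp
 have Xt: "expw (k t) E (vol R) \<le> X" if "0 \<le> t" "t \<le> 1" "E \<in> fins" for t E
  using expct_kernel_mono[OF k[OF that(1)] k[OF zero_le_one] kle[OF that(2)] that(3) increasing_on_card_clus_Int[OF R]]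
   X[OF that(3)] unfolding k1 by (rule order_trans)
 have cht: "expw (k t) E csize0 \<le> ch" if "0 \<le> t" "t \<le> 1" "E \<in> fins" for t E
  using expct_kernel_mono[OF k[OF that(1)] k[OF zero_le_one] kle[OF that(2)] that(3)
    increasing_on_card_clus[OF finsD[OF that(3)]]]
   ch[OF that(3)] unfolding k1 by (rule order_trans)
 have ch0: "ch \<ge> 0"
  using cht[of 0 "{}"] expct_nonneg[of "wt (k 0)" "{}" "\<lambda>W. csize W 0"] by simp
 define D where "D = b\<^sup>2 / (2 * \<Delta>) + km * X / 2"
 \<comment> \<open>Each time step has a second-order error \<delta>^2 C. The bound \<open>ch\<close>
   on the mean cluster size enters only through \<open>C\<close>, which disappears in the limit; it
   need only be finite.\<close>
 define C where "C = \<Delta> * b * ch + \<Delta>\<^sup>2 * ch"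
 have C0: "C \<ge> 0" unfolding C_def using \<Delta> b ch0 by simp
 have "ghost_int c b \<le> D + C / n" if n: "n \<ge> (1::nat)" for n
 proof -
  define \<delta> where "\<delta> = 1 / real n"
  have \<delta>: "\<delta> > 0" "\<delta> \<le> 1" using n by (auto simp: \<delta>_def)
  define A where "A j = ghost_int (k (j * \<delta>)) (b * (1 - j * \<delta>))" for j :: nat
  have step: "A j - (\<delta> * D + \<delta>\<^sup>2 * C) \<le> A (Suc j)" if j: "j < n" for j
  proof -
   define t where "t = j * \<delta>"
   have t: "0 \<le> t" "t + \<delta> \<le> 1"
    using \<delta> j n by (auto simp: t_def \<delta>_def field_simps)
   define b1 b0 where "b1 = b * (1 - t)" and "b0 = b * (1 - (t + \<delta>))"
   have b01: "0 \<le> b0" "b0 \<le> b1" "b1 - b0 = \<delta> * b" "b1 \<ge> 0"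
    using b t \<delta> mult_nonneg_nonneg[of b "1 - (t + \<delta>)"] mult_nonneg_nonneg[of b "1 - t"]
     mult_nonneg_nonneg[of \<delta> b]
    by (auto simp: b1_def b0_def algebra_simps)
   let ?I = "ghost_int (k t)" and ?M = "ghost_prob (k t)"
   have kt: "kernel_fn (k t)" by (rule k[OF t(1)])
   have eq: "(\<lambda>x. k t x + \<delta> * \<kappa> x) = k (t + \<delta>)" by (simp add: k_def algebra_simps)
   have "?I b0 + \<delta> / 2 * (\<Delta> * (?M b0)\<^sup>2 - km * X) - \<delta>\<^sup>2 * \<Delta>\<^sup>2 * ch \<le> ghost_int (k (t + \<delta>)) b0"
    unfolding eq[symmetric]
    by (rule merge_step[OF kt \<kappa> R supp km \<Delta>(1) b01(1)]) (use \<delta> t Xt cht in auto)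
   moreover have "?I b1 \<le> ?I b0 + \<delta> * b * ?M b1"
    using ghost_int_le_add[OF kt b01(1,2)] b01(3) by simp
   moreover have "(?M b1)\<^sup>2 - (?M b0)\<^sup>2 \<le> 2 * (\<delta> * b * ch)"
   proof -
    have le: "?M b0 \<le> ?M b1" by (rule ghost_prob_mono[OF kt b01(2)])
    have "(?M b1)\<^sup>2 - (?M b0)\<^sup>2 = (?M b1 + ?M b0) * (?M b1 - ?M b0)"
     by (simp add: power2_eq_square algebra_simps)
    also have "\<dots> \<le> 2 * (\<delta> * b * ch)"
    proof (rule mult_mono)
     show "?M b1 - ?M b0 \<le> \<delta> * b * ch"
      using ghost_prob_le_add[OF kt b01(1,2) cht[OF t(1)]] t(2) \<delta>(1) b01(3) by simp
    qed (use le ghost_prob_bounds[OF kt b01(1)] ghost_prob_bounds[OF kt b01(4)] in auto)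
    finally show ?thesis .
   qed
   then have "\<delta> / 2 * (\<Delta> * ((?M b1)\<^sup>2 - (?M b0)\<^sup>2)) \<le> \<delta> / 2 * (\<Delta> * (2 * (\<delta> * b * ch)))"
    using \<delta> \<Delta> by (intro mult_left_mono) auto
   \<comment> \<open>Along the line b(t) = b (1 - t) the drift loses \<open>b * M\<close> and
     merging gains \<open>\<Delta> / 2\<close> times M^2. Completing the square bounds the net loss
     by \<open>b\<^sup>2 / (2 * \<Delta>)\<close> whatever M is.\<close>
   moreover have "\<delta> * b * ?M b1 - \<delta> / 2 * (\<Delta> * (?M b1)\<^sup>2) \<le> \<delta> * (b\<^sup>2 / (2 * \<Delta>))"
   proof -
    have "0 \<le> (b - \<Delta> * ?M b1)\<^sup>2 / (2 * \<Delta>)" using \<Delta> by simp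
    also have "\<dots> = b\<^sup>2 / (2 * \<Delta>) - b * ?M b1 + \<Delta> * (?M b1)\<^sup>2 / 2"
     using \<Delta>(2) by (simp add: field_simps power2_eq_square)
    finally have "\<delta> * (b * ?M b1 - \<Delta> * (?M b1)\<^sup>2 / 2) \<le> \<delta> * (b\<^sup>2 / (2 * \<Delta>))"
     using \<delta> by (intro mult_left_mono) auto
    then show ?thesis by (simp add: algebra_simps)
   qed
   ultimately have "?I b1 - (\<delta> * D + \<delta>\<^sup>2 * C) \<le> ghost_int (k (t + \<delta>)) b0"
    by (simp add: D_def C_def algebra_simps power2_eq_square)
   then show ?thesis by (simp add: A_def t_def b1_def b0_def algebra_simps)
  qed
  have "A 0 - j * (\<delta> * D + \<delta>\<^sup>2 * C) \<le> A j" if "j \<le> n" for j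
   using that
  proof (induction j)
   case (Suc j)
   then show ?case using step[of j] by (simp add: algebra_simps)
  qed simp
  from this[of n] have "A 0 \<le> A n + n * (\<delta> * D + \<delta>\<^sup>2 * C)" by simp
  moreover have "A n = 0" using n by (simp add: A_def \<delta>_def)
  moreover have "A 0 = ghost_int c b" by (simp add: A_def k_def)
  moreover have "n * (\<delta> * D + \<delta>\<^sup>2 * C) = D + C / n"
   using n by (simp add: \<delta>_def field_simps power2_eq_square)
  ultimately show ?thesis by simp
 qed
 from this[of "Suc _"] have "ghost_int c b \<le> D + inverse (real (Suc m)) * C" for m
  by (simp add: divide_inverse mult.commute)
 moreover have "(\<lambda>m. D + inverse (real (Suc m)) * C) \<longlonglongrightarrow> D + 0 * C"
  by (intro tendsto_intros LIMSEQ_inverse_real_of_nat)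
 ultimately have "ghost_int c b \<le> D + 0 * C"
  by (intro LIMSEQ_le_const) auto
 then show ?thesis by (simp add: D_def)
qed

text \<open>\<open>ghost_free b n\<close> is the integral over [0, b] of a concave function
  vanishing at 0, hence at least the area of the triangle under its chord.\<close>

lemma half_ghost_free:
 assumes "b \<ge> 0" "n > 0"
 shows "b / 2 * (1 - exp (- (b * real n))) \<le> ghost_free b n"
proof -
 define u where "u = b * real n"
 have u: "u \<ge> 0" using assms by (simp add: u_def)
 have "0 \<le> u / 2 - 1 + exp (- u) * (1 + u / 2)"
 proof -
  have "(\<lambda>u. u / 2 - 1 + exp (- u) * (1 + u / 2)) 0 \<le> (\<lambda>u. u / 2 - 1 + exp (- u) * (1 + u / 2)) u"
  proof (rule DERIV_nonneg_imp_nondecreasing[OF u])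
   fix x :: real assume x: "0 \<le> x" "x \<le> u"
   have "exp (- x) * (1 + x) \<le> exp (- x) * exp x"
    by (intro mult_left_mono exp_ge_add_one_self) auto
   then have "exp (- x) * (1 + x) \<le> 1" by (simp add: exp_minus)
   then show "\<exists>y. ((\<lambda>u. u / 2 - 1 + exp (- u) * (1 + u / 2)) has_real_derivative y) (at x) \<and> 0 \<le> y"
    by (intro exI[of _ "1 / 2 - exp (- x) * (1 + x) / 2"] conjI)
      (auto intro!: derivative_eq_intros simp: field_simps)
  qed
  then show ?thesis by simp
 qed
 then have "u / 2 * (1 - exp (- u)) \<le> u - (1 - exp (- u))"
  by (simp add: algebra_simps add_divide_distrib diff_divide_distrib)
 then have "u / 2 * (1 - exp (- u)) / n \<le> (u - (1 - exp (- u))) / n"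
  using assms by (intro divide_right_mono) auto
 then show ?thesis using assms by (simp add: ghost_free_def u_def diff_divide_distrib)
qed

lemma half_ghost_int:
 assumes c: "kernel_fn c" and b: "b > 0"
 shows "b / 2 * ghost_prob c b \<le> ghost_int c b"
proof -
 have "ghost_prob c b \<le> 2 / b * ghost_int c b"
 proof (rule ghost_prob_least)
  fix E :: "'a set set" assume E: "E \<in> fins"
  have "expw c E (\<lambda>W. b / 2 * (1 - lap b 0 W)) \<le> expw c E (\<lambda>W. ghost_free b (card (clus W 0)))"
  proof (intro expct_mono wt_nonneg[OF c])
   fix W assume "W \<subseteq> E"
   then have "0 < card (clus W 0)" using finsD[OF E] finite_subset by (intro card_clus_pos) blast
   then show "b / 2 * (1 - lap b 0 W) \<le> ghost_free b (card (clus W 0))"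
    using half_ghost_free[of b] b by (simp add: lap_def)
  qed
  also have "\<dots> \<le> ghost_int c b" by (rule ghost_int_upper[OF c E]) (use b in auto)
  finally have "b / 2 * (1 - expw c E (lap b 0)) \<le> ghost_int c b"
   unfolding expct_cmult using finsD[OF E] by (simp add: expct_diff)
  then show "1 - expw c E (lap b 0) \<le> 2 / b * ghost_int c b"
   using b by (simp add: field_simps)
 qed
 then show ?thesis using b by (simp add: field_simps)
qed

text \<open>With u = b n this bounds the excess in \<open>half_ghost_free\<close>, divided by b. The
  excess is w(u) / u, and derivative estimates give w(x) at least x^3 / 24 up to 1/2 and x / 96
  beyond; the constant 1/96 makes both equal to 1/192 at 1/2.\<close>

lemma bend_lower:
 fixes u :: real
 assumes "u > 0"
 shows "min (u\<^sup>2) 1 / 96 \<le> 1 - (1 - exp (- u)) / u - (1 - exp (- u)) / 2"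
proof -
 define w where "w u = u / 2 - 1 + exp (- u) * (1 + u / 2)" for u :: real
 have der: "(w has_real_derivative (1 - exp (- x) * (1 + x)) / 2) (at x)" for x
  unfolding w_def[abs_def] by (auto intro!: derivative_eq_intros simp: field_simps)
 have low: "x\<^sup>2 / 2 \<le> (1 - exp (- x) * (1 + x)) * (1 + x + x\<^sup>2 / 2)" if "x \<ge> 0" for x :: real
 proof -
  have "exp (- x) * (1 + x + x\<^sup>2 / 2) \<le> exp (- x) * exp x"
   by (intro mult_left_mono exp_lower_Taylor_quadratic that) auto
  then have "exp (- x) * (1 + x + x\<^sup>2 / 2) \<le> 1" by (simp add: exp_minus)
  then have "(1 + x) * (exp (- x) * (1 + x + x\<^sup>2 / 2)) \<le> (1 + x) * 1"
   using that by (intro mult_left_mono) auto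
  then show ?thesis by (simp add: algebra_simps)
 qed
 have small: "x ^ 3 / 24 \<le> w x" if "0 \<le> x" "x \<le> 1 / 2" for x
 proof -
  have "(\<lambda>x. w x - x ^ 3 / 24) 0 \<le> (\<lambda>x. w x - x ^ 3 / 24) x"
  proof (rule DERIV_nonneg_imp_nondecreasing[OF that(1)])
   fix y assume y: "0 \<le> y" "y \<le> x"
   have y2: "y \<le> 1 / 2" using y that by simp
   have "y\<^sup>2 \<le> (1 / 2)\<^sup>2" using y y2 by (intro power_mono) auto
   then have "1 + y + y\<^sup>2 / 2 \<le> 2" using y2 by (simp add: power2_eq_square)
   moreover have "0 \<le> 1 - exp (- y) * (1 + y)"
    using exp_ge_add_one_self[of y] by (simp add: exp_minus field_simps)
   ultimately have "(1 - exp (- y) * (1 + y)) * (1 + y + y\<^sup>2 / 2) \<le> (1 - exp (- y) * (1 + y)) * 2"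
    by (intro mult_left_mono)
   then have "y\<^sup>2 / 8 \<le> (1 - exp (- y) * (1 + y)) / 2" using low[OF y(1)] by simp
   then show "\<exists>d. ((\<lambda>x. w x - x ^ 3 / 24) has_real_derivative d) (at y) \<and> 0 \<le> d"
    by (intro exI[of _ "(1 - exp (- y) * (1 + y)) / 2 - y\<^sup>2 / 8"] conjI)
      (auto intro!: derivative_eq_intros der simp: power2_eq_square)
  qed
  then show ?thesis by (simp add: w_def)
 qed
 have large: "x / 96 \<le> w x" if "1 / 2 \<le> x" for x
 proof -
  have "(\<lambda>x. w x - x / 96) (1 / 2) \<le> (\<lambda>x. w x - x / 96) x"
  proof (rule DERIV_nonneg_imp_nondecreasing[OF that])
   fix y :: real assume y: "1 / 2 \<le> y" "y \<le> x"
   have "1 / 48 * (1 + y + y\<^sup>2 / 2) \<le> y\<^sup>2 / 2"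
   proof -
    have "1 \<le> 2 * y" using y by simp
    moreover have "y * 1 \<le> y * (2 * y)" using y by (intro mult_left_mono) auto
    ultimately have "y \<le> 2 * y\<^sup>2" "1 \<le> 4 * y\<^sup>2" unfolding power2_eq_square by linarith+
    then show ?thesis by simp
   qed
   also have "\<dots> \<le> (1 - exp (- y) * (1 + y)) * (1 + y + y\<^sup>2 / 2)" using y by (intro low) auto
   finally have "1 / 48 \<le> 1 - exp (- y) * (1 + y)"
    by (rule mult_right_le_imp_le) (use y in \<open>auto intro!: add_pos_nonneg\<close>)
   then show "\<exists>d. ((\<lambda>x. w x - x / 96) has_real_derivative d) (at y) \<and> 0 \<le> d"
    by (intro exI[of _ "(1 - exp (- y) * (1 + y)) / 2 - 1 / 96"] conjI)
      (auto intro!: derivative_eq_intros der)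
  qed
  moreover have "1 / 192 \<le> w (1 / 2)" using small[of "1 / 2"] by (simp add: power3_eq_cube)
  ultimately show ?thesis by simp
 qed
 have "min (u\<^sup>2) 1 / 96 \<le> w u / u"
 proof (cases "u \<le> 1 / 2")
  case True
  have "min (u\<^sup>2) 1 / 96 \<le> u\<^sup>2 / 24" by (auto simp: min_def)
  also have "\<dots> = u ^ 3 / 24 / u" using assms by (simp add: power2_eq_square power3_eq_cube)
  also have "\<dots> \<le> w u / u" using small[of u] True assms by (intro divide_right_mono) auto
  finally show ?thesis .
 next
  case False
  have "min (u\<^sup>2) 1 / 96 \<le> u / 96 / u" using assms by (auto simp: min_def)
  also have "\<dots> \<le> w u / u" using large[of u] False assms by (intro divide_right_mono) auto
  finally show ?thesis .
 qed
 also have "w u / u = 1 - (1 - exp (- u)) / u - (1 - exp (- u)) / 2"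
  using assms by (simp add: w_def field_simps)
 finally show ?thesis .
qed

text \<open>The defect of linearity L (1 - exp(-u)) - (1 - exp(-L u)) is at most L^2 min(u^2, 1),
  which \<open>bend_lower\<close> turns into 96 L^2 times the excess over the chord. The chord
  itself contributes the 48.\<close>

lemma bend_pointwise:
 fixes u L :: real
 assumes u: "u > 0" and L: "L \<ge> 1"
 shows "(L + 48 * L\<^sup>2) * (1 - exp (- u)) \<le> (1 - exp (- (L * u))) + 96 * L\<^sup>2 * (1 - (1 - exp (- u)) / u)"
proof -
 have e: "0 \<le> exp (- (L * u))" by simp
 have "L * (1 - exp (- u)) - (1 - exp (- (L * u))) \<le> L\<^sup>2 * min (u\<^sup>2) 1"
 proof (cases "u \<le> 1")
  case True
  have "L * (1 - exp (- u)) \<le> L * u" using L by (intro mult_left_mono one_minus_exp_le) auto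
  moreover have "L * u - (L * u)\<^sup>2 \<le> 1 - exp (- (L * u))"
  proof -
   have p: "0 < 1 + L * u" using L u by (simp add: add_pos_nonneg)
   have "1 + L * u \<le> exp (L * u)" by (rule exp_ge_add_one_self)
   then have "exp (- (L * u)) \<le> 1 / (1 + L * u)" using p by (simp add: exp_minus field_simps)
   moreover have "(L * u - (L * u)\<^sup>2) * (1 + L * u) \<le> L * u"
    using L u by (simp add: algebra_simps power2_eq_square)
   then have "L * u - (L * u)\<^sup>2 \<le> 1 - 1 / (1 + L * u)" using p by (simp add: field_simps)
   ultimately show ?thesis by linarith
  qed
  moreover have "u\<^sup>2 \<le> 1" using True u by (simp add: power_le_one)
  ultimately show ?thesis by (simp add: min_def power_mult_distrib)
 next
  case False
 have "L * (1 - exp (- u)) \<le> L * 1" using L by (intro mult_left_mono) auto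
  moreover have "L \<le> L\<^sup>2" using L by (simp add: self_le_power)
  moreover have "exp (- (L * u)) \<le> exp 0" using L u by (intro exp_le_cancel_iff[THEN iffD2]) auto
  ultimately have "L * (1 - exp (- u)) - (1 - exp (- (L * u))) \<le> L\<^sup>2 * 1"
   unfolding exp_zero by linarith
  moreover have "min (u\<^sup>2) 1 = 1" using False by (simp add: one_le_power)
  ultimately show ?thesis by simp
 qed
 also have "\<dots> \<le> L\<^sup>2 * (96 * (1 - (1 - exp (- u)) / u - (1 - exp (- u)) / 2))"
 proof (intro mult_left_mono)
  show "min (u\<^sup>2) 1 \<le> 96 * (1 - (1 - exp (- u)) / u - (1 - exp (- u)) / 2)"
   using mult_left_mono[OF bend_lower[OF u], of 96] unfolding times_divide_eq_right
   by (simp del: diff_divide_eq_iff diff_numeral_special)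
 qed simp
 finally show ?thesis
  unfolding times_divide_eq_right
  by (simp add: algebra_simps diff_divide_distrib add_divide_distrib)
qed

text \<open>
 If \<open>I(b)\<close> is close to its lower bound \<open>b M(b) / 2\<close>, then \<open>M\<close> stays nearly linear well beyond \<open>b\<close>.
\<close>

lemma ghost_prob_extend:
 assumes c: "kernel_fn c" and b: "b > 0" and L: "L \<ge> 1"
 shows "(L + 48 * L\<^sup>2) * ghost_prob c b \<le> ghost_prob c (L * b) + 96 * L\<^sup>2 / b * ghost_int c b"
proof -
 define R where "R = ghost_prob c (L * b) + 96 * L\<^sup>2 / b * ghost_int c b"
 have p: "L + 48 * L\<^sup>2 > 0" using L by (simp add: add_pos_nonneg)
 have "ghost_prob c b \<le> R / (L + 48 * L\<^sup>2)"
 proof (rule ghost_prob_least)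
  fix E :: "'a set set" assume E: "E \<in> fins"
  have "expw c E (\<lambda>W. (L + 48 * L\<^sup>2) * (1 - lap b 0 W)) \<le>
   expw c E (\<lambda>W. (1 - lap (L * b) 0 W) + 96 * L\<^sup>2 / b * ghost_free b (card (clus W 0)))"
  proof (intro expct_mono wt_nonneg[OF c])
   fix W assume "W \<subseteq> E"
   then have "0 < card (clus W 0)" using finsD[OF E] finite_subset by (intro card_clus_pos) blast
   then show "(L + 48 * L\<^sup>2) * (1 - lap b 0 W) \<le> (1 - lap (L * b) 0 W) + 96 * L\<^sup>2 / b * ghost_free b (card (clus W 0))"
    using bend_pointwise[of "b * card (clus W 0)" L] b L
    by (simp add: lap_def ghost_free_def field_simps)
  qed
  also have "\<dots> = (1 - expw c E (lap (L * b) 0)) + 96 * L\<^sup>2 / b * expw c E (\<lambda>W. ghost_free b (card (clus W 0)))"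
   using finsD[OF E] by (simp add: expct_add expct_cmult expct_diff del: times_divide_eq_left)
  also have "\<dots> \<le> R"
   unfolding R_def using b
   by (intro add_mono mult_left_mono ghost_prob_upper ghost_int_upper c E) auto
  finally have "(L + 48 * L\<^sup>2) * (1 - expw c E (lap b 0)) \<le> R"
   using finsD[OF E] by (simp add: expct_cmult expct_diff)
  then show "1 - expw c E (lap b 0) \<le> R / (L + 48 * L\<^sup>2)"
   using p by (simp add: field_simps)
 qed
 then show ?thesis using p by (simp add: R_def field_simps)
qed

lemma min_le_ghost:
 fixes n :: real
 assumes "n > 0"
 shows "min (real m) n \<le> 2 * n * (1 - exp (- (1 / n * m)))"
proof -
 define u where "u = m / n"
 have u: "u \<ge> 0" using assms by (simp add: u_def)
 have "min u 1 \<le> 2 * (1 - exp (- u))"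
 proof (cases "u \<le> 1")
  case True
  have "1 + u \<le> exp u" by (rule exp_ge_add_one_self)
  then have "exp (- u) \<le> 1 / (1 + u)" using u by (simp add: exp_minus field_simps)
  moreover have "u / 2 \<le> 1 - 1 / (1 + u)" using True u by (simp add: field_simps mult_left_le)
  ultimately show ?thesis using True by simp
 next
  case False
  have "1 + u \<le> exp u" by (rule exp_ge_add_one_self)
  then have "2 \<le> exp u" using False by linarith
  then have "exp (- u) \<le> 1 / 2" using exp_gt_zero[of u] by (simp add: exp_minus field_simps)
  then show ?thesis using False by simp
 qed
 then have "n * min u 1 \<le> n * (2 * (1 - exp (- u)))" using assms by (intro mult_left_mono) auto
 moreover have "n * min u 1 = min (real m) n"
  using assms by (simp add: u_def min_mult_distrib_left)
 ultimately show ?thesis by (simp add: u_def mult.assoc mult.left_commute)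
qed

lemma expct_min_card_le:
 assumes c: "kernel_fn c" and E: "E \<in> fins" and n: "n > 0"
 shows "expw c E (\<lambda>W. min (csize W x) n) \<le> 2 * n * ghost_prob c (1 / n)"
proof -
 have "expw c E (\<lambda>W. min (csize W x) n) \<le> expw c E (\<lambda>W. 2 * n * (1 - lap (1 / n) x W))"
  using min_le_ghost[OF n] by (intro expct_mono wt_nonneg[OF c]) (simp add: lap_def)
 also have "\<dots> = 2 * n * (1 - expw c E (lap (1 / n) x))"
  using finsD[OF E] by (simp add: expct_cmult expct_diff)
 also have "\<dots> \<le> 2 * n * ghost_prob c (1 / n)"
  using n by (intro mult_left_mono ghost_prob_upper c E) auto
 finally show ?thesis .
qed

lemma prb_card_ge_le:
 assumes c: "kernel_fn c" and E: "E \<in> fins" and n: "n > 0"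
 shows "prw c E (\<lambda>W. n \<le> csize W x) \<le> 2 * ghost_prob c (1 / n)"
proof -
 have "n * prw c E (\<lambda>W. n \<le> csize W x) \<le> expw c E (\<lambda>W. min (csize W x) n)"
  unfolding expct_cmult[symmetric] using n by (intro expct_mono wt_nonneg[OF c]) auto
 also have "\<dots> \<le> 2 * n * ghost_prob c (1 / n)" by (rule expct_min_card_le[OF assms])
 finally show ?thesis using n by simp
qed

section \<open>Sharpness of the phase transition\<close>

lemma expct_zero_weight:
 assumes "finite E" "\<And>e. e \<in> E \<Longrightarrow> k e = 0"
 shows "expct k E f = f {}"
 using assms
 by (induction E arbitrary: f rule: finite_induct) (auto simp: expct_insert)

lemma expct_support:
 assumes "finite E" "F \<subseteq> E" "\<And>e. e \<in> E - F \<Longrightarrow> k e = 0"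
 shows "expct k E f = expct k F f"
proof -
 have "E = F \<union> (E - F)" using assms by auto
 then have "expct k E f = expct k (F \<union> (E - F)) f" by simp
 also have "\<dots> = expct k F (\<lambda>A. expct k (E - F) (\<lambda>B. f (A \<union> B)))"
  using assms finite_subset by (intro expct_Un) auto
 also have "\<dots> = expct k F f"
 proof (rule expct_cong)
  fix A
  show "expct k (E - F) (\<lambda>B. f (A \<union> B)) = f A"
   using expct_zero_weight[of "E - F" k "\<lambda>B. f (A \<union> B)"] assms by simp
 qed
 finally show ?thesis .
qed

text \<open>Expand 1 - exp(-h |K|) to second order on the fixed finite graph; the second moment
  there is finite and drops out as \<open>h\<close> tends to 0.\<close>

lemma card_bound_of_ghost_prob:
 assumes c: "kernel_fn c" and B: "\<And>h. h > 0 \<Longrightarrow> ghost_prob c h \<le> h * B" and E: "E \<in> fins"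
 shows "expw c E csize0 \<le> B"
proof (rule le_of_scaled_error)
 fix h :: real assume h: "0 < h" "h < 1"
 let ?f = "\<lambda>W. csize W 0"
 have "expw c E (\<lambda>W. h * ?f W - h\<^sup>2 * (?f W)\<^sup>2) \<le> expw c E (\<lambda>W. 1 - lap h 0 W)"
 proof (intro expct_mono wt_nonneg[OF c])
  fix W
  define u where "u = h * ?f W"
  have u: "u \<ge> 0" using h by (simp add: u_def)
  have "1 + u \<le> exp u" by (rule exp_ge_add_one_self)
  then have "exp (- u) \<le> 1 / (1 + u)" using u by (simp add: exp_minus field_simps)
  moreover have "u - u\<^sup>2 \<le> 1 - 1 / (1 + u)"
  proof -
   have "(u - u\<^sup>2) * (1 + u) \<le> u" using u by (simp add: algebra_simps power2_eq_square)
   then show ?thesis using u by (simp add: field_simps)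
  qed
  ultimately show "h * ?f W - h\<^sup>2 * (?f W)\<^sup>2 \<le> 1 - lap h 0 W"
   by (simp add: lap_def u_def power_mult_distrib)
 qed
 also have "\<dots> \<le> ghost_prob c h"
  using ghost_prob_upper[OF c E, of h 0] finsD[OF E] by (simp add: expct_diff)
 also have "\<dots> \<le> h * B" using h by (intro B)
 finally have "h * (expw c E ?f - h * expw c E (\<lambda>W. (?f W)\<^sup>2)) \<le> h * B"
  by (simp add: expct_diff expct_cmult algebra_simps power2_eq_square)
 then show "expw c E ?f \<le> B + h * expw c E (\<lambda>W. (?f W)\<^sup>2)"
  using h by simp
qed

text \<open>
 The mean weight of the edges leaving \<open>S\<close> from the cluster of the origin inside \<open>S\<close>; only edges
 of the finite set \<open>F\<close> are counted.
\<close>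

definition exit_weight :: "('v::ab_group_add \<Rightarrow> real) \<Rightarrow> 'v set \<Rightarrow> 'v set set \<Rightarrow> real" where
 "exit_weight c S F = expw c (pairs S) (\<lambda>W. \<Sum>e\<in>bdry F (clus W 0) - pairs S. wt c e)"

text \<open>Regard the edges outside \<open>pairs S\<close> as sprinkled. The cluster inside
  \<open>S\<close> has at most \<open>card S\<close> vertices and mean outgoing weight at most
  \<open>\<phi>\<close>, so the magnetization satisfies \<mu> \<le> h |S| + \<mu> \<phi>, which is
  solvable for \<phi> < 1.\<close>

lemma subcritical_of_exit_weight:
 assumes c: "kernel_fn c" and S: "finite S" "0 \<in> S" and \<phi>: "\<phi> < 1"
  and exit: "\<And>F. F \<in> fins \<Longrightarrow> exit_weight c S F \<le> \<phi>"
  and E: "E \<in> fins"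
 shows "expw c E csize0 \<le> card S / (1 - \<phi>)"
proof (rule card_bound_of_ghost_prob[OF c _ E])
 fix h :: real assume h: "h > 0"
 let ?\<mu> = "ghost_prob c h"
 define k where "k e = (if e \<in> pairs S then wt c e else 0)" for e
 define \<kappa> where "\<kappa> e = (if e \<in> pairs S then 0 else wt c e)" for e
 have k: "0 \<le> k e" and \<kappa>: "0 \<le> \<kappa> e" for e using wt_nonneg[OF c] by (auto simp: k_def \<kappa>_def)
 have sum: "(\<lambda>e. k e + \<kappa> e) = wt c" by (auto simp: k_def \<kappa>_def)
 have \<mu>: "0 \<le> ?\<mu>" using ghost_prob_bounds[OF c] h by simp
 have pS: "finite (pairs S)" using pairs_fins[OF S(1)] by (rule finsD)
 have "?\<mu> \<le> h * card S + ?\<mu> * \<phi>"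
 proof (rule ghost_prob_least)
  fix E :: "'a set set" assume E: "E \<in> fins"
  define E' where "E' = E \<union> pairs S"
  have E': "E' \<in> fins" unfolding E'_def by (intro Un_fins E pairs_fins S)
  have finE': "finite E'" by (rule finsD[OF E'])
  have "expw c E (\<lambda>W. - lap h 0 W) \<le> expw c E' (\<lambda>W. - lap h 0 W)"
   using h by (intro expct_mono_set wt_nonneg[OF c] finE')
    (auto simp: increasing_on_def E'_def intro!: lap_antimono finite_subset[OF _ finE'])
  then have mono: "1 - expw c E (lap h 0) \<le> 1 - expw c E' (lap h 0)"
   using expct_cmult[of "wt c" _ "-1"] by simp
  have "expct k E' (\<lambda>W. 1 - (h * card (clus W 0) + ?\<mu> * (\<Sum>e\<in>bdry E' (clus W 0). \<kappa> e)))
   \<le> expct k E' (\<lambda>W. exp (- (h * card (clus W 0)) - ?\<mu> * (\<Sum>e\<in>bdry E' (clus W 0). \<kappa> e)))"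
  proof (intro expct_mono k)
   fix W
   show "1 - (h * card (clus W 0) + ?\<mu> * (\<Sum>e\<in>bdry E' (clus W 0). \<kappa> e)) \<le>
    exp (- (h * card (clus W 0)) - ?\<mu> * (\<Sum>e\<in>bdry E' (clus W 0). \<kappa> e))"
    using exp_ge_add_one_self[of "- (h * card (clus W 0)) - ?\<mu> * (\<Sum>e\<in>bdry E' (clus W 0). \<kappa> e)"] by linarith
  qed
  also have "\<dots> \<le> expw c E' (lap h 0)"
   using sprinkle_ghost[of E' k \<kappa> h ?\<mu> 0, OF finE' k \<kappa>] h ghost_prob_upper[OF c E'] by (simp add: sum)
  also have "expct k E' (\<lambda>W. 1 - (h * card (clus W 0) + ?\<mu> * (\<Sum>e\<in>bdry E' (clus W 0). \<kappa> e))) =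
   expw c (pairs S) (\<lambda>W. 1 - (h * card (clus W 0) + ?\<mu> * (\<Sum>e\<in>bdry E' (clus W 0) - pairs S. wt c e)))"
  proof -
   have "expct k E' f = expw c (pairs S) f" for f
   proof -
    have "expct k E' f = expct k (pairs S) f"
     by (rule expct_support[OF finE']) (auto simp: E'_def k_def)
    also have "\<dots> = expw c (pairs S) f" by (rule expct_weight_cong) (simp add: k_def)
    finally show ?thesis .
   qed
   moreover have "(\<Sum>e\<in>bdry E' K. \<kappa> e) = (\<Sum>e\<in>bdry E' K - pairs S. wt c e)" for K
    using finE' by (intro sum.mono_neutral_cong_right) (auto simp: \<kappa>_def)
   ultimately show ?thesis by simp
  qed
  also have "\<dots> = 1 - (h * expw c (pairs S) csize0 + ?\<mu> * exit_weight c S E')"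
   using pS by (simp add: expct_diff expct_add expct_cmult exit_weight_def)
  finally have "1 - expw c E' (lap h 0) \<le>
    h * expw c (pairs S) csize0 + ?\<mu> * exit_weight c S E'" by simp
  also have "\<dots> \<le> h * card S + ?\<mu> * \<phi>"
  proof (intro add_mono mult_left_mono \<mu> exit E')
   show "expw c (pairs S) csize0 \<le> card S"
    using pS S clus_pairs_subset[of _ S 0]
    by (intro expct_le_const wt_nonneg[OF c]) (auto intro!: card_mono)
  qed (use h in auto)
  finally show "1 - expw c E (lap h 0) \<le> h * card S + ?\<mu> * \<phi>" using mono by linarith
 qed
 then have "?\<mu> * (1 - \<phi>) \<le> h * card S" by (simp add: algebra_simps)
 then show "?\<mu> \<le> h * (card S / (1 - \<phi>))" using \<phi> by (simp add: field_simps)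
qed

lemma exit_sum_mono:
 assumes c: "kernel_fn c" and F: "F \<in> fins" and "K \<subseteq> K'" "K' \<subseteq> S"
 shows "(\<Sum>e\<in>bdry F K - pairs S. wt c e) \<le> (\<Sum>e\<in>bdry F K' - pairs S. wt c e)"
proof (rule sum_mono2)
 show "bdry F K - pairs S \<subseteq> bdry F K' - pairs S"
  using assms by (auto simp: bdry_def pairs_def fins_def)
qed (use finsD[OF F] wt_nonneg[OF c] in auto)

lemma exit_weight_mono:
 assumes c: "kernel_fn c" and F: "F \<in> fins" "F \<subseteq> F'" "F' \<in> fins" and S: "finite S" "0 \<in> S"
 shows "exit_weight c S F \<le> exit_weight c S F'"
 unfolding exit_weight_def
 using finsD[OF F(3)] F(2) wt_nonneg[OF c]
 by (intro expct_mono wt_nonneg[OF c] sum_mono2) (auto simp: bdry_def)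

text \<open>
 The differential inequality of Duminil-Copin and Tassion: while the origin is not connected to
 the complement of \<open>L\<close>, the exit weight of the set of vertices of \<open>L\<close> not connected to that
 complement is at least \<open>1/2\<close>.
\<close>

lemma escape_step:
 assumes c: "kernel_fn c" and L: "finite L" "0 \<in> L" and \<beta>: "0 < \<beta>1" "\<beta>1 \<le> \<beta>" and \<delta>: "\<delta> \<ge> 0"
  and F: "F \<in> fins" and EF: "E = F \<union> pairs L"
  and exit: "\<And>S. S \<subseteq> L \<Longrightarrow> 0 \<in> S \<Longrightarrow> 1 / 2 \<le> exit_weight (\<lambda>x. \<beta>1 * c x) S F"
  and esc: "esc = (\<lambda>W. \<exists>y\<in>\<Union>E - L. conn W 0 y)"
 shows "prw (\<lambda>x. (\<beta> + \<delta>) * c x) E (\<lambda>W. \<not> esc W) \<le>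
  (1 - \<delta> * exp (- (\<delta> * (\<Sum>e\<in>E. wt c e))) / (2 * \<beta>1)) * prw (\<lambda>x. \<beta> * c x) E (\<lambda>W. \<not> esc W)"
proof -
 have E: "E \<in> fins" unfolding EF by (intro Un_fins F pairs_fins L)
 have finE: "finite E" by (rule finsD[OF E])
 have \<beta>0: "0 \<le> \<beta>" using \<beta> by simp
 have wb: "wt (\<lambda>x. b * c x) = (\<lambda>e. b * wt c e)" if "b \<ge> 0" for b using wt_cmult[OF c that] by auto
 let ?k = "wt (\<lambda>x. \<beta> * c x)"
 have ck: "kernel_fn (\<lambda>x. \<beta> * c x)" by (rule kernel_fn_cmult[OF c \<beta>0])
 have ck1: "kernel_fn (\<lambda>x. \<beta>1 * c x)" by (rule kernel_fn_cmult[OF c]) (use \<beta> in simp)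
 define s where "s = (\<Sum>e\<in>E. wt c e)"
 define R where "R = \<Union>E - L"
 have ER: "e \<subseteq> L \<union> R" if "e \<in> E" for e using that by (auto simp: R_def)
 have esc_reach: "esc W \<longleftrightarrow> 0 \<in> reach R W" for W
  unfolding esc R_def[symmetric] reach_def clus_def by (auto simp: conn_commute)
 have up: "up_closed esc"
  unfolding up_closed_def esc
 proof (intro allI impI)
  fix A B assume "A \<subseteq> B" "\<exists>y\<in>\<Union>E - L. conn A 0 y"
  then show "\<exists>y\<in>\<Union>E - L. conn B 0 y" using conn_mono[of A 0 _ B] by auto
 qed
 \<comment> \<open>The exploration starts from \<open>R\<close>, the vertices outside
   \<open>L\<close>. If the set \<open>T\<close> reached misses the origin, the edges inside
   \<open>L - T\<close> are still fresh, and each edge counted by \<open>Y\<close> joins the cluster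
   of the origin to \<open>T\<close>, so that opening it makes \<open>esc\<close> true.\<close>
 define Y where "Y T W' = of_bool (0 \<notin> T) * (\<Sum>e\<in>bdry F (clus W' 0) - pairs (L - T). wt c e)" for T W'
 have gain: "Y (reach R W) (off (reach R W) W) \<le> (\<Sum>e\<in>E. wt c e * (of_bool (esc (insert e W)) - of_bool (esc W)))"
  if W: "W \<subseteq> E" for W
 proof (cases "esc W")
  case True
  then have "esc (insert e W)" for e using up_closedD[OF up, of W "insert e W"] by auto
  then show ?thesis using True by (simp add: Y_def esc_reach)
 next
  case False
  define T where "T = reach R W"
  have 0: "0 \<notin> T" using False by (simp add: esc_reach T_def)
  have cl: "clus W 0 \<inter> T = {}"
  proof (rule ccontr)
   assume "clus W 0 \<inter> T \<noteq> {}"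
   then obtain y r where "conn W 0 y" "r \<in> R" "conn W r y" by (auto simp: T_def reach_def clus_def)
   then have "conn W 0 r" using conn_trans[of W 0 y r] conn_sym[of W r y] by simp
   then show False using False \<open>r \<in> R\<close> by (auto simp: esc R_def)
  qed
  have K: "clus (off T W) 0 = clus W 0"
  proof
   show "clus W 0 \<subseteq> clus (off T W) 0"
   proof
    fix y assume "y \<in> clus W 0"
    then have "conn W 0 y" by (simp add: clus_def)
    then have "conn (off T W) 0 y"
    proof (induction rule: conn_induct)
     case (step u v)
     have "u \<in> clus W 0" "v \<in> clus W 0" using step conn_step[of W 0 u v] by (auto simp: clus_def)
     then have "{u, v} \<in> off T W" using cl step by (auto simp: off_def)
     then show ?case using conn_step[OF step(4)] by simp
    qed simp
    then show "y \<in> clus (off T W) 0" by (simp add: clus_def)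
   qed
  qed (rule clus_mono[OF off_subset])
  have RT: "R \<subseteq> T" by (auto simp: T_def reach_def)
  have clL: "clus W 0 \<subseteq> L - T"
  proof (rule clus_subsetI)
   fix u v assume "u \<in> L - T" "u \<noteq> v" "{u, v} \<in> W"
   moreover then have "v \<notin> T" unfolding T_def reach_def using clus_closed[of v W _ u]
    by (auto simp: insert_commute T_def reach_def)
   ultimately show "v \<in> L - T" using ER[of "{u, v}"] W RT by auto
  qed (use 0 L in auto)
  have "Y T (off T W) = (\<Sum>e\<in>bdry F (clus W 0) - pairs (L - T). wt c e)"
   using 0 by (simp add: Y_def K)
  also have "\<dots> = (\<Sum>e\<in>bdry F (clus W 0) - pairs (L - T). wt c e * (of_bool (esc (insert e W)) - of_bool (esc W)))"
  proof (rule sum.cong[OF refl])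
   fix e assume e: "e \<in> bdry F (clus W 0) - pairs (L - T)"
   then have "e \<in> edges" using F by (auto simp: bdry_def fins_def)
   then obtain a b where ab: "a \<noteq> b" "e = {a, b}" by (rule edges_cases)
   have "\<exists>x y. e = {x, y} \<and> x \<in> clus W 0 \<and> y \<notin> clus W 0"
    using e ab by (auto simp: bdry_def)
   then obtain x y where xy: "e = {x, y}" "x \<in> clus W 0" "y \<notin> clus W 0" by blast
   have "y \<notin> L - T"
   proof
    assume "y \<in> L - T"
    then have "e \<in> pairs (L - T)" using xy clL \<open>e \<in> edges\<close> by (auto simp: pairs_def)
    then show False using e by auto
   qed
   moreover have "y \<in> L \<union> R" using ER[of e] e xy by (auto simp: bdry_def EF)
   ultimately have "y \<in> T" using RT by auto
   then obtain r where r: "r \<in> R" "conn W r y" by (auto simp: T_def reach_def clus_def)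
   have "conn (insert e W) 0 x" using xy conn_mono[of W 0 x "insert e W"] by (auto simp: clus_def)
   then have "conn (insert e W) 0 y" by (rule conn_step) (simp add: xy)
   moreover have "conn (insert e W) y r" using conn_sym[OF conn_mono[OF r(2), of "insert e W"]] by auto
   ultimately have "conn (insert e W) 0 r" by (rule conn_trans)
   then have "esc (insert e W)" using r by (auto simp: esc R_def)
   then show "wt c e = wt c e * (of_bool (esc (insert e W)) - of_bool (esc W))" using False by simp
  qed
  also have "\<dots> \<le> (\<Sum>e\<in>E. wt c e * (of_bool (esc (insert e W)) - of_bool (esc W)))"
   using finE False wt_nonneg[OF c] by (intro sum_mono2) (auto simp: bdry_def EF)
  finally show ?thesis by (simp add: T_def)
 qed
 \<comment> \<open>On a fresh configuration with parameter \<open>\<beta>1\<close> the mean of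
   \<open>Y\<close> is the exit weight of \<open>L - T\<close> divided by \<open>\<beta>1\<close>,
   since \<open>Y\<close> counts the edge with weight \<open>c\<close> only. Monotonicity passes to
   \<open>\<beta>\<close>.\<close>
 have mean: "(1 / (2 * \<beta>1)) * of_bool (0 \<notin> T) \<le> expct ?k E (\<lambda>W'. Y T (off T W'))" if RT: "R \<subseteq> T" for T
 proof (cases "0 \<in> T")
  case False
  let ?S = "L - T"
  have S: "?S \<subseteq> L" "0 \<in> ?S" "finite ?S" using False L by auto
  have sub: "pairs ?S \<subseteq> E" by (auto simp: EF pairs_def)
  have "off T W' = W' \<inter> pairs ?S" if "W' \<subseteq> E" for W'
  proof -
   have "e \<in> pairs ?S \<longleftrightarrow> e \<inter> T = {}" if "e \<in> W'" for e
   proof -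
    have "e \<in> E" "e \<in> edges" using that \<open>W' \<subseteq> E\<close> E by (auto simp: fins_def)
    then show ?thesis using ER[of e] RT by (auto simp: pairs_def)
   qed
   then show ?thesis by (auto simp: off_def)
  qed
  then have "expct ?k E (\<lambda>W'. Y T (off T W')) = expct ?k E (\<lambda>W'. Y T (W' \<inter> pairs ?S))"
   by (intro expct_cong) simp
  also have "\<dots> = expct ?k (pairs ?S) (Y T)"
   using finE finite_subset[OF sub] by (intro expct_restrict sub) auto
  also have "\<dots> \<ge> expw (\<lambda>x. \<beta>1 * c x) (pairs ?S) (Y T)"
  proof (rule expct_kernel_mono[OF ck1 ck])
   show "\<beta>1 * c x \<le> \<beta> * c x" for x using \<beta> kernel_fn_nonneg[OF c] by (intro mult_right_mono) auto
   show "pairs ?S \<in> fins" by (rule pairs_fins[OF S(3)])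
   show "increasing_on (pairs ?S) (Y T)"
    unfolding increasing_on_def Y_def
    using clus_pairs_subset[of _ ?S 0] S(2)
    by (auto intro!: mult_left_mono exit_sum_mono[OF c F] clus_mono)
  qed
  also have "expw (\<lambda>x. \<beta>1 * c x) (pairs ?S) (Y T) = exit_weight (\<lambda>x. \<beta>1 * c x) ?S F / \<beta>1"
   using \<beta> False by (simp add: exit_weight_def Y_def[abs_def] wb sum_distrib_left[symmetric] expct_cmult)
  finally show ?thesis using exit[OF S(1,2)] \<beta> False by (simp add: field_simps)
 qed (auto simp: Y_def finE)
 have "(1 / (2 * \<beta>1)) * prb ?k E (\<lambda>W. \<not> esc W) = expct ?k E (\<lambda>W. (1 / (2 * \<beta>1)) * of_bool (0 \<notin> reach R W))"
  by (simp only: expct_cmult esc_reach)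
 also have "\<dots> \<le> expct ?k E (\<lambda>W. expct ?k E (\<lambda>W'. Y (reach R W) (off (reach R W) W')))"
  by (intro expct_mono wt_nonneg[OF ck] mean) (auto simp: reach_def)
 also have "\<dots> = expct ?k E (\<lambda>W. Y (reach R W) (off (reach R W) W))"
  by (rule expct_explore[OF finE, symmetric])
 also have "\<dots> \<le> expct ?k E (\<lambda>W. \<Sum>e\<in>E. wt c e * (of_bool (esc (insert e W)) - of_bool (esc W)))"
  by (intro expct_mono wt_nonneg[OF ck] gain)
 finally have gain': "(1 / (2 * \<beta>1)) * prb ?k E (\<lambda>W. \<not> esc W) \<le>
   expct ?k E (\<lambda>W. \<Sum>e\<in>E. wt c e * (of_bool (esc (insert e W)) - of_bool (esc W)))" .
 have first: "of_bool (esc W) + (\<Sum>e\<in>E. \<delta> * wt c e * (of_bool (esc (insert e W)) - of_bool (esc W))) * exp (- (\<Sum>e\<in>E. \<delta> * wt c e))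
   \<le> expct (\<lambda>e. \<delta> * wt c e) E (\<lambda>B. of_bool (esc (W \<union> B)))" for W
 proof (rule expct_first_order[OF finE order_refl])
  show "increasing_on E (\<lambda>B. of_bool (esc (W \<union> B)))"
   unfolding increasing_on_def using up_closedD[OF up] by (auto simp: of_bool_def) (metis Un_mono order_refl)
 qed (use \<delta> wt_nonneg[OF c] in auto)
 have "prw (\<lambda>x. (\<beta> + \<delta>) * c x) E esc = expct (\<lambda>e. ?k e + \<delta> * wt c e) E (\<lambda>W. of_bool (esc W))"
  unfolding wb[OF \<beta>0] wb[OF add_nonneg_nonneg[OF \<beta>0 \<delta>]] by (simp only: distrib_right)
 also have "\<dots> = expct ?k E (\<lambda>W. expct (\<lambda>e. \<delta> * wt c e) E (\<lambda>B. of_bool (esc (W \<union> B))))"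
  by (rule expct_add_weight[OF finE])
 also have "\<dots> \<ge> expct ?k E (\<lambda>W. of_bool (esc W) + (\<delta> * exp (- (\<delta> * s))) * (\<Sum>e\<in>E. wt c e * (of_bool (esc (insert e W)) - of_bool (esc W))))"
  using first by (intro expct_mono wt_nonneg[OF ck]) (simp add: s_def sum_distrib_left mult_ac)
 also have "expct ?k E (\<lambda>W. of_bool (esc W) + (\<delta> * exp (- (\<delta> * s))) * (\<Sum>e\<in>E. wt c e * (of_bool (esc (insert e W)) - of_bool (esc W)))) =
   prb ?k E esc + (\<delta> * exp (- (\<delta> * s))) * expct ?k E (\<lambda>W. \<Sum>e\<in>E. wt c e * (of_bool (esc (insert e W)) - of_bool (esc W)))"
  by (simp only: expct_add expct_cmult)
 finally have main: "prb ?k E esc + (\<delta> * exp (- (\<delta> * s))) * ((1 / (2 * \<beta>1)) * prb ?k E (\<lambda>W. \<not> esc W)) \<le> prw (\<lambda>x. (\<beta> + \<delta>) * c x) E esc"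
  using mult_left_mono[OF gain', of "\<delta> * exp (- (\<delta> * s))"] \<delta> by simp
 have neg: "prb k E (\<lambda>W. \<not> esc W) = 1 - prb k E esc" for k
 proof -
  have "(\<lambda>W. of_bool (\<not> esc W)) = (\<lambda>W. 1 - of_bool (esc W) :: real)" by auto
  then show ?thesis using finE by (simp add: expct_diff)
 qed
 show ?thesis
  using main unfolding neg s_def[symmetric] by (simp add: field_simps)
qed

text \<open>An unbounded mean cluster size forces, by \<open>subcritical_of_exit_weight\<close>, an
  exit weight above 1/2 from every finite set containing the origin. Iterating
  \<open>escape_step\<close> from \<open>\<beta>1\<close> to \<open>\<beta>2\<close> then makes the
  probability of staying in \<open>L\<close> decay at a rate independent of
  \<open>L\<close>.\<close>

theorem sharpness:
 assumes c: "kernel_fn c" and \<beta>: "0 \<le> \<beta>1" "\<beta>1 < \<beta>2"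
  and unbounded: "\<And>C. \<exists>E\<in>fins. C < expw (\<lambda>x. \<beta>1 * c x) E csize0"
 shows "\<exists>\<theta>>0. \<forall>L. finite L \<longrightarrow> (\<exists>E\<in>fins. \<theta> \<le> prw (\<lambda>x. \<beta>2 * c x) E (\<lambda>W. \<not> clus W 0 \<subseteq> L))"
proof -
 have ck1: "kernel_fn (\<lambda>x. \<beta>1 * c x)" by (rule kernel_fn_cmult[OF c \<beta>(1)])
 have exF: "\<exists>F\<in>fins. 1 / 2 < exit_weight (\<lambda>x. \<beta>1 * c x) S F" if "finite S" "0 \<in> S" for S
 proof (rule ccontr)
  assume "\<not> ?thesis"
  then have "expw (\<lambda>x. \<beta>1 * c x) E csize0 \<le> card S / (1 - 1 / 2)" if "E \<in> fins" for E
   using that \<open>finite S\<close> \<open>0 \<in> S\<close> by (intro subcritical_of_exit_weight[OF ck1]) (auto simp: not_less)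
  then show False using unbounded[of "card S / (1 - 1 / 2)"] by fastforce
 qed
 have \<beta>1: "\<beta>1 > 0"
 proof (rule ccontr)
  assume "\<not> \<beta>1 > 0"
  then have "\<beta>1 = 0" using \<beta> by simp
  moreover have "wt (\<lambda>x::'a. 0) e = 0" for e
   using wt_cmult[OF c order_refl] by simp
  ultimately show False using exF[of "{0}"] by (auto simp: exit_weight_def pairs_fins[THEN finsD])
 qed
 define \<theta> where "\<theta> = 1 - exp (- ((\<beta>2 - \<beta>1) / (4 * \<beta>1)))"
 have \<theta>: "\<theta> > 0" unfolding \<theta>_def using \<beta> \<beta>1 by simp
 have "\<exists>E\<in>fins. \<theta> \<le> prw (\<lambda>x. \<beta>2 * c x) E (\<lambda>W. \<not> clus W 0 \<subseteq> L)" if finL: "finite L" for L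
 proof -
  define L' where "L' = insert 0 L"
  have L': "finite L'" "0 \<in> L'" using finL by (auto simp: L'_def)
  let ?SS = "{S. S \<subseteq> L' \<and> 0 \<in> S}"
  have finSS: "finite ?SS" using L' by auto
  have "\<forall>S\<in>?SS. \<exists>F\<in>fins. 1 / 2 < exit_weight (\<lambda>x. \<beta>1 * c x) S F"
   using exF L' finite_subset by blast
  then obtain G where G: "\<And>S. S \<in> ?SS \<Longrightarrow> G S \<in> fins \<and> 1 / 2 < exit_weight (\<lambda>x. \<beta>1 * c x) S (G S)"
   by metis
  \<comment> \<open>A single finite graph witnessing the exit weights of all subsets of
    \<open>L'\<close> at once; the set \<open>L' - T\<close> left by the exploration is
    random.\<close>
  define F where "F = (\<Union>S\<in>?SS. G S)"
  have F: "F \<in> fins" unfolding F_def using finSS G by (intro UN_fins) auto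
  have exit: "1 / 2 \<le> exit_weight (\<lambda>x. \<beta>1 * c x) S F" if "S \<subseteq> L'" "0 \<in> S" for S
  proof -
   have "S \<in> ?SS" using that by simp
   then have "exit_weight (\<lambda>x. \<beta>1 * c x) S (G S) \<le> exit_weight (\<lambda>x. \<beta>1 * c x) S F"
    using G F that L' finite_subset[OF that(1)] by (intro exit_weight_mono[OF ck1]) (auto simp: F_def)
   then show ?thesis using G[OF \<open>S \<in> ?SS\<close>] by linarith
  qed
  define E where "E = F \<union> pairs L'"
  have E: "E \<in> fins" unfolding E_def by (intro Un_fins F pairs_fins L')
  define esc where "esc = (\<lambda>W. \<exists>y\<in>\<Union>E - L'. conn W 0 y)"
  define s where "s = (\<Sum>e\<in>E. wt c e)"
  have s: "s \<ge> 0" unfolding s_def by (intro sum_nonneg wt_nonneg[OF c])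
  define d where "d = \<beta>2 - \<beta>1"
  have d: "d > 0" using \<beta> by (simp add: d_def)
  \<comment> \<open>The first summand makes \<delta> s at most ln 2, so the exponential factor of
    \<open>escape_step\<close> is at least 1/2, whence the 4 in \<open>\<theta>\<close>. The second
    keeps the contraction factor \<open>q\<close> nonnegative.\<close>
  obtain n :: nat where n0: "d * s / ln 2 + d / (2 * \<beta>1) < n" using reals_Archimedean2 by blast
  have pos: "0 \<le> d * s / ln 2" "0 < d / (2 * \<beta>1)" using d s \<beta>1 by auto
  have npos: "n > 0" using n0 pos by (intro Nat.gr0I) auto
  define \<delta> where "\<delta> = d / n"
  have \<delta>: "\<delta> > 0" using d npos by (simp add: \<delta>_def)
  have "d * s / ln 2 \<le> n" using n0 pos by linarith
  then have "\<delta> * s \<le> ln 2" using npos by (simp add: \<delta>_def field_simps)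
  then have "exp (- ln 2) \<le> exp (- (\<delta> * s))" by simp
  then have half: "1 / 2 \<le> exp (- (\<delta> * s))" by (simp add: exp_minus)
  define q where "q = 1 - \<delta> * exp (- (\<delta> * s)) / (2 * \<beta>1)"
  have q: "q \<le> exp (- (\<delta> / (4 * \<beta>1)))" "0 \<le> q"
  proof -
   have "q \<le> 1 - \<delta> * (1 / 2) / (2 * \<beta>1)"
    unfolding q_def using half \<delta> \<beta>1 by (intro diff_left_mono divide_right_mono mult_left_mono) auto
   also have "\<dots> \<le> exp (- (\<delta> / (4 * \<beta>1)))"
    using exp_ge_add_one_self[of "- (\<delta> / (4 * \<beta>1))"] by simp
   finally show "q \<le> exp (- (\<delta> / (4 * \<beta>1)))" .
   have "d / (2 * \<beta>1) < n" using n0 pos by linarith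
   then have "\<delta> / (2 * \<beta>1) \<le> 1" using npos \<beta>1 by (simp add: \<delta>_def field_simps)
   moreover have "\<delta> * exp (- (\<delta> * s)) / (2 * \<beta>1) \<le> \<delta> * 1 / (2 * \<beta>1)"
    using \<delta> \<beta>1 s by (intro divide_right_mono mult_left_mono) auto
   ultimately show "0 \<le> q" by (simp add: q_def)
  qed
  have step: "prw (\<lambda>x. (\<beta>1 + j * \<delta>) * c x) E (\<lambda>W. \<not> esc W) \<le> q ^ j" for j :: nat
  proof (induction j)
   case 0
   show ?case using \<beta>(1) finsD[OF E] by (auto intro!: expct_le_const wt_nonneg kernel_fn_cmult[OF c])
  next
   case (Suc j)
   have "prw (\<lambda>x. (\<beta>1 + j * \<delta> + \<delta>) * c x) E (\<lambda>W. \<not> esc W) \<le>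
    q * prw (\<lambda>x. (\<beta>1 + j * \<delta>) * c x) E (\<lambda>W. \<not> esc W)"
    unfolding q_def s_def
    by (rule escape_step[OF c L' \<beta>1 _ _ F E_def exit esc_def]) (use \<delta> in auto)
   also have "\<dots> \<le> q * q ^ j" by (intro mult_left_mono Suc q)
   finally show ?case by (simp add: algebra_simps)
  qed
  have "\<beta>1 + n * \<delta> = \<beta>2" using npos by (simp add: \<delta>_def d_def)
  then have "prw (\<lambda>x. \<beta>2 * c x) E (\<lambda>W. \<not> esc W) \<le> q ^ n" using step[of n] by simp
  also have "\<dots> \<le> exp (- (\<delta> / (4 * \<beta>1))) ^ n" by (intro power_mono q)
  also have "\<dots> = 1 - \<theta>"
   using npos by (simp add: \<theta>_def exp_of_nat_mult[symmetric] \<delta>_def d_def)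
  finally have *: "prw (\<lambda>x. \<beta>2 * c x) E (\<lambda>W. \<not> esc W) \<le> 1 - \<theta>" .
  have "1 = expw (\<lambda>x. \<beta>2 * c x) E (\<lambda>W. of_bool (\<not> esc W) + of_bool (esc W))"
   using finsD[OF E] by (auto simp: of_bool_def if_distrib cong: if_cong)
  also have "\<dots> = prw (\<lambda>x. \<beta>2 * c x) E (\<lambda>W. \<not> esc W) + prw (\<lambda>x. \<beta>2 * c x) E esc"
   by (rule expct_add)
  finally have "\<theta> \<le> prw (\<lambda>x. \<beta>2 * c x) E esc" using * by simp
  also have "\<dots> \<le> prw (\<lambda>x. \<beta>2 * c x) E (\<lambda>W. \<not> clus W 0 \<subseteq> L)"
   using \<beta> by (intro prb_mono wt_nonneg kernel_fn_cmult[OF c]) (auto simp: esc_def clus_def L'_def)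
  finally show ?thesis using E by blast
 qed
 then show ?thesis using \<theta> by blast
qed

section \<open>From finite graphs to the percolation measure\<close>

definition law :: "('v set \<Rightarrow> real) \<Rightarrow> ('v set \<Rightarrow> bool) measure" where
 "law w = PiM edges (\<lambda>e. measure_pmf (bernoulli_pmf (1 - exp (- w e))))"

definition opens :: "('v set \<Rightarrow> bool) \<Rightarrow> 'v set set" where
 "opens \<omega> = {e \<in> edges. \<omega> e}"

lemma law_percolation: "(\<And>e. e \<in> edges \<Longrightarrow> w e = \<beta> * edge_weight k e) \<Longrightarrow> percolation k \<beta> = law w"
 unfolding law_def percolation_def by (intro PiM_cong) auto

lemma cluster_eq_clus: "cluster \<omega> x = clus (opens \<omega>) x"
proof -
 have "open_adj \<omega> = (\<lambda>x y. x \<noteq> y \<and> {x, y} \<in> opens \<omega>)"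
  by (auto simp: open_adj_def opens_def fun_eq_iff edges_pair)
 then show ?thesis by (simp add: cluster_def clus_def conn_def)
qed

lemma prob_space_law: "prob_space (law w)"
 unfolding law_def by (intro prob_space_PiM measure_pmf.prob_space_axioms)

lemma law_cylinder:
 assumes w: "\<And>e. 0 \<le> w e" and E: "E \<in> fins" and A: "A \<subseteq> E"
 shows "{\<omega> \<in> space (law w). opens \<omega> \<inter> E = A} \<in> sets (law w)"
  and "measure (law w) {\<omega> \<in> space (law w). opens \<omega> \<inter> E = A} =
   (\<Prod>e\<in>A. 1 - exp (- w e)) * (\<Prod>e\<in>E - A. exp (- w e))"
proof -
 let ?M = "\<lambda>e. measure_pmf (bernoulli_pmf (1 - exp (- w e)))"
 interpret product_prob_space ?M "edges :: 'a set set"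
  by (intro product_prob_spaceI measure_pmf.prob_space_axioms)
 have E': "finite E" "E \<subseteq> edges" using E by (auto simp: fins_def)
 have eq: "{\<omega> \<in> space (law w). opens \<omega> \<inter> E = A} = prod_emb edges ?M E (PiE E (\<lambda>e. {e \<in> A}))"
  using A E' by (auto simp: law_def prod_emb_def space_PiM opens_def PiE_iff restrict_def extensional_def Pi_iff)
 show "{\<omega> \<in> space (law w). opens \<omega> \<inter> E = A} \<in> sets (law w)"
  unfolding eq unfolding law_def using E' by (intro sets_PiM_I) auto
 have p: "measure (?M e) {b} = (if b then 1 - exp (- w e) else exp (- w e))" for e b
  using w[of e] by (simp add: measure_pmf_single)
 have "measure (law w) {\<omega> \<in> space (law w). opens \<omega> \<inter> E = A} = (\<Prod>e\<in>E. measure (?M e) {e \<in> A})"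
  unfolding eq unfolding law_def using E' by (intro measure_PiM_emb) auto
 also have "\<dots> = (\<Prod>e\<in>E. if e \<in> A then 1 - exp (- w e) else exp (- w e))"
  by (intro prod.cong refl) (simp add: p)
 also have "\<dots> = (\<Prod>e\<in>A. 1 - exp (- w e)) * (\<Prod>e\<in>E - A. exp (- w e))"
  using E' A by (subst prod.If_cases) (auto simp: Int_absorb1 Int_absorb2 Diff_eq intro!: arg_cong2[where f=times] prod.cong)
 finally show "measure (law w) {\<omega> \<in> space (law w). opens \<omega> \<inter> E = A} =
   (\<Prod>e\<in>A. 1 - exp (- w e)) * (\<Prod>e\<in>E - A. exp (- w e))" .
qed

lemma law_finite:
 assumes w: "\<And>e. 0 \<le> w e" and E: "E \<in> fins"
 shows "{\<omega> \<in> space (law w). Q (opens \<omega> \<inter> E)} \<in> sets (law w)"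
  and "measure (law w) {\<omega> \<in> space (law w). Q (opens \<omega> \<inter> E)} = prb w E Q"
proof -
 interpret prob_space "law w" by (rule prob_space_law)
 have fin: "finite (Pow E)" using finsD[OF E] by simp
 let ?C = "\<lambda>A. {\<omega> \<in> space (law w). opens \<omega> \<inter> E = A}"
 have eq: "{\<omega> \<in> space (law w). Q (opens \<omega> \<inter> E)} = (\<Union>A\<in>{A \<in> Pow E. Q A}. ?C A)" by auto
 show "{\<omega> \<in> space (law w). Q (opens \<omega> \<inter> E)} \<in> sets (law w)"
  unfolding eq using fin law_cylinder(1)[OF w E] by (intro sets.finite_UN) auto
 have "measure (law w) {\<omega> \<in> space (law w). Q (opens \<omega> \<inter> E)} = (\<Sum>A\<in>{A \<in> Pow E. Q A}. measure (law w) (?C A))"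
  unfolding eq using fin law_cylinder(1)[OF w E]
  by (intro finite_measure_finite_Union) (auto simp: disjoint_family_on_def)
 also have "\<dots> = (\<Sum>A\<in>{A \<in> Pow E. Q A}. (\<Prod>e\<in>A. 1 - exp (- w e)) * (\<Prod>e\<in>E - A. exp (- w e)))"
  by (intro sum.cong law_cylinder(2)[OF w E]) auto
 also have "\<dots> = prb w E Q"
  unfolding expct_def using fin by (intro sum.mono_neutral_cong_left) auto
 finally show "measure (law w) {\<omega> \<in> space (law w). Q (opens \<omega> \<inter> E)} = prb w E Q" .
qed

text \<open>Increasing events with finite witnesses; for these the probability is the supremum of
  the finite-graph probabilities.\<close>

definition finitary :: "('e set \<Rightarrow> bool) \<Rightarrow> bool" where
 "finitary Q \<longleftrightarrow> up_closed Q \<and> (\<forall>A. Q A \<longrightarrow> (\<exists>F\<subseteq>A. finite F \<and> Q F))"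

text \<open>The countable edge set is exhausted by the finite sets \<open>En n\<close>, one of which
  contains a given finite witness, so continuity from below applies.\<close>

lemma finitary_exhaust:
 assumes Q: "finitary Q" and w: "\<And>e. 0 \<le> w e"
 shows "{\<omega> \<in> space (law w). Q (opens \<omega>)} \<in> sets (law w)"
  and "E \<in> fins \<Longrightarrow> prb w E Q \<le> measure (law w) {\<omega> \<in> space (law w). Q (opens \<omega>)}"
  and "\<epsilon> > 0 \<Longrightarrow> \<exists>E\<in>fins. measure (law w) {\<omega> \<in> space (law w). Q (opens (\<omega> :: 'v::countable set \<Rightarrow> bool))} - \<epsilon> < prb w E Q"
proof -
 interpret prob_space "law w" by (rule prob_space_law)
 have cnt: "countable (edges :: 'v set set)"
 proof (rule countable_subset)
  show "(edges :: 'v set set) \<subseteq> (\<lambda>(x, y). {x, y}) ` UNIV" by (auto simp: edges_def)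
 qed simp
 define En where "En n = {e \<in> edges. to_nat_on (edges :: 'v set set) e < n}" for n
 have En: "En n \<in> fins" for n
 proof -
  have "inj_on (to_nat_on (edges :: 'v set set)) (En n)"
   using inj_on_to_nat_on[OF cnt] by (rule inj_on_subset) (auto simp: En_def)
  moreover have "to_nat_on (edges :: 'v set set) ` En n \<subseteq> {..<n}" by (auto simp: En_def)
  ultimately have "finite (En n)" using finite_subset finite_imageD by blast
  then show ?thesis by (auto simp: fins_def En_def)
 qed
 have En_cover: "\<exists>n. F \<subseteq> En n" if "finite F" "F \<subseteq> edges" for F
 proof -
  have "\<forall>e\<in>F. to_nat_on (edges :: 'v set set) e < Suc (Max (to_nat_on edges ` F))"
   using that by (auto simp: less_Suc_eq_le intro!: Max_ge)
  then show ?thesis using that by (intro exI[of _ "Suc (Max (to_nat_on edges ` F))"]) (auto simp: En_def)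
 qed
 have up: "up_closed Q" using Q by (simp add: finitary_def)
 let ?S = "\<lambda>n. {\<omega> \<in> space (law w). Q (opens \<omega> \<inter> En n)}"
 have eq: "{\<omega> \<in> space (law w). Q (opens \<omega>)} = (\<Union>n. ?S n)"
 proof
  show "(\<Union>n. ?S n) \<subseteq> {\<omega> \<in> space (law w). Q (opens \<omega>)}"
   using up_closedD[OF up] by (auto intro: Int_lower1)
  show "{\<omega> \<in> space (law w). Q (opens \<omega>)} \<subseteq> (\<Union>n. ?S n)"
  proof
   fix \<omega> assume \<omega>: "\<omega> \<in> {\<omega> \<in> space (law w). Q (opens \<omega>)}"
   then obtain F where F: "F \<subseteq> opens \<omega>" "finite F" "Q F" using Q by (auto simp: finitary_def)
   moreover have "F \<subseteq> edges" using F by (auto simp: opens_def)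
   ultimately obtain n where "F \<subseteq> En n" using En_cover by blast
   then have "Q (opens \<omega> \<inter> En n)" using F by (intro up_closedD[OF up F(3)]) auto
   then show "\<omega> \<in> (\<Union>n. ?S n)" using \<omega> by auto
  qed
 qed
 have S: "?S n \<in> sets (law w)" for n by (rule law_finite(1)[OF w En])
 show m: "{\<omega> \<in> space (law w). Q (opens \<omega>)} \<in> sets (law w)"
  unfolding eq using S by auto
 have "incseq ?S"
 proof (rule incseq_SucI)
  fix n
  have "opens \<omega> \<inter> En n \<subseteq> opens \<omega> \<inter> En (Suc n)" for \<omega> by (auto simp: En_def)
  then show "?S n \<subseteq> ?S (Suc n)" using up_closedD[OF up] by blast
 qed
 then have lim: "(\<lambda>n. measure (law w) (?S n)) \<longlonglongrightarrow> measure (law w) (\<Union>n. ?S n)"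
  using S by (intro finite_Lim_measure_incseq) auto
 show "prb w E Q \<le> measure (law w) {\<omega> \<in> space (law w). Q (opens \<omega>)}" if "E \<in> fins" for E
  unfolding law_finite(2)[OF w that, symmetric]
  using up_closedD[OF up] by (intro finite_measure_mono m) (auto intro: Int_lower1)
 show "\<exists>E\<in>fins. measure (law w) {\<omega> \<in> space (law w). Q (opens \<omega>)} - \<epsilon> < prb w E Q" if "\<epsilon> > 0" for \<epsilon>
 proof -
  have "\<forall>\<^sub>F n in sequentially. measure (law w) (\<Union>n. ?S n) - \<epsilon> < measure (law w) (?S n)"
   using that by (intro order_tendstoD(1)[OF lim]) auto
  then obtain n where "measure (law w) (\<Union>n. ?S n) - \<epsilon> < measure (law w) (?S n)"
   by (auto simp: eventually_sequentially)
  then have "measure (law w) (\<Union>n. ?S n) - \<epsilon> < prb w (En n) Q"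
   using law_finite(2)[of w "En n" Q, OF w En] by simp
  then show ?thesis unfolding eq by (rule bexI[OF _ En])
 qed
qed

text \<open>Stated through finite subsets because \<open>card\<close> of an infinite set is 0. In
  this form the event is finitary, also for infinite clusters.\<close>

definition many :: "nat \<Rightarrow> 'v set \<Rightarrow> 'v \<Rightarrow> 'v set set \<Rightarrow> bool" where
 "many n B x W \<longleftrightarrow> (\<exists>S. finite S \<and> card S = n \<and> S \<subseteq> clus W x \<inter> B)"

lemma many_iff: "finite W \<Longrightarrow> many n B x W \<longleftrightarrow> n \<le> card (clus W x \<inter> B)"
proof
 assume "finite W"
 then have fin: "finite (clus W x \<inter> B)" by simp
 show "many n B x W \<Longrightarrow> n \<le> card (clus W x \<inter> B)" unfolding many_def using fin card_mono by blast
 show "n \<le> card (clus W x \<inter> B) \<Longrightarrow> many n B x W"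
  unfolding many_def by (metis obtain_subset_with_card_n)
qed

lemma many_iff_finite: "finite B \<Longrightarrow> many n B x W \<longleftrightarrow> n \<le> card (clus W x \<inter> B)"
proof
 assume "finite B"
 then have fin: "finite (clus W x \<inter> B)" by simp
 show "many n B x W \<Longrightarrow> n \<le> card (clus W x \<inter> B)" unfolding many_def using fin card_mono by blast
 show "n \<le> card (clus W x \<inter> B) \<Longrightarrow> many n B x W"
  unfolding many_def by (metis obtain_subset_with_card_n)
qed

lemma many_iff_size: "many n UNIV x W \<longleftrightarrow> of_nat n \<le> size_of (clus W x)"
proof (cases "finite (clus W x)")
 case True
 have "many n UNIV x W \<longleftrightarrow> n \<le> card (clus W x)"
  unfolding many_def using True card_mono by (metis Int_UNIV_right obtain_subset_with_card_n)
 then show ?thesis using True by (simp add: size_of_def emeasure_count_space_finite)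
next
 case False
 then show ?thesis
  using infinite_arbitrarily_large[OF False, of n] by (auto simp: size_of_def many_def)
qed

lemma conn_finitary: "conn W x y \<Longrightarrow> \<exists>F\<subseteq>W. finite F \<and> conn F x y"
proof (induction rule: conn_induct)
 case refl
 then show ?case by (intro exI[of _ "{}"]) auto
next
 case (step u v)
 then obtain F where F: "F \<subseteq> W" "finite F" "conn F x u" by blast
 have "conn (insert {u, v} F) x u" using F(3) by (rule conn_mono) auto
 then have "conn (insert {u, v} F) x v" by (rule conn_step) simp
 then show ?case using F step by (intro exI[of _ "insert {u, v} F"]) auto
qed

lemma finitary_conn: "finitary (\<lambda>W. conn W x y)"
 unfolding finitary_def up_closed_def using conn_finitary conn_mono by metis

lemma finitary_many: "finitary (many n B x)"
 unfolding finitary_def up_closed_def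
proof (intro conjI allI impI)
 fix W W' assume "W \<subseteq> W'" "many n B x W"
 then show "many n B x W'" unfolding many_def using clus_mono[of W W' x] by blast
next
 fix W assume "many n B x W"
 then obtain S where S: "finite S" "card S = n" "S \<subseteq> clus W x \<inter> B" by (auto simp: many_def)
 have "\<forall>y\<in>S. \<exists>F\<subseteq>W. finite F \<and> conn F x y"
 proof
  fix y assume "y \<in> S"
  then have "conn W x y" using S by (auto simp: clus_def)
  then show "\<exists>F\<subseteq>W. finite F \<and> conn F x y" by (rule conn_finitary)
 qed
 then obtain F where F: "\<And>y. y \<in> S \<Longrightarrow> F y \<subseteq> W \<and> finite (F y) \<and> conn (F y) x y" by metis
 let ?F = "\<Union>y\<in>S. F y"
 have "conn ?F x y" if "y \<in> S" for y using F[OF that] that by (blast intro: conn_mono)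
 then have "many n B x ?F" unfolding many_def using S by (intro exI[of _ S]) (auto simp: clus_def)
 then show "\<exists>F\<subseteq>W. finite F \<and> many n B x F" using F S by (intro exI[of _ ?F]) auto
qed

lemma finitary_escape: "finitary (\<lambda>W. \<not> clus W x \<subseteq> L)"
proof -
 have "(\<not> clus W x \<subseteq> L) \<longleftrightarrow> (\<exists>y. y \<notin> L \<and> conn W x y)" for W by (auto simp: clus_def)
 then show ?thesis
  unfolding finitary_def up_closed_def using conn_finitary conn_mono by metis
qed

section \<open>The critical point\<close>

lemma percolation_eq_law:
 assumes c: "kernel_fn c" and k: "\<And>x y. k x y = c (x - y)" and \<beta>: "0 \<le> \<beta>"
 shows "percolation k \<beta> = law (wt (\<lambda>x. \<beta> * c x))"
proof (rule law_percolation)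
 fix e :: "'a set" assume "e \<in> edges"
 moreover have "k = (\<lambda>x y. c (x - y))" using k by auto
 ultimately show "wt (\<lambda>x. \<beta> * c x) e = \<beta> * edge_weight k e"
  using wt_cmult[OF c \<beta>, of e] by (simp add: wt_def)
qed

lemma infinite_cluster_measure:
 fixes w :: "'v::countable set \<Rightarrow> real"
 assumes w: "\<And>e. 0 \<le> w e"
 shows "{\<omega> \<in> space (law w). infinite (cluster \<omega> x)} \<in> sets (law w)"
  and "(\<lambda>n. measure (law w) {\<omega> \<in> space (law w). many n UNIV x (opens \<omega>)})
   \<longlonglongrightarrow> measure (law w) {\<omega> \<in> space (law w). infinite (cluster \<omega> x)}"
proof -
 interpret prob_space "law w" by (rule prob_space_law)
 let ?S = "\<lambda>n. {\<omega> \<in> space (law w). many n UNIV x (opens \<omega>)}"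
 have eq: "{\<omega> \<in> space (law w). infinite (cluster \<omega> x)} = (\<Inter>n. ?S n)"
 proof -
  have "infinite A \<longleftrightarrow> (\<forall>n. \<exists>S. finite S \<and> card S = n \<and> S \<subseteq> A)" for A :: "'v set"
  proof
   assume "\<forall>n. \<exists>S. finite S \<and> card S = n \<and> S \<subseteq> A"
   then obtain S where "finite S" "card S = Suc (card A)" "S \<subseteq> A" by blast
   then show "infinite A" using card_mono[of A S] by auto
  qed (use infinite_arbitrarily_large in blast)
  then show ?thesis by (auto simp: cluster_eq_clus many_def)
 qed
 have S: "?S n \<in> sets (law w)" for n by (rule finitary_exhaust(1)[OF finitary_many w])
 show "{\<omega> \<in> space (law w). infinite (cluster \<omega> x)} \<in> sets (law w)"
  unfolding eq using S by auto
 have "decseq ?S"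
 proof (rule decseq_SucI)
  fix n
  have "many n UNIV x W" if many: "many (Suc n) UNIV x W" for W
  proof -
   obtain S where S: "finite S" "card S = Suc n" "S \<subseteq> clus W x" using many by (auto simp: many_def)
   obtain T where "T \<subseteq> S" "card T = n" using obtain_subset_with_card_n[of n S] S by auto
   then show ?thesis using S finite_subset unfolding many_def by blast
  qed
  then show "?S (Suc n) \<subseteq> ?S n" by auto
 qed
 then show "(\<lambda>n. measure (law w) (?S n)) \<longlonglongrightarrow> measure (law w) {\<omega> \<in> space (law w). infinite (cluster \<omega> x)}"
  unfolding eq using S by (intro finite_Lim_measure_decseq) auto
qed

lemma prb_many:
 assumes "finite E"
 shows "prb k E (many n B x) = expct k E (\<lambda>W. of_bool (n \<le> card (clus W x \<inter> B)))"
proof (rule expct_cong)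
 fix W assume "W \<subseteq> E"
 then have "finite W" using assms by (rule finite_subset)
 then show "of_bool (many n B x W) = of_bool (n \<le> card (clus W x \<inter> B))" by (simp add: many_iff)
qed

lemma prb_many_root:
 assumes c: "kernel_fn c" and E: "E \<in> fins"
 shows "prw c E (many n UNIV x) = prw c (shift (- x) E) (many n UNIV 0)"
proof -
 have 1: "prw c F (many n UNIV y) = expw c F (\<lambda>W. of_bool (n \<le> card (clus W y)))" if "F \<in> fins" for F y
  using prb_many[OF finsD[OF that]] by simp
 show ?thesis
  unfolding 1[OF E] 1[OF shift_fins[OF E]] using expct_card_root[OF c E, of "\<lambda>m. of_bool (n \<le> m)" x] .
qed

lemma measure_many_root:
 fixes c :: "'v::{ab_group_add, countable} \<Rightarrow> real"
 assumes c: "kernel_fn c"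
 shows "measure (law (wt c)) {\<omega> \<in> space (law (wt c)). many n UNIV x (opens \<omega>)} \<le>
  measure (law (wt c)) {\<omega> \<in> space (law (wt c)). many n UNIV 0 (opens \<omega>)}"
proof (rule field_le_epsilon)
 fix \<epsilon> :: real assume "\<epsilon> > 0"
 then obtain E where E: "E \<in> fins"
  "measure (law (wt c)) {\<omega> \<in> space (law (wt c)). many n UNIV x (opens \<omega>)} - \<epsilon> < prw c E (many n UNIV x)"
  using finitary_exhaust(3)[where w = "wt c", OF finitary_many[of n UNIV x] wt_nonneg[OF c] \<open>\<epsilon> > 0\<close>] by auto
 then show "measure (law (wt c)) {\<omega> \<in> space (law (wt c)). many n UNIV x (opens \<omega>)} \<le>
  measure (law (wt c)) {\<omega> \<in> space (law (wt c)). many n UNIV 0 (opens \<omega>)} + \<epsilon>"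
  using finitary_exhaust(2)[where w = "wt c", OF finitary_many[of n UNIV 0] wt_nonneg[OF c] shift_fins[OF E(1), of "- x"]]
   prb_many_root[OF c E(1), of n x] by linarith
qed

lemma measure_infinite_root:
 fixes c :: "'v::{ab_group_add, countable} \<Rightarrow> real"
 assumes c: "kernel_fn c"
 shows "measure (law (wt c)) {\<omega> \<in> space (law (wt c)). infinite (cluster \<omega> x)} \<le>
  measure (law (wt c)) {\<omega> \<in> space (law (wt c)). infinite (cluster \<omega> 0)}"
 by (rule LIMSEQ_le[OF infinite_cluster_measure(2)[OF wt_nonneg[OF c]] infinite_cluster_measure(2)[OF wt_nonneg[OF c]]])
   (use measure_many_root[OF c] in blast)

text \<open>By translation invariance no root is more likely to percolate than the origin; if the
  origin had probability 0, countable additivity over roots would give 0 for the union.\<close>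

lemma percolates_at_root:
 fixes c :: "'v::{ab_group_add, countable} \<Rightarrow> real"
 assumes c: "kernel_fn c"
  and pos: "0 < measure (law (wt c)) {\<omega> \<in> space (law (wt c)). \<exists>x. infinite (cluster \<omega> x)}"
 shows "0 < measure (law (wt c)) {\<omega> \<in> space (law (wt c)). infinite (cluster \<omega> 0)}"
proof (rule ccontr)
 interpret prob_space "law (wt c)" by (rule prob_space_law)
 assume "\<not> ?thesis"
 then have "measure (law (wt c)) {\<omega> \<in> space (law (wt c)). infinite (cluster \<omega> 0)} = 0"
  by (simp add: not_less measure_le_0_iff)
 then have "measure (law (wt c)) {\<omega> \<in> space (law (wt c)). infinite (cluster \<omega> x)} = 0" for x
  using measure_infinite_root[OF c, of x] by (simp add: measure_le_0_iff)
 then have "{\<omega> \<in> space (law (wt c)). infinite (cluster \<omega> x)} \<in> null_sets (law (wt c))" for x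
  using infinite_cluster_measure(1)[OF wt_nonneg[OF c]] by (auto simp: null_sets_def emeasure_eq_measure)
 then have "(\<Union>x. {\<omega> \<in> space (law (wt c)). infinite (cluster \<omega> x)}) \<in> null_sets (law (wt c))"
  by (intro null_sets_UN)
 moreover have "(\<Union>x. {\<omega> \<in> space (law (wt c)). infinite (cluster \<omega> x)}) =
   {\<omega> \<in> space (law (wt c)). \<exists>x. infinite (cluster \<omega> x)}" by auto
 ultimately show False using pos by (auto simp: null_sets_def measure_def)
qed

lemma prb_kernel_mono:
 assumes "kernel_fn c" "kernel_fn c'" "\<And>x. c x \<le> c' x" "E \<in> fins" "up_closed Q"
 shows "prw c E Q \<le> prw c' E Q"
 using assms by (intro expct_kernel_mono) auto

context
 fixes c :: "'v::{ab_group_add, countable} \<Rightarrow> real" and k :: "'v \<Rightarrow> 'v \<Rightarrow> real"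
 assumes c: "kernel_fn c" and k: "\<And>x y. k x y = c (x - y)"
begin

lemma critical_point_nonneg: "0 \<le> critical_point k"
 unfolding critical_point_def by (intro Inf_greatest) auto

lemma supercritical_tail:
 assumes "critical_point k < ereal \<beta>"
 shows "\<exists>\<theta>>0. \<forall>n. \<exists>E\<in>fins. \<theta> < prw (\<lambda>x. \<beta> * c x) E (many n UNIV 0)"
proof -
 obtain \<beta>' where \<beta>': "0 \<le> \<beta>'" "\<beta>' < \<beta>"
  "0 < measure (percolation k \<beta>') {\<omega> \<in> space (percolation k \<beta>'). \<exists>x. infinite (cluster \<omega> x)}"
  using assms unfolding critical_point_def Inf_less_iff by auto
 let ?c = "\<lambda>x. \<beta>' * c x" and ?c2 = "\<lambda>x. \<beta> * c x"
 have c': "kernel_fn ?c" "kernel_fn ?c2" using \<beta>' by (auto intro!: kernel_fn_cmult[OF c])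
 define \<theta> where "\<theta> = measure (law (wt ?c)) {\<omega> \<in> space (law (wt ?c)). infinite (cluster \<omega> 0)}"
 have \<theta>: "\<theta> > 0"
  unfolding \<theta>_def using \<beta>'(3) percolates_at_root[OF c'(1)] percolation_eq_law[OF c k \<beta>'(1)] by simp
 interpret prob_space "law (wt ?c)" by (rule prob_space_law)
 have "\<exists>E\<in>fins. \<theta> / 2 < prw ?c2 E (many n UNIV 0)" for n
 proof -
  have "\<theta> \<le> measure (law (wt ?c)) {\<omega> \<in> space (law (wt ?c)). many n UNIV 0 (opens \<omega>)}"
   unfolding \<theta>_def
  proof (rule finite_measure_mono)
   show "{\<omega> \<in> space (law (wt ?c)). infinite (cluster \<omega> 0)} \<subseteq> {\<omega> \<in> space (law (wt ?c)). many n UNIV 0 (opens \<omega>)}"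
    using infinite_arbitrarily_large by (auto simp: many_def cluster_eq_clus)
  qed (rule finitary_exhaust(1)[OF finitary_many wt_nonneg[OF c'(1)]])
  then obtain E where E: "E \<in> fins" "\<theta> - \<theta> / 2 < prw ?c E (many n UNIV 0)"
   using finitary_exhaust(3)[where w = "wt ?c", OF finitary_many[of n UNIV 0] wt_nonneg[OF c'(1)], of "\<theta> / 2"] \<theta>
   by auto
  moreover have "prw ?c E (many n UNIV 0) \<le> prw ?c2 E (many n UNIV 0)"
   using finitary_many[of n UNIV 0] \<beta>' kernel_fn_nonneg[OF c]
   by (intro prb_kernel_mono c' E mult_right_mono) (auto simp: finitary_def)
  ultimately show ?thesis by (intro bexI[of _ E]) auto
 qed
 then show ?thesis using \<theta> by (intro exI[of _ "\<theta> / 2"]) auto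
qed

text \<open>Below the critical point the cluster of the origin is almost surely finite, so it stays
  in one finite set up to small probability. Escaping is increasing, hence the same bound holds on
  every finite graph.\<close>

lemma subcritical_escape:
 assumes \<beta>: "0 \<le> \<beta>" "ereal \<beta> < critical_point k" and \<theta>: "\<theta> > 0"
 shows "\<exists>L. finite L \<and> (\<forall>E\<in>fins. prw (\<lambda>x. \<beta> * c x) E (\<lambda>W. \<not> clus W 0 \<subseteq> L) < \<theta>)"
proof (rule ccontr)
 assume neg: "\<not> ?thesis"
 let ?c = "\<lambda>x. \<beta> * c x"
 let ?P = "law (wt ?c)"
 have c': "kernel_fn ?c" by (rule kernel_fn_cmult[OF c \<beta>(1)])
 interpret prob_space ?P by (rule prob_space_law)
 have "\<not> 0 < measure (percolation k \<beta>) {\<omega> \<in> space (percolation k \<beta>). \<exists>x. infinite (cluster \<omega> x)}"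
 proof
  assume "0 < measure (percolation k \<beta>) {\<omega> \<in> space (percolation k \<beta>). \<exists>x. infinite (cluster \<omega> x)}"
  then have "critical_point k \<le> ereal \<beta>" unfolding critical_point_def using \<beta> by (intro Inf_lower) auto
  then show False using \<beta> by simp
 qed
 then have 0: "measure ?P {\<omega> \<in> space ?P. \<exists>x. infinite (cluster \<omega> x)} = 0"
  unfolding percolation_eq_law[OF c k \<beta>(1)] by (simp add: not_less measure_le_0_iff)
 have U: "(\<Union>x. {\<omega> \<in> space ?P. infinite (cluster \<omega> x)}) = {\<omega> \<in> space ?P. \<exists>x. infinite (cluster \<omega> x)}" by auto
 have meas: "{\<omega> \<in> space ?P. \<exists>x. infinite (cluster \<omega> x)} \<in> sets ?P"
  unfolding U[symmetric] using infinite_cluster_measure(1)[OF wt_nonneg[OF c']] by (intro sets.countable_UN) auto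
 have inf0: "measure ?P {\<omega> \<in> space ?P. infinite (cluster \<omega> 0)} = 0"
  using finite_measure_mono[OF _ meas, of "{\<omega> \<in> space ?P. infinite (cluster \<omega> 0)}"] 0
  by (auto simp: measure_le_0_iff)
 define Ln where "Ln n = {x :: 'v. to_nat x < n}" for n
 have Ln: "finite (Ln n)" for n
  using finite_imageD[of to_nat "Ln n"] finite_subset[of "to_nat ` Ln n" "{..<n}"]
  by (auto simp: Ln_def inj_on_def)
 let ?S = "\<lambda>n. {\<omega> \<in> space ?P. \<not> clus (opens \<omega>) 0 \<subseteq> Ln n}"
 have S: "?S n \<in> sets ?P" for n by (rule finitary_exhaust(1)[OF finitary_escape wt_nonneg[OF c']])
 have "decseq ?S" by (rule decseq_SucI) (auto simp: Ln_def)
 then have lim: "(\<lambda>n. measure ?P (?S n)) \<longlonglongrightarrow> measure ?P (\<Inter>n. ?S n)"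
  using S by (intro finite_Lim_measure_decseq) auto
 have sub: "(\<Inter>n. ?S n) \<subseteq> {\<omega> \<in> space ?P. infinite (cluster \<omega> 0)}"
 proof
  fix \<omega> assume \<omega>: "\<omega> \<in> (\<Inter>n. ?S n)"
  have "infinite (clus (opens \<omega>) 0)"
  proof
   assume fin: "finite (clus (opens \<omega>) 0)"
   have "clus (opens \<omega>) 0 \<subseteq> Ln (Suc (Max (to_nat ` clus (opens \<omega>) 0)))"
    using fin by (auto simp: Ln_def less_Suc_eq_le intro!: Max_ge)
   then show False using \<omega> by auto
  qed
  then show "\<omega> \<in> {\<omega> \<in> space ?P. infinite (cluster \<omega> 0)}" using \<omega> by (auto simp: cluster_eq_clus)
 qed
 have "measure ?P (\<Inter>n. ?S n) \<le> 0"
  unfolding inf0[symmetric] by (rule finite_measure_mono[OF sub infinite_cluster_measure(1)[OF wt_nonneg[OF c']]])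
 moreover have "\<theta> \<le> measure ?P (?S n)" for n
 proof -
  obtain E where "E \<in> fins" "\<theta> \<le> prw ?c E (\<lambda>W. \<not> clus W 0 \<subseteq> Ln n)"
   using neg Ln[of n] by (auto simp: not_less)
  then show ?thesis
   using finitary_exhaust(2)[where w = "wt ?c", OF finitary_escape[of 0 "Ln n"] wt_nonneg[OF c'], of E] by linarith
 qed
 then have "\<theta> \<le> measure ?P (\<Inter>n. ?S n)" using lim by (intro LIMSEQ_le_const) auto
 ultimately show False using \<theta> by simp
qed

text \<open>At an intermediate \<open>\<beta>2\<close> sharpness would give a uniform escape
  probability, while \<open>subcritical_escape\<close> still applies there.\<close>

lemma subcritical_bounded:
 assumes \<beta>: "0 \<le> \<beta>" "ereal \<beta> < critical_point k"
 shows "\<exists>C. \<forall>E\<in>fins. expw (\<lambda>x. \<beta> * c x) E csize0 \<le> C"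
proof (rule ccontr)
 assume neg: "\<not> ?thesis"
 obtain \<beta>2 where \<beta>2: "\<beta> < \<beta>2" "ereal \<beta>2 < critical_point k"
  using \<beta> ereal_dense2 by (metis ereal_less_eq(3) less_ereal.simps(1))
 have "\<exists>\<theta>>0. \<forall>L. finite L \<longrightarrow> (\<exists>E\<in>fins. \<theta> \<le> prw (\<lambda>x. \<beta>2 * c x) E (\<lambda>W. \<not> clus W 0 \<subseteq> L))"
  by (rule sharpness[OF c \<beta>(1) \<beta>2(1)]) (use neg in \<open>auto simp: not_le\<close>)
 then obtain \<theta> where "\<theta> > 0" "\<And>L. finite L \<Longrightarrow> \<exists>E\<in>fins. \<theta> \<le> prw (\<lambda>x. \<beta>2 * c x) E (\<lambda>W. \<not> clus W 0 \<subseteq> L)"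
  by blast
 moreover obtain L where "finite L" "\<And>E. E \<in> fins \<Longrightarrow> prw (\<lambda>x. \<beta>2 * c x) E (\<lambda>W. \<not> clus W 0 \<subseteq> L) < \<theta>"
  using subcritical_escape[of \<beta>2 \<theta>] \<beta> \<beta>2 \<open>\<theta> > 0\<close> by auto
 ultimately show False by (meson not_le)
qed

text \<open>Sprinkling from \<open>c0\<close> gives M \<le> (h + \<Delta> M) ch, which is solvable
  when \<Delta> ch < 1 and makes M linear in h. Large clusters then become unlikely, against
  \<open>supercritical_tail\<close>.\<close>

lemma not_supercritical:
 assumes k0: "kernel_fn c0" and \<beta>: "0 \<le> \<beta>" and le: "\<And>x. c0 x \<le> \<beta> * c x"
  and \<Delta>: "\<And>Y. finite Y \<Longrightarrow> (\<Sum>y\<in>Y. \<beta> * c y - c0 y) \<le> \<Delta>"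
  and ch: "\<And>E. E \<in> fins \<Longrightarrow> expw c0 E csize0 \<le> ch"
  and small: "\<Delta> * ch < 1"
 shows "ereal \<beta> \<le> critical_point k"
proof (rule ccontr)
 assume "\<not> ?thesis"
 then obtain \<theta> where \<theta>: "\<theta> > 0" "\<And>n. \<exists>E\<in>fins. \<theta> < prw (\<lambda>x. \<beta> * c x) E (many n UNIV 0)"
  using supercritical_tail[of \<beta>] by (auto simp: not_le)
 let ?c = "\<lambda>x. \<beta> * c x" and ?\<kappa> = "\<lambda>x. \<beta> * c x - c0 x"
 have c': "kernel_fn ?c" by (rule kernel_fn_cmult[OF c \<beta>])
 have \<kappa>: "kernel_fn ?\<kappa>" using k0 c' le by (auto simp: kernel_fn_def)
 have ch1: "ch \<ge> 0" using ch[of "{}"] by simp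
 have bound: "ghost_prob ?c h * (1 - \<Delta> * ch) \<le> h * ch" if h: "h > 0" for h
 proof -
  let ?M = "ghost_prob ?c h"
  have M0: "0 \<le> ?M" using ghost_prob_bounds[OF c'] h by simp
  have \<Delta>0: "0 \<le> \<Delta>" using \<Delta>[of "{}"] by simp
  have eq: "(\<lambda>x. c0 x + ?\<kappa> x) = ?c" by auto
  have "?M \<le> ghost_prob c0 (h + \<Delta> * ?M)"
   using ghost_prob_sprinkle[OF k0 \<kappa> less_imp_le[OF h] \<Delta>] unfolding eq .
  also have "\<dots> \<le> (h + \<Delta> * ?M) * ch"
  proof (rule ghost_prob_least)
   fix E :: "'v set set" assume E: "E \<in> fins"
   have "expw c0 E (\<lambda>W. 1 - lap (h + \<Delta> * ?M) 0 W) \<le> expw c0 E (\<lambda>W. (h + \<Delta> * ?M) * card (clus W 0))"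
    unfolding lap_def by (intro expct_mono wt_nonneg[OF k0] one_minus_exp_le)
   also have "\<dots> = (h + \<Delta> * ?M) * expw c0 E csize0"
    by (rule expct_cmult)
   also have "\<dots> \<le> (h + \<Delta> * ?M) * ch" using h \<Delta>0 M0 by (intro mult_left_mono ch E) auto
   finally show "1 - expw c0 E (lap (h + \<Delta> * ?M) 0) \<le> (h + \<Delta> * ?M) * ch"
    using finsD[OF E] by (simp add: expct_diff)
  qed
  finally show ?thesis by (simp add: algebra_simps)
 qed
 define B where "B = ch / (1 - \<Delta> * ch)"
 obtain n :: nat where n: "2 * B / \<theta> < n" "n > 0"
  using reals_Archimedean2[of "max 0 (2 * B / \<theta>)"] by (auto simp: max_less_iff_conj)
 obtain E where E: "E \<in> fins" "\<theta> < prw ?c E (many n UNIV 0)" using \<theta>(2) by blast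
 have "prw ?c E (many n UNIV 0) = prw ?c E (\<lambda>W. real n \<le> csize W 0)"
  using prb_many[OF finsD[OF E(1)]] by simp
 also have "\<dots> \<le> 2 * ghost_prob ?c (1 / n)" using n by (intro prb_card_ge_le[OF c' E(1)]) auto
 also have "ghost_prob ?c (1 / n) \<le> 1 / n * ch / (1 - \<Delta> * ch)"
  using bound[of "1 / n"] small n by (subst pos_le_divide_eq) auto
 finally have "\<theta> < 2 * B / n" using E(2) by (simp add: B_def mult.commute)
 then show False using n \<theta> by (simp add: field_simps)
qed

end

section \<open>Norms and lattice balls\<close>

lemma real_vec_simps [simp]:
 "real_vec 0 = 0" "real_vec (- x) = - real_vec x" "real_vec (x + y) = real_vec x + real_vec y"
 "real_vec (x - y) = real_vec x - real_vec y"
 by (auto simp: real_vec_def vec_eq_iff)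

lemma real_vec_eq_0 [simp]: "real_vec x = 0 \<longleftrightarrow> x = 0"
 by (auto simp: real_vec_def vec_eq_iff)

lemma real_vec_nth [simp]: "real_vec x $ i = real_of_int (x $ i)"
 by (simp add: real_vec_def)

lemma is_normD:
 assumes "is_norm N"
 shows "0 \<le> N x" "N x = 0 \<longleftrightarrow> x = 0" "N (c *\<^sub>R x) = \<bar>c\<bar> * N x" "N (x + y) \<le> N x + N y"
  "N (- x) = N x" "N 0 = 0"
proof -
 show *: "0 \<le> N x" "N x = 0 \<longleftrightarrow> x = 0" "N (c *\<^sub>R x) = \<bar>c\<bar> * N x" "N (x + y) \<le> N x + N y" for x y c
  using assms by (auto simp: is_norm_def)
 show "N (- x) = N x" using *(3)[of "-1" x] by simp
 show "N 0 = 0" using *(2)[of 0] by simp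
qed

lemma is_norm_sum:
 assumes "is_norm N" "finite A"
 shows "N (\<Sum>i\<in>A. f i) \<le> (\<Sum>i\<in>A. N (f i))"
 using assms(2)
proof (induction A rule: finite_induct)
 case (insert i A)
 then show ?case using is_normD(4)[OF assms(1), of "f i" "\<Sum>i\<in>A. f i"] by simp
qed (simp add: is_normD[OF assms(1)])

lemma is_norm_equivalent:
 fixes N :: "real ^ 'd \<Rightarrow> real"
 assumes N: "is_norm N"
 obtains a b where "a > 0" "b > 0" "\<And>v. a * norm v \<le> N v" "\<And>v. N v \<le> b * norm v"
proof -
 define b where "b = 1 + (\<Sum>i\<in>(UNIV :: 'd set). N (axis i 1))"
 have b: "b > 0" unfolding b_def by (intro add_pos_nonneg sum_nonneg is_normD(1)[OF N]) simp
 have up: "N v \<le> b * norm v" for v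
 proof -
  have "v = (\<Sum>i\<in>UNIV. v $ i *\<^sub>R axis i 1)"
   using basis_expansion[of v] by (simp add: scalar_mult_eq_scaleR)
  then have "N v \<le> (\<Sum>i\<in>UNIV. N (v $ i *\<^sub>R axis i 1))"
   using is_norm_sum[OF N, of UNIV "\<lambda>i. v $ i *\<^sub>R axis i 1"] by simp
  also have "\<dots> = (\<Sum>i\<in>UNIV. \<bar>v $ i\<bar> * N (axis i 1))" by (simp add: is_normD(3)[OF N])
  also have "\<dots> \<le> (\<Sum>i\<in>UNIV. norm v * N (axis i 1))"
   by (intro sum_mono mult_right_mono component_le_norm_cart is_normD(1)[OF N])
  also have "\<dots> \<le> b * norm v"
   unfolding b_def by (simp add: sum_distrib_left[symmetric] algebra_simps)
  finally show ?thesis .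
 qed
 have lip: "\<bar>N u - N v\<bar> \<le> b * norm (u - v)" for u v
 proof -
  have "N u \<le> N v + N (u - v)" using is_normD(4)[OF N, of v "u - v"] by simp
  moreover have "N v \<le> N u + N (u - v)"
   using is_normD(4)[OF N, of u "v - u"] is_normD(5)[OF N, of "u - v"] by simp
  ultimately show ?thesis using up[of "u - v"] by linarith
 qed
 have "continuous_on (sphere 0 1) N"
 proof (rule continuous_onI)
  fix x :: "real ^ 'd" and e :: real assume "e > 0"
  then show "\<exists>d>0. \<forall>x'\<in>sphere 0 1. dist x' x < d \<longrightarrow> dist (N x') (N x) \<le> e"
  proof (intro exI[of _ "e / b"] conjI ballI impI)
   fix x' assume "dist x' x < e / b"
   then have "b * norm (x' - x) \<le> e" using b by (simp add: dist_norm field_simps)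
   then show "dist (N x') (N x) \<le> e" using lip[of x' x] by (simp add: dist_real_def)
  qed (use b in auto)
 qed
 moreover have "compact (sphere (0 :: real ^ 'd) 1)" "sphere (0 :: real ^ 'd) 1 \<noteq> {}" by auto
 ultimately obtain u where u: "u \<in> sphere 0 1" "\<And>v. v \<in> sphere 0 1 \<Longrightarrow> N u \<le> N v"
  using continuous_attains_inf[of "sphere 0 1" N] by blast
 have a: "N u > 0" using u(1) is_normD(1)[OF N, of u] is_normD(2)[OF N, of u] by (cases "u = 0") auto
 have "N u * norm v \<le> N v" for v
 proof (cases "v = 0")
  case False
  have "N u \<le> N ((1 / norm v) *\<^sub>R v)" by (rule u(2)) (use False in simp)
  also have "\<dots> = N v / norm v" by (subst is_normD(3)[OF N]) simp
  finally show ?thesis using False by (simp add: field_simps)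
 qed (simp add: is_normD[OF N])
 then show ?thesis using that[OF a b _ up] by blast
qed

lemma lattice_ball_card:
 fixes N :: "real ^ 'd \<Rightarrow> real"
 assumes N: "is_norm N"
 obtains lo hi :: real where "lo > 0" "hi > 0" "\<And>r. finite (lattice_ball N r)"
  "\<And>r :: real. r \<ge> 1 \<Longrightarrow> lo * r ^ CARD('d) \<le> card (lattice_ball N r)"
  "\<And>r :: real. r \<ge> 1 \<Longrightarrow> card (lattice_ball N r) \<le> hi * r ^ CARD('d)"
proof -
 obtain a b where ab: "a > 0" "b > 0" "\<And>v. a * norm v \<le> N v" "\<And>v. N v \<le> b * norm v"
  using is_norm_equivalent[OF N] by blast
 let ?d = "real CARD('d)"
 have d: "?d \<ge> 1" by (simp add: Suc_leI)
 define box where "box m k = {x :: int ^ 'd. \<forall>i. m \<le> x $ i \<and> x $ i < k}" for m k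
 have up: "lattice_ball N r \<subseteq> box (- \<lfloor>r / a\<rfloor>) (\<lfloor>r / a\<rfloor> + 1)" for r
 proof
  fix x assume "x \<in> lattice_ball N r"
  then have "a * norm (real_vec x) \<le> r" using ab(3)[of "real_vec x"] by (simp add: lattice_ball_def)
  then have *: "norm (real_vec x) \<le> r / a" using ab by (simp add: field_simps)
  have *: "\<bar>x $ i\<bar> \<le> \<lfloor>r / a\<rfloor>" for i
   using component_le_norm_cart[of "real_vec x" i] * by (simp add: le_floor_iff)
  show "x \<in> box (- \<lfloor>r / a\<rfloor>) (\<lfloor>r / a\<rfloor> + 1)"
   unfolding box_def
  proof (intro CollectI allI)
   fix i
   show "- \<lfloor>r / a\<rfloor> \<le> x $ i \<and> x $ i < \<lfloor>r / a\<rfloor> + 1" using *[of i] by linarith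
  qed
 qed
 have fin: "finite (lattice_ball N r)" for r
  by (rule finite_subset[OF up], unfold box_def, rule finite_int_box)
 have hi: "card (lattice_ball N r) \<le> (2 / a + 1) ^ CARD('d) * r ^ CARD('d)" if r: "r \<ge> 1" for r
 proof -
  have "card (lattice_ball N r) \<le> card (box (- \<lfloor>r / a\<rfloor>) (\<lfloor>r / a\<rfloor> + 1))"
   by (intro card_mono up, unfold box_def, rule finite_int_box)
  also have "\<dots> = nat (2 * \<lfloor>r / a\<rfloor> + 1) ^ CARD('d)"
   unfolding box_def card_int_box by (simp add: algebra_simps)
  finally have "real (card (lattice_ball N r)) \<le> real (nat (2 * \<lfloor>r / a\<rfloor> + 1)) ^ CARD('d)"
   by (simp flip: of_nat_power)
  also have "\<dots> \<le> ((2 / a + 1) * r) ^ CARD('d)"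
  proof (rule power_mono)
   have "0 \<le> \<lfloor>r / a\<rfloor>" using r ab by simp
   then have "real (nat (2 * \<lfloor>r / a\<rfloor> + 1)) = 2 * real_of_int \<lfloor>r / a\<rfloor> + 1" by simp
   also have "\<dots> \<le> 2 * (r / a) + r" using r of_int_floor_le[of "r / a"] by linarith
   also have "\<dots> = (2 / a + 1) * r" by (simp add: algebra_simps)
   finally show "real (nat (2 * \<lfloor>r / a\<rfloor> + 1)) \<le> (2 / a + 1) * r" .
  qed simp
  finally show ?thesis by (simp add: power_mult_distrib)
 qed
 have lo: "(1 / (b * ?d)) ^ CARD('d) * r ^ CARD('d) \<le> card (lattice_ball N r)" if r: "r \<ge> 1" for r
 proof -
  define m where "m = \<lfloor>r / (b * ?d)\<rfloor> + 1"
  have m: "r / (b * ?d) \<le> real_of_int m" "0 \<le> m"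
   unfolding m_def using r ab d by (auto intro: less_imp_le)
  have "box 0 m \<subseteq> lattice_ball N r"
  proof
   fix x assume x: "x \<in> box 0 m"
   have "norm (real_vec x) \<le> (\<Sum>i\<in>UNIV. \<bar>real_vec x $ i\<bar>)" by (rule norm_le_l1_cart)
   also have "\<dots> \<le> (\<Sum>i\<in>(UNIV :: 'd set). r / (b * ?d))"
   proof (rule sum_mono)
    fix i
    have "0 \<le> x $ i" "x $ i \<le> \<lfloor>r / (b * ?d)\<rfloor>" using x by (auto simp: box_def m_def)
    then show "\<bar>real_vec x $ i\<bar> \<le> r / (b * ?d)" by (simp add: le_floor_iff)
   qed
   also have "\<dots> = r / b" using d by simp
   finally have "b * norm (real_vec x) \<le> r" using ab by (simp add: field_simps)
   then show "x \<in> lattice_ball N r" using ab(4)[of "real_vec x"] by (simp add: lattice_ball_def)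
  qed
  then have "card (box 0 m) \<le> card (lattice_ball N r)" by (intro card_mono fin)
  then have "nat m ^ CARD('d) \<le> card (lattice_ball N r)" by (simp add: box_def card_int_box)
  then have "real (nat m ^ CARD('d)) \<le> real (card (lattice_ball N r))" by (simp only: of_nat_le_iff)
  then have "real (nat m) ^ CARD('d) \<le> card (lattice_ball N r)" by (simp only: of_nat_power)
  moreover have "(r / (b * ?d)) ^ CARD('d) \<le> real (nat m) ^ CARD('d)"
   using m r ab d by (intro power_mono) auto
  moreover have "(1 / (b * ?d)) ^ CARD('d) * r ^ CARD('d) = (r / (b * ?d)) ^ CARD('d)"
   by (simp flip: power_mult_distrib)
  ultimately show ?thesis by linarith
 qed
 show ?thesis
  by (rule that[of "(1 / (b * ?d)) ^ CARD('d)" "(2 / a + 1) ^ CARD('d)", OF _ _ fin lo hi])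
    (use ab d in \<open>auto intro!: zero_less_power add_pos_pos\<close>)
qed

section \<open>The profile\<close>

lemma profile_deriv_nonpos:
 assumes J: "admissible_profile m \<alpha> J" and r: "r > 0"
 shows "deriv J r \<le> 0"
proof (rule ccontr)
 assume neg: "\<not> ?thesis"
 have anti: "antimono_on {0<..} J" and "J differentiable (at r)"
  using J r by (auto simp: admissible_profile_def)
 then have "(J has_real_derivative deriv J r) (at r)"
  by (simp add: DERIV_deriv_iff_real_differentiable)
 then obtain e where e: "e > 0" "\<And>h. 0 < h \<Longrightarrow> h < e \<Longrightarrow> J r < J (r + h)"
  using DERIV_pos_inc_right[of J "deriv J r" r] neg by auto
 have "J (r + e / 2) \<le> J r"
  using anti r e by (auto simp: monotone_on_def)
 then show False using e(2)[of "e / 2"] e(1) by simp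
qed

text \<open>Once |\<delta>| < 1/2, the derivative of \<open>J\<close> lies between multiples of that
  of r^(-m - \<alpha>), so differences of \<open>J\<close> and such powers are monotone. This bounds
  increments; sending the outer radius to infinity bounds \<open>J\<close> itself.\<close>

lemma profile_bounds:
 assumes J: "admissible_profile m \<alpha> J" and \<alpha>: "\<alpha> > 0"
 obtains R0 j1 j2 where "R0 \<ge> 1" "j1 > 0" "j2 > 0"
  "\<And>r s. R0 \<le> r \<Longrightarrow> r \<le> s \<Longrightarrow> j1 * (r powr (- (m + \<alpha>)) - s powr (- (m + \<alpha>))) \<le> J r - J s"
  "\<And>r. R0 \<le> r \<Longrightarrow> j1 * r powr (- (m + \<alpha>)) \<le> J r"
  "\<And>r. R0 \<le> r \<Longrightarrow> J r \<le> j2 * r powr (- (m + \<alpha>))"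
proof -
 obtain C \<delta> where C: "C > 0" and \<delta>: "(\<delta> \<longlongrightarrow> 0) at_top"
  and dJ: "\<And>r. r > 0 \<Longrightarrow> \<bar>deriv J r\<bar> = C * (1 + \<delta> r) * r powr (- real m - \<alpha> - 1)"
  using J unfolding admissible_profile_def by blast
 have diff: "\<And>r. r > 0 \<Longrightarrow> J differentiable (at r)" and lim: "(J \<longlongrightarrow> 0) at_top"
  and anti: "antimono_on {0<..} J"
  using J by (auto simp: admissible_profile_def)
 have der: "(J has_real_derivative deriv J r) (at r)" if "r > 0" for r
  using diff[OF that] by (simp add: DERIV_deriv_iff_real_differentiable)
 have neg: "deriv J r \<le> 0" if "r > 0" for r by (rule profile_deriv_nonpos[OF J that])
 let ?p = "real m + \<alpha>"
 have p: "?p > 0" using \<alpha> by simp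
 have "\<forall>\<^sub>F r in at_top. \<bar>\<delta> r\<bar> < 1 / 2"
  using tendstoD[OF \<delta>, of "1 / 2"] by (simp add: dist_real_def)
 then obtain R where R: "\<And>r. r \<ge> R \<Longrightarrow> \<bar>\<delta> r\<bar> < 1 / 2" by (auto simp: eventually_at_top_linorder)
 define R0 where "R0 = max 1 R"
 have R0: "R0 \<ge> 1" "R0 > 0" "\<And>r. r \<ge> R0 \<Longrightarrow> \<bar>\<delta> r\<bar> < 1 / 2" using R by (auto simp: R0_def)
 have bounds: "C / 2 * r powr (- ?p - 1) \<le> - deriv J r" "- deriv J r \<le> 2 * C * r powr (- ?p - 1)" if "r \<ge> R0" for r
 proof -
  have r: "r > 0" using that R0 by linarith
  have "- real m - \<alpha> - 1 = - ?p - 1" by simp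
  then have eq: "- deriv J r = C * (1 + \<delta> r) * r powr (- ?p - 1)"
   using dJ[OF r] neg[OF r] by simp
  have "\<bar>\<delta> r\<bar> < 1 / 2" by (rule R0(3)[OF that])
  then have "C * (1 / 2) \<le> C * (1 + \<delta> r)" "C * (1 + \<delta> r) \<le> C * 2"
   using C by (auto intro!: mult_left_mono)
  then have "C / 2 \<le> C * (1 + \<delta> r)" "C * (1 + \<delta> r) \<le> 2 * C" by simp_all
  then show "C / 2 * r powr (- ?p - 1) \<le> - deriv J r"
   unfolding eq by (intro mult_right_mono powr_ge_zero)
  show "- deriv J r \<le> 2 * C * r powr (- ?p - 1)"
   unfolding eq using \<open>C * (1 + \<delta> r) \<le> 2 * C\<close> by (intro mult_right_mono powr_ge_zero)
 qed
 define j1 j2 where "j1 = C / 2 / ?p" and "j2 = 2 * C / ?p"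
 have derp: "((\<lambda>r. j * r powr (- ?p)) has_real_derivative (- j * ?p * r powr (- ?p - 1))) (at r)" if "r > 0" for j r
  using that by (auto intro!: derivative_eq_intros simp: algebra_simps)
 have jp: "j1 * ?p = C / 2" "j2 * ?p = 2 * C" using p by (auto simp: j1_def j2_def simp del: distrib_left_numeral)
 have jp': "- j1 * ?p * y = - (C / 2 * y)" "- j2 * ?p * y = - (2 * C * y)" for y
  by (simp_all only: mult_minus_left jp)
 have low: "j1 * (r powr (- ?p) - s powr (- ?p)) \<le> J r - J s" if "R0 \<le> r" "r \<le> s" for r s
 proof -
  have "(\<lambda>r. J r - j1 * r powr (- ?p)) s \<le> (\<lambda>r. J r - j1 * r powr (- ?p)) r"
  proof (rule DERIV_nonpos_imp_nonincreasing[OF that(2)])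
   fix x assume x: "r \<le> x" "x \<le> s"
   then have x0: "x > 0" "x \<ge> R0" using that R0 by linarith+
   show "\<exists>y. ((\<lambda>r. J r - j1 * r powr (- ?p)) has_real_derivative y) (at x) \<and> y \<le> 0"
    by (intro exI conjI, rule DERIV_diff[OF der[OF x0(1)] derp[OF x0(1)]])
      (use bounds(1)[OF x0(2)] jp'(1)[of "x powr (- ?p - 1)"] in linarith)
  qed
  then show ?thesis by (simp add: algebra_simps)
 qed
 have high: "J r - J s \<le> j2 * (r powr (- ?p) - s powr (- ?p))" if "R0 \<le> r" "r \<le> s" for r s
 proof -
  have "(\<lambda>r. j2 * r powr (- ?p) - J r) s \<le> (\<lambda>r. j2 * r powr (- ?p) - J r) r"
  proof (rule DERIV_nonpos_imp_nonincreasing[OF that(2)])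
   fix x assume x: "r \<le> x" "x \<le> s"
   then have x0: "x > 0" "x \<ge> R0" using that R0 by linarith+
   show "\<exists>y. ((\<lambda>r. j2 * r powr (- ?p) - J r) has_real_derivative y) (at x) \<and> y \<le> 0"
    by (intro exI conjI, rule DERIV_diff[OF derp[OF x0(1)] der[OF x0(1)]])
      (use bounds(2)[OF x0(2)] jp'(2)[of "x powr (- ?p - 1)"] in linarith)
  qed
  then show ?thesis by (simp add: algebra_simps)
 qed
 have pl: "((\<lambda>s. s powr (- ?p)) \<longlongrightarrow> 0) at_top"
  using p by (intro tendsto_neg_powr filterlim_ident) auto
 have l1: "j1 * r powr (- ?p) \<le> J r" if "R0 \<le> r" for r
 proof -
  have "((\<lambda>s. j1 * (r powr (- ?p) - s powr (- ?p))) \<longlongrightarrow> j1 * (r powr (- ?p) - 0)) at_top"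
   by (intro tendsto_intros pl)
  moreover have "((\<lambda>s. J r - J s) \<longlongrightarrow> J r - 0) at_top" by (intro tendsto_intros lim)
  moreover have "\<forall>\<^sub>F s in at_top. j1 * (r powr (- ?p) - s powr (- ?p)) \<le> J r - J s"
   using eventually_ge_at_top[of r] by eventually_elim (rule low[OF that])
  ultimately have "j1 * (r powr (- ?p) - 0) \<le> J r - 0"
   using tendsto_le[OF trivial_limit_at_top_linorder] by blast
  then show ?thesis by simp
 qed
 have l2: "J r \<le> j2 * r powr (- ?p)" if "R0 \<le> r" for r
 proof -
  have "((\<lambda>s. j2 * (r powr (- ?p) - s powr (- ?p))) \<longlongrightarrow> j2 * (r powr (- ?p) - 0)) at_top"
   by (intro tendsto_intros pl)
  moreover have "((\<lambda>s. J r - J s) \<longlongrightarrow> J r - 0) at_top" by (intro tendsto_intros lim)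
  moreover have "\<forall>\<^sub>F s in at_top. J r - J s \<le> j2 * (r powr (- ?p) - s powr (- ?p))"
   using eventually_ge_at_top[of r] by eventually_elim (rule high[OF that])
  ultimately have "J r - 0 \<le> j2 * (r powr (- ?p) - 0)"
   using tendsto_le[OF trivial_limit_at_top_linorder] by blast
  then show ?thesis by simp
 qed
 have "j1 > 0" "j2 > 0" using C p by (auto simp: j1_def j2_def)
 then show ?thesis using that[OF R0(1) _ _ low l1 l2] by blast
qed

text \<open>Lets the cut-off kernel be replaced by a difference of values of \<open>J\<close>.
  Measurability of the derivative on the interval comes from its formula in terms of
  \<delta>.\<close>

lemma profile_integral:
 assumes J: "admissible_profile m \<alpha> J" and r: "0 < a" "a \<le> b"
 shows "set_lebesgue_integral lborel {a..b} (\<lambda>s. \<bar>deriv J s\<bar>) = J a - J b"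
proof -
 obtain C \<delta> where \<delta>: "set_borel_measurable borel {0<..} \<delta>"
  and dJ: "\<And>r. r > 0 \<Longrightarrow> \<bar>deriv J r\<bar> = C * (1 + \<delta> r) * r powr (- real m - \<alpha> - 1)"
  using J unfolding admissible_profile_def by blast
 have diff: "\<And>r. r > 0 \<Longrightarrow> J differentiable (at r)" and anti: "antimono_on {0<..} J"
  using J by (auto simp: admissible_profile_def)
 have der: "(J has_real_derivative deriv J r) (at r)" if "r > 0" for r
  using diff[OF that] by (simp add: DERIV_deriv_iff_real_differentiable)
 have neg: "deriv J r \<le> 0" if "r > 0" for r by (rule profile_deriv_nonpos[OF J that])
 have meas: "(\<lambda>s. indicator {a..b} s * \<bar>deriv J s\<bar>) \<in> borel_measurable borel"
 proof -
  have "(\<lambda>s. indicator {0<..} s *\<^sub>R \<delta> s) \<in> borel_measurable borel"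
   using \<delta> by (simp add: set_borel_measurable_def)
  then have "(\<lambda>s. indicator {a..b} s * (C * (1 + indicator {0<..} s *\<^sub>R \<delta> s) * s powr (- real m - \<alpha> - 1))) \<in> borel_measurable borel"
   by measurable
  also have "(\<lambda>s. indicator {a..b} s * (C * (1 + indicator {0<..} s *\<^sub>R \<delta> s) * s powr (- real m - \<alpha> - 1))) =
    (\<lambda>s. indicator {a..b} s * \<bar>deriv J s\<bar>)"
   using dJ r by (auto simp: fun_eq_iff indicator_def)
  finally show ?thesis .
 qed
 have "(\<integral>x. (indicator {a..b} x * \<bar>deriv J x\<bar>) * indicator {a..b} x \<partial>lborel) = (\<lambda>x. - J x) b - (\<lambda>x. - J x) a"
 proof (rule integral_FTC_Icc_nonneg[where F="\<lambda>x. - J x" and f="\<lambda>x. indicator {a..b} x * \<bar>deriv J x\<bar>"])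
  show "(\<lambda>s. indicator {a..b} s * \<bar>deriv J s\<bar>) \<in> borel_measurable borel" by (rule meas)
 next
  show "a \<le> b" by (rule r(2))
 next
  fix x assume "x \<in> {a..b}"
  then show "((\<lambda>x. - J x) has_real_derivative indicator {a..b} x * \<bar>deriv J x\<bar>) (at x)"
   using DERIV_minus[OF der[of x]] neg[of x] r by (simp add: indicator_def)
 qed auto
 moreover have "(indicator {a..b} x * \<bar>deriv J x\<bar>) * indicator {a..b} x = indicator {a..b} x *\<^sub>R \<bar>deriv J x\<bar>" for x
  by (simp add: indicator_def)
 ultimately show ?thesis by (simp add: set_lebesgue_integral_def)
qed

section \<open>The kernel and its cut-offs\<close>

locale lrp =
 fixes N :: "real ^ 'd \<Rightarrow> real" and J :: "real \<Rightarrow> real" and \<alpha> :: real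
 assumes N: "is_norm N" and J: "admissible_profile CARD('d) \<alpha> J" and \<alpha>: "\<alpha> > 0"
begin

definition n :: "int ^ 'd \<Rightarrow> real" where "n x = N (real_vec x)"

definition full :: "int ^ 'd \<Rightarrow> real" where "full x = (if x = 0 then 0 else J (n x))"

definition cut :: "real \<Rightarrow> int ^ 'd \<Rightarrow> real" where
 "cut r x = (if x = 0 \<or> r < n x then 0 else J (n x) - J r)"

definition ball :: "real \<Rightarrow> (int ^ 'd) set" where "ball r = {x. n x \<le> r}"

text \<open>The decay exponent of the kernel; \<open>p / 2\<close> will turn out to be the fractal
  dimension.\<close>

definition p where "p = real CARD('d) + \<alpha>"

definition tail :: "real \<Rightarrow> real" where "tail r = (\<Sum>\<^sub>\<infinity>x. full x - cut r x)"

lemma ball_eq: "lattice_ball N r = ball r"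
 by (simp add: lattice_ball_def ball_def n_def)

lemma n_simps [simp]: "n 0 = 0" "n (- x) = n x" "0 \<le> n x" "n x = 0 \<longleftrightarrow> x = 0"
 by (auto simp: n_def is_normD[OF N])

lemma n_pos: "x \<noteq> 0 \<Longrightarrow> n x > 0"
 using n_simps(3,4)[of x] by linarith

lemma n_add: "n (x + y) \<le> n x + n y"
 by (simp add: n_def is_normD[OF N])

lemma n_diff: "n (x - y) \<le> n x + n y"
 using n_add[of x "- y"] by simp

lemma finite_ball [simp]: "finite (ball r)"
 using lattice_ball_card[OF N] ball_eq by metis

lemma ball_mono: "r \<le> s \<Longrightarrow> ball r \<subseteq> ball s"
 by (auto simp: ball_def)

lemma zero_in_ball [simp]: "0 \<le> r \<Longrightarrow> 0 \<in> ball r"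
 by (simp add: ball_def)

lemma card_ball_pos: "0 \<le> r \<Longrightarrow> card (ball r) > 0"
 using zero_in_ball[of r] finite_ball[of r] by (metis card_gt_0_iff empty_iff)

lemma p_pos: "p > 0"
 using \<alpha> by (simp add: p_def add_nonneg_pos)

lemma J_pos: "r > 0 \<Longrightarrow> J r > 0" and J_anti: "0 < r \<Longrightarrow> r \<le> s \<Longrightarrow> J s \<le> J r"
 using J by (auto simp: admissible_profile_def monotone_on_def)

lemma lattice_kernel_eq: "lattice_kernel N J x y = full (x - y)"
 by (simp add: lattice_kernel_def full_def n_def)

lemma cutoff_kernel_eq: "cutoff_kernel N J r x y = cut r (x - y)"
proof (cases "x \<noteq> y \<and> n (x - y) \<le> r")
 case True
 then show ?thesis
  using profile_integral[OF J, of "n (x - y)" r] n_pos[of "x - y"]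
  by (simp add: cutoff_kernel_def cut_def n_def)
next
 case False
 then show ?thesis by (auto simp: cutoff_kernel_def cut_def n_def)
qed

lemma full_kernel_fn: "kernel_fn full"
 using J_pos n_pos by (auto simp: kernel_fn_def full_def intro: less_imp_le)

lemma cut_kernel_fn: "kernel_fn (cut r)"
 using J_anti n_pos by (auto simp: kernel_fn_def cut_def)

lemma cut_mono: "r \<le> s \<Longrightarrow> cut r x \<le> cut s x"
proof (cases "x = 0 \<or> r < n x")
 case True
 then show ?thesis using kernel_fn_nonneg[OF cut_kernel_fn, of s x] by (auto simp: cut_def)
next
 case False
 then show "r \<le> s \<Longrightarrow> ?thesis" using J_anti[of r s] n_pos[of x] by (auto simp: cut_def)
qed

lemma full_minus_cut: "0 < r \<Longrightarrow> full x - cut r x = (if x = 0 then 0 else J (max r (n x)))"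
 by (auto simp: full_def cut_def max_def)

lemma cut_le_full: "cut r x \<le> full x"
proof (cases "r > 0")
 case True
 then have "J (max r (n x)) > 0" by (intro J_pos) simp
 then show ?thesis using full_minus_cut[OF True, of x] by (auto split: if_splits)
next
 case False
 then have "cut r x = 0" using n_pos[of x] by (auto simp: cut_def)
 then show ?thesis using kernel_fn_nonneg[OF full_kernel_fn, of x] by simp
qed

lemma cut_diff_le:
 assumes "0 < r" "r \<le> s"
 shows "cut s x - cut r x \<le> J r"
proof -
 have "J (max s (n x)) > 0" "J (max r (n x)) \<le> J r" "J r > 0"
  using assms by (auto intro: J_pos J_anti)
 then show ?thesis
  using full_minus_cut[of r x] full_minus_cut[of s x] assms by (auto split: if_splits)
qed

lemma cut_diff_eq: "0 < r \<Longrightarrow> r \<le> s \<Longrightarrow> x \<in> ball r \<Longrightarrow> x \<noteq> 0 \<Longrightarrow> cut s x - cut r x = J r - J s"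
 by (auto simp: cut_def ball_def)

lemma cut_diff_eq': "0 < r \<Longrightarrow> r \<le> s \<Longrightarrow> x \<in> ball s \<Longrightarrow> x \<noteq> 0 \<Longrightarrow> cut s x - cut r x = J (max r (n x)) - J s"
 by (auto simp: cut_def ball_def max_def)

lemma cut_outside: "x \<notin> ball r \<Longrightarrow> cut r x = 0"
 by (auto simp: cut_def ball_def)

lemma card_ball_bounds:
 obtains lo hi :: real where "lo > 0" "hi > 0"
  "\<And>r. r \<ge> 1 \<Longrightarrow> lo * r powr real CARD('d) \<le> card (ball r)"
  "\<And>r. r \<ge> 1 \<Longrightarrow> card (ball r) \<le> hi * r powr real CARD('d)"
proof -
 obtain lo hi :: real where "lo > 0" "hi > 0"
  "\<And>r :: real. r \<ge> 1 \<Longrightarrow> lo * r ^ CARD('d) \<le> card (lattice_ball N r)"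
  "\<And>r :: real. r \<ge> 1 \<Longrightarrow> card (lattice_ball N r) \<le> hi * r ^ CARD('d)"
  using lattice_ball_card[OF N] by metis
 then show ?thesis by (intro that[of lo hi]) (auto simp: ball_eq powr_realpow)
qed

lemma tail_sum_bound:
 obtains R0 t where "R0 \<ge> 1" "t > 0"
  "\<And>r Y. r \<ge> R0 \<Longrightarrow> finite Y \<Longrightarrow> (\<Sum>x\<in>Y. full x - cut r x) \<le> t * r powr (- \<alpha>)"
proof -
 obtain lo hi where hi: "hi > 0" "\<And>r. r \<ge> 1 \<Longrightarrow> card (ball r) \<le> hi * r powr real CARD('d)"
  using card_ball_bounds by metis
 obtain R0 j2 where R0: "R0 \<ge> 1" and j2: "j2 > 0" "\<And>r. R0 \<le> r \<Longrightarrow> J r \<le> j2 * r powr (- p)"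
  using profile_bounds[OF J \<alpha>] unfolding p_def by metis
 let ?d = "real CARD('d)"
 define q where "q = 2 powr (- \<alpha>)"
 have q: "0 < q" "q < 1" using \<alpha> by (auto simp: q_def powr_less_one)
 define t where "t = hi * j2 * (1 + 2 powr ?d / (1 - q))"
 have "(\<Sum>x\<in>Y. full x - cut r x) \<le> t * r powr (- \<alpha>)" if r: "r \<ge> R0" and Y: "finite Y" for r Y
 proof -
  have r0: "r > 0" "r \<ge> 1" using r R0 by auto
  let ?f = "\<lambda>x. full x - cut r x"
  have f0: "0 \<le> ?f x" for x using cut_le_full[of r x] by simp
  \<comment> \<open>A dyadic shell with inner radius s = 2^k r has of order s^d points, each of
    missing weight at most J(s), so the shells contribute a geometric series with ratio q =
    2^(-\<alpha>).\<close>
  have shell: "sum ?f (ball (2 ^ k * r)) \<le> hi * j2 * r powr (- \<alpha>) * (1 + 2 powr ?d * (\<Sum>j<k. q ^ j))" for k :: nat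
  proof (induction k)
   case 0
   have "?f x \<le> J r" for x
    using full_minus_cut[OF r0(1), of x] J_anti[OF r0(1), of "max r (n x)"] J_pos[OF r0(1)] by (auto split: if_splits)
   then have "sum ?f (ball r) \<le> card (ball r) * J r" by (intro sum_bounded_above)
   also have "\<dots> \<le> (hi * r powr ?d) * (j2 * r powr (- p))"
    using hi(2)[OF r0(2)] j2(2)[OF r] hi(1) J_pos[OF r0(1)] by (intro mult_mono) auto
   also have "\<dots> = hi * j2 * (r powr ?d * r powr (- p))" by (simp add: algebra_simps)
   also have "r powr ?d * r powr (- p) = r powr (- \<alpha>)"
    by (simp add: powr_add[symmetric] p_def)
   finally show ?case by simp
  next
   case (Suc k)
   let ?s = "2 ^ k * r"
   have s: "?s \<ge> R0" "?s > 0" "?s \<ge> 1" "r \<le> ?s"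
   proof -
    have "1 * r \<le> ?s" using r0 by (intro mult_right_mono) auto
    then show "?s \<ge> R0" "?s > 0" "?s \<ge> 1" "r \<le> ?s" using r R0 by linarith+
   qed
   have sub: "ball ?s \<subseteq> ball (2 ^ Suc k * r)" using s r0 by (intro ball_mono) auto
   have "?f x \<le> J ?s" if "x \<in> ball (2 ^ Suc k * r) - ball ?s" for x
    using full_minus_cut[OF r0(1), of x] J_anti[OF s(2), of "max r (n x)"] J_pos[OF s(2)] that
    by (auto simp: ball_def split: if_splits)
   then have "sum ?f (ball (2 ^ Suc k * r) - ball ?s) \<le> card (ball (2 ^ Suc k * r) - ball ?s) * J ?s"
    by (intro sum_bounded_above)
   also have "\<dots> \<le> card (ball (2 ^ Suc k * r)) * J ?s"
    using J_pos[OF s(2)] by (intro mult_right_mono) (auto intro!: card_mono)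
   also have "\<dots> \<le> (hi * (2 * ?s) powr ?d) * (j2 * ?s powr (- p))"
    using hi(2)[of "2 * ?s"] j2(2)[OF s(1)] hi(1) J_pos[OF s(2)] s(3)
    by (intro mult_mono) (auto simp: mult.assoc)
   also have "\<dots> = hi * j2 * (2 powr ?d * (?s powr ?d * ?s powr (- p)))"
    using s(2) by (simp add: powr_mult)
   also have "?s powr ?d * ?s powr (- p) = ?s powr (- \<alpha>)"
    by (simp add: powr_add[symmetric] p_def)
   also have "?s powr (- \<alpha>) = (2 ^ k) powr (- \<alpha>) * r powr (- \<alpha>)" using r0 by (intro powr_mult)
   also have "(2 ^ k) powr (- \<alpha>) = q ^ k"
    by (simp add: q_def powr_powr powr_realpow[symmetric] mult.commute)
   finally have "sum ?f (ball (2 ^ Suc k * r) - ball ?s) \<le> hi * j2 * r powr (- \<alpha>) * (2 powr ?d * q ^ k)"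
    by (simp add: mult_ac)
   moreover have "sum ?f (ball (2 ^ Suc k * r)) = sum ?f (ball (2 ^ Suc k * r) - ball ?s) + sum ?f (ball ?s)"
    by (rule sum.subset_diff[OF sub]) simp
   ultimately show ?case using Suc by (simp add: algebra_simps)
  qed
  obtain M where M: "\<And>x. x \<in> Y \<Longrightarrow> n x \<le> M"
   using finite_imageI[OF Y, of n] by (meson Max_ge imageI)
  obtain k :: nat where k: "M / r < 2 ^ k"
   using real_arch_pow[of 2 "M / r"] by auto
  have "Y \<subseteq> ball (2 ^ k * r)"
  proof
   fix x assume "x \<in> Y"
   then have "n x \<le> M" by (rule M)
   also have "M \<le> 2 ^ k * r" using k r0 by (simp add: field_simps)
   finally show "x \<in> ball (2 ^ k * r)" by (simp add: ball_def)
  qed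
  then have "sum ?f Y \<le> sum ?f (ball (2 ^ k * r))"
   by (intro sum_mono2 f0) simp
  also have "\<dots> \<le> hi * j2 * r powr (- \<alpha>) * (1 + 2 powr ?d * (\<Sum>j<k. q ^ j))" by (rule shell)
  also have "\<dots> \<le> hi * j2 * r powr (- \<alpha>) * (1 + 2 powr ?d * (1 / (1 - q)))"
  proof (intro mult_left_mono add_left_mono)
   have "(\<Sum>j<k. q ^ j) = (1 - q ^ k) / (1 - q)" using q by (simp add: sum_gp_strict)
   also have "\<dots> \<le> 1 / (1 - q)" using q by (intro divide_right_mono) auto
   finally show "(\<Sum>j<k. q ^ j) \<le> 1 / (1 - q)" .
  qed (use hi j2 in auto)
  finally show ?thesis by (simp add: t_def mult_ac)
 qed
 moreover have "t > 0" using hi j2 q by (auto simp: t_def intro!: mult_pos_pos add_pos_nonneg)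
 ultimately show ?thesis using that[OF R0] by blast
qed

lemma tail_summable: "(\<lambda>x. full x - cut r x) summable_on UNIV"
proof -
 obtain R0 t where t: "\<And>r Y. r \<ge> R0 \<Longrightarrow> finite Y \<Longrightarrow> (\<Sum>x\<in>Y. full x - cut r x) \<le> t * r powr (- \<alpha>)"
  using tail_sum_bound by metis
 let ?s = "max R0 r"
 have 1: "(\<lambda>x. full x - cut ?s x) summable_on UNIV"
 proof (rule nonneg_bdd_above_summable_on)
  show "bdd_above (sum (\<lambda>x. full x - cut ?s x) ` {F. F \<subseteq> UNIV \<and> finite F})"
   using t[of ?s] by (intro bdd_aboveI[of _ "t * ?s powr (- \<alpha>)"]) auto
 qed (use cut_le_full[of ?s] in auto)
 have 2: "(\<lambda>x. cut ?s x - cut r x) summable_on UNIV"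
 proof (subst summable_on_cong_neutral)
  show "(\<lambda>x. cut ?s x - cut r x) summable_on ball ?s" by (rule summable_on_finite) simp
 next
  fix x assume "x \<in> UNIV - ball ?s"
  then show "cut ?s x - cut r x = 0" by (auto simp: cut_def ball_def)
 qed auto
 show ?thesis using summable_on_add[OF 1 2] by simp
qed

lemma sum_le_tail: "finite Y \<Longrightarrow> (\<Sum>x\<in>Y. full x - cut r x) \<le> tail r"
 unfolding tail_def by (rule finite_sum_le_infsum[OF tail_summable]) (use cut_le_full in auto)

lemma tail_diff: "r \<le> s \<Longrightarrow> tail r - tail s = (\<Sum>x\<in>ball s. cut s x - cut r x)"
proof -
 assume rs: "r \<le> s"
 have "tail r - tail s = (\<Sum>\<^sub>\<infinity>x. (full x - cut r x) - (full x - cut s x))"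
  unfolding tail_def
  using infsum_add[OF tail_summable[of r] iffD2[OF summable_on_uminus tail_summable[of s]]]
   infsum_uminus[of "\<lambda>x. full x - cut s x" UNIV]
  by simp
 also have "\<dots> = (\<Sum>\<^sub>\<infinity>x\<in>ball s. cut s x - cut r x)"
  by (rule infsum_cong_neutral) (use rs in \<open>auto simp: cut_def ball_def\<close>)
 finally show ?thesis by simp
qed

lemma tail_antimono: "r \<le> s \<Longrightarrow> tail s \<le> tail r"
 using tail_diff[of r s] sum_nonneg[of "ball s" "\<lambda>x. cut s x - cut r x"] cut_mono[of r s] by simp

lemma kernel_bounds:
 obtains R0 lo hi j1 j2 t0 t1 t2 where "R0 \<ge> 1" "lo > 0" "hi > 0" "j1 > 0" "j2 > 0" "t0 > 0" "t1 > 0" "t2 > 0"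
  "\<And>r. r \<ge> 1 \<Longrightarrow> lo * r powr real CARD('d) \<le> card (ball r)"
  "\<And>r. r \<ge> 1 \<Longrightarrow> card (ball r) \<le> hi * r powr real CARD('d)"
  "\<And>r s. R0 \<le> r \<Longrightarrow> r \<le> s \<Longrightarrow> j1 * (r powr (- p) - s powr (- p)) \<le> J r - J s"
  "\<And>r. R0 \<le> r \<Longrightarrow> J r \<le> j2 * r powr (- p)"
  "\<And>r. R0 \<le> r \<Longrightarrow> t0 * r powr (- \<alpha>) \<le> tail r - tail (2 * r)"
  "\<And>r. R0 \<le> r \<Longrightarrow> t1 * r powr (- \<alpha>) \<le> tail r"
  "\<And>r. R0 \<le> r \<Longrightarrow> tail r \<le> t2 * r powr (- \<alpha>)"
proof -
 let ?d = "real CARD('d)"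
 obtain lo hi where lh: "lo > 0" "hi > 0"
  and lo: "\<And>r. r \<ge> 1 \<Longrightarrow> lo * r powr ?d \<le> card (ball r)"
  and hi: "\<And>r. r \<ge> 1 \<Longrightarrow> card (ball r) \<le> hi * r powr ?d"
  using card_ball_bounds by metis
 obtain R1 j1 j2 where R1: "R1 \<ge> 1" and j: "j1 > 0" "j2 > 0"
  and jd: "\<And>r s. R1 \<le> r \<Longrightarrow> r \<le> s \<Longrightarrow> j1 * (r powr (- p) - s powr (- p)) \<le> J r - J s"
  and j1: "\<And>r. R1 \<le> r \<Longrightarrow> j1 * r powr (- p) \<le> J r"
  and j2: "\<And>r. R1 \<le> r \<Longrightarrow> J r \<le> j2 * r powr (- p)"
  using profile_bounds[OF J \<alpha>] unfolding p_def by metis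
 obtain R2 t where R2: "R2 \<ge> 1" and t: "t > 0"
  and ts: "\<And>r Y. r \<ge> R2 \<Longrightarrow> finite Y \<Longrightarrow> (\<Sum>x\<in>Y. full x - cut r x) \<le> t * r powr (- \<alpha>)"
  using tail_sum_bound by metis
 \<comment> \<open>The entry \<open>2 / lo\<close> ensures that removing the origin, where the
   kernel vanishes, costs at most half of the lower bound on the number of points of the
   ball.\<close>
 define R0 where "R0 = max (max R1 R2) (2 / lo)"
 have R0: "R0 \<ge> 1" "R0 \<ge> R1" "R0 \<ge> R2" "R0 \<ge> 2 / lo" using R1 by (auto simp: R0_def)
 have card: "lo / 2 * r powr ?d \<le> card (ball r - {0})" if "R0 \<le> r" for r
 proof -
  have r: "r \<ge> 1" "r \<ge> 2 / lo" using that R0 by linarith+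
  have "r powr 1 \<le> r powr ?d" using r by (intro powr_mono) (auto simp: Suc_leI)
  then have "2 / lo \<le> r powr ?d" using r by simp
  then have "2 \<le> lo * r powr ?d" using lh by (simp add: field_simps)
  moreover have "card (ball r - {0}) = card (ball r) - 1" using r by (simp add: card_Diff_singleton)
  ultimately show ?thesis using lo[OF r(1)] card_ball_pos[of r] r by linarith
 qed
 have pw: "r powr ?d * r powr (- p) = r powr (- \<alpha>)" if "r > 0" for r
  using that by (simp add: powr_add[symmetric] p_def)
 define q where "q = 1 - 2 powr (- p)"
 have q: "q > 0" using p_pos by (simp add: q_def powr_less_one)
 have T0: "lo / 2 * j1 * q * r powr (- \<alpha>) \<le> tail r - tail (2 * r)" if r: "R0 \<le> r" for r
 proof -
  have r0: "r > 0" using r R0 by linarith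
  have d: "j1 * q * r powr (- p) \<le> J r - J (2 * r)"
   using jd[of r "2 * r"] r R0 r0 by (simp add: powr_mult q_def algebra_simps)
  have "lo / 2 * j1 * q * r powr (- \<alpha>) = (lo / 2 * r powr ?d) * (j1 * q * r powr (- p))"
   by (simp flip: pw[OF r0])
  also have "\<dots> \<le> card (ball r - {0}) * (J r - J (2 * r))"
   using card[OF r] d j q by (intro mult_mono) auto
  also have "\<dots> = (\<Sum>x\<in>ball r - {0}. cut (2 * r) x - cut r x)"
   using cut_diff_eq[OF r0, of "2 * r"] r0 by simp
  also have "\<dots> \<le> (\<Sum>x\<in>ball (2 * r). cut (2 * r) x - cut r x)"
   using ball_mono[of r "2 * r"] cut_mono[of r "2 * r"] r0 by (intro sum_mono2) auto
  also have "\<dots> = tail r - tail (2 * r)" using tail_diff[of r "2 * r"] r0 by simp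
  finally show ?thesis .
 qed
 have T1: "lo / 2 * j1 * r powr (- \<alpha>) \<le> tail r" if r: "R0 \<le> r" for r
 proof -
  have r0: "r > 0" using r R0 by linarith
  have "lo / 2 * j1 * r powr (- \<alpha>) = (lo / 2 * r powr ?d) * (j1 * r powr (- p))"
   by (simp flip: pw[OF r0])
  also have "\<dots> \<le> card (ball r - {0}) * J r"
   using card[OF r] j1[of r] j r R0 by (intro mult_mono) auto
  also have "\<dots> = (\<Sum>x\<in>ball r - {0}. J r)" by simp
  also have "\<dots> = (\<Sum>x\<in>ball r - {0}. full x - cut r x)"
   by (rule sum.cong) (use full_minus_cut[OF r0] in \<open>auto simp: ball_def max_def\<close>)
  also have "\<dots> \<le> tail r" by (rule sum_le_tail) simp
  finally show ?thesis .
 qed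
 have T2: "tail r \<le> t * r powr (- \<alpha>)" if r: "R0 \<le> r" for r
  unfolding tail_def
  by (rule infsum_le_finite_sums[OF tail_summable]) (use ts r R0 in auto)
 have "lo / 2 * j1 * q > 0" "lo / 2 * j1 > 0" using lh j q by auto
 then show ?thesis
  by (intro that[OF R0(1) lh j _ _ t lo hi _ _ T0 T1 T2] jd j2) (use R0 in auto)
qed

end

section \<open>Sums over the cluster of the origin\<close>

lemma nn_integral_count_space_least:
 fixes g :: "'v::countable \<Rightarrow> ennreal"
 assumes "\<And>Y. finite Y \<Longrightarrow> (\<Sum>x\<in>Y. g x) \<le> c"
 shows "(\<integral>\<^sup>+x. g x \<partial>count_space UNIV) \<le> c"
proof -
 define Y where "Y i = {x :: 'v. to_nat x < i}" for i
 have fin: "finite (Y i)" for i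
  by (rule inj_on_finite[of to_nat _ "{..<i}"]) (auto simp: Y_def inj_on_def)
 have "g x = (SUP i. g x * indicator (Y i) x)" for x
 proof (rule antisym)
  have "g x = g x * indicator (Y (Suc (to_nat x))) x" by (simp add: Y_def)
  also have "\<dots> \<le> (SUP i. g x * indicator (Y i) x)" by (rule SUP_upper) simp
  finally show "g x \<le> (SUP i. g x * indicator (Y i) x)" .
 qed (auto intro!: SUP_least simp: indicator_def)
 then have "(\<integral>\<^sup>+x. g x \<partial>count_space UNIV) = (\<integral>\<^sup>+x. (SUP i. g x * indicator (Y i) x) \<partial>count_space UNIV)"
  by simp
 also have "\<dots> = (SUP i. \<integral>\<^sup>+x. g x * indicator (Y i) x \<partial>count_space UNIV)"
  by (rule nn_integral_monotone_convergence_SUP)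
    (auto simp: incseq_def le_fun_def indicator_def Y_def)
 also have "\<dots> = (SUP i. \<Sum>x\<in>Y i. g x)"
  by (simp add: nn_integral_count_space_indicator[symmetric] nn_integral_count_space_finite fin)
 also have "\<dots> \<le> c" by (rule SUP_least) (rule assms[OF fin])
 finally show ?thesis .
qed

lemma cluster_integral:
 fixes f :: "'v::countable \<Rightarrow> real"
 assumes w: "\<And>e. 0 \<le> w e" and f: "\<And>x. 0 \<le> f x"
 shows "(\<integral>\<^sup>+\<omega>. (\<integral>\<^sup>+x. ennreal (f x) \<partial>count_space (cluster \<omega> z)) \<partial>law w) =
  (\<integral>\<^sup>+x. ennreal (f x * measure (law w) {\<omega> \<in> space (law w). conn (opens \<omega>) z x}) \<partial>count_space UNIV)"
proof -
 interpret prob_space "law w" by (rule prob_space_law)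
 let ?A = "\<lambda>x. {\<omega> \<in> space (law w). conn (opens \<omega>) z x}"
 have A[measurable]: "?A x \<in> sets (law w)" for x
  by (rule finitary_exhaust(1)[OF finitary_conn w])
 have "(\<integral>\<^sup>+\<omega>. (\<integral>\<^sup>+x. ennreal (f x) \<partial>count_space (cluster \<omega> z)) \<partial>law w) =
   (\<integral>\<^sup>+\<omega>. (\<integral>\<^sup>+x. ennreal (f x) * indicator (?A x) \<omega> \<partial>count_space UNIV) \<partial>law w)"
 proof (rule nn_integral_cong)
  fix \<omega> assume \<omega>: "\<omega> \<in> space (law w)"
  have "(\<integral>\<^sup>+x. ennreal (f x) \<partial>count_space (cluster \<omega> z)) =
    (\<integral>\<^sup>+x. ennreal (f x) * indicator (cluster \<omega> z) x \<partial>count_space UNIV)"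
   by (rule nn_integral_count_space_indicator) simp
  also have "\<dots> = (\<integral>\<^sup>+x. ennreal (f x) * indicator (?A x) \<omega> \<partial>count_space UNIV)"
   using \<omega> by (intro nn_integral_cong) (auto simp: indicator_def cluster_eq_clus clus_def)
  finally show "(\<integral>\<^sup>+x. ennreal (f x) \<partial>count_space (cluster \<omega> z)) =
    (\<integral>\<^sup>+x. ennreal (f x) * indicator (?A x) \<omega> \<partial>count_space UNIV)" .
 qed
 also have "\<dots> = (\<integral>\<^sup>+x. (\<integral>\<^sup>+\<omega>. ennreal (f x) * indicator (?A x) \<omega> \<partial>law w) \<partial>count_space UNIV)"
  by (rule nn_integral_count_space_nn_integral) auto
 also have "\<dots> = (\<integral>\<^sup>+x. ennreal (f x * measure (law w) (?A x)) \<partial>count_space UNIV)"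
  by (intro nn_integral_cong, subst nn_integral_cmult_indicator[OF A])
    (simp add: emeasure_eq_measure ennreal_mult f)
 finally show ?thesis .
qed

lemma sum_clus: "finite Y \<Longrightarrow> clus W x \<subseteq> Y \<Longrightarrow> (\<Sum>y\<in>clus W x. f y) = (\<Sum>y\<in>Y. f y * of_bool (conn W x y))"
 for f :: "'v \<Rightarrow> real"
 by (rule sum.mono_neutral_cong_left) (auto simp: clus_def)

text \<open>Both bounds pass through the two-point probabilities \<tau>; finitely many of them are
  approximated simultaneously on one finite graph.\<close>

lemma
 fixes f :: "'v::countable \<Rightarrow> real" and z :: 'v
 assumes w: "\<And>e. 0 \<le> w e" and f: "\<And>x. 0 \<le> f x"
 defines "F \<equiv> \<integral>\<^sup>+\<omega>. (\<integral>\<^sup>+x. ennreal (f x) \<partial>count_space (cluster \<omega> z)) \<partial>law w"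
 shows expct_le_cluster_integral:
   "E \<in> fins \<Longrightarrow> ennreal (expct w E (\<lambda>W. \<Sum>x\<in>clus W z. f x)) \<le> F"
  and cluster_integral_least:
   "(\<And>E. E \<in> fins \<Longrightarrow> expct w E (\<lambda>W. \<Sum>x\<in>clus W z. f x) \<le> c) \<Longrightarrow> F \<le> ennreal c"
proof -
 interpret prob_space "law w" by (rule prob_space_law)
 define \<tau> where "\<tau> x = measure (law w) {\<omega> \<in> space (law w). conn (opens \<omega>) z x}" for x
 have F: "F = (\<integral>\<^sup>+x. ennreal (f x * \<tau> x) \<partial>count_space UNIV)"
  unfolding F_def \<tau>_def by (rule cluster_integral[OF w f])
 have \<tau>0: "0 \<le> \<tau> x" for x by (simp add: \<tau>_def)
 {
  assume E: "E \<in> fins"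
  define Y where "Y = insert z (\<Union>E)"
  have Y: "finite Y" using finite_Union_fins[OF E] by (simp add: Y_def)
  have sub: "clus W z \<subseteq> Y" if "W \<subseteq> E" for W
   using clus_subset_insert[of W z] that by (auto simp: Y_def)
  have "expct w E (\<lambda>W. \<Sum>x\<in>clus W z. f x) = expct w E (\<lambda>W. \<Sum>y\<in>Y. f y * of_bool (conn W z y))"
   by (rule expct_cong) (rule sum_clus[OF Y sub])
  also have "\<dots> = (\<Sum>y\<in>Y. f y * prb w E (\<lambda>W. conn W z y))"
   by (simp add: expct_sum expct_cmult)
  also have "\<dots> \<le> (\<Sum>y\<in>Y. f y * \<tau> y)"
   unfolding \<tau>_def by (intro sum_mono mult_left_mono f finitary_exhaust(2)[OF finitary_conn w E])
  finally have "ennreal (expct w E (\<lambda>W. \<Sum>x\<in>clus W z. f x)) \<le> (\<Sum>y\<in>Y. ennreal (f y * \<tau> y))"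
   using f \<tau>0 by (simp add: sum_ennreal ennreal_leI)
  also have "\<dots> = (\<integral>\<^sup>+x. ennreal (f x * \<tau> x) * indicator Y x \<partial>count_space UNIV)"
   using Y by (simp add: nn_integral_count_space_indicator[symmetric] nn_integral_count_space_finite)
  also have "\<dots> \<le> F" unfolding F by (intro nn_integral_mono) (auto simp: indicator_def)
  finally show "ennreal (expct w E (\<lambda>W. \<Sum>x\<in>clus W z. f x)) \<le> F" .
 }
 {
  assume c: "\<And>E. E \<in> fins \<Longrightarrow> expct w E (\<lambda>W. \<Sum>x\<in>clus W z. f x) \<le> c"
  have "(\<Sum>y\<in>Y. f y * \<tau> y) \<le> c" if Y: "finite Y" for Y
  proof (rule field_le_epsilon)
   fix e :: real assume e: "0 < e"
   define \<eta> where "\<eta> = e / (1 + sum f Y)"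
   have s0: "0 \<le> sum f Y" by (rule sum_nonneg) (rule f)
   have \<eta>: "\<eta> > 0" using e s0 by (simp add: \<eta>_def)
   have "\<forall>y. \<exists>E\<in>fins. \<tau> y - \<eta> < prb w E (\<lambda>W. conn W z y)"
    unfolding \<tau>_def by (intro allI finitary_exhaust(3)[OF finitary_conn w \<eta>])
   then obtain E where E: "\<And>y. E y \<in> fins" "\<And>y. \<tau> y - \<eta> < prb w (E y) (\<lambda>W. conn W z y)" by metis
   let ?U = "\<Union>y\<in>Y. E y"
   have U: "?U \<in> fins" by (rule UN_fins[OF Y E(1)])
   have "(\<Sum>y\<in>Y. f y * (\<tau> y - \<eta>)) \<le> (\<Sum>y\<in>Y. f y * prb w ?U (\<lambda>W. conn W z y))"
   proof (intro sum_mono mult_left_mono f)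
    fix y assume "y \<in> Y"
    then have "prb w (E y) (\<lambda>W. conn W z y) \<le> prb w ?U (\<lambda>W. conn W z y)"
     by (intro expct_mono_set[OF w]) (use finsD[OF U] conn_mono in \<open>auto simp: increasing_on_def\<close>)
    then show "\<tau> y - \<eta> \<le> prb w ?U (\<lambda>W. conn W z y)" using E(2)[of y] by linarith
   qed
   also have "\<dots> = expct w ?U (\<lambda>W. \<Sum>y\<in>Y. f y * of_bool (conn W z y))"
    by (simp add: expct_sum expct_cmult)
   also have "\<dots> \<le> expct w ?U (\<lambda>W. \<Sum>x\<in>clus W z. f x)"
   proof (rule expct_mono[OF w])
    fix W assume "W \<subseteq> ?U"
    then have W: "finite (clus W z)" using finsD[OF U] by (meson finite_clus finite_subset)
    have "(\<Sum>y\<in>Y. f y * of_bool (conn W z y)) = (\<Sum>y\<in>Y \<inter> clus W z. f y)"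
     using Y by (intro sum.mono_neutral_cong_right) (auto simp: clus_def)
    also have "\<dots> \<le> (\<Sum>x\<in>clus W z. f x)" using W f by (intro sum_mono2) auto
    finally show "(\<Sum>y\<in>Y. f y * of_bool (conn W z y)) \<le> (\<Sum>x\<in>clus W z. f x)" .
   qed
   also have "\<dots> \<le> c" by (rule c[OF U])
   finally have "(\<Sum>y\<in>Y. f y * (\<tau> y - \<eta>)) \<le> c" .
   moreover have "(\<Sum>y\<in>Y. f y * (\<tau> y - \<eta>)) = (\<Sum>y\<in>Y. f y * \<tau> y) - sum f Y * \<eta>"
    by (simp add: algebra_simps sum_subtractf sum_distrib_left)
   moreover have "sum f Y * \<eta> \<le> e" using s0 e by (simp add: \<eta>_def field_simps)
   ultimately show "(\<Sum>y\<in>Y. f y * \<tau> y) \<le> c + e" by linarith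
  qed
  then show "F \<le> ennreal c"
   unfolding F by (intro nn_integral_count_space_least) (simp add: sum_ennreal f \<tau>0 ennreal_leI)
 }
qed

section \<open>Consequences of the correlation length condition\<close>

locale crit = lrp N J \<alpha> for N :: "real ^ 'd \<Rightarrow> real" and J \<alpha> +
 assumes CL: "correlation_length_condition N J"
begin

definition bc :: real where "bc = real_of_ereal (beta_crit N J)"

definition kc :: "real \<Rightarrow> int ^ 'd \<Rightarrow> real" where "kc r x = bc * cut r x"

definition kf :: "int ^ 'd \<Rightarrow> real" where "kf x = bc * full x"

definition chi :: "real \<Rightarrow> real" where
 "chi r = (SUP E\<in>fins. expw (kc r) E csize0)"

lemma bc_nonneg: "0 \<le> bc" and bc_eq: "ereal bc = beta_crit N J"
proof -
 have "0 \<le> beta_crit N J" by (rule critical_point_nonneg[OF full_kernel_fn lattice_kernel_eq])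
 moreover have "beta_crit N J < \<infinity>" using CL by (simp add: correlation_length_condition_def)
 ultimately show "0 \<le> bc" "ereal bc = beta_crit N J"
  by (auto simp: bc_def real_of_ereal_pos ereal_real)
qed

lemma kc_kernel_fn: "kernel_fn (kc r)" and kf_kernel_fn: "kernel_fn kf"
 unfolding kc_def[abs_def] kf_def[abs_def]
 by (intro kernel_fn_cmult cut_kernel_fn full_kernel_fn bc_nonneg)+

lemma wt_kc_nonneg: "0 \<le> wt (kc r) e" and wt_kf_nonneg: "0 \<le> wt kf e"
 by (intro wt_nonneg kc_kernel_fn kf_kernel_fn)+

lemma kc_mono: "r \<le> s \<Longrightarrow> kc r x \<le> kc s x" and kc_le_kf: "kc r x \<le> kf x"
 unfolding kc_def kf_def using bc_nonneg cut_mono cut_le_full by (auto intro: mult_left_mono)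

lemma cutoff_law_eq: "cutoff_law N J r = law (wt (kc r))"
 unfolding cutoff_law_def bc_def[symmetric] kc_def[abs_def]
 by (rule percolation_eq_law[OF cut_kernel_fn cutoff_kernel_eq bc_nonneg])

lemma critical_law_eq: "critical_law N J = law (wt kf)"
 unfolding critical_law_def bc_def[symmetric] kf_def[abs_def]
 by (rule percolation_eq_law[OF full_kernel_fn lattice_kernel_eq bc_nonneg])

text \<open>If the product were below 1, the kernel cut off at \<open>r\<close> would satisfy the
  criterion of \<open>not_supercritical\<close> even for a parameter slightly above
  \<open>bc\<close>.\<close>

lemma susceptibility_lower:
 assumes ch: "\<And>E. E \<in> fins \<Longrightarrow> expw (kc r) E csize0 \<le> ch"
 shows "1 \<le> bc * tail r * ch"
proof (rule ccontr)
 assume neg: "\<not> ?thesis"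
 have ch0: "0 \<le> ch" using ch[of "{}"] expct_nonneg[where k="wt (kc r)" and E="{}" and f="\<lambda>W. csize W 0", OF wt_kc_nonneg] by auto
 have cut0: "cut 0 x = 0" for x using n_pos[of x] by (auto simp: cut_def)
 have T: "0 \<le> tail 0" using sum_le_tail[of "{}" 0] by simp
 \<comment> \<open>\<open>tail 0\<close> is the total weight of the full kernel, because
   \<open>cut 0\<close> vanishes. Raising the parameter by \<open>\<eta>\<close> uses at most half
   of the gap below 1.\<close>
 define \<eta> where "\<eta> = (1 - bc * tail r * ch) / (2 * (tail 0 * ch + 1))"
 have \<eta>: "\<eta> > 0" unfolding \<eta>_def using neg T ch0 by (auto intro!: divide_pos_pos add_nonneg_pos)
 have "ereal (bc + \<eta>) \<le> critical_point (lattice_kernel N J)"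
 proof (rule not_supercritical[OF full_kernel_fn lattice_kernel_eq kc_kernel_fn[of r]])
  show "0 \<le> bc + \<eta>" using bc_nonneg \<eta> by simp
  show "kc r x \<le> (bc + \<eta>) * full x" for x
   using kc_le_kf[of r x] \<eta> kernel_fn_nonneg[OF full_kernel_fn, of x]
   by (simp add: kf_def algebra_simps) (smt (verit) mult_nonneg_nonneg)
  show "(\<Sum>y\<in>Y. (bc + \<eta>) * full y - kc r y) \<le> \<eta> * tail 0 + bc * tail r" if "finite Y" for Y
  proof -
   have "(\<Sum>y\<in>Y. (bc + \<eta>) * full y - kc r y) =
     \<eta> * (\<Sum>y\<in>Y. full y - cut 0 y) + bc * (\<Sum>y\<in>Y. full y - cut r y)"
    by (simp add: kc_def cut0 sum_distrib_left sum.distrib[symmetric] sum_subtractf[symmetric] algebra_simps)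
   moreover have "\<eta> * (\<Sum>y\<in>Y. full y - cut 0 y) \<le> \<eta> * tail 0"
    using sum_le_tail[OF that, of 0] \<eta> by (intro mult_left_mono) auto
   moreover have "bc * (\<Sum>y\<in>Y. full y - cut r y) \<le> bc * tail r"
    by (intro mult_left_mono sum_le_tail that bc_nonneg)
   ultimately show ?thesis by linarith
  qed
  show "(\<eta> * tail 0 + bc * tail r) * ch < 1"
  proof -
   have "\<eta> * (tail 0 * ch) \<le> \<eta> * (tail 0 * ch + 1)" using \<eta> by simp
   also have "\<dots> = (1 - bc * tail r * ch) / 2"
   proof -
    have "tail 0 * ch + 1 > 0" using T ch0 by (simp add: add_nonneg_pos)
    moreover have "a / (2 * b) * b = a / 2" if "b > 0" for a b :: real using that by simp
    ultimately show ?thesis unfolding \<eta>_def by blast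
   qed
   finally show ?thesis using neg by (simp add: algebra_simps)
  qed
 qed (rule ch)
 then have "ereal (bc + \<eta>) \<le> ereal bc" unfolding bc_eq .
 then show False using \<eta> by simp
qed

text \<open>At range 0 the kernel vanishes and clusters are singletons, so
  \<open>susceptibility_lower\<close> applies with \<open>ch\<close> equal to 1 and excludes
  \<open>bc\<close> = 0.\<close>

lemma bc_pos: "0 < bc"
proof -
 have "cut 0 x = 0" for x using n_pos[of x] by (auto simp: cut_def)
 then have "wt (kc 0) e = 0" if "e \<in> edges" for e
  using that by (auto simp: edges_def wt_pair kc_kernel_fn kc_def)
 then have "expw (kc 0) E csize0 = real (card (clus {} (0 :: int ^ 'd)))" if "E \<in> fins" for E
  using that \<open>\<And>e. e \<in> edges \<Longrightarrow> wt (kc 0) e = 0\<close>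
  by (subst expct_zero_weight) (auto simp: fins_def)
 moreover have "clus {} (0 :: int ^ 'd) \<subseteq> {0}" by (rule clus_subsetI) auto
 then have "card (clus {} (0 :: int ^ 'd)) \<le> 1" using card_mono[of "{0}" "clus {} (0 :: int ^ 'd)"] by simp
 ultimately have "1 \<le> bc * tail 0 * 1" by (intro susceptibility_lower[where r=0 and ch=1]) simp
 then have "bc \<noteq> 0" by (intro notI) simp
 then show ?thesis using bc_nonneg by simp
qed

text \<open>This is (CL) with exponent 1. Nonzero lattice points have Euclidean norm at least 1, so
  the cluster size is at most 1 plus the sum of norms; the finite gyration moment therefore also
  bounds the mean size, and \<open>chi\<close> is a genuine supremum.\<close>

lemma gyration_bound:
 obtains C where "C > 0" "\<And>r. r \<ge> 1 \<Longrightarrow> \<exists>ch. (\<forall>E\<in>fins. expw (kc r) E csize0 \<le> ch)"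
  "\<And>r E. r \<ge> 1 \<Longrightarrow> E \<in> fins \<Longrightarrow> expw (kc r) E (\<lambda>W. \<Sum>x\<in>clus W 0. norm (real_vec x)) \<le> C * r * chi r"
proof -
 obtain C where C: "\<And>r. r \<ge> 1 \<Longrightarrow> gyration_radius N J 1 r \<le> ennreal (C * r)"
  using CL unfolding correlation_length_condition_def by (metis zero_less_one)
 define C' where "C' = max C 0 + 1"
 let ?nm = "\<lambda>x :: int ^ 'd. norm (real_vec x)"
 let ?e = "\<lambda>r E. expw (kc r) E csize0"
 let ?g = "\<lambda>r E. expw (kc r) E (\<lambda>W. \<Sum>x\<in>clus W 0. ?nm x)"
 have main: "(\<exists>ch. \<forall>E\<in>fins. ?e r E \<le> ch) \<and> (\<forall>E\<in>fins. ?g r E \<le> C' * r * chi r)" if r: "r \<ge> 1" for r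
 proof -
  define G where "G = gyration_moment N J 1 r"
  define S where "S = (\<integral>\<^sup>+\<omega>. size_of (cluster \<omega> 0) \<partial>cutoff_law N J r)"
  have Geq: "G = (\<integral>\<^sup>+\<omega>. (\<integral>\<^sup>+x. ennreal (?nm x) \<partial>count_space (cluster \<omega> 0)) \<partial>law (wt (kc r)))"
   by (simp add: G_def gyration_moment_def cutoff_law_eq)
  have Seq: "S = (\<integral>\<^sup>+\<omega>. (\<integral>\<^sup>+x. ennreal 1 \<partial>count_space (cluster \<omega> 0)) \<partial>law (wt (kc r)))"
   unfolding S_def cutoff_law_eq
   by (intro nn_integral_cong) (simp add: size_of_def emeasure_count_space)
  have fin: "G \<noteq> \<infinity>"
  proof
   assume "G = \<infinity>"
   then have "\<infinity> \<le> ennreal (C * r)" using C[OF r] by (simp add: gyration_radius_def G_def)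
   then show False by (simp add: top_unique)
  qed
  then obtain \<gamma> where \<gamma>: "0 \<le> \<gamma>" "G = ennreal \<gamma>" by (cases G) auto
  have g: "?g r E \<le> \<gamma>" if "E \<in> fins" for E
   using expct_le_cluster_integral[where f="?nm" and w="wt (kc r)" and z=0, OF wt_kc_nonneg _ that] \<gamma>(1)
   by (simp add: Geq[symmetric] \<gamma>(2))
  have nm1: "1 \<le> ?nm x" if x: "x \<noteq> 0" for x
  proof -
   obtain i where "x $ i \<noteq> 0" using x by (auto simp: vec_eq_iff)
   then have "1 \<le> \<bar>real_vec x $ i\<bar>" by (simp flip: of_int_abs)
   then show ?thesis using component_le_norm_cart[of "real_vec x" i] by linarith
  qed
  have e: "?e r E \<le> 1 + \<gamma>" if E: "E \<in> fins" for E
  proof -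
   have "?e r E \<le> expw (kc r) E (\<lambda>W. 1 + (\<Sum>x\<in>clus W 0. ?nm x))"
   proof (rule expct_mono[OF wt_kc_nonneg])
    fix W assume "W \<subseteq> E"
    then have W: "finite (clus W 0)" using finsD[OF E] by (meson finite_clus finite_subset)
    have "csize W 0 = (\<Sum>x\<in>clus W 0. 1)" by simp
    also have "\<dots> \<le> (\<Sum>x\<in>clus W 0. of_bool (x = 0) + ?nm x)" by (intro sum_mono) (use nm1 in auto)
    also have "\<dots> \<le> 1 + (\<Sum>x\<in>clus W 0. ?nm x)"
     using W by (simp add: sum.distrib of_bool_def sum.If_cases)
    finally show "csize W 0 \<le> 1 + (\<Sum>x\<in>clus W 0. ?nm x)" .
   qed
   also have "\<dots> = 1 + ?g r E" using finsD[OF E] by (simp add: expct_add)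
   finally show ?thesis using g[OF E] by simp
  qed
  have bdd: "bdd_above (?e r ` fins)" using e by (intro bdd_aboveI[of _ "1 + \<gamma>"]) auto
  have chi: "?e r E \<le> chi r" if "E \<in> fins" for E
   unfolding chi_def by (rule cSUP_upper[OF that bdd])
  have chi0: "0 \<le> chi r" using chi[of "{}"] expct_nonneg[where k="wt (kc r)" and E="{}" and f="\<lambda>W. csize W 0", OF wt_kc_nonneg] by auto
  have "S \<le> ennreal (chi r)"
   unfolding Seq by (rule cluster_integral_least[OF wt_kc_nonneg]) (use chi in auto)
  moreover have "1 \<le> S"
  proof -
   interpret prob_space "law (wt (kc r))" by (rule prob_space_law)
   have "1 \<le> size_of (cluster \<omega> (0 :: int ^ 'd))" for \<omega>
    by (simp add: cluster_eq_clus many_iff_size[of 1, symmetric, simplified] many_def)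
      (intro exI[of _ "{0}"], auto simp: clus_def)
   then have "(\<integral>\<^sup>+\<omega>. 1 \<partial>law (wt (kc r))) \<le> S"
    unfolding S_def cutoff_law_eq by (intro nn_integral_mono)
   then show ?thesis by (simp add: emeasure_space_1)
  qed
  ultimately obtain \<sigma> where \<sigma>: "S = ennreal \<sigma>" "1 \<le> \<sigma>" "\<sigma> \<le> chi r"
   using chi0 by (cases S) (auto simp: ennreal_le_iff2 top_unique)
  have "ennreal (\<gamma> / \<sigma>) \<le> ennreal (C * r)"
   using C[OF r] fin \<gamma> \<sigma> unfolding gyration_radius_def G_def[symmetric] S_def[symmetric]
   by (simp add: divide_ennreal)
  then have "\<gamma> / \<sigma> \<le> C' * r"
  proof (cases "0 \<le> C * r")
   case True
   then have "\<gamma> / \<sigma> \<le> C * r" using \<open>ennreal (\<gamma> / \<sigma>) \<le> ennreal (C * r)\<close> by (simp add: ennreal_le_iff)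
   also have "\<dots> \<le> C' * r" using r by (intro mult_right_mono) (auto simp: C'_def)
   finally show ?thesis .
  next
   case False
   then have "\<gamma> / \<sigma> \<le> 0"
    using \<open>ennreal (\<gamma> / \<sigma>) \<le> ennreal (C * r)\<close> by (simp add: ennreal_neg ennreal_eq_0_iff)
   also have "0 \<le> C' * r" using r by (auto simp: C'_def)
   finally show ?thesis .
  qed
  then have "\<gamma> \<le> C' * r * \<sigma>" using \<sigma> by (simp add: field_simps)
  also have "\<dots> \<le> C' * r * chi r" using \<sigma> r by (intro mult_left_mono) (auto simp: C'_def)
  finally show ?thesis using e g by force
 qed
 show ?thesis by (rule that[of C']) (use main in \<open>auto simp: C'_def\<close>)
qed

lemma chi_upper: "r \<ge> 1 \<Longrightarrow> E \<in> fins \<Longrightarrow> expw (kc r) E csize0 \<le> chi r"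
proof -
 assume r: "r \<ge> 1" and E: "E \<in> fins"
 obtain ch where "\<And>E. E \<in> fins \<Longrightarrow> expw (kc r) E csize0 \<le> ch"
  using gyration_bound r by metis
 then show ?thesis unfolding chi_def by (intro cSUP_upper[OF E] bdd_aboveI[of _ ch]) auto
qed

lemma chi_least: "(\<And>E. E \<in> fins \<Longrightarrow> expw (kc r) E csize0 \<le> c) \<Longrightarrow> chi r \<le> c"
 unfolding chi_def by (intro cSUP_least) (metis empty_fins empty_iff)+

lemma chi_ge_1: "r \<ge> 1 \<Longrightarrow> 1 \<le> chi r"
proof -
 assume r: "r \<ge> 1"
 have "1 \<le> card (clus {} (0 :: int ^ 'd))" by (simp add: Suc_le_eq card_clus_pos)
 then show ?thesis using chi_upper[OF r empty_fins] by (simp add: expct_def)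
qed

lemma chi_tail: "r \<ge> 1 \<Longrightarrow> 1 \<le> bc * tail r * chi r"
 by (rule susceptibility_lower) (rule chi_upper)

text \<open>Markov's inequality applied to the sum of norms: vertices outside radius B r account for
  at most b C / B of the susceptibility, and \<open>B\<close> is chosen to make this at most
  1/4.\<close>

lemma cluster_localized:
 obtains B where "B \<ge> 1" "\<And>r E. r \<ge> 1 \<Longrightarrow> E \<in> fins \<Longrightarrow>
  expw (kc r) E csize0 \<le>
  expw (kc r) E (vol (ball (B * r))) + chi r / 4"
proof -
 obtain C where C: "C > 0" "\<And>r E. r \<ge> 1 \<Longrightarrow> E \<in> fins \<Longrightarrow>
   expw (kc r) E (\<lambda>W. \<Sum>x\<in>clus W 0. norm (real_vec x)) \<le> C * r * chi r"
  using gyration_bound by metis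
 obtain b where b: "b > 0" "\<And>v. N v \<le> b * norm v" using is_norm_equivalent[OF N] by metis
 define B where "B = 4 * b * C + 1"
 have B: "B \<ge> 1" "B > 0" using b C by (auto simp: B_def add_pos_pos)
 have "expw (kc r) E csize0 \<le>
  expw (kc r) E (vol (ball (B * r))) + chi r / 4"
  if r: "r \<ge> 1" and E: "E \<in> fins" for r E
 proof -
  let ?g = "\<lambda>W. \<Sum>x\<in>clus W 0. norm (real_vec x)"
  have "expw (kc r) E csize0 \<le>
   expw (kc r) E (\<lambda>W. vol (ball (B * r)) W + (b / (B * r)) * ?g W)"
  proof (rule expct_mono[OF wt_kc_nonneg])
   fix W assume "W \<subseteq> E"
   then have W: "finite (clus W 0)" using finsD[OF E] by (meson finite_clus finite_subset)
   have "csize W 0 = (\<Sum>x\<in>clus W 0. 1)" by simp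
   also have "\<dots> \<le> (\<Sum>x\<in>clus W 0. of_bool (x \<in> ball (B * r)) + b / (B * r) * norm (real_vec x))"
   proof (rule sum_mono)
    fix x :: "int ^ 'd"
    show "1 \<le> of_bool (x \<in> ball (B * r)) + b / (B * r) * norm (real_vec x)"
    proof (cases "x \<in> ball (B * r)")
     case False
     then have "B * r < b * norm (real_vec x)" using b(2)[of "real_vec x"] by (simp add: ball_def n_def)
     then show ?thesis using False B r by (simp add: field_simps)
    qed (use b B r in simp)
   qed
   also have "\<dots> = vol (ball (B * r)) W + (b / (B * r)) * ?g W"
    using W by (simp add: sum.distrib sum_distrib_left of_bool_def sum.If_cases Int_def)
   finally show "csize W 0 \<le> vol (ball (B * r)) W + (b / (B * r)) * ?g W" .
  qed
  also have "\<dots> = expw (kc r) E (vol (ball (B * r))) + (b / (B * r)) * expw (kc r) E ?g"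
   by (simp only: expct_add expct_cmult)
  also have "(b / (B * r)) * expw (kc r) E ?g \<le> (b / (B * r)) * (C * r * chi r)"
   using C(2)[OF r E] b B r by (intro mult_left_mono) auto
  also have "\<dots> = b * C / B * chi r" using r by simp
  also have "\<dots> \<le> 1 / 4 * chi r"
   using chi_ge_1[OF r] B by (intro mult_right_mono) (auto simp: B_def field_simps)
  finally show ?thesis by simp
 qed
 then show ?thesis using that[OF B(1)] by blast
qed

end

section \<open>Joining many translates of a good ball\<close>

lemma prb_join:
 assumes k: "\<And>e. 0 \<le> k e" and E: "finite E" and ST: "finite S" "finite T" "S \<inter> T = {}"
  and e: "\<And>u v. u \<in> S \<Longrightarrow> v \<in> T \<Longrightarrow> {u, v} \<in> E" "\<And>u v. u \<in> S \<Longrightarrow> v \<in> T \<Longrightarrow> \<kappa>0 \<le> k {u, v}"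
  and sub: "S \<subseteq> clus A x" "T \<subseteq> clus A y"
 shows "1 - exp (- (\<kappa>0 * (real (card S) * real (card T)))) \<le> prb k E (\<lambda>B. conn (A \<union> B) x y)"
proof -
 define F where "F = (\<lambda>(u, v). {u, v}) ` (S \<times> T)"
 have inj: "inj_on (\<lambda>(u, v). {u, v}) (S \<times> T)"
  using ST(3) by (auto simp: inj_on_def doubleton_eq_iff)
 have cF: "card F = card S * card T"
  unfolding F_def by (simp add: card_image[OF inj] card_cartesian_product)
 have F: "F \<subseteq> E" "finite F" using e(1) ST by (auto simp: F_def)
 have "prb k E (\<lambda>B. B \<inter> F = {}) = prb k F (\<lambda>B. B = {})"
  using expct_restrict[OF F(2,1) E, of k "\<lambda>B. of_bool (B = {})"] by simp
 also have "\<dots> = (\<Prod>e\<in>F. exp (- k e))"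
 proof -
  have "prb k F (\<lambda>B. B = {}) = (\<Sum>B\<in>{{}}. (\<Prod>e\<in>B. 1 - exp (- k e)) * (\<Prod>e\<in>F - B. exp (- k e)) * of_bool (B = {}))"
   unfolding expct_def by (rule sum.mono_neutral_right) (use F in auto)
  then show ?thesis by simp
 qed
 also have "\<dots> \<le> (\<Prod>e\<in>F. exp (- \<kappa>0))"
  by (intro prod_mono) (use e(2) in \<open>auto simp: F_def\<close>)
 also have "\<dots> = exp (- (\<kappa>0 * (real (card S) * real (card T))))"
  by (simp add: cF exp_of_nat_mult[symmetric] mult_ac)
 finally have "1 - exp (- (\<kappa>0 * (real (card S) * real (card T)))) \<le> 1 - prb k E (\<lambda>B. B \<inter> F = {})" by simp
 also have "\<dots> = expct k E (\<lambda>B. 1 - of_bool (B \<inter> F = {}))" using E by (simp add: expct_diff)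
 also have "\<dots> \<le> prb k E (\<lambda>B. conn (A \<union> B) x y)"
 proof (rule expct_mono[OF k])
  fix B assume "B \<subseteq> E"
  have "conn (A \<union> B) x y" if ne: "B \<inter> F \<noteq> {}"
  proof -
   obtain u v where uv: "u \<in> S" "v \<in> T" "{u, v} \<in> B" using ne by (auto simp: F_def)
   have "conn A x u" "conn A y v" using uv sub by (auto simp: clus_def)
   then have 1: "conn (A \<union> B) x u" "conn (A \<union> B) y v" by (auto intro: conn_mono)
   have "conn (A \<union> B) x v" by (rule conn_step[OF 1(1)]) (use uv in simp)
   then show ?thesis using conn_trans[OF _ conn_sym[OF 1(2)]] by blast
  qed
  then show "1 - of_bool (B \<inter> F = {}) \<le> (of_bool (conn (A \<union> B) x y) :: real)" by auto
 qed
 finally show ?thesis .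
qed

lemma sum_clus_Int_lower:
 assumes "finite U" "finite I" "\<And>i. i \<in> I \<Longrightarrow> S i \<subseteq> U \<inter> clus W (x i)"
  "\<And>i j. i \<in> I \<Longrightarrow> j \<in> I \<Longrightarrow> i \<noteq> j \<Longrightarrow> S i \<inter> S j = {}"
 shows "(\<Sum>i\<in>I. \<Sum>j\<in>I. real (card (S i)) * real (card (S j)) * of_bool (conn W (x i) (x j)))
  \<le> (\<Sum>u\<in>U. csize_in W u U)"
proof -
 have finS: "finite (S i)" if "i \<in> I" for i using assms(1,3) that by (meson finite_Int finite_subset)
 have "(\<Sum>j\<in>I. real (card (S i)) * real (card (S j)) * of_bool (conn W (x i) (x j)))
   \<le> (\<Sum>u\<in>S i. csize_in W u U)" if i: "i \<in> I" for i
 proof -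
  define I' where "I' = {j \<in> I. conn W (x i) (x j)}"
  have I': "finite I'" "I' \<subseteq> I" using assms(2) by (auto simp: I'_def)
  have "(\<Sum>j\<in>I. real (card (S j)) * of_bool (conn W (x i) (x j))) = (\<Sum>j\<in>I'. real (card (S j)))"
   using assms(2) by (intro sum.mono_neutral_cong_right) (auto simp: I'_def)
  also have "\<dots> = real (card (\<Union>j\<in>I'. S j))"
  proof (subst card_UN_disjoint)
   show "\<forall>i\<in>I'. finite (S i)" using I' finS by auto
   show "\<forall>i\<in>I'. \<forall>j\<in>I'. i \<noteq> j \<longrightarrow> S i \<inter> S j = {}" using I' assms(4) by (meson subsetD)
  qed (use I' in auto)
  also have "\<dots> \<le> csize_in W u U" if u: "u \<in> S i" for u
  proof -
   have "conn W (x i) u" using assms(3)[OF i] u by (auto simp: clus_def)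
   then have "clus W u = clus W (x i)" by (rule clus_eq[symmetric])
   moreover have "clus W (x j) = clus W (x i)" if "j \<in> I'" for j
    using that clus_eq[of W "x i" "x j"] by (simp add: I'_def)
   ultimately have "(\<Union>j\<in>I'. S j) \<subseteq> clus W u \<inter> U" using assms(3) I'(2) by fastforce
   then show ?thesis using assms(1) by (simp add: card_mono)
  qed
  finally have *: "(\<Sum>j\<in>I. real (card (S j)) * of_bool (conn W (x i) (x j))) \<le> csize_in W u U"
   if "u \<in> S i" for u using that .
  have "(\<Sum>j\<in>I. real (card (S i)) * real (card (S j)) * of_bool (conn W (x i) (x j))) =
    (\<Sum>u\<in>S i. \<Sum>j\<in>I. real (card (S j)) * of_bool (conn W (x i) (x j)))"
   by (simp add: sum_distrib_left mult.assoc)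
  also have "\<dots> \<le> (\<Sum>u\<in>S i. csize_in W u U)" by (rule sum_mono) (rule *)
  finally show ?thesis .
 qed
 then have "(\<Sum>i\<in>I. \<Sum>j\<in>I. real (card (S i)) * real (card (S j)) * of_bool (conn W (x i) (x j)))
   \<le> (\<Sum>i\<in>I. \<Sum>u\<in>S i. csize_in W u U)" by (rule sum_mono)
 also have "\<dots> = (\<Sum>u\<in>(\<Union>i\<in>I. S i). csize_in W u U)"
  using assms(2,4) finS by (subst sum.UNION_disjoint) auto
 also have "\<dots> \<le> (\<Sum>u\<in>U. csize_in W u U)"
  using assms(1,3) by (intro sum_mono2) auto
 finally show ?thesis .
qed

abbreviation tr :: "'v::ab_group_add set \<Rightarrow> 'v \<Rightarrow> 'v set" where
 "tr S z \<equiv> (\<lambda>v. v + z) ` S"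

lemma card_tr [simp]: "card (tr S z) = card S"
 by (rule card_image) (simp add: inj_on_def)

lemma card_clus_shift_Int: "card (clus (shift z W) (x + z) \<inter> tr S z) = card (clus W x \<inter> S)"
 unfolding clus_shift by (subst image_Int[symmetric]) (auto simp: inj_on_def card_image)

lemma has_clus_shift: "has_clus L m W \<Longrightarrow> has_clus (tr L z) m (shift z W)"
 unfolding has_clus_def using card_clus_shift_Int[of z W _ L] by metis

text \<open>On average half of the translates contain a large cluster, and two such clusters have at
  least m^2 potential joining edges of weight \<open>\<kappa>0\<close>, so they join with
  probability at least 1 - 1/e. Counting joined pairs of vertices and averaging over the roots in
  \<open>U\<close> gives the bound; 8 is 2 for joining times 4 for the squared number of good
  translates.\<close>

lemma merge_translates:
 fixes c \<kappa> :: "'v::ab_group_add \<Rightarrow> real"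
 assumes c: "kernel_fn c" and \<kappa>: "kernel_fn \<kappa>" and Z: "finite Z" and L: "finite L" "L \<noteq> {}"
  and disj: "\<And>z z'. z \<in> Z \<Longrightarrow> z' \<in> Z \<Longrightarrow> z \<noteq> z' \<Longrightarrow> tr L z \<inter> tr L z' = {}"
  and E1: "E1 \<in> fins" "1 / 2 \<le> prw c E1 (has_clus L m)"
  and U: "U = (\<Union>z\<in>Z. tr L z)" "U \<noteq> {}"
  and \<kappa>0: "\<And>u v. u \<in> U \<Longrightarrow> v \<in> U \<Longrightarrow> u \<noteq> v \<Longrightarrow> \<kappa>0 \<le> \<kappa> (u - v)" "0 \<le> \<kappa>0" "1 \<le> \<kappa>0 * real m ^ 2"
 shows "\<exists>x\<in>U. \<exists>E\<in>fins. real m ^ 2 * card Z / (8 * card L) \<le>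
  expw (\<lambda>x. c x + \<kappa> x) E (\<lambda>W. csize_in W x U)"
proof -
 have finU: "finite U" using Z L U by auto
 define E where "E = (\<Union>z\<in>Z. shift z E1) \<union> pairs U"
 have E: "E \<in> fins" unfolding E_def by (intro Un_fins UN_fins Z shift_fins E1 pairs_fins finU)
 have finE: "finite E" by (rule finsD[OF E])
 note w = wt_nonneg[OF c] and w' = wt_nonneg[OF \<kappa>]
 let ?good = "\<lambda>z. has_clus (tr L z) m"
 let ?f = "\<lambda>W. \<Sum>u\<in>U. csize_in W u U"
 let ?N = "\<lambda>W. \<Sum>z\<in>Z. of_bool (?good z W) :: real"
 have good: "1 / 2 \<le> prw c E (?good z)" if z: "z \<in> Z" for z
 proof -
  have "1 / 2 \<le> prw c E1 (has_clus L m)" by (rule E1(2))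
  also have "\<dots> \<le> prw c E1 (\<lambda>W. ?good z (shift z W))" by (rule prb_mono[OF w]) (rule has_clus_shift)
  also have "\<dots> = prw c (shift z E1) (?good z)" by (rule expct_shift[OF c finsD[OF E1(1)], symmetric])
  also have "\<dots> \<le> prw c E (?good z)"
   by (rule expct_mono_set[OF w]) (use finE L z in \<open>auto simp: E_def intro!: increasing_of_bool up_closed_has_clus\<close>)
  finally show ?thesis .
 qed
 have inner: "real m ^ 2 / 2 * (?N A)\<^sup>2 \<le> expw \<kappa> E (\<lambda>B. ?f (A \<union> B))" if A: "A \<subseteq> E" for A
 proof -
  define I where "I = {z \<in> Z. ?good z A}"
  have I: "finite I" "I \<subseteq> Z" using Z by (auto simp: I_def)
  have NI: "?N A = card I" using Z by (simp add: I_def of_bool_def sum.If_cases Int_def)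
  have "\<forall>z\<in>I. \<exists>x. m \<le> card (clus A x \<inter> tr L z)" by (auto simp: I_def has_clus_def)
  then obtain x where x: "\<And>z. z \<in> I \<Longrightarrow> m \<le> card (clus A (x z) \<inter> tr L z)" by metis
  define S where "S z = clus A (x z) \<inter> tr L z" for z
  have S: "m \<le> card (S z)" "finite (S z)" "S z \<subseteq> U" "S z \<subseteq> clus A (x z)" "S z \<subseteq> tr L z" if "z \<in> I" for z
   using x[OF that] L I that by (auto simp: S_def U(1))
  have Sd: "S y \<inter> S z = {}" if "y \<in> I" "z \<in> I" "y \<noteq> z" for y z
   using S(5)[OF that(1)] S(5)[OF that(2)] disj[of y z] that I by blast
  have join: "1 / 2 \<le> prw \<kappa> E (\<lambda>B. conn (A \<union> B) (x y) (x z))" if yz: "y \<in> I" "z \<in> I" for y z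
  proof (cases "y = z")
   case True
   then show ?thesis using finE by simp
  next
   case False
   have ne: "u \<noteq> v" if "u \<in> S y" "v \<in> S z" for u v using Sd[OF yz False] that by blast
   have "real m ^ 2 \<le> real (card (S y)) * real (card (S z))"
    unfolding power2_eq_square using S(1)[OF yz(1)] S(1)[OF yz(2)] by (intro mult_mono) auto
   then have "1 \<le> \<kappa>0 * (real (card (S y)) * real (card (S z)))"
    using \<kappa>0(2,3) by (meson mult_left_mono order_trans)
   then have "exp (- (\<kappa>0 * (real (card (S y)) * real (card (S z))))) \<le> exp (- 1)" by simp
   also have "exp (- 1) \<le> (1 / 2 :: real)" using exp_ge_add_one_self[of 1] by (simp add: exp_minus field_simps)
   finally have "1 / 2 \<le> 1 - exp (- (\<kappa>0 * (real (card (S y)) * real (card (S z)))))" by simp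
   also have "\<dots> \<le> prw \<kappa> E (\<lambda>B. conn (A \<union> B) (x y) (x z))"
   proof (rule prb_join[OF w' finE S(2)[OF yz(1)] S(2)[OF yz(2)] Sd[OF yz False] _ _ S(4)[OF yz(1)] S(4)[OF yz(2)]])
    fix u v assume uv: "u \<in> S y" "v \<in> S z"
    then have "u \<in> U" "v \<in> U" "u \<noteq> v" using S(3)[OF yz(1)] S(3)[OF yz(2)] ne[OF uv] by auto
    then show "{u, v} \<in> E" "\<kappa>0 \<le> wt \<kappa> {u, v}"
     using \<kappa>0(1)[of u v] by (auto simp: E_def pairs_def edges_pair wt_pair[OF \<kappa>])
   qed
   finally show ?thesis .
  qed
  have "real m ^ 2 / 2 * (?N A)\<^sup>2 = (\<Sum>y\<in>I. \<Sum>z\<in>I. real m * real m * (1 / 2))"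
   unfolding NI by (simp add: power2_eq_square)
  also have "\<dots> \<le> (\<Sum>y\<in>I. \<Sum>z\<in>I. (real (card (S y)) * real (card (S z))) * prw \<kappa> E (\<lambda>B. conn (A \<union> B) (x y) (x z)))"
   using S(1) by (intro sum_mono mult_mono join) auto
  also have "\<dots> = expw \<kappa> E (\<lambda>B. \<Sum>y\<in>I. \<Sum>z\<in>I. real (card (S y)) * real (card (S z)) * of_bool (conn (A \<union> B) (x y) (x z)))"
   by (simp add: expct_sum expct_cmult)
  also have "\<dots> \<le> expw \<kappa> E (\<lambda>B. ?f (A \<union> B))"
  proof (rule expct_mono[OF w'], rule sum_clus_Int_lower[OF finU I(1) _ Sd])
   fix B i assume "i \<in> I"
   then show "S i \<subseteq> U \<inter> clus (A \<union> B) (x i)"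
    using S(3,4)[of i] clus_mono[of A "A \<union> B" "x i"] by auto
  qed
  finally show ?thesis .
 qed
 have "real (card Z) / 2 = (\<Sum>z\<in>Z. 1 / 2)" by simp
 also have "\<dots> \<le> (\<Sum>z\<in>Z. prw c E (?good z))" by (rule sum_mono) (rule good)
 also have "\<dots> = expw c E ?N" by (simp add: expct_sum)
 finally have EN: "real (card Z) / 2 \<le> expw c E ?N" .
 have "(real (card Z) / 2)\<^sup>2 \<le> (expw c E ?N)\<^sup>2" using EN by (intro power_mono) auto
 also have "\<dots> \<le> expw c E (\<lambda>W. (?N W)\<^sup>2)"
  using expct_Cauchy_Schwarz[of "wt c" E ?N "\<lambda>_. 1", OF w] finE by simp
 finally have "real m ^ 2 / 2 * (real (card Z) / 2)\<^sup>2 \<le> real m ^ 2 / 2 * expw c E (\<lambda>W. (?N W)\<^sup>2)"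
  by (intro mult_left_mono) auto
 also have "\<dots> = expw c E (\<lambda>A. real m ^ 2 / 2 * (?N A)\<^sup>2)" by (simp only: expct_cmult)
 also have "\<dots> \<le> expw c E (\<lambda>A. expw \<kappa> E (\<lambda>B. ?f (A \<union> B)))"
  by (rule expct_mono[OF w]) (rule inner)
 also have "\<dots> = expct (\<lambda>e. wt c e + wt \<kappa> e) E ?f" by (rule expct_add_weight[OF finE, symmetric])
 also have "(\<lambda>e. wt c e + wt \<kappa> e) = wt (\<lambda>x. c x + \<kappa> x)" using wt_add[OF c \<kappa>] by auto
 also have "expw (\<lambda>x. c x + \<kappa> x) E ?f = (\<Sum>u\<in>U. expw (\<lambda>x. c x + \<kappa> x) E (\<lambda>W. csize_in W u U))"
  by (rule expct_sum)
 finally have total: "real m ^ 2 / 2 * (real (card Z) / 2)\<^sup>2 \<le>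
   (\<Sum>u\<in>U. expw (\<lambda>x. c x + \<kappa> x) E (\<lambda>W. csize_in W u U))" (is "_ \<le> sum ?g U") .
 have cU: "card U = card Z * card L" unfolding U(1) using Z L disj by (subst card_UN_disjoint) auto
 have pos: "card U > 0" using finU U(2) by (simp add: card_gt_0_iff)
 show ?thesis
 proof (rule ccontr)
  let ?b = "real m ^ 2 * card Z / (8 * card L)"
  assume "\<not> ?thesis"
  then have "?g u < ?b" if "u \<in> U" for u using E that by (auto simp: not_le)
  then have "sum ?g U < (\<Sum>u\<in>U. ?b)" using finU U(2) by (intro sum_strict_mono) auto
  also have "\<dots> = real m ^ 2 / 2 * (real (card Z) / 2)\<^sup>2"
   using pos by (simp add: cU power2_eq_square)
  finally show False using total by simp
 qed
qed

section \<open>Moments of the volume in a ball\<close>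

text \<open>As m \<ge> n, a cluster with \<open>m\<close> vertices in \<open>L\<close> makes all of
  them count, so \<open>big_count\<close> is at least \<open>m\<close> and Markov's inequality
  applies.\<close>

lemma prb_half_of_big_count:
 assumes k: "\<And>e. 0 \<le> k e" and L: "finite L" and m: "2 * expct k E (big_count L n) \<le> m" "n \<le> real m" "m > 0"
 shows "prb k E (has_clus L m) \<le> 1 / 2"
proof -
 have "real m * prb k E (has_clus L m) = expct k E (\<lambda>W. real m * of_bool (has_clus L m W))"
  by (simp add: expct_cmult)
 also have "\<dots> \<le> expct k E (big_count L n)"
 proof (rule expct_mono[OF k])
  fix W assume "W \<subseteq> E"
  show "real m * of_bool (has_clus L m W) \<le> big_count L n W"
  proof (cases "has_clus L m W")
   case True
   then obtain x where x: "m \<le> card (clus W x \<inter> L)" by (auto simp: has_clus_def)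
   have "real m \<le> csize_in W x L" using x by simp
   also have "\<dots> = (\<Sum>y\<in>clus W x \<inter> L. 1)" by simp
   also have "\<dots> \<le> (\<Sum>y\<in>L. of_bool (n \<le> csize_in W y L))"
   proof -
    have nx: "n \<le> csize_in W x L" using x m(2) by linarith
    have one: "of_bool (n \<le> csize_in W y L) = (1 :: real)" if "y \<in> clus W x" for y
    proof -
     have "conn W x y" using that by (simp add: clus_def)
     then have "clus W y = clus W x" using clus_eq by metis
     then show ?thesis using nx by simp
    qed
    have "(\<Sum>y\<in>clus W x \<inter> L. 1 :: real) = (\<Sum>y\<in>clus W x \<inter> L. of_bool (n \<le> csize_in W y L))"
     by (rule sum.cong) (simp_all only: one Int_iff)
    also have "\<dots> \<le> (\<Sum>y\<in>L. of_bool (n \<le> csize_in W y L))"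
     using L by (intro sum_mono2) auto
    finally show ?thesis .
   qed
   finally show ?thesis using True by (simp add: big_count_def)
  qed (simp add: big_count_def sum_nonneg)
 qed
 also have "\<dots> \<le> real m * (1 / 2)" using m(1) by simp
 finally show ?thesis using m(3) by (simp only: mult_le_cancel_left_pos of_nat_0_less_iff)
qed

lemma expct_big_count_le:
 assumes c: "kernel_fn c" and E: "E \<in> fins" and L: "finite L" and n: "n > 0"
 shows "expw c E (big_count L n) \<le> card L * (2 * ghost_prob c (1 / n))"
proof -
 have "expw c E (big_count L n) = (\<Sum>x\<in>L. prw c E (\<lambda>W. n \<le> csize_in W x L))"
  by (simp add: big_count_def[abs_def] expct_sum)
 also have "\<dots> \<le> (\<Sum>x\<in>L. 2 * ghost_prob c (1 / n))"
 proof (rule sum_mono)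
  fix x
  have "prw c E (\<lambda>W. n \<le> csize_in W x L) \<le> prw c E (\<lambda>W. n \<le> csize W x)"
  proof (rule prb_mono[OF wt_nonneg[OF c]])
   fix W assume "W \<subseteq> E" "n \<le> csize_in W x L"
   moreover have "finite (clus W x)" using \<open>W \<subseteq> E\<close> finsD[OF E] by (meson finite_clus finite_subset)
   then have "card (clus W x \<inter> L) \<le> card (clus W x)" by (intro card_mono) auto
   ultimately show "n \<le> csize W x" by linarith
  qed
  also have "\<dots> \<le> 2 * ghost_prob c (1 / n)" by (rule prb_card_ge_le[OF c E n])
  finally show "prw c E (\<lambda>W. n \<le> csize_in W x L) \<le> 2 * ghost_prob c (1 / n)" .
 qed
 finally show ?thesis by simp
qed

text \<open>The moment at the origin is copied to every root in \<open>A\<close>; the translate of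
  \<open>A\<close> around each root stays in \<open>L\<close>, so the sum over roots is a vertex sum
  controlled by \<open>expct_cluster_moment\<close>.\<close>

lemma expct_ball_moment:
 fixes c :: "int ^ 'd \<Rightarrow> real" and n \<mu> :: real and m p :: nat
 assumes c: "kernel_fn c" and n: "n > 0" and p: "1 \<le> p" and m: "1 \<le> m" and A: "finite A" "finite L"
  and AL: "\<And>x y. x \<in> A \<Longrightarrow> y \<in> A \<Longrightarrow> x + y \<in> L" "0 \<in> A"
  and half: "\<And>E. E \<in> fins \<Longrightarrow> prw c E (has_clus L m) \<le> 1 / 2" and E0: "E0 \<in> fins"
 defines "\<mu> \<equiv> ghost_prob c (1 / n)"
 shows "card A * expw c E0 (\<lambda>W. vol A W ^ p) \<le>
  2 * n ^ p * card L * \<mu> + moment_const p * real m ^ p * (2 * card L * \<mu> + m)"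
proof -
 note w = wt_nonneg[OF c]
 define E where "E = (\<Union>x\<in>A. shift x E0)"
 have E: "E \<in> fins" unfolding E_def by (intro UN_fins A shift_fins E0)
 have sub: "A \<subseteq> L" using AL by fastforce
 have "card A * expw c E0 (\<lambda>W. vol A W ^ p) =
   (\<Sum>x\<in>A. expw c E0 (\<lambda>W. vol A W ^ p))" by simp
 also have "\<dots> \<le> (\<Sum>x\<in>A. expw c E (\<lambda>W. csize_in W x L ^ p))"
 proof (rule sum_mono)
  fix x assume x: "x \<in> A"
  have "expw c E0 (\<lambda>W. vol A W ^ p) =
    expw c (shift x E0) (\<lambda>W. csize_in W x (tr A x) ^ p)"
   unfolding expct_shift[OF c finsD[OF E0]] using card_clus_shift_Int[of x _ 0 A] by simp
  also have "\<dots> \<le> expw c (shift x E0) (\<lambda>W. csize_in W x L ^ p)"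
  proof (intro expct_mono[OF w] power_mono of_nat_mono card_mono)
   show "clus W x \<inter> tr A x \<subseteq> clus W x \<inter> L" for W using AL(1) x by auto
  qed (use A in auto)
  also have "\<dots> \<le> expw c E (\<lambda>W. csize_in W x L ^ p)"
  proof (rule expct_mono_set[OF w _ finsD[OF E]])
   show "increasing_on E (\<lambda>W. csize_in W x L ^ p)"
    unfolding increasing_on_def using A by (auto intro!: power_mono card_clus_Int_mono)
  qed (use x in \<open>auto simp: E_def\<close>)
  finally show "expw c E0 (\<lambda>W. vol A W ^ p) \<le> expw c E (\<lambda>W. csize_in W x L ^ p)" .
 qed
 also have "\<dots> \<le> (\<Sum>x\<in>L. expw c E (\<lambda>W. csize_in W x L ^ p))"
  using A sub by (intro sum_mono2 expct_nonneg[OF w]) auto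
 also have "\<dots> \<le> n ^ (p - 1) * (\<Sum>x\<in>L. expw c E (\<lambda>W. min (csize_in W x L) n)) +
   moment_const p * real m ^ p * (card L * (2 * \<mu>) + m)"
  unfolding \<mu>_def by (rule expct_cluster_moment[OF w finsD[OF E] A(2) m p half[OF E] n expct_big_count_le[OF c E A(2) n]])
 also have "(\<Sum>x\<in>L. expw c E (\<lambda>W. min (csize_in W x L) n)) \<le> (\<Sum>x\<in>L. 2 * n * \<mu>)"
 proof (rule sum_mono)
  fix x
  have "expw c E (\<lambda>W. min (csize_in W x L) n) \<le> expw c E (\<lambda>W. min (csize W x) n)"
  proof (rule expct_mono[OF w])
   fix W assume "W \<subseteq> E"
   then have "finite (clus W x)" using finsD[OF E] by (meson finite_clus finite_subset)
   then have "card (clus W x \<inter> L) \<le> card (clus W x)" by (intro card_mono) auto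
   then show "min (csize_in W x L) n \<le> min (csize W x) n" by simp
  qed
  also have "\<dots> \<le> 2 * n * \<mu>" unfolding \<mu>_def by (rule expct_min_card_le[OF c E n])
  finally show "expw c E (\<lambda>W. min (csize_in W x L) n) \<le> 2 * n * \<mu>" .
 qed
 finally have "card A * expw c E0 (\<lambda>W. vol A W ^ p) \<le>
   n ^ (p - 1) * (\<Sum>x\<in>L. 2 * n * \<mu>) + moment_const p * real m ^ p * (card L * (2 * \<mu>) + m)"
  using n by simp
 also have "n ^ (p - 1) * (\<Sum>x\<in>L. 2 * n * \<mu>) = 2 * n ^ p * card L * \<mu>"
  using p by (cases p) (simp_all add: mult_ac)
 finally show ?thesis by (simp only: mult.assoc mult.left_commute[of "real (card L)"] of_nat_mult of_nat_numeral)
qed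

section \<open>The volume of the cluster in a ball\<close>

context crit
begin

definition kb :: "real \<Rightarrow> real \<Rightarrow> int ^ 'd \<Rightarrow> real" where "kb \<beta> r x = \<beta> * cut r x"

lemma kb_kernel_fn: "0 \<le> \<beta> \<Longrightarrow> kernel_fn (kb \<beta> r)"
 unfolding kb_def[abs_def] by (intro kernel_fn_cmult cut_kernel_fn)

lemma kb_bc: "kb bc r = kc r" by (auto simp: kb_def kc_def)

text \<open>One half of a dichotomy for the normalized volume, measured by \<open>Y\<close>. The
  bound for the ghost integral between ranges s and 2 s controls the magnetization, and the moment
  bound returns the volume. The coefficient of \<open>Y\<close> carries the small factor
  \<open>a\<close>, so a large \<open>Y\<close> cannot persist without clusters of size of order
  \<open>a * sqrt Y * s powr (p / 2)\<close>.\<close>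

lemma few_large_clusters:
 obtains C2 C3 s1 where "C2 > 0" "C3 > 0" "s1 \<ge> 1"
  "\<And>\<beta> s a m Y E. bc / 2 \<le> \<beta> \<Longrightarrow> \<beta> \<le> bc \<Longrightarrow> s1 \<le> s \<Longrightarrow> 0 < Y \<Longrightarrow> 0 < a \<Longrightarrow> a \<le> 1 \<Longrightarrow> 1 \<le> m \<Longrightarrow>
   (\<And>E. E \<in> fins \<Longrightarrow> expw (kb \<beta> (2 * s)) E (vol (ball (2 * s))) \<le> 2 powr \<alpha> * Y * s powr \<alpha>) \<Longrightarrow>
   (\<And>E. E \<in> fins \<Longrightarrow> prw (kb \<beta> s) E (has_clus (ball (2 * s)) m) \<le> 1 / 2) \<Longrightarrow>
   real m \<le> 2 * a * sqrt Y * s powr (p / 2) \<Longrightarrow> E \<in> fins \<Longrightarrow>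
   expw (kb \<beta> s) E (vol (ball s)) \<le> (C2 + C3 * a * Y) * s powr \<alpha>"
proof -
 let ?d = "real CARD('d)"
 obtain R0 lo hi j2 t0 where R0: "R0 \<ge> 1" and pos: "lo > 0" "hi > 0" "j2 > 0" "t0 > 0"
  and lo: "\<And>r. r \<ge> 1 \<Longrightarrow> lo * r powr ?d \<le> card (ball r)"
  and hi: "\<And>r. r \<ge> 1 \<Longrightarrow> card (ball r) \<le> hi * r powr ?d"
  and j2: "\<And>r. R0 \<le> r \<Longrightarrow> J r \<le> j2 * r powr (- p)"
  and t0: "\<And>r. R0 \<le> r \<Longrightarrow> t0 * r powr (- \<alpha>) \<le> tail r - tail (2 * r)"
  using kernel_bounds by metis
 define C1 where "C1 = 2 / (bc * t0) + bc * j2 * 2 powr \<alpha>"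
 define h where "h = hi * 2 powr ?d"
 define mc where "mc = moment_const 1"
 have C1: "C1 > 0" and h: "h > 0" and mc: "mc > 0"
  using bc_pos pos by (auto simp: C1_def h_def mc_def moment_const_pos intro!: add_pos_pos)
 show ?thesis
 proof (rule that[of "2 * h * C1 / lo" "mc * (4 * h * C1 + 4) / lo" R0])
  show "2 * h * C1 / lo > 0" "mc * (4 * h * C1 + 4) / lo > 0"
   using C1 h mc pos by (auto intro!: add_pos_pos mult_pos_pos divide_pos_pos)
  show "1 \<le> R0" by fact
 next
  fix \<beta> s a Y :: real and m :: nat and E :: "(int ^ 'd) set set"
  assume \<beta>: "bc / 2 \<le> \<beta>" "\<beta> \<le> bc" and s: "R0 \<le> s" and Y: "0 < Y" and a: "0 < a" "a \<le> 1" and m: "1 \<le> m"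
   and X: "\<And>E. E \<in> fins \<Longrightarrow> expw (kb \<beta> (2 * s)) E (vol (ball (2 * s))) \<le> 2 powr \<alpha> * Y * s powr \<alpha>"
   and half: "\<And>E. E \<in> fins \<Longrightarrow> prw (kb \<beta> s) E (has_clus (ball (2 * s)) m) \<le> 1 / 2"
   and ma: "real m \<le> 2 * a * sqrt Y * s powr (p / 2)" and E: "E \<in> fins"
  have s0: "s > 0" "s \<ge> 1" using s R0 by auto
  have \<beta>0: "\<beta> > 0" using \<beta> bc_pos by simp
  define z q S D where "z = s powr (p / 2)" and "q = sqrt Y" and "S = s powr \<alpha>" and "D = s powr ?d"
  have zq: "z > 0" "q > 0" "S > 0" "D > 0" using s0 Y by (auto simp: z_def q_def S_def D_def)
  have z2: "z * z = S * D"
   unfolding z_def S_def D_def using s0 by (simp add: powr_add[symmetric] p_def add.commute)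
  have q2: "q * q = Y" using Y by (simp add: q_def)
  define c where "c = kb \<beta> s"
  define \<kappa> where "\<kappa> = (\<lambda>x. \<beta> * (cut (2 * s) x - cut s x))"
  have c: "kernel_fn c" unfolding c_def by (rule kb_kernel_fn) (use \<beta>0 in simp)
  have \<kappa>: "kernel_fn \<kappa>"
   using \<beta>0 cut_mono[of s "2 * s"] s0 cut_kernel_fn[of s] cut_kernel_fn[of "2 * s"] by (auto simp: kernel_fn_def \<kappa>_def)
  have c\<kappa>: "(\<lambda>x. c x + \<kappa> x) = kb \<beta> (2 * s)" by (auto simp: c_def \<kappa>_def kb_def algebra_simps)
  \<comment> \<open>Balances the two terms 1 / (n \<Delta>) and n km Y S in the bound for \<mu>, up
    to constants: \<Delta> is at least of order 1 / S, and km is of order 1 / z^2.\<close>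
  define n where "n = z / q"
  have n: "n > 0" using zq by (simp add: n_def)
  define \<mu> where "\<mu> = ghost_prob c (1 / n)"
  have "\<mu> \<le> C1 * q * S / z"
  proof -
   define \<Delta> where "\<Delta> = sum \<kappa> (ball (2 * s))"
   have "\<Delta> = \<beta> * (tail s - tail (2 * s))"
    unfolding \<Delta>_def \<kappa>_def using tail_diff[of s "2 * s"] s0 by (simp add: sum_distrib_left)
   moreover have "bc / 2 * (t0 * s powr (- \<alpha>)) \<le> \<beta> * (tail s - tail (2 * s))"
    using \<beta> t0[OF s] pos \<beta>0 by (intro mult_mono) auto
   ultimately have \<Delta>: "bc * t0 / (2 * S) \<le> \<Delta>" by (simp add: S_def powr_minus field_simps)
   moreover have "0 < bc * t0 / (2 * S)" using bc_pos pos zq by simp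
   ultimately have \<Delta>0: "\<Delta> > 0" by linarith
   define km where "km = bc * j2 / (z * z)"
   have km: "\<kappa> x \<le> km" for x
   proof -
    have "\<kappa> x \<le> \<beta> * J s" unfolding \<kappa>_def using \<beta>0 s0 by (intro mult_left_mono cut_diff_le) auto
    also have "\<dots> \<le> bc * (j2 * s powr (- p))"
     using \<beta> j2[OF s] \<beta>0 J_pos[OF s0(1)] by (intro mult_mono) auto
    also have "\<dots> = km" using s0 by (simp add: km_def z_def powr_add[symmetric] powr_minus field_simps)
    finally show ?thesis .
   qed
   have ch: "expw (\<lambda>x. c x + \<kappa> x) E csize0 \<le> chi (2 * s)" if E: "E \<in> fins" for E
   proof -
    have "expw (kb \<beta> (2 * s)) E csize0 \<le> expw (kc (2 * s)) E csize0"
    proof (rule expct_kernel_mono[OF kb_kernel_fn kc_kernel_fn _ E increasing_on_card_clus[OF finsD[OF E]]])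
     show "kb \<beta> (2 * s) x \<le> kc (2 * s) x" for x
      unfolding kb_def kc_def using \<beta> kernel_fn_nonneg[OF cut_kernel_fn] by (intro mult_right_mono) auto
    qed (use \<beta>0 in simp)
    also have "\<dots> \<le> chi (2 * s)" by (rule chi_upper[OF _ E]) (use s0 in simp)
    finally show ?thesis by (simp add: c\<kappa>)
   qed
   have I: "ghost_int c (1 / n) \<le> (1 / n)\<^sup>2 / (2 * \<Delta>) + km * (2 powr \<alpha> * Y * S) / 2"
   proof (rule ghost_int_bound[OF c \<kappa> finite_ball[of "2 * s"] _ km \<Delta>_def \<Delta>0 _ _ ch])
    show "\<kappa> x = 0" if "x \<notin> ball (2 * s)" for x
     using that s0 cut_outside[OF that] cut_outside[of x s] ball_mono[of s "2 * s"] by (auto simp: \<kappa>_def)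
    show "expw (\<lambda>x. c x + \<kappa> x) E (vol (ball (2 * s))) \<le> 2 powr \<alpha> * Y * S" if "E \<in> fins" for E
     using X[OF that] by (simp add: c\<kappa> S_def)
   qed (use n in auto)
   have "1 / n / 2 * \<mu> \<le> ghost_int c (1 / n)" unfolding \<mu>_def by (rule half_ghost_int[OF c]) (use n in simp)
   then have "2 * n * (1 / n / 2 * \<mu>) \<le> 2 * n * ((1 / n)\<^sup>2 / (2 * \<Delta>) + km * (2 powr \<alpha> * Y * S) / 2)"
    using I n by (intro mult_left_mono) auto
   then have "\<mu> \<le> 1 / n / \<Delta> + n * km * (2 powr \<alpha> * Y * S)"
    using n by (simp add: power2_eq_square distrib_left)
   also have "1 / n / \<Delta> \<le> 1 / n / (bc * t0 / (2 * S))"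
    using \<Delta> n bc_pos pos zq \<Delta>0 by (intro divide_left_mono) (auto intro!: divide_pos_pos mult_pos_pos)
   also have "1 / n / (bc * t0 / (2 * S)) + n * km * (2 powr \<alpha> * Y * S) = C1 * q * S / z"
    unfolding n_def km_def C1_def q2[symmetric] using zq bc_pos pos by (simp add: field_simps)
   finally show ?thesis by simp
  qed
  moreover have "0 \<le> \<mu>" unfolding \<mu>_def by (rule ghost_prob_bounds[OF c]) (use n in simp)
  ultimately have \<mu>: "0 \<le> \<mu>" "\<mu> \<le> C1 * q * S / z" by auto
  have L: "real (card (ball (2 * s))) \<le> h * D"
   using hi[of "2 * s"] s0 by (simp add: h_def D_def powr_mult mult.assoc)
  have nm: "n * \<mu> \<le> C1 * S"
   using mult_left_mono[OF \<mu>(2), of n] zq by (simp add: n_def)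
  have Lm: "real (card (ball (2 * s))) * \<mu> \<le> h * C1 * (q * z)"
  proof -
   have "real (card (ball (2 * s))) * \<mu> \<le> (h * D) * (C1 * q * S / z)"
    using L \<mu> h zq by (intro mult_mono) auto
   also have "\<dots> = h * C1 * q * (S * D) / z" by simp
   also have "\<dots> = h * C1 * (q * z)" using zq by (simp flip: z2)
   finally show ?thesis .
  qed
  have mz: "real m \<le> 2 * a * (q * z)" using ma by (simp add: q_def z_def)
  let ?e = "expw c E (vol (ball s))"
  have "lo * D * ?e \<le> card (ball s) * ?e"
   using lo[of s] s0 by (intro mult_right_mono expct_nonneg wt_nonneg[OF c]) (auto simp: D_def)
  also have "\<dots> \<le> 2 * (n * (card (ball (2 * s)) * \<mu>)) + mc * real m * (2 * (card (ball (2 * s)) * \<mu>) + m)"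
  proof -
   have "x \<in> ball s \<Longrightarrow> y \<in> ball s \<Longrightarrow> x + y \<in> ball (2 * s)" for x y
    using n_add[of x y] by (simp add: ball_def)
   then show ?thesis
    using expct_ball_moment[OF c n _ m finite_ball[of s] finite_ball[of "2 * s"], of 1 E] half E s0
    by (simp add: \<mu>_def c_def mc_def mult_ac)
  qed
  also have "\<dots> \<le> 2 * (h * D * (C1 * S)) + mc * (2 * a * (q * z)) * (2 * (h * C1 * (q * z)) + 2 * a * (q * z))"
  proof -
   have "n * (card (ball (2 * s)) * \<mu>) = card (ball (2 * s)) * (n * \<mu>)" by simp
   also have "\<dots> \<le> (h * D) * (C1 * S)" using h zq n \<mu> by (intro mult_mono[OF L nm]) auto
   finally have 1: "n * (card (ball (2 * s)) * \<mu>) \<le> h * D * (C1 * S)" .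
   have 2: "mc * real m \<le> mc * (2 * a * (q * z))" using mz mc by (intro mult_left_mono) auto
   have 3: "2 * (card (ball (2 * s)) * \<mu>) + m \<le> 2 * (h * C1 * (q * z)) + 2 * a * (q * z)"
    using Lm mz by linarith
   have "mc * real m * (2 * (card (ball (2 * s)) * \<mu>) + m) \<le>
     mc * (2 * a * (q * z)) * (2 * (h * C1 * (q * z)) + 2 * a * (q * z))"
    by (rule mult_mono[OF 2 3]) (use mc a zq \<mu> in auto)
   then show ?thesis using 1 by linarith
  qed
  also have "\<dots> = D * S * (2 * h * C1) + mc * (4 * a * h * C1 + 4 * (a * a)) * ((q * q) * (z * z))"
   by (simp add: algebra_simps)
  also have "\<dots> \<le> D * S * (2 * h * C1) + mc * (4 * a * h * C1 + 4 * a) * ((q * q) * (z * z))"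
   using a mc zq by (intro add_left_mono mult_right_mono mult_left_mono) (auto simp: mult_left_le)
  also have "\<dots> = lo * D * ((2 * h * C1 / lo + mc * (4 * h * C1 + 4) / lo * a * Y) * S)"
   unfolding q2 z2 using pos by (simp add: field_simps)
  finally have "?e \<le> (2 * h * C1 / lo + mc * (4 * h * C1 + 4) / lo * a * Y) * S"
   using pos zq by (simp only: mult_le_cancel_left_pos mult_pos_pos)
  then show "expw (kb \<beta> s) E (vol (ball s)) \<le>
    (2 * h * C1 / lo + mc * (4 * h * C1 + 4) / lo * a * Y) * s powr \<alpha>"
   by (simp add: c_def S_def)
 qed
qed

text \<open>For a separated set of maximal size the balls of radius \<open>r\<close> around its
  points cover \<open>ball R\<close>; otherwise an uncovered point could be added.\<close>

lemma separated_set: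
 assumes "1 \<le> r"
 obtains Z where "finite Z" "Z \<subseteq> ball R" "\<And>z z'. z \<in> Z \<Longrightarrow> z' \<in> Z \<Longrightarrow> z \<noteq> z' \<Longrightarrow> r < n (z - z')"
  "card (ball R) \<le> card Z * card (ball r)"
proof -
 define sep where "sep Z \<longleftrightarrow> Z \<subseteq> ball R \<and> (\<forall>z\<in>Z. \<forall>z'\<in>Z. z \<noteq> z' \<longrightarrow> r < n (z - z'))" for Z
 have "sep {}" by (simp add: sep_def)
 moreover have "\<forall>Z. sep Z \<longrightarrow> card Z < Suc (card (ball R))"
  by (auto simp: sep_def less_Suc_eq_le intro!: card_mono)
 ultimately obtain Z where Z: "sep Z" "\<And>Z'. sep Z' \<Longrightarrow> card Z' \<le> card Z"
  using ex_has_greatest_nat[of sep "{}" card "Suc (card (ball R))"] by auto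
 have fin: "finite Z" using Z(1) finite_subset[OF _ finite_ball] by (auto simp: sep_def)
 have "ball R \<subseteq> (\<Union>z\<in>Z. tr (ball r) z)"
 proof
  fix x assume x: "x \<in> ball R"
  have "\<exists>z\<in>Z. n (x - z) \<le> r"
  proof (rule ccontr)
   assume neg: "\<not> ?thesis"
   then have "x \<notin> Z" using assms by auto
   moreover have "sep (insert x Z)"
    using Z(1) x neg n_simps(2)[of "x - _"] by (auto simp: sep_def not_le)
   ultimately show False using Z(2)[of "insert x Z"] fin by simp
  qed
  then obtain z where "z \<in> Z" "n (x - z) \<le> r" by blast
  then show "x \<in> (\<Union>z\<in>Z. tr (ball r) z)"
   by (intro UN_I[of z] rev_image_eqI[of "x - z"]) (auto simp: ball_def)
 qed
 then have "card (ball R) \<le> card (\<Union>z\<in>Z. tr (ball r) z)" using fin by (intro card_mono) auto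
 also have "\<dots> \<le> (\<Sum>z\<in>Z. card (tr (ball r) z))" by (rule card_UN_le[OF fin])
 also have "\<dots> = card Z * card (ball r)" by simp
 finally show ?thesis using Z(1) fin by (intro that[of Z]) (auto simp: sep_def)
qed

text \<open>The other half of the dichotomy. At range L s there is room for of order L^d disjoint
  translates, whose large clusters are joined by the new edges. The gain L^d beats the normalization
  L^\<alpha> because \<alpha> < d, and this fixes the choice of \<open>L\<close>.\<close>

lemma many_large_clusters:
 assumes \<alpha>d: "\<alpha> < real CARD('d)" and a: "a > 0"
 obtains L Y1 s1 where "L \<ge> 2" "Y1 > 0" "s1 \<ge> 1"
  "\<And>\<beta> s m Y E. bc / 2 \<le> \<beta> \<Longrightarrow> \<beta> \<le> bc \<Longrightarrow> s1 \<le> s \<Longrightarrow> Y1 \<le> Y \<Longrightarrow> a * sqrt Y * s powr (p / 2) \<le> real m \<Longrightarrow>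
   E \<in> fins \<Longrightarrow> 1 / 2 \<le> prw (kb \<beta> s) E (has_clus (ball (2 * s)) m) \<Longrightarrow>
   \<exists>E\<in>fins. Y * (L * s) powr \<alpha> \<le> expw (kb \<beta> (L * s)) E (vol (ball (L * s)))"
proof -
 let ?d = "real CARD('d)"
 obtain R0 lo hi j1 where R0: "R0 \<ge> 1" and pos: "lo > 0" "hi > 0" "j1 > 0"
  and lo: "\<And>r. r \<ge> 1 \<Longrightarrow> lo * r powr ?d \<le> card (ball r)"
  and hi: "\<And>r. r \<ge> 1 \<Longrightarrow> card (ball r) \<le> hi * r powr ?d"
  and j1: "\<And>r s. R0 \<le> r \<Longrightarrow> r \<le> s \<Longrightarrow> j1 * (r powr (- p) - s powr (- p)) \<le> J r - J s"
  using kernel_bounds by metis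
 define h where "h = hi * 2 powr ?d"
 define c0 where "c0 = lo / (hi * 32 powr ?d)"
 have hc: "h > 0" "c0 > 0" using pos by (auto simp: h_def c0_def)
 define L where "L = max 16 ((8 * h / (a\<^sup>2 * c0)) powr (1 / (?d - \<alpha>)))"
 have L: "L \<ge> 16" "L > 0" "8 * h / (a\<^sup>2 * c0) \<le> L powr (?d - \<alpha>)"
 proof -
  show "L \<ge> 16" "L > 0" by (auto simp: L_def)
  have "8 * h / (a\<^sup>2 * c0) = ((8 * h / (a\<^sup>2 * c0)) powr (1 / (?d - \<alpha>))) powr (?d - \<alpha>)"
   using hc a \<alpha>d by (simp add: powr_powr)
  also have "\<dots> \<le> L powr (?d - \<alpha>)" using \<alpha>d by (intro powr_mono2) (auto simp: L_def)
  finally show "8 * h / (a\<^sup>2 * c0) \<le> L powr (?d - \<alpha>)" .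
 qed
 \<comment> \<open>\<open>w * s powr (- p)\<close> bounds the added weight between points at
   distance at most L s / 2. The margin 1/2 is needed because the kernel cut at L s vanishes at that
   distance; it gives the factor \<open>2 powr p - 1\<close>. \<open>Y1\<close> is chosen so that
   m^2 edges of this weight add up to at least 1.\<close>
 define w where "w = bc / 2 * j1 * (2 powr p - 1) * L powr (- p)"
 have w: "w > 0" using bc_pos pos L p_pos by (simp add: w_def)
 define Y1 where "Y1 = 1 / (w * a\<^sup>2)"
 show ?thesis
 proof (rule that[of L Y1 R0])
  show "2 \<le> L" "0 < Y1" "1 \<le> R0" using L w a R0 by (auto simp: Y1_def)
 next
  fix \<beta> s Y :: real and m :: nat and E
  assume \<beta>: "bc / 2 \<le> \<beta>" "\<beta> \<le> bc" and s: "R0 \<le> s" and Y: "Y1 \<le> Y"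
   and m: "a * sqrt Y * s powr (p / 2) \<le> real m" and E: "E \<in> fins"
   and good: "1 / 2 \<le> prw (kb \<beta> s) E (has_clus (ball (2 * s)) m)"
  have s0: "s > 0" "s \<ge> 1" using s R0 by auto
  have \<beta>0: "\<beta> > 0" using \<beta> bc_pos by simp
  have Y0: "Y > 0" using Y w a less_le_trans[of 0 Y1 Y] by (auto simp: Y1_def)
  have Ls: "16 * s \<le> L * s" using L s0 by (intro mult_right_mono) auto
  have m2: "a\<^sup>2 * Y * s powr p \<le> real m ^ 2"
  proof -
   have "a\<^sup>2 * Y * s powr p = (a * sqrt Y * s powr (p / 2))\<^sup>2"
    using Y0 s0 by (simp add: power_mult_distrib powr_power)
   also have "\<dots> \<le> real m ^ 2" using m a Y0 by (intro power_mono) auto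
   finally show ?thesis .
  qed
  obtain Z where Z: "finite Z" "Z \<subseteq> ball (L * s / 8)" "\<And>z z'. z \<in> Z \<Longrightarrow> z' \<in> Z \<Longrightarrow> z \<noteq> z' \<Longrightarrow> 4 * s < n (z - z')"
   and cZ: "card (ball (L * s / 8)) \<le> card Z * card (ball (4 * s))"
   using separated_set[of "4 * s" "L * s / 8"] s0 by auto
  have Zc: "c0 * L powr ?d \<le> card Z"
  proof -
   have "lo * (L * s / 8) powr ?d \<le> card (ball (L * s / 8))" by (rule lo) (use Ls s0 in linarith)
   also have "\<dots> \<le> card Z * real (card (ball (4 * s)))" using cZ by (metis of_nat_le_iff of_nat_mult)
   also have "\<dots> \<le> card Z * (hi * (4 * s) powr ?d)" using hi[of "4 * s"] s0 by (intro mult_left_mono) auto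
   also have "(L * s / 8) = (L / 32) * (4 * s)" by simp
   also have "((L / 32) * (4 * s)) powr ?d = (L / 32) powr ?d * (4 * s) powr ?d" using L s0 by (intro powr_mult)
   finally have "(lo * (L / 32) powr ?d) * (4 * s) powr ?d \<le> (card Z * hi) * (4 * s) powr ?d" by (simp add: mult_ac)
   then have "lo * (L / 32) powr ?d \<le> card Z * hi" using s0 by (simp add: mult_le_cancel_right)
   then show ?thesis using pos L by (simp add: c0_def powr_divide field_simps)
  qed
  have Zne: "Z \<noteq> {}"
  proof
   assume "Z = {}"
   then have "c0 * L powr ?d \<le> 0" using Zc by simp
   moreover have "0 < c0 * L powr ?d" using hc L(2) by (intro mult_pos_pos) auto
   ultimately show False by linarith
  qed
  define U where "U = (\<Union>z\<in>Z. tr (ball (2 * s)) z)"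
  have U: "n u \<le> 2 * s + L * s / 8" if uU: "u \<in> U" for u
  proof -
   obtain z v where "z \<in> Z" "v \<in> ball (2 * s)" "u = v + z" using uU by (auto simp: U_def)
   then show ?thesis using n_add[of v z] Z(2) by (auto simp: ball_def)
  qed
  have Ud: "n (u - v) \<le> L * s / 2" if "u \<in> U" "v \<in> U" for u v
   using n_diff[of u v] U[OF that(1)] U[OF that(2)] Ls by linarith
  define \<kappa> where "\<kappa> = (\<lambda>x. \<beta> * (cut (L * s) x - cut s x))"
  have sL: "s \<le> L * s" "s \<le> L * s / 2" using Ls s0 by auto
  have c: "kernel_fn (kb \<beta> s)" by (rule kb_kernel_fn) (use \<beta>0 in simp)
  have \<kappa>: "kernel_fn \<kappa>"
   using \<beta>0 cut_mono[OF sL(1)] cut_kernel_fn[of s] cut_kernel_fn[of "L * s"] by (auto simp: kernel_fn_def \<kappa>_def)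
  have c\<kappa>: "(\<lambda>x. kb \<beta> s x + \<kappa> x) = kb \<beta> (L * s)" by (auto simp: \<kappa>_def kb_def algebra_simps)
  have \<kappa>0: "w * s powr (- p) \<le> \<kappa> (u - v)" if uv: "u \<in> U" "v \<in> U" "u \<noteq> v" for u v
  proof -
   have "w * s powr (- p) = bc / 2 * (j1 * ((L * s / 2) powr (- p) - (L * s) powr (- p)))"
    using L s0 by (simp add: w_def powr_mult powr_divide powr_minus field_simps)
   also have "\<dots> \<le> bc / 2 * (J (L * s / 2) - J (L * s))"
   proof (intro mult_left_mono j1)
    show "R0 \<le> L * s / 2" "L * s / 2 \<le> L * s" using Ls s s0 by linarith+
   qed (use bc_pos in simp)
   also have "\<dots> \<le> \<beta> * (J (L * s / 2) - J (L * s))"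
    using \<beta> J_anti[of "L * s / 2" "L * s"] L s0 by (intro mult_right_mono) auto
   also have "\<dots> \<le> \<beta> * (J (max s (n (u - v))) - J (L * s))"
   proof (intro mult_left_mono diff_right_mono J_anti)
    show "0 < max s (n (u - v))" "max s (n (u - v)) \<le> L * s / 2"
     using s0 max.boundedI[OF sL(2) Ud[OF uv(1,2)]] by auto
   qed (use \<beta>0 in simp)
   also have "\<dots> = \<kappa> (u - v)"
    unfolding \<kappa>_def using uv Ud[OF uv(1,2)] L s0 sL
    order_trans[OF Ud[OF uv(1,2)], of "L * s"]
    by (subst cut_diff_eq') (auto simp: ball_def)
   finally show ?thesis .
  qed
  have "1 \<le> w * s powr (- p) * real m ^ 2"
  proof -
   have "1 = w * s powr (- p) * (a\<^sup>2 * Y1 * s powr p)"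
    using w a s0 by (simp add: Y1_def powr_minus)
   also have "\<dots> \<le> w * s powr (- p) * (a\<^sup>2 * Y * s powr p)"
    using w Y by (intro mult_left_mono mult_right_mono) auto
   also have "\<dots> \<le> w * s powr (- p) * real m ^ 2" using w m2 by (intro mult_left_mono) auto
   finally show ?thesis .
  qed
  moreover have "tr (ball (2 * s)) z \<inter> tr (ball (2 * s)) z' = {}" if "z \<in> Z" "z' \<in> Z" "z \<noteq> z'" for z z'
  proof (rule ccontr)
   assume "\<not> ?thesis"
   then obtain v v' where v: "v \<in> ball (2 * s)" "v' \<in> ball (2 * s)" "v + z = v' + z'" by blast
   then have "z - z' = v' - v" by (simp add: algebra_simps)
   then show False using Z(3)[OF that] n_diff[of v' v] v(1,2) by (simp add: ball_def)
  qed
  moreover have "0 \<in> ball (2 * s)" using s0 by simp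
  then have "ball (2 * s) \<noteq> {}" "U \<noteq> {}" using Zne by (auto simp: U_def)
  ultimately obtain x E' where x: "x \<in> U" "E' \<in> fins" "real m ^ 2 * card Z / (8 * card (ball (2 * s))) \<le>
    expw (kb \<beta> (L * s)) E' (\<lambda>W. csize_in W x U)"
   using merge_translates[OF c \<kappa> Z(1) finite_ball[of "2 * s"] _ _ E good U_def _ \<kappa>0] w s0 unfolding c\<kappa> by force
  have k: "kernel_fn (kb \<beta> (L * s))" by (rule kb_kernel_fn) (use \<beta>0 in simp)
  have "Y * (L * s) powr \<alpha> = a\<^sup>2 * Y * s powr p * (c0 * L powr ?d) / (8 * (h * s powr ?d)) * (8 * h / (a\<^sup>2 * c0) / L powr (?d - \<alpha>))"
   using hc a L s0 by (simp add: powr_mult powr_diff p_def powr_add)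
  also have "\<dots> \<le> a\<^sup>2 * Y * s powr p * (c0 * L powr ?d) / (8 * (h * s powr ?d)) * 1"
  proof (rule mult_left_mono)
   show "8 * h / (a\<^sup>2 * c0) / L powr (?d - \<alpha>) \<le> 1"
    using L(2) by (subst divide_le_eq_1_pos) (auto intro: L(3))
  qed (use hc Y0 in auto)
  also have "\<dots> \<le> real m ^ 2 * card Z / (8 * card (ball (2 * s)))"
  proof -
   have "card (ball (2 * s)) \<le> h * s powr ?d" using hi[of "2 * s"] s0 by (simp add: h_def powr_mult mult.assoc)
   moreover have "card (ball (2 * s)) > 0" using s0 by (intro card_ball_pos) simp
   moreover have "a\<^sup>2 * Y * s powr p * (c0 * L powr ?d) \<le> real m ^ 2 * card Z"
    using m2 Zc hc Y0 by (intro mult_mono) auto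
   ultimately show ?thesis using hc s0 by (simp only: mult_1_right, intro frac_le) auto
  qed
  also have "\<dots> \<le> expw (kb \<beta> (L * s)) E' (\<lambda>W. csize_in W x U)" by (rule x(3))
  also have "\<dots> = expw (kb \<beta> (L * s)) (shift (- x) E') (vol (tr U (- x)))"
   unfolding expct_shift[OF k finsD[OF x(2)]] using card_clus_shift_Int[of "- x" _ x U] by simp
  also have "\<dots> \<le> expw (kb \<beta> (L * s)) (shift (- x) E') (vol (ball (L * s)))"
  proof (intro expct_mono wt_nonneg[OF k] of_nat_mono card_mono)
   show "clus W 0 \<inter> tr U (- x) \<subseteq> clus W 0 \<inter> ball (L * s)" for W
   proof -
    have "n (u - x) \<le> L * s" if "u \<in> U" for u using Ud[OF that x(1)] L s0 sL by linarith
    then show ?thesis by (auto simp: ball_def)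
   qed
  qed simp
  finally show "\<exists>E\<in>fins. Y * (L * s) powr \<alpha> \<le> expw (kb \<beta> (L * s)) E (vol (ball (L * s)))"
   using shift_fins[OF x(2)] by blast
 qed
qed

text \<open>The thresholds \<open>Y0\<close> and \<open>s0\<close> are built from the two halves of
  the dichotomy, which hold uniformly for \<beta> between \<open>bc / 2\<close> and
  \<open>bc\<close>. The strict inequality \<beta> < \<open>bc\<close> serves only to contradict the
  growing scales, so the bound survives the limit.\<close>

lemma subcritical_volume:
 assumes \<alpha>d: "\<alpha> < real CARD('d)"
 obtains Y0 s0 where "Y0 > 0" "s0 \<ge> 1"
  "\<And>\<beta> s E. bc / 2 \<le> \<beta> \<Longrightarrow> \<beta> < bc \<Longrightarrow> s0 \<le> s \<Longrightarrow> E \<in> fins \<Longrightarrow>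
   expw (kb \<beta> s) E (vol (ball s)) \<le> Y0 * s powr \<alpha>"
proof -
 obtain C2 C3 s1 where C: "C2 > 0" "C3 > 0" "s1 \<ge> 1" and few:
  "\<And>\<beta> s a m Y E. bc / 2 \<le> \<beta> \<Longrightarrow> \<beta> \<le> bc \<Longrightarrow> s1 \<le> s \<Longrightarrow> 0 < Y \<Longrightarrow> 0 < a \<Longrightarrow> a \<le> 1 \<Longrightarrow> 1 \<le> m \<Longrightarrow>
   (\<And>E. E \<in> fins \<Longrightarrow> expw (kb \<beta> (2 * s)) E (vol (ball (2 * s))) \<le> 2 powr \<alpha> * Y * s powr \<alpha>) \<Longrightarrow>
   (\<And>E. E \<in> fins \<Longrightarrow> prw (kb \<beta> s) E (has_clus (ball (2 * s)) m) \<le> 1 / 2) \<Longrightarrow>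
   real m \<le> 2 * a * sqrt Y * s powr (p / 2) \<Longrightarrow> E \<in> fins \<Longrightarrow>
   expw (kb \<beta> s) E (vol (ball s)) \<le> (C2 + C3 * a * Y) * s powr \<alpha>"
  using few_large_clusters by metis
 define a where "a = min 1 (1 / (2 * C3))"
 have a: "0 < a" "a \<le> 1" "C3 * a \<le> 1 / 2" using C by (auto simp: a_def min_def field_simps)
 obtain L Y1 s2 where L: "L \<ge> 2" "Y1 > 0" "s2 \<ge> 1" and many:
  "\<And>\<beta> s m Y E. bc / 2 \<le> \<beta> \<Longrightarrow> \<beta> \<le> bc \<Longrightarrow> s2 \<le> s \<Longrightarrow> Y1 \<le> Y \<Longrightarrow> a * sqrt Y * s powr (p / 2) \<le> real m \<Longrightarrow>
   E \<in> fins \<Longrightarrow> 1 / 2 \<le> prw (kb \<beta> s) E (has_clus (ball (2 * s)) m) \<Longrightarrow>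
   \<exists>E\<in>fins. Y * (L * s) powr \<alpha> \<le> expw (kb \<beta> (L * s)) E (vol (ball (L * s)))"
  using many_large_clusters[OF \<alpha>d a(1)] by metis
 \<comment> \<open>With C3 a \<le> 1/2, the entry \<open>4 * C2\<close> makes C2 + C3 a Y smaller
   than Y. The last entry of \<open>s0\<close> makes the target size \<open>x\<close> below at least
   1, so that rounding it up at most doubles it.\<close>
 define Y0 where "Y0 = max (max 1 Y1) (4 * C2)"
 define s0 where "s0 = max (max s1 s2) ((1 / a) powr (2 / p))"
 have Y0: "Y0 \<ge> 1" "Y0 \<ge> Y1" "Y0 \<ge> 4 * C2" by (auto simp: Y0_def)
 have s0: "s0 \<ge> 1" "s0 \<ge> s1" "s0 \<ge> s2" "s0 \<ge> (1 / a) powr (2 / p)" using C by (auto simp: s0_def)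
 show ?thesis
 proof (rule that[of Y0 s0])
  show "0 < Y0" "1 \<le> s0" using Y0 s0 by auto
 next
  fix \<beta> s :: real and E :: "(int ^ 'd) set set"
  assume \<beta>: "bc / 2 \<le> \<beta>" "\<beta> < bc" and s: "s0 \<le> s" and E: "E \<in> fins"
  have \<beta>0: "0 \<le> \<beta>" using \<beta> bc_pos by simp
  let ?e = "\<lambda>s E. expw (kb \<beta> s) E (vol (ball s))"
  show "?e s E \<le> Y0 * s powr \<alpha>"
  proof (rule ccontr)
   assume neg: "\<not> ?thesis"
   define Y where "Y = ?e s E / s powr \<alpha>"
   have sp: "s powr \<alpha> > 0" using s s0 by simp
   have Y: "Y > Y0" using neg sp by (simp add: Y_def field_simps)
   define good where "good t \<longleftrightarrow> s0 \<le> t \<and> (\<exists>E\<in>fins. Y * t powr \<alpha> \<le> ?e t E)" for t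
   have base: "good s" unfolding good_def using s E sp by (auto simp: Y_def intro!: bexI[of _ E])
   have step: "good (2 * t) \<or> good (L * t)" if t: "good t" for t
   proof (rule ccontr)
    assume ng: "\<not> ?thesis"
    have t0: "s0 \<le> t" "t > 0" using t s0 by (auto simp: good_def)
    have t2: "s0 \<le> 2 * t" "s0 \<le> L * t" using t0 L mult_right_mono[of 1 L t] by linarith+
    obtain E1 where E1: "E1 \<in> fins" "Y * t powr \<alpha> \<le> ?e t E1" using t by (auto simp: good_def)
    have z: "1 / a \<le> t powr (p / 2)"
    proof -
     have "1 / a = ((1 / a) powr (2 / p)) powr (p / 2)" using a p_pos by (simp add: powr_powr)
     also have "\<dots> \<le> t powr (p / 2)" using s0(4) t0 p_pos by (intro powr_mono2) auto
     finally show ?thesis .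
    qed
    define x where "x = a * sqrt Y * t powr (p / 2)"
    have x: "1 \<le> x"
    proof -
     have "1 = a * (1 / a)" using a by simp
     also have "\<dots> \<le> (a * sqrt Y) * t powr (p / 2)"
      using z a Y Y0 by (intro mult_mono) (auto simp: mult_le_cancel_left1)
     finally show ?thesis by (simp add: x_def)
    qed
    define m where "m = nat \<lceil>x\<rceil>"
    have m: "x \<le> real m" "real m \<le> 2 * x" "1 \<le> m" using x by (auto simp: m_def) linarith+
    have "?e t E1 \<le> (C2 + C3 * a * Y) * t powr \<alpha>"
    proof (rule few)
     show "expw (kb \<beta> (2 * t)) E (vol (ball (2 * t))) \<le> 2 powr \<alpha> * Y * t powr \<alpha>"
      if "E \<in> fins" for E
     proof -
      have "?e (2 * t) E < Y * (2 * t) powr \<alpha>"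
       using ng t2 that unfolding good_def by (meson not_le)
      then show ?thesis using t0 by (simp add: powr_mult mult_ac)
     qed
     show "prw (kb \<beta> t) E (has_clus (ball (2 * t)) m) \<le> 1 / 2" if "E \<in> fins" for E
     proof (rule ccontr)
      assume "\<not> ?thesis"
      then have "\<exists>E\<in>fins. Y * (L * t) powr \<alpha> \<le> ?e (L * t) E"
       using m(1) Y Y0 \<beta> t0 s0 that by (intro many[of \<beta> t Y m E]) (auto simp: x_def)
      then show False using ng t2 by (auto simp: good_def)
     qed
     show "real m \<le> 2 * a * sqrt Y * t powr (p / 2)" using m(2) by (simp add: x_def)
    qed (use \<beta> s0 t0 Y Y0 a m E1 in auto)
    then have "Y * t powr \<alpha> \<le> (C2 + C3 * a * Y) * t powr \<alpha>" using E1 by linarith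
    then have "Y \<le> C2 + C3 * a * Y" using t0 by simp
    moreover have "C3 * a * Y \<le> 1 / 2 * Y" using a Y Y0 by (intro mult_right_mono) auto
    ultimately show False using Y Y0 C by linarith
   qed
   have iter: "\<exists>t\<ge>2 ^ k. good t" for k :: nat
   proof (induction k)
    case 0
    then show ?case using base s s0 by (intro exI[of _ s]) auto
   next
    case (Suc k)
    then obtain t where t: "2 ^ k \<le> t" "good t" by blast
    have "0 < t" using t(2) s0 by (auto simp: good_def)
    then have "2 * t \<le> L * t" using L by (intro mult_right_mono) auto
    then show ?case using step[OF t(2)] t(1) by (metis mult_left_mono order_trans power_Suc zero_le_numeral)
   qed
   have "ereal \<beta> < critical_point (lattice_kernel N J)" using \<beta> by (simp flip: bc_eq)
   then obtain C where C: "\<And>E. E \<in> fins \<Longrightarrow> expw (\<lambda>x. \<beta> * full x) E csize0 \<le> C"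
    using subcritical_bounded[OF full_kernel_fn lattice_kernel_eq \<beta>0] by metis
   have bound: "Y * t powr \<alpha> \<le> C" if t: "good t" for t
   proof -
    obtain E1 where E1: "E1 \<in> fins" "Y * t powr \<alpha> \<le> ?e t E1" using t by (auto simp: good_def)
    have "?e t E1 \<le> expw (kb \<beta> t) E1 csize0"
    proof (intro expct_mono wt_nonneg kb_kernel_fn \<beta>0 of_nat_mono card_mono)
     fix W assume "W \<subseteq> E1"
     then show "finite (clus W 0)" using finsD[OF E1(1)] by (meson finite_clus finite_subset)
    qed auto
    also have "\<dots> \<le> expw (\<lambda>x. \<beta> * full x) E1 csize0"
     by (intro expct_kernel_mono kb_kernel_fn \<beta>0 kernel_fn_cmult full_kernel_fn E1 increasing_on_card_clus finsD)
       (simp add: kb_def mult_left_mono cut_le_full \<beta>0)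
    also have "\<dots> \<le> C" by (rule C[OF E1(1)])
    finally show ?thesis using E1(2) by linarith
   qed
   obtain k :: nat where k: "(C / Y) powr (1 / \<alpha>) < 2 ^ k" using real_arch_pow[of 2] by auto
   obtain t where t: "2 ^ k \<le> t" "good t" using iter[of k] by blast
   have CY: "0 \<le> C / Y"
   proof -
    have "0 \<le> Y * s powr \<alpha>" using Y Y0 by simp
    then have "0 \<le> C" using bound[OF base] by linarith
    then show ?thesis using Y Y0 by simp
   qed
   have "(C / Y) = ((C / Y) powr (1 / \<alpha>)) powr \<alpha>" using \<alpha> CY by (simp add: powr_powr del: abs_divide)
   also have "\<dots> < t powr \<alpha>" using k t(1) \<alpha> by (intro powr_less_mono2) auto
   finally have "C < Y * t powr \<alpha>" using Y Y0 by (simp add: field_simps)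
   then show False using bound[OF t(2)] by simp
  qed
 qed
qed

text \<open>For \<alpha> < d the subcritical bound passes to \<open>bc\<close>, since on a fixed
  finite graph the expectation is continuous in \<beta>. For \<alpha> \<ge> d counting the points of
  the ball suffices.\<close>

lemma volume_upper:
 obtains Y0 s0 where "Y0 > 0" "s0 \<ge> 1"
  "\<And>s E. s0 \<le> s \<Longrightarrow> E \<in> fins \<Longrightarrow> expw (kc s) E (vol (ball s)) \<le> Y0 * s powr \<alpha>"
proof (cases "\<alpha> < real CARD('d)")
 case True
 obtain Y0 s0 where Y0: "Y0 > 0" "s0 \<ge> 1" "\<And>\<beta> s E. bc / 2 \<le> \<beta> \<Longrightarrow> \<beta> < bc \<Longrightarrow> s0 \<le> s \<Longrightarrow> E \<in> fins \<Longrightarrow>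
   expw (kb \<beta> s) E (vol (ball s)) \<le> Y0 * s powr \<alpha>"
  using subcritical_volume[OF True] by metis
 show ?thesis
 proof (rule that[OF Y0(1,2)])
  fix s :: real and E :: "(int ^ 'd) set set" assume s: "s0 \<le> s" and E: "E \<in> fins"
  let ?f = "\<lambda>\<beta>. expct (\<lambda>e. \<beta> * wt (cut s) e) E (vol (ball s))"
  have eq: "wt (kb \<beta> s) = (\<lambda>e. \<beta> * wt (cut s) e)" if "0 \<le> \<beta>" for \<beta>
   unfolding kb_def[abs_def] using wt_cmult[OF cut_kernel_fn that] by auto
  have "isCont ?f bc" unfolding expct_def by (intro continuous_intros)
  then have "(?f \<longlongrightarrow> ?f bc) (at_left bc)" by (simp add: isCont_def filterlim_at_split)
  moreover have "\<forall>\<^sub>F \<beta> in at_left bc. ?f \<beta> \<le> Y0 * s powr \<alpha>"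
   unfolding eventually_at_left_field
  proof (intro exI[of _ "bc / 2"] conjI allI impI)
   fix \<beta> assume "bc / 2 < \<beta>" "\<beta> < bc"
   then show "?f \<beta> \<le> Y0 * s powr \<alpha>" using Y0(3)[of \<beta> s E] s E eq[of \<beta>] bc_pos by simp
  qed (use bc_pos in simp)
  ultimately have "?f bc \<le> Y0 * s powr \<alpha>" by (intro tendsto_upperbound) auto
  then show "expw (kc s) E (vol (ball s)) \<le> Y0 * s powr \<alpha>"
   using eq[of bc] bc_nonneg by (simp add: kb_bc)
 qed
next
 case False
 obtain hi where hi: "hi > 0" "\<And>r. r \<ge> 1 \<Longrightarrow> card (ball r) \<le> hi * r powr real CARD('d)"
  using card_ball_bounds by metis
 show ?thesis
 proof (rule that[of hi 1])
  fix s :: real and E :: "(int ^ 'd) set set" assume s: "1 \<le> s" and E: "E \<in> fins"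
  have "expw (kc s) E (vol (ball s)) \<le> card (ball s)"
   by (intro expct_le_const[OF wt_kc_nonneg finsD[OF E]]) (auto intro!: card_mono)
  also have "\<dots> \<le> hi * s powr real CARD('d)" by (rule hi(2)[OF s])
  also have "\<dots> \<le> hi * s powr \<alpha>" using hi s False by (intro mult_left_mono powr_mono) auto
  finally show "expw (kc s) E (vol (ball s)) \<le> hi * s powr \<alpha>" .
 qed (use hi in auto)
qed

end

section \<open>Mean-field behaviour of the cut-off magnetization\<close>

context crit
begin

definition tt :: "real \<Rightarrow> real" where "tt r = bc * tail r"

lemma tt_bounds:
 obtains R0 T1 T2 where "R0 \<ge> 1" "T1 > 0" "T2 > 0"
  "\<And>r. R0 \<le> r \<Longrightarrow> T1 * r powr (- \<alpha>) \<le> tt r" "\<And>r. R0 \<le> r \<Longrightarrow> tt r \<le> T2 * r powr (- \<alpha>)"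
proof -
 obtain R0 t1 t2 where t: "R0 \<ge> 1" "t1 > 0" "t2 > 0"
  "\<And>r. R0 \<le> r \<Longrightarrow> t1 * r powr (- \<alpha>) \<le> tail r" "\<And>r. R0 \<le> r \<Longrightarrow> tail r \<le> t2 * r powr (- \<alpha>)"
  using kernel_bounds by metis
 show ?thesis
 proof (rule that[of R0 "bc * t1" "bc * t2"])
  fix r assume "R0 \<le> r"
  then show "bc * t1 * r powr (- \<alpha>) \<le> tt r" "tt r \<le> bc * t2 * r powr (- \<alpha>)"
   unfolding tt_def mult.assoc using t(4,5) bc_nonneg by (auto intro: mult_left_mono)
 qed (use t bc_pos in auto)
qed

lemma ghost_prob_sprinkle_le:
 assumes c: "kernel_fn c" and c': "kernel_fn c'" and le: "\<And>x. c x \<le> c' x"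
  and \<Delta>: "\<And>Y. finite Y \<Longrightarrow> (\<Sum>x\<in>Y. c' x - c x) \<le> \<Delta>" and h: "0 \<le> h"
 shows "ghost_prob c' h \<le> ghost_prob c (h + \<Delta> * ghost_prob c' h)"
proof -
 have "kernel_fn (\<lambda>x. c' x - c x)" using c c' le by (auto simp: kernel_fn_def)
 then show ?thesis using ghost_prob_sprinkle[OF c _ h, of "\<lambda>x. c' x - c x" \<Delta>] \<Delta> by simp
qed

lemma sum_kf_kc: "finite Y \<Longrightarrow> (\<Sum>x\<in>Y. kf x - kc r x) \<le> tt r"
 unfolding kf_def kc_def tt_def right_diff_distrib[symmetric] sum_distrib_left[symmetric]
 by (intro mult_left_mono sum_le_tail bc_nonneg)

lemma sum_kc_kc:
 assumes "s \<le> r"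
 shows "(\<Sum>x\<in>ball r. kc r x - kc s x) = tt s - tt r" "finite Y \<Longrightarrow> (\<Sum>x\<in>Y. kc r x - kc s x) \<le> tt s - tt r"
proof -
 show eq: "(\<Sum>x\<in>ball r. kc r x - kc s x) = tt s - tt r"
  unfolding kc_def tt_def right_diff_distrib[symmetric] sum_distrib_left[symmetric]
  by (simp add: tail_diff[OF assms])
 assume Y: "finite Y"
 have "(\<Sum>x\<in>Y. kc r x - kc s x) = (\<Sum>x\<in>Y \<inter> ball r. kc r x - kc s x)"
  by (rule sum.mono_neutral_right[OF Y]) (use assms in \<open>auto simp: kc_def cut_def ball_def\<close>)
 also have "\<dots> \<le> (\<Sum>x\<in>ball r. kc r x - kc s x)"
  using kc_mono[OF assms] by (intro sum_mono2) auto
 finally show "(\<Sum>x\<in>Y. kc r x - kc s x) \<le> tt s - tt r" by (simp add: eq)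
qed

text \<open>
 If the magnetization \<open>M\<^sub>r\<close> exceeds half of its mean-field slope \<open>1 / t\<^sub>r\<close> at some field \<open>h\<close>, then
 \<open>M\<^sub>s\<close> nearly attains the full slope \<open>1 / t\<^sub>s\<close> at the field \<open>h\<^sub>a\<close>, while the bound for its integral
 shows that it is nearly linear up to \<open>h\<^sub>a\<close>; hence it stays large up to a multiple of \<open>h\<^sub>a\<close>.
\<close>

lemma ghost_step:
 assumes s: "1 \<le> s" "s \<le> r" and h: "0 < h" and bad: "h / (2 * tt r) < ghost_prob (kc r) h"
  and t: "0 < tt r" "1000 * tt r \<le> tt s"
  and X: "\<And>E. E \<in> fins \<Longrightarrow> expw (kc r) E (vol (ball r)) \<le> X"
  and small: "bc * J s * X * tt s \<le> (h / (4 * (tt r / tt s)))\<^sup>2 * (tt r / tt s)"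
 shows "\<exists>h'\<ge>h / (4000 * (tt r / tt s)\<^sup>2). h' / (2 * tt s) < ghost_prob (kc s) h'"
proof -
 define \<rho> where "\<rho> = tt r / tt s"
 have ts: "tt s > 0" using t by linarith
 have \<rho>: "0 < \<rho>" "\<rho> \<le> 1 / 1000" "tt r = \<rho> * tt s" using t ts by (auto simp: \<rho>_def field_simps)
 define \<mu> where "\<mu> = ghost_prob (kc r) h"
 \<comment> \<open>The field produced by sprinkling from range \<open>s\<close> to \<open>r\<close>.
   By \<open>bad\<close> the term \<open>h\<close> is below
   \<open>2 * \<rho> * tt s * \<mu>\<close>, so \<open>ha\<close> is about
   \<open>tt s * \<mu>\<close>, and the magnetization at \<open>ha\<close> is nearly
   \<open>ha / tt s\<close> or more.\<close>
 define ha where "ha = h + (tt s - tt r) * \<mu>"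
 have \<mu>: "h < 2 * tt r * \<mu>" using bad t by (simp add: \<mu>_def field_simps)
 then have \<mu>0: "\<mu> > 0" using h t by (smt (verit) mult_nonneg_nonpos)
 have diff: "tt s - tt r = tt s * (1 - \<rho>)" using \<rho>(3) by (simp add: algebra_simps)
 have up: "\<mu> \<le> ghost_prob (kc s) ha"
  unfolding \<mu>_def ha_def using h
  by (intro ghost_prob_sprinkle_le kc_kernel_fn kc_mono s sum_kc_kc(2)) auto
 have ha_le: "ha \<le> tt s * (1 + \<rho>) * \<mu>"
  using \<mu> unfolding ha_def \<rho>(3) by (simp add: algebra_simps)
 have ha_ge: "h / (4 * \<rho>) \<le> ha"
 proof -
  have "h / (4 * \<rho>) \<le> 2 * tt r * \<mu> / (4 * \<rho>)" using \<mu> \<rho> by (intro divide_right_mono) auto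
  also have "\<dots> = tt s * (1 / 2) * \<mu>" using \<rho> by simp
  also have "\<dots> \<le> tt s * (1 - \<rho>) * \<mu>" using \<rho> ts \<mu>0 by (intro mult_right_mono mult_left_mono) auto
  also have "\<dots> \<le> ha" using h by (simp add: ha_def diff)
  finally show ?thesis .
 qed
 have ha0: "ha > 0" using ha_ge h \<rho> by (smt (verit) divide_pos_pos mult_pos_pos)
 have I: "ghost_int (kc s) ha \<le> ha\<^sup>2 / (2 * tt s) * (1 + 3 * \<rho>)"
 proof -
  define \<kappa> where "\<kappa> = (\<lambda>x. kc r x - kc s x)"
  have \<kappa>: "kernel_fn \<kappa>"
   using kc_mono[OF s(2)] kc_kernel_fn[of r] kc_kernel_fn[of s] by (auto simp: kernel_fn_def \<kappa>_def)
  have eq: "(\<lambda>x. kc s x + \<kappa> x) = kc r" by (auto simp: \<kappa>_def)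
  have "ghost_int (kc s) ha \<le> ha\<^sup>2 / (2 * (tt s - tt r)) + bc * J s * X / 2"
  proof (rule ghost_int_bound[OF kc_kernel_fn \<kappa> finite_ball[of r]])
   show "\<kappa> x = 0" if "x \<notin> ball r" for x
    using that s by (auto simp: \<kappa>_def kc_def cut_def ball_def)
   show "\<kappa> x \<le> bc * J s" for x
    unfolding \<kappa>_def kc_def right_diff_distrib[symmetric] using s
    by (intro mult_left_mono cut_diff_le bc_nonneg) auto
   show "tt s - tt r = sum \<kappa> (ball r)" by (simp add: \<kappa>_def sum_kc_kc(1)[OF s(2)])
   show "0 < tt s - tt r" using t by linarith
   show "expw (\<lambda>x. kc s x + \<kappa> x) E (vol (ball r)) \<le> X" if "E \<in> fins" for E
    unfolding eq by (rule X[OF that])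
   show "expw (\<lambda>x. kc s x + \<kappa> x) E csize0 \<le> chi r" if "E \<in> fins" for E
    unfolding eq using s that by (intro chi_upper) auto
  qed (use ha0 in simp)
  also have "bc * J s * X / 2 \<le> ha\<^sup>2 / (2 * tt s) * \<rho>"
  proof -
   have "bc * J s * X * tt s \<le> (h / (4 * \<rho>))\<^sup>2 * \<rho>" using small by (simp add: \<rho>_def)
   also have "\<dots> \<le> ha\<^sup>2 * \<rho>" using ha_ge h \<rho> by (intro mult_right_mono power_mono) auto
   finally show ?thesis using ts by (simp add: field_simps)
  qed
  also have "ha\<^sup>2 / (2 * (tt s - tt r)) \<le> ha\<^sup>2 / (2 * tt s) * (1 + 2 * \<rho>)"
  proof -
   have "1 / (1 - \<rho>) \<le> 1 + 2 * \<rho>"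
   proof -
    have "\<rho> * \<rho> \<le> \<rho> * (1 / 2)" using \<rho> by (intro mult_left_mono) auto
    then show ?thesis using \<rho> by (simp add: field_simps)
   qed
   then have "ha\<^sup>2 / (2 * tt s) * (1 / (1 - \<rho>)) \<le> ha\<^sup>2 / (2 * tt s) * (1 + 2 * \<rho>)"
    using ts by (intro mult_left_mono) auto
   then show ?thesis by (simp add: diff)
  qed
  also have "ha\<^sup>2 / (2 * tt s) * (1 + 2 * \<rho>) + ha\<^sup>2 / (2 * tt s) * \<rho> = ha\<^sup>2 / (2 * tt s) * (1 + 3 * \<rho>)"
   by (simp only: distrib_left[symmetric]) simp
  finally show ?thesis by simp
 qed
 \<comment> \<open>In the extension bound the quadratic terms leave a loss of 48 L^2 times 4 \<rho>,
   that is a fraction 192 L \<rho> of the main term. With L \<rho> = 1/1000 more than half of the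
   main term survives.\<close>
 define L where "L = 1 / (1000 * \<rho>)"
 have L: "L \<ge> 1" "L * \<rho> = 1 / 1000" using \<rho> by (auto simp: L_def field_simps)
 have "(L + 48 * L\<^sup>2) * (ha / tt s * (1 - \<rho>)) \<le> (L + 48 * L\<^sup>2) * ghost_prob (kc s) ha"
 proof (rule mult_left_mono)
  have "ha / tt s * (1 - \<rho>) \<le> (1 + \<rho>) * \<mu> * (1 - \<rho>)"
   using ha_le ts \<rho> by (intro mult_right_mono) (auto simp: field_simps)
  also have "\<dots> = \<mu> * (1 - \<rho> * \<rho>)" by (simp add: algebra_simps)
  also have "\<dots> \<le> \<mu> * 1" using \<mu>0 \<rho> by (intro mult_left_mono) auto
  finally show "ha / tt s * (1 - \<rho>) \<le> ghost_prob (kc s) ha" using up by simp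
 qed (use L in auto)
 also have "\<dots> \<le> ghost_prob (kc s) (L * ha) + 96 * L\<^sup>2 / ha * ghost_int (kc s) ha"
  by (rule ghost_prob_extend[OF kc_kernel_fn ha0 L(1)])
 also have "96 * L\<^sup>2 / ha * ghost_int (kc s) ha \<le> 96 * L\<^sup>2 / ha * (ha\<^sup>2 / (2 * tt s) * (1 + 3 * \<rho>))"
  using I ha0 by (intro mult_left_mono) auto
 also have "\<dots> = 48 * L\<^sup>2 * (ha / tt s) * (1 + 3 * \<rho>)"
  using ha0 ts by (simp add: power2_eq_square field_simps)
 finally have "(L + 48 * L\<^sup>2) * (ha / tt s * (1 - \<rho>)) \<le> ghost_prob (kc s) (L * ha) + 48 * L\<^sup>2 * (ha / tt s) * (1 + 3 * \<rho>)"
  by simp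
 then have "(L + 48 * L\<^sup>2) * (ha / tt s * (1 - \<rho>)) - 48 * L\<^sup>2 * (ha / tt s) * (1 + 3 * \<rho>) \<le> ghost_prob (kc s) (L * ha)"
  by (simp only: diff_le_eq)
 moreover have "(L + 48 * L\<^sup>2) * (x * (1 - \<rho>)) - 48 * L\<^sup>2 * x * (1 + 3 * \<rho>) =
   L * x * (1 - \<rho> - 192 * (L * \<rho>))" for x
  by (simp add: power2_eq_square algebra_simps)
 note this[of "ha / tt s"]
 moreover have "L * (ha / tt s) * (1 / 2) < L * (ha / tt s) * (1 - \<rho> - 192 * (L * \<rho>))"
  using L \<rho> ha0 ts by (intro mult_strict_left_mono) auto
 ultimately have "L * ha / (2 * tt s) < ghost_prob (kc s) (L * ha)" by simp
 moreover have "h / (4000 * \<rho>\<^sup>2) \<le> L * ha"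
 proof -
  have "h / (4000 * \<rho>\<^sup>2) = L * (h / (4 * \<rho>))" by (simp add: L_def power2_eq_square)
  also have "\<dots> \<le> L * ha" using ha_ge L by (intro mult_left_mono) auto
  finally show ?thesis .
 qed
 ultimately show ?thesis unfolding \<rho>_def by blast
qed

text \<open>A violation at range r reproduces itself at r / l with a field above the threshold of
  the smaller range, because \<open>4000 * (tt r / tt s)\<^sup>2 * l powr (p / 2) \<le> 1\<close>; d
  < 3 \<alpha> enters here through e > 0. At ranges between r1 and l r1 the threshold is so high
  that M \<le> 1 excludes a violation.\<close>

lemma ghost_prob_cut_bound:
 assumes d3: "real CARD('d) < 3 * \<alpha>"
 obtains \<epsilon> r1 where "\<epsilon> > 0" "r1 \<ge> 1"
  "\<And>r h. r1 \<le> r \<Longrightarrow> 1 / (\<epsilon> * r powr (p / 2)) \<le> h \<Longrightarrow> ghost_prob (kc r) h \<le> h / (2 * tt r)"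
proof -
 obtain R0 T1 T2 where R0: "R0 \<ge> 1" and T: "T1 > 0" "T2 > 0"
  and T1: "\<And>r. R0 \<le> r \<Longrightarrow> T1 * r powr (- \<alpha>) \<le> tt r" and T2: "\<And>r. R0 \<le> r \<Longrightarrow> tt r \<le> T2 * r powr (- \<alpha>)"
  using tt_bounds by metis
 obtain R2 j2 where j2: "R2 \<ge> 1" "j2 > 0" "\<And>r. R2 \<le> r \<Longrightarrow> J r \<le> j2 * r powr (- p)"
  using kernel_bounds by metis
 obtain Y0 s0 where Y0: "Y0 > 0" and vol:
  "\<And>s E. s0 \<le> s \<Longrightarrow> E \<in> fins \<Longrightarrow> expw (kc s) E (vol (ball s)) \<le> Y0 * s powr \<alpha>"
  using volume_upper by metis
 define r1 where "r1 = max (max R0 R2) s0"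
 have r1: "r1 \<ge> 1" "r1 \<ge> R0" "r1 \<ge> R2" "r1 \<ge> s0" using R0 by (auto simp: r1_def)
 define K where "K = T2 / T1"
 have K: "K > 0" using T by (simp add: K_def)
 define e where "e = (3 * \<alpha> - real CARD('d)) / 2"
 have e: "e > 0" "p / 2 - 2 * \<alpha> = - e" using d3 by (auto simp: e_def p_def field_simps)
 \<comment> \<open>The second entry makes the ratio of the tails at most 1/1000, as
   \<open>ghost_step\<close> requires. The third lets l^e absorb 4000 K^2, so the violating field
   outgrows the threshold.\<close>
 define l where "l = max 2 (max ((1000 * K) powr (1 / \<alpha>)) ((4000 * K\<^sup>2) powr (1 / e)))"
 have l: "l \<ge> 2" "1000 * K \<le> l powr \<alpha>" "4000 * K\<^sup>2 \<le> l powr e"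
 proof -
  show "l \<ge> 2" by (simp add: l_def)
  have "1000 * K = ((1000 * K) powr (1 / \<alpha>)) powr \<alpha>" using K \<alpha> by (simp add: powr_powr)
  also have "\<dots> \<le> l powr \<alpha>" using \<alpha> by (intro powr_mono2) (auto simp: l_def)
  finally show "1000 * K \<le> l powr \<alpha>" .
  have "4000 * K\<^sup>2 = ((4000 * K\<^sup>2) powr (1 / e)) powr e" using K e by (simp add: powr_powr)
  also have "\<dots> \<le> l powr e" using e by (intro powr_mono2) (auto simp: l_def)
  finally show "4000 * K\<^sup>2 \<le> l powr e" .
 qed
 \<comment> \<open>\<open>G\<close> collects the constants of the volume error, which at fields
   above the threshold is at most G \<epsilon>^2 times h^2. The second entry of
   \<open>\<epsilon>\<close> makes this harmless; the first settles the base ranges.\<close>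
 define G where "G = 16 * (bc * j2 * Y0 * T2 * l powr (\<alpha> + p))"
 have G: "G > 0" using bc_pos j2 Y0 T l by (simp add: G_def)
 define \<epsilon> where "\<epsilon> = min (1 / (2 * T2 * (l * r1) powr (p / 2))) (1 / sqrt G)"
 have \<epsilon>: "\<epsilon> > 0" "\<epsilon> * (2 * T2 * (l * r1) powr (p / 2)) \<le> 1" "G * \<epsilon>\<^sup>2 \<le> 1"
 proof -
  have pos: "2 * T2 * (l * r1) powr (p / 2) > 0" using T l r1 by simp
  then show "\<epsilon> > 0" using G by (simp add: \<epsilon>_def)
  have "\<epsilon> \<le> 1 / (2 * T2 * (l * r1) powr (p / 2))" by (simp add: \<epsilon>_def)
  then show "\<epsilon> * (2 * T2 * (l * r1) powr (p / 2)) \<le> 1" using pos by (simp add: pos_le_divide_eq)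
  have "\<epsilon>\<^sup>2 \<le> (1 / sqrt G)\<^sup>2" using \<open>\<epsilon> > 0\<close> by (intro power_mono) (auto simp: \<epsilon>_def)
  then show "G * \<epsilon>\<^sup>2 \<le> 1" using G by (simp add: power_divide field_simps)
 qed
 define bad where "bad r \<longleftrightarrow> (\<exists>h\<ge>1 / (\<epsilon> * r powr (p / 2)). h / (2 * tt r) < ghost_prob (kc r) h)" for r
 have base: "\<not> bad r" if r: "r1 \<le> r" "r < l * r1" for r
 proof
  assume "bad r"
  then obtain h where h: "1 / (\<epsilon> * r powr (p / 2)) \<le> h" "h / (2 * tt r) < ghost_prob (kc r) h"
   by (auto simp: bad_def)
  have r0: "r > 0" "r \<ge> 1" using r r1 by auto
  have h0: "h > 0" using h(1) \<epsilon> r0 by (smt (verit) divide_pos_pos mult_pos_pos powr_gt_zero)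
  have "0 < T1 * r powr (- \<alpha>)" using T r0 by simp
  then have tr: "0 < tt r" using T1[of r] r r1 by linarith
  have "2 * tt r \<le> 2 * T2"
  proof -
   have "tt r \<le> T2 * r powr (- \<alpha>)" using T2 r r1 by simp
   also have "\<dots> \<le> T2 * 1" using T r0 \<alpha> by (intro mult_left_mono) (auto simp: powr_le_one_le ge_one_powr_ge_zero powr_minus inverse_le_1_iff)
   finally show ?thesis by simp
  qed
  also have "\<dots> \<le> 1 / (\<epsilon> * (l * r1) powr (p / 2))"
   using \<epsilon> l r1 by (simp add: pos_le_divide_eq mult_ac)
  also have "\<dots> \<le> 1 / (\<epsilon> * r powr (p / 2))"
   using \<epsilon> r r0 p_pos l r1 by (intro divide_left_mono mult_left_mono powr_mono2) auto
  also have "\<dots> \<le> h" by (rule h(1))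
  finally have "1 \<le> h / (2 * tt r)" using tr by simp
  then show False using h(2) ghost_prob_bounds(2)[OF kc_kernel_fn, of h r] h0 by simp
 qed
 have step: "bad (r / l)" if r: "l * r1 \<le> r" and b: "bad r" for r
 proof -
  define s where "s = r / l"
  have rs: "r = l * s" using l by (simp add: s_def)
  have s: "r1 \<le> s" "s \<ge> 1" "s \<le> r" "s > 0"
  proof -
   show "r1 \<le> s" using r l by (simp add: s_def field_simps)
   then show "s \<ge> 1" "s > 0" using r1 by auto
   then show "s \<le> r" unfolding rs using l by simp
  qed
  have r0: "r > 0" "r1 \<le> r" using s by auto
  obtain h where h: "1 / (\<epsilon> * r powr (p / 2)) \<le> h" "h / (2 * tt r) < ghost_prob (kc r) h"
   using b by (auto simp: bad_def)
  have h0: "h > 0" using h(1) \<epsilon> r0 by (smt (verit) divide_pos_pos mult_pos_pos powr_gt_zero)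
  have "0 < T1 * r powr (- \<alpha>)" "0 < T1 * s powr (- \<alpha>)" using T r0 s by auto
  then have tr: "0 < tt r" "0 < tt s" using T1[of r] T1[of s] r0 s r1 by linarith+
  have ratio: "tt r / tt s \<le> K * l powr (- \<alpha>)"
  proof -
   have "tt r / tt s \<le> (T2 * r powr (- \<alpha>)) / (T1 * s powr (- \<alpha>))"
    using T1[of s] T2[of r] T s r0 r1 tr by (intro frac_le) auto
   also have "\<dots> = K * l powr (- \<alpha>)" using s l by (simp add: rs powr_mult K_def)
   finally show ?thesis .
  qed
  have lK: "1000 * (K * l powr (- \<alpha>)) \<le> 1"
   using l by (simp add: powr_minus field_simps)
  have \<rho>: "1000 * tt r \<le> tt s"
  proof -
   have "tt r / tt s \<le> 1 / 1000" using ratio lK by linarith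
   then show ?thesis using tr by (simp add: field_simps)
  qed
  have \<rho>1: "tt r / tt s \<le> 1" using \<rho> tr by (simp add: field_simps)
  have \<rho>0: "0 < tt r / tt s" using tr by simp
  define Z where "Z = s powr (p / 2)"
  have Z: "Z > 0" "Z * Z = s powr p" using s by (auto simp: Z_def powr_add[symmetric])
  have rZ: "r powr (p / 2) = l powr (p / 2) * Z" using l s by (simp add: rs Z_def powr_mult)
  have hZ: "1 \<le> h * (\<epsilon> * (l powr (p / 2) * Z))"
  proof -
   have "0 < \<epsilon> * r powr (p / 2)" using \<epsilon> r0 by simp
   then show ?thesis using h(1) unfolding rZ by (simp add: pos_divide_le_eq)
  qed
  have "\<exists>h'\<ge>h / (4000 * (tt r / tt s)\<^sup>2). h' / (2 * tt s) < ghost_prob (kc s) h'"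
  proof (rule ghost_step[OF s(2,3) h0 h(2) tr(1) \<rho>])
   show "expw (kc r) E (vol (ball r)) \<le> Y0 * r powr \<alpha>" if "E \<in> fins" for E
    using vol[OF _ that, of r] r0 r1 by simp
   have "16 * (bc * J s * (Y0 * r powr \<alpha>) * tt s) \<le> 16 * (bc * (j2 * s powr (- p)) * (Y0 * r powr \<alpha>) * (T2 * s powr (- \<alpha>)))"
    using j2(3)[of s] T2[of s] s r1 bc_pos Y0 tr J_pos[of s] by (intro mult_left_mono mult_mono mult_right_mono) auto
   also have "\<dots> = G * (l powr (- (p / 2)))\<^sup>2 / (Z * Z)"
    using s l by (simp add: Z(2) rs powr_mult powr_minus G_def powr_add powr_power field_simps)
   also have "\<dots> = G * \<epsilon>\<^sup>2 * (1 / (\<epsilon> * (l powr (p / 2) * Z)))\<^sup>2"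
    using \<epsilon>(1) Z(1) l by (simp add: power2_eq_square powr_minus field_simps)
   also have "\<dots> \<le> 1 * h\<^sup>2"
   proof (intro mult_mono power_mono \<epsilon>(3))
    show "1 / (\<epsilon> * (l powr (p / 2) * Z)) \<le> h" using h(1) rZ by simp
   qed (use \<epsilon> Z in auto)
   also have "\<dots> \<le> h\<^sup>2 / (tt r / tt s)"
   proof -
    have "1 * h\<^sup>2 \<le> h\<^sup>2 / q" if "0 < q" "q \<le> 1" for q
     using that by (simp add: pos_le_divide_eq mult_left_le)
    then show ?thesis using \<rho>0 \<rho>1 .
   qed
   also have "\<dots> = 16 * ((h / (4 * (tt r / tt s)))\<^sup>2 * (tt r / tt s))"
    using \<rho>0 tr by (simp add: power2_eq_square field_simps)
   finally show "bc * J s * (Y0 * r powr \<alpha>) * tt s \<le> (h / (4 * (tt r / tt s)))\<^sup>2 * (tt r / tt s)" by simp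
  qed
  then obtain h' where h': "h / (4000 * (tt r / tt s)\<^sup>2) \<le> h'" "h' / (2 * tt s) < ghost_prob (kc s) h'" by blast
  have "4000 * (tt r / tt s)\<^sup>2 * l powr (p / 2) \<le> 1"
  proof -
   have "(tt r / tt s)\<^sup>2 \<le> (K * l powr (- \<alpha>))\<^sup>2" using ratio \<rho>0 by (intro power_mono) auto
   then have "4000 * (tt r / tt s)\<^sup>2 * l powr (p / 2) \<le> 4000 * (K * l powr (- \<alpha>))\<^sup>2 * l powr (p / 2)"
    by (intro mult_right_mono) auto
   also have "\<dots> = 4000 * K\<^sup>2 * (l powr (- \<alpha>) * l powr (- \<alpha>) * l powr (p / 2))"
    by (simp add: power2_eq_square)
   also have "l powr (- \<alpha>) * l powr (- \<alpha>) * l powr (p / 2) = l powr (- e)"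
    using e(2) by (simp add: powr_add[symmetric])
   also have "4000 * K\<^sup>2 * l powr (- e) \<le> l powr e * l powr (- e)" using l by (intro mult_right_mono) auto
   also have "\<dots> = 1" using l by (simp add: powr_add[symmetric])
   finally show ?thesis .
  qed
  then have "1 / (\<epsilon> * Z) \<le> 1 / (\<epsilon> * Z) / (4000 * (tt r / tt s)\<^sup>2 * l powr (p / 2))"
   using \<epsilon> Z \<rho>0 l tr by (simp add: pos_le_divide_eq mult_left_le)
  also have "\<dots> = 1 / (\<epsilon> * r powr (p / 2)) / (4000 * (tt r / tt s)\<^sup>2)" by (simp add: rZ mult_ac)
  also have "\<dots> \<le> h / (4000 * (tt r / tt s)\<^sup>2)" using h(1) by (intro divide_right_mono) auto
  also have "\<dots> \<le> h'" by (rule h')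
  finally show ?thesis using h'(2) unfolding bad_def s_def[symmetric] Z_def by blast
 qed
 have "\<not> bad r" if "r1 \<le> r" "r < l ^ k * r1" for r and k :: nat
  using that
 proof (induction k arbitrary: r)
  case (Suc k)
  show ?case
  proof (cases "r < l * r1")
   case True
   then show ?thesis using base Suc.prems by simp
  next
   case False
   have "r / l < l ^ k * r1" "r1 \<le> r / l" using Suc.prems False l by (auto simp: field_simps)
   then show ?thesis using Suc.IH[of "r / l"] step[of r] False by auto
  qed
 qed auto
 moreover have "\<exists>k :: nat. r < l ^ k * r1" for r
 proof -
  obtain k :: nat where "r < l ^ k" using real_arch_pow[of l r] l by auto
  also have "l ^ k \<le> l ^ k * r1" using r1 l by (simp add: mult_le_cancel_left1)
  finally show ?thesis by blast
 qed
 ultimately have "\<not> bad r" if "r1 \<le> r" for r using that by blast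
 then show ?thesis using that[OF \<epsilon>(1) r1(1)] by (auto simp: bad_def not_less)
qed

text \<open>With t = \<open>tt r\<close>, sprinkling the missing weight gives \<mu> \<le> (h + t
  \<mu>) / (2 t). The factor 1/2 in the cut-off bound is what allows solving for \<mu>. The argument
  covers every kernel above \<open>kc r\<close> that exceeds it by total weight at most t.\<close>

lemma ghost_prob_bound:
 assumes d3: "real CARD('d) < 3 * \<alpha>"
 obtains \<epsilon> r1 where "\<epsilon> > 0" "r1 \<ge> 1"
  "\<And>r h. r1 \<le> r \<Longrightarrow> 1 / (\<epsilon> * r powr (p / 2)) \<le> h \<Longrightarrow> ghost_prob kf h \<le> h / tt r"
  "\<And>r s h. r1 \<le> r \<Longrightarrow> r \<le> s \<Longrightarrow> 1 / (\<epsilon> * r powr (p / 2)) \<le> h \<Longrightarrow> ghost_prob (kc s) h \<le> h / tt r"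
proof -
 obtain \<epsilon> r1 where \<epsilon>: "\<epsilon> > 0" "r1 \<ge> 1" and M:
  "\<And>r h. r1 \<le> r \<Longrightarrow> 1 / (\<epsilon> * r powr (p / 2)) \<le> h \<Longrightarrow> ghost_prob (kc r) h \<le> h / (2 * tt r)"
  using ghost_prob_cut_bound[OF d3] by metis
 obtain R0 T1 where R0: "T1 > 0" "\<And>r. R0 \<le> r \<Longrightarrow> T1 * r powr (- \<alpha>) \<le> tt r"
  using tt_bounds by metis
 define r2 where "r2 = max r1 R0"
 have main: "ghost_prob c h \<le> h / tt r"
  if r: "r2 \<le> r" and h: "1 / (\<epsilon> * r powr (p / 2)) \<le> h" and c: "kernel_fn c" "\<And>x. kc r x \<le> c x"
   and S: "\<And>Y. finite Y \<Longrightarrow> (\<Sum>x\<in>Y. c x - kc r x) \<le> tt r" for r h c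
 proof -
  have r0: "r > 0" "r1 \<le> r" "R0 \<le> r" using r \<epsilon> by (auto simp: r2_def)
  have h0: "h > 0" using h \<epsilon> r0 by (smt (verit) divide_pos_pos mult_pos_pos powr_gt_zero)
  have "0 < T1 * r powr (- \<alpha>)" using R0 r0 by simp
  then have tr: "0 < tt r" using R0(2)[OF r0(3)] by linarith
  define \<mu> where "\<mu> = ghost_prob c h"
  have \<mu>: "0 \<le> \<mu>" unfolding \<mu>_def using h0 by (intro ghost_prob_bounds c) simp
  have "\<mu> \<le> ghost_prob (kc r) (h + tt r * \<mu>)"
   unfolding \<mu>_def using h0 by (intro ghost_prob_sprinkle_le kc_kernel_fn c S) auto
  also have "\<dots> \<le> (h + tt r * \<mu>) / (2 * tt r)"
  proof (rule M[OF r0(2)])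
   have "h \<le> h + tt r * \<mu>" using tr \<mu> by simp
   then show "1 / (\<epsilon> * r powr (p / 2)) \<le> h + tt r * \<mu>" using h by linarith
  qed
  finally have "\<mu> * (2 * tt r) \<le> h + tt r * \<mu>" using tr by (simp add: pos_le_divide_eq)
  then have "\<mu> * tt r \<le> h" by (simp add: algebra_simps)
  then show ?thesis using tr by (simp add: \<mu>_def pos_le_divide_eq)
 qed
 show ?thesis
 proof (rule that[of \<epsilon> r2])
  fix r h assume r: "r2 \<le> r" "1 / (\<epsilon> * r powr (p / 2)) \<le> h"
  show "ghost_prob kf h \<le> h / tt r"
   by (rule main[OF r kf_kernel_fn kc_le_kf sum_kf_kc])
  fix s assume s: "r \<le> s"
  show "ghost_prob (kc s) h \<le> h / tt r"
  proof (rule main[OF r kc_kernel_fn kc_mono[OF s]])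
   fix Y :: "(int ^ 'd) set" assume Y: "finite Y"
   have "(\<Sum>x\<in>Y. kc s x - kc r x) \<le> (\<Sum>x\<in>Y. kf x - kc r x)" by (intro sum_mono diff_right_mono kc_le_kf)
   then show "(\<Sum>x\<in>Y. kc s x - kc r x) \<le> tt r" using sum_kf_kc[OF Y, of r] by linarith
  qed
 qed (use \<epsilon> in \<open>auto simp: r2_def\<close>)
qed

end

section \<open>Moments under the infinite-volume law\<close>

lemma power_layers:
 assumes "m \<le> b" "1 \<le> q"
 shows "real m ^ q = (\<Sum>j<b. (real (Suc j) ^ q - real j ^ q) * of_bool (Suc j \<le> m))"
proof -
 have "(\<Sum>j<b. (real (Suc j) ^ q - real j ^ q) * of_bool (Suc j \<le> m)) = (\<Sum>j<m. real (Suc j) ^ q - real j ^ q)"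
  using assms(1) by (intro sum.mono_neutral_cong_right) auto
 also have "\<dots> = real m ^ q - real 0 ^ q" by (rule sum_lessThan_telescope)
 finally show ?thesis using assms(2) by simp
qed

text \<open>By \<open>power_layers\<close> the power of the volume is a finite nonnegative
  combination of indicators of finitary events, whose probabilities are approximated on one common
  finite graph.\<close>

lemma
 fixes w :: "'v::countable set \<Rightarrow> real" and z :: 'v
 assumes w: "\<And>e. 0 \<le> w e" and B: "finite B" and q: "1 \<le> q"
 defines "F \<equiv> \<lambda>W. csize_in W z B ^ q"
 shows expct_le_integral: "E \<in> fins \<Longrightarrow> expct w E F \<le> (\<integral>\<omega>. F (opens \<omega>) \<partial>law w)"
  and integral_least: "(\<And>E. E \<in> fins \<Longrightarrow> expct w E F \<le> c) \<Longrightarrow> (\<integral>\<omega>. F (opens \<omega>) \<partial>law w) \<le> c"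
proof -
 interpret prob_space "law w" by (rule prob_space_law)
 define a where "a j = real (Suc j) ^ q - real j ^ q" for j
 have a: "0 \<le> a j" for j unfolding a_def using power_mono[of "real j" "real (Suc j)" q] by simp
 let ?A = "\<lambda>j. {\<omega> \<in> space (law w). many (Suc j) B z (opens \<omega>)}"
 define \<tau> where "\<tau> j = prob (?A j)" for j
 have A: "?A j \<in> events" for j by (rule finitary_exhaust(1)[OF finitary_many w])
 have F: "F W = (\<Sum>j<card B. a j * of_bool (many (Suc j) B z W))" for W
  unfolding F_def a_def many_iff_finite[OF B]
  by (rule power_layers[OF _ q]) (use B in \<open>auto intro!: card_mono\<close>)
 have int: "(\<integral>\<omega>. F (opens \<omega>) \<partial>law w) = (\<Sum>j<card B. a j * \<tau> j)"
 proof -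
  have "(\<integral>\<omega>. F (opens \<omega>) \<partial>law w) = (\<integral>\<omega>. (\<Sum>j<card B. a j * indicator (?A j) \<omega>) \<partial>law w)"
   by (rule Bochner_Integration.integral_cong) (auto simp: F indicator_def intro!: sum.cong)
  also have "\<dots> = (\<Sum>j<card B. a j * \<tau> j)"
   unfolding \<tau>_def using A by (subst Bochner_Integration.integral_sum) (auto simp: emeasure_eq_measure)
  finally show ?thesis .
 qed
 have ex: "expct w E F = (\<Sum>j<card B. a j * prb w E (many (Suc j) B z))" for E
  unfolding F[abs_def] by (simp only: expct_sum expct_cmult)
 {
  assume E: "E \<in> fins"
  show "expct w E F \<le> (\<integral>\<omega>. F (opens \<omega>) \<partial>law w)"
   unfolding int ex \<tau>_def
   by (intro sum_mono mult_left_mono a finitary_exhaust(2)[OF finitary_many w E])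
 }
 {
  assume c: "\<And>E. E \<in> fins \<Longrightarrow> expct w E F \<le> c"
  show "(\<integral>\<omega>. F (opens \<omega>) \<partial>law w) \<le> c"
  proof (rule field_le_epsilon)
   fix e :: real assume e: "0 < e"
   define \<eta> where "\<eta> = e / (1 + sum a {..<card B})"
   have s0: "0 \<le> sum a {..<card B}" by (rule sum_nonneg) (rule a)
   have \<eta>: "\<eta> > 0" using e s0 by (simp add: \<eta>_def)
   have "\<forall>j. \<exists>E\<in>fins. \<tau> j - \<eta> < prb w E (many (Suc j) B z)"
    unfolding \<tau>_def by (intro allI finitary_exhaust(3)[OF finitary_many w \<eta>])
   then obtain E where E: "\<And>j. E j \<in> fins" "\<And>j. \<tau> j - \<eta> < prb w (E j) (many (Suc j) B z)" by metis
   let ?U = "\<Union>j<card B. E j"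
   have U: "?U \<in> fins" by (rule UN_fins[OF _ E(1)]) simp
   have "(\<Sum>j<card B. a j * \<tau> j) - \<eta> * sum a {..<card B} = (\<Sum>j<card B. a j * (\<tau> j - \<eta>))"
    by (simp add: right_diff_distrib sum_subtractf sum_distrib_left mult.commute)
   also have "\<dots> \<le> expct w ?U F"
    unfolding ex
   proof (intro sum_mono mult_left_mono a)
    fix j assume "j \<in> {..<card B}"
    then have "prb w (E j) (many (Suc j) B z) \<le> prb w ?U (many (Suc j) B z)"
     by (intro expct_mono_set[OF w] increasing_of_bool)
       (use finsD[OF U] finitary_many[of "Suc j" B z] in \<open>auto simp: finitary_def\<close>)
    then show "\<tau> j - \<eta> \<le> prb w ?U (many (Suc j) B z)" using E(2)[of j] by linarith
   qed
   also have "\<dots> \<le> c" by (rule c[OF U])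
   finally have "(\<Sum>j<card B. a j * \<tau> j) - \<eta> * sum a {..<card B} \<le> c" .
   moreover have "\<eta> * sum a {..<card B} \<le> e" using s0 e by (simp add: \<eta>_def field_simps)
   ultimately show "(\<integral>\<omega>. F (opens \<omega>) \<partial>law w) \<le> c + e" unfolding int by linarith
  qed
 }
qed

section \<open>Comparison up to constants\<close>

text \<open>Reduces a comparison on all of \<open>S\<close> to large arguments: elsewhere both
  functions lie between positive constants, which are absorbed into the final constants.\<close>

lemma comparable_onI:
 fixes f g :: "'a \<Rightarrow> real"
 assumes pos: "c > 0" "C > 0" "a > 0" "b > 0" "gl > 0" "gu > 0"
  and large: "\<And>x. x \<in> S \<Longrightarrow> P x \<Longrightarrow> c * g x \<le> f x \<and> f x \<le> C * g x"
  and small: "\<And>x. x \<in> S \<Longrightarrow> \<not> P x \<Longrightarrow> a \<le> f x \<and> f x \<le> b \<and> gl \<le> g x \<and> g x \<le> gu"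
  and g: "\<And>x. x \<in> S \<Longrightarrow> 0 \<le> g x"
 shows "comparable_on S f g"
 unfolding comparable_on_def
proof (intro exI conjI ballI)
 show "0 < min c (a / gu)" "0 < max C (b / gl)" using pos by auto
 fix x assume x: "x \<in> S"
 show "min c (a / gu) * g x \<le> f x"
 proof (cases "P x")
  case True
  then have "min c (a / gu) * g x \<le> c * g x" using g[OF x] by (intro mult_right_mono) auto
  then show ?thesis using large[OF x True] by linarith
 next
  case False
  have "min c (a / gu) * g x \<le> a / gu * gu"
   using small[OF x False] g[OF x] pos by (intro mult_mono) auto
  then show ?thesis using small[OF x False] pos by simp
 qed
 show "f x \<le> max C (b / gl) * g x"
 proof (cases "P x")
  case True
  then have "C * g x \<le> max C (b / gl) * g x" using g[OF x] by (intro mult_right_mono) auto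
  then show ?thesis using large[OF x True] by linarith
 next
  case False
  have "b / gl * gl \<le> max C (b / gl) * g x"
   using small[OF x False] g[OF x] pos by (intro mult_mono) auto
  then show ?thesis using small[OF x False] pos by simp
 qed
qed

text \<open>Multiplicative constants disappear after dividing logarithms by \<open>ln (x t)\<close>.
  The equivalence contains both existence and uniqueness of the exponent.\<close>

lemma exponent_iff:
 fixes x f :: "'a \<Rightarrow> real"
 assumes x: "filterlim x at_top F" and F: "F \<noteq> bot" and c: "c > 0" "C > 0"
  and f: "\<forall>\<^sub>F t in F. c * x t powr u \<le> f t \<and> f t \<le> C * x t powr u"
 shows "(\<exists>\<epsilon>. (\<epsilon> \<longlongrightarrow> 0) F \<and> (\<forall>\<^sub>F t in F. f t = x t powr (v + \<epsilon> t))) \<longleftrightarrow> v = u"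
proof -
 define g where "g t = ln (f t) / ln (x t)" for t
 have x1: "\<forall>\<^sub>F t in F. x t > 1" using x by (simp add: filterlim_at_top_dense)
 have lnx: "filterlim (\<lambda>t. ln (x t)) at_top F" by (rule filterlim_compose[OF ln_at_top x])
 have g: "(g \<longlongrightarrow> u) F"
 proof (rule tendsto_sandwich)
  have bounds: "\<forall>\<^sub>F t in F. u + ln c / ln (x t) \<le> g t \<and> g t \<le> u + ln C / ln (x t)"
   using f x1
  proof eventually_elim
   case (elim t)
   have l: "ln (x t) > 0" using elim by simp
   have p: "0 < x t powr u" using elim by simp
   have pf: "0 < f t" using elim c mult_pos_pos[OF c(1) p] by linarith
   have "ln (c * x t powr u) \<le> ln (f t)" "ln (f t) \<le> ln (C * x t powr u)"
    using elim pf p c by (auto intro!: ln_mono mult_pos_pos)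
   then have "ln c + u * ln (x t) \<le> ln (f t)" "ln (f t) \<le> ln C + u * ln (x t)"
    using c p elim by (auto simp: ln_mult ln_powr)
   have "ln c / ln (x t) + u = (ln c + u * ln (x t)) / ln (x t)" "ln C / ln (x t) + u = (ln C + u * ln (x t)) / ln (x t)"
    using l by (simp_all add: add_divide_distrib)
   then show ?case
    using divide_right_mono[OF \<open>ln c + u * ln (x t) \<le> ln (f t)\<close>, of "ln (x t)"]
     divide_right_mono[OF \<open>ln (f t) \<le> ln C + u * ln (x t)\<close>, of "ln (x t)"] l
    by (simp add: g_def add.commute)
  qed
  then show "\<forall>\<^sub>F t in F. u + ln c / ln (x t) \<le> g t" "\<forall>\<^sub>F t in F. g t \<le> u + ln C / ln (x t)"
   by (auto elim: eventually_mono)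
  show "((\<lambda>t. u + ln c / ln (x t)) \<longlongrightarrow> u) F" "((\<lambda>t. u + ln C / ln (x t)) \<longlongrightarrow> u) F"
   using tendsto_add[OF tendsto_const[of u] real_tendsto_divide_at_top[OF tendsto_const[of "ln c"] lnx]]
    tendsto_add[OF tendsto_const[of u] real_tendsto_divide_at_top[OF tendsto_const[of "ln C"] lnx]] by simp_all
 qed
 show ?thesis
 proof
  assume "v = u"
  have "((\<lambda>t. g t - u) \<longlongrightarrow> 0) F" using g by (simp add: LIM_zero_iff)
  moreover have "\<forall>\<^sub>F t in F. f t = x t powr (v + (g t - u))"
   using f x1
  proof eventually_elim
   case (elim t)
   have p: "0 < x t powr u" using elim by simp
   have "0 < f t" using elim c mult_pos_pos[OF c(1) p] by linarith
   then show ?case using elim \<open>v = u\<close> by (simp add: g_def powr_def)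
  qed
  ultimately show "\<exists>\<epsilon>. (\<epsilon> \<longlongrightarrow> 0) F \<and> (\<forall>\<^sub>F t in F. f t = x t powr (v + \<epsilon> t))"
   by (intro exI[of _ "\<lambda>t. g t - u"] conjI)
 next
  assume "\<exists>\<epsilon>. (\<epsilon> \<longlongrightarrow> 0) F \<and> (\<forall>\<^sub>F t in F. f t = x t powr (v + \<epsilon> t))"
  then obtain \<epsilon> where \<epsilon>: "(\<epsilon> \<longlongrightarrow> 0) F" "\<forall>\<^sub>F t in F. f t = x t powr (v + \<epsilon> t)" by blast
  have "((\<lambda>t. v + \<epsilon> t) \<longlongrightarrow> v + 0) F" by (intro tendsto_intros \<epsilon>)
  moreover have "\<forall>\<^sub>F t in F. v + \<epsilon> t = g t"
   using \<epsilon>(2) x1 by eventually_elim (simp add: g_def ln_powr)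
  ultimately have "(g \<longlongrightarrow> v + 0) F" by (rule Lim_transform_eventually)
  then show "v = u" using tendsto_unique[OF F g] by simp
 qed
qed

section \<open>Bounds at the critical point\<close>

context crit
begin

lemma cluster_tail_eq: "cluster_tail N J m = measure (law (wt kf)) {\<omega> \<in> space (law (wt kf)). many m UNIV 0 (opens \<omega>)}"
 by (simp add: cluster_tail_def critical_law_eq many_iff_size cluster_eq_clus)

lemma cluster_tail_least:
 assumes "\<And>E. E \<in> fins \<Longrightarrow> prw kf E (\<lambda>W. real m \<le> csize W 0) \<le> c"
 shows "cluster_tail N J m \<le> c"
proof (rule field_le_epsilon)
 fix e :: real assume "0 < e"
 then obtain E where E: "E \<in> fins" "cluster_tail N J m - e < prw kf E (many m UNIV 0)"
  unfolding cluster_tail_eq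
  using finitary_exhaust(3)[where w="wt kf", OF finitary_many[of m UNIV 0] wt_kf_nonneg] by blast
 then show "cluster_tail N J m \<le> c + e"
  using assms[OF E(1)] prb_many[OF finsD[OF E(1)], of "wt kf" m UNIV 0] by simp
qed

lemma prb_le_cluster_tail:
 assumes "E \<in> fins"
 shows "prw kf E (\<lambda>W. real m \<le> csize W 0) \<le> cluster_tail N J m"
 unfolding cluster_tail_eq
 using finitary_exhaust(2)[where w="wt kf", OF finitary_many[of m UNIV 0] wt_kf_nonneg assms]
  prb_many[OF finsD[OF assms], of "wt kf" m UNIV 0] by simp

lemma cluster_tail_le_1: "cluster_tail N J m \<le> 1"
 unfolding cluster_tail_def critical_law_eq by (rule prob_space.prob_le_1[OF prob_space_law])

lemma cluster_tail_antimono: "m \<le> m' \<Longrightarrow> cluster_tail N J m' \<le> cluster_tail N J m"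
proof (rule cluster_tail_least)
 fix E :: "(int ^ 'd) set set" assume m: "m \<le> m'" and E: "E \<in> fins"
 have "prw kf E (\<lambda>W. real m' \<le> csize W 0) \<le> prw kf E (\<lambda>W. real m \<le> csize W 0)"
  by (rule prb_mono[OF wt_kf_nonneg]) (use m in auto)
 also have "\<dots> \<le> cluster_tail N J m" by (rule prb_le_cluster_tail[OF E])
 finally show "prw kf E (\<lambda>W. real m' \<le> csize W 0) \<le> cluster_tail N J m" .
qed

lemma ball_moment_eq: "ball_moment N J q r = (\<integral>\<omega>. csize_in (opens \<omega>) 0 (ball r) ^ q \<partial>law (wt kf))"
 by (simp add: ball_moment_def critical_law_eq cluster_eq_clus ball_eq)

lemma ball_moment_bounds:
 assumes "1 \<le> q" "0 \<le> r"
 shows "1 \<le> ball_moment N J q r" "ball_moment N J q r \<le> real (card (ball r)) ^ q"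
proof -
 have "0 < card (clus {} (0 :: int ^ 'd) \<inter> ball r)" using assms(2) by (auto simp: card_gt_0_iff)
 then have "1 \<le> real (card (clus {} (0 :: int ^ 'd) \<inter> ball r)) ^ q" by (intro one_le_power) simp
 also have "\<dots> \<le> ball_moment N J q r"
  unfolding ball_moment_eq
  using expct_le_integral[where w="wt kf" and z=0, OF wt_kf_nonneg finite_ball[of r] assms(1) empty_fins] by simp
 finally show "1 \<le> ball_moment N J q r" .
 show "ball_moment N J q r \<le> real (card (ball r)) ^ q"
  unfolding ball_moment_eq
  by (rule integral_least[where w="wt kf" and z=0, OF wt_kf_nonneg finite_ball assms(1)])
    (auto intro!: expct_le_const wt_kf_nonneg finsD power_mono card_mono)
qed

text \<open>Criticality makes the susceptibility at range r at least of order r^\<alpha>, while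
  localization in a ball makes it at most of order r^d. Thus (CL) forces \<alpha> \<le> d, and the
  tail exponent is nonpositive.\<close>

lemma alpha_le_dim: "\<alpha> \<le> real CARD('d)"
proof (rule ccontr)
 assume neg: "\<not> ?thesis"
 let ?d = "real CARD('d)"
 obtain hi where hi: "hi > 0" "\<And>r. r \<ge> 1 \<Longrightarrow> card (ball r) \<le> hi * r powr ?d"
  using card_ball_bounds by metis
 obtain B where B: "B \<ge> 1" and loc: "\<And>r E. r \<ge> 1 \<Longrightarrow> E \<in> fins \<Longrightarrow>
  expw (kc r) E csize0 \<le>
  expw (kc r) E (vol (ball (B * r))) + chi r / 4"
  using cluster_localized by metis
 obtain R0 T2 where R0: "R0 \<ge> 1" "T2 > 0" "\<And>r. R0 \<le> r \<Longrightarrow> tt r \<le> T2 * r powr (- \<alpha>)"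
  using tt_bounds by metis
 define K where "K = T2 * (2 * hi * B powr ?d)"
 have K: "K > 0" using R0 hi B by (simp add: K_def)
 have bound: "1 \<le> K * r powr (- (\<alpha> - ?d))" if r: "R0 \<le> r" for r
 proof -
  have r1: "r \<ge> 1" using r R0 by simp
  have Br: "1 \<le> B * r" using B r1 mult_mono[of 1 B 1 r] by simp
  have "chi r \<le> hi * (B * r) powr ?d + chi r / 4"
  proof (rule chi_least)
   fix E :: "(int ^ 'd) set set" assume E: "E \<in> fins"
   have "expw (kc r) E (vol (ball (B * r))) \<le> card (ball (B * r))"
    by (intro expct_le_const[OF wt_kc_nonneg finsD[OF E]]) (auto intro!: card_mono)
   then show "expw (kc r) E csize0 \<le> hi * (B * r) powr ?d + chi r / 4"
    using loc[OF r1 E] hi(2)[OF Br] by linarith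
  qed
  moreover have "0 \<le> hi * (B * r) powr ?d" using hi by simp
  ultimately have chi: "chi r \<le> 2 * hi * (B * r) powr ?d" by linarith
  have "1 \<le> tt r * chi r" using chi_tail[OF r1] by (simp add: tt_def)
  also have "\<dots> \<le> (T2 * r powr (- \<alpha>)) * (2 * hi * (B * r) powr ?d)"
   using R0 r chi chi_ge_1[OF r1] by (intro mult_mono) auto
  also have "\<dots> = K * (r powr (- \<alpha>) * r powr ?d)" using B r1 by (simp add: K_def powr_mult)
  also have "r powr (- \<alpha>) * r powr ?d = r powr (- (\<alpha> - ?d))" by (simp add: powr_add[symmetric])
  finally show ?thesis .
 qed
 have "((\<lambda>r. K * r powr (- (\<alpha> - ?d))) \<longlongrightarrow> K * 0) at_top"
  using neg by (intro tendsto_intros tendsto_neg_powr filterlim_ident) auto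
 moreover have "\<forall>\<^sub>F r in at_top. 1 \<le> K * r powr (- (\<alpha> - ?d))"
  using eventually_ge_at_top[of R0] by eventually_elim (rule bound)
 ultimately have "1 \<le> K * 0" by (intro tendsto_lowerbound) auto
 then show False by simp
qed

lemma tail_upper:
 assumes d3: "real CARD('d) < 3 * \<alpha>"
 obtains C n1 where "C > 0" "n1 \<ge> 1"
  "\<And>m. n1 \<le> real m \<Longrightarrow> cluster_tail N J m \<le> C * real m powr (- (real CARD('d) - \<alpha>) / p)"
proof -
 obtain \<epsilon> r1 where \<epsilon>: "\<epsilon> > 0" "r1 \<ge> 1" and M:
  "\<And>r h. r1 \<le> r \<Longrightarrow> 1 / (\<epsilon> * r powr (p / 2)) \<le> h \<Longrightarrow> ghost_prob kf h \<le> h / tt r"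
  using ghost_prob_bound[OF d3] by metis
 obtain R0 T1 where R0: "T1 > 0" "\<And>r. R0 \<le> r \<Longrightarrow> T1 * r powr (- \<alpha>) \<le> tt r"
  using tt_bounds by metis
 define r2 where "r2 = max r1 R0"
 define n1 where "n1 = max 1 (\<epsilon> * r2 powr (p / 2))"
 have r2: "r2 \<ge> 1" using \<epsilon> by (simp add: r2_def)
 show ?thesis
 proof (rule that[of "2 / T1 * (1 / \<epsilon>) powr (2 * \<alpha> / p)" n1])
  show "0 < 2 / T1 * (1 / \<epsilon>) powr (2 * \<alpha> / p)" "1 \<le> n1" using R0 \<epsilon> by (auto simp: n1_def)
 next
  fix m :: nat assume m: "n1 \<le> real m"
  have m0: "real m > 0" using m by (auto simp: n1_def)
  \<comment> \<open>The range whose threshold field 1 / (\<epsilon> r^(p/2)) equals 1 / m.\<close>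
  define r where "r = (real m / \<epsilon>) powr (2 / p)"
  have rp: "r powr (p / 2) = real m / \<epsilon>" using m0 \<epsilon> p_pos by (simp add: r_def powr_powr)
  have "r2 \<le> r"
  proof -
   have "r2 = (r2 powr (p / 2)) powr (2 / p)" using r2 p_pos by (simp add: powr_powr)
   also have "\<dots> \<le> r" unfolding r_def using m \<epsilon> p_pos
    by (intro powr_mono2) (auto simp: n1_def pos_le_divide_eq mult.commute)
   finally show ?thesis .
  qed
  then have r: "r1 \<le> r" "R0 \<le> r" "r > 0" using r2 by (auto simp: r2_def)
  show "cluster_tail N J m \<le> 2 / T1 * (1 / \<epsilon>) powr (2 * \<alpha> / p) * real m powr (- (real CARD('d) - \<alpha>) / p)"
  proof (rule cluster_tail_least)
   fix E :: "(int ^ 'd) set set" assume E: "E \<in> fins"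
   have "prw kf E (\<lambda>W. real m \<le> csize W 0) \<le> 2 * ghost_prob kf (1 / real m)"
    by (rule prb_card_ge_le[OF kf_kernel_fn E m0])
   also have "ghost_prob kf (1 / real m) \<le> 1 / real m / tt r"
    by (rule M[OF r(1)]) (use \<epsilon> m0 in \<open>simp add: rp\<close>)
   also have "\<dots> \<le> 1 / real m / (T1 * r powr (- \<alpha>))"
   proof (rule divide_left_mono[OF R0(2)[OF r(2)]])
    have "0 < T1 * r powr (- \<alpha>)" using R0 r by simp
    then show "0 < tt r * (T1 * r powr (- \<alpha>))"
     using R0(2)[OF r(2)] by (intro mult_pos_pos[of "tt r"]) linarith+
   qed (use m0 in simp)
   also have "\<dots> = 1 / T1 * (r powr \<alpha> / real m)" by (simp add: powr_minus field_simps)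
   also have "r powr \<alpha> = (1 / \<epsilon>) powr (2 * \<alpha> / p) * real m powr (2 * \<alpha> / p)"
    using m0 \<epsilon> by (simp add: r_def powr_powr powr_divide mult.commute)
   also have "\<dots> / real m = (1 / \<epsilon>) powr (2 * \<alpha> / p) * real m powr (2 * \<alpha> / p - 1)"
    using m0 by (simp add: powr_diff)
   also have "2 * \<alpha> / p - 1 = - (real CARD('d) - \<alpha>) / p"
    using p_pos by (simp add: p_def divide_simps)
   finally show "prw kf E (\<lambda>W. real m \<le> csize W 0) \<le>
     2 / T1 * (1 / \<epsilon>) powr (2 * \<alpha> / p) * real m powr (- (real CARD('d) - \<alpha>) / p)" by simp
  qed
 qed
qed

text \<open>At the truncation \<epsilon> r^(p/2) the expected number of vertices of the ball in
  larger clusters is itself of order at most r^(p/2). A size \<open>m\<close> of that order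
  therefore exceeds the largest cluster with probability at least 1/2, as the moment bound
  requires.\<close>

lemma moments_upper:
 assumes d3: "real CARD('d) < 3 * \<alpha>" and q: "1 \<le> q"
 obtains C r2 where "C > 0" "r2 \<ge> 1"
  "\<And>r E. r2 \<le> r \<Longrightarrow> E \<in> fins \<Longrightarrow> expw kf E (\<lambda>W. vol (ball r) W ^ q) \<le>
   C * (r powr \<alpha> * (r powr (p / 2)) ^ (q - 1))"
proof -
 let ?d = "real CARD('d)"
 obtain \<epsilon> r1 where \<epsilon>: "\<epsilon> > 0" "r1 \<ge> 1" and M:
  "\<And>r h. r1 \<le> r \<Longrightarrow> 1 / (\<epsilon> * r powr (p / 2)) \<le> h \<Longrightarrow> ghost_prob kf h \<le> h / tt r"
  using ghost_prob_bound[OF d3] by metis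
 obtain R0 T1 where R0: "T1 > 0" "\<And>r. R0 \<le> r \<Longrightarrow> T1 * r powr (- \<alpha>) \<le> tt r"
  using tt_bounds by metis
 obtain lo hi where pos: "lo > 0" "hi > 0"
  and lo: "\<And>r. r \<ge> 1 \<Longrightarrow> lo * r powr ?d \<le> card (ball r)"
  and hi: "\<And>r. r \<ge> 1 \<Longrightarrow> card (ball r) \<le> hi * r powr ?d"
  using card_ball_bounds by metis
 define h where "h = hi * 2 powr ?d"
 define K1 where "K1 = h / (\<epsilon> * T1)"
 define K where "K = max (4 * K1) \<epsilon>"
 define G where "G = 2 * \<epsilon> ^ q * K1 + moment_const q * (K + 1) ^ q * (2 * K1 + (K + 1))"
 have K: "h > 0" "K1 > 0" "K > 0" "4 * K1 \<le> K" "\<epsilon> \<le> K" using pos \<epsilon> R0 by (auto simp: h_def K1_def K_def)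
 have G: "G > 0" unfolding G_def using K \<epsilon> moment_const_pos[of q] by (intro add_pos_pos mult_pos_pos) auto
 show ?thesis
 proof (rule that[of "G / lo" "max r1 R0"])
  show "0 < G / lo" "1 \<le> max r1 R0" using G pos \<epsilon> by auto
 next
  fix r :: real and E :: "(int ^ 'd) set set" assume "max r1 R0 \<le> r" and E: "E \<in> fins"
  then have r: "r1 \<le> r" "R0 \<le> r" "r > 0" "r \<ge> 1" using \<epsilon> by auto
  define z S D where "z = r powr (p / 2)" and "S = r powr \<alpha>" and "D = r powr ?d"
  have z: "z \<ge> 1" "z > 0" "S > 0" "D > 0" using r p_pos by (auto simp: z_def S_def D_def ge_one_powr_ge_zero)
  have z2: "z * z = S * D"
   unfolding z_def S_def D_def by (simp add: powr_add[symmetric] p_def add.commute)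
  define n where "n = \<epsilon> * z"
  have n: "n > 0" using \<epsilon> z by (simp add: n_def)
  define \<mu> where "\<mu> = ghost_prob kf (1 / n)"
  have \<mu>0: "0 \<le> \<mu>" unfolding \<mu>_def using n by (intro ghost_prob_bounds kf_kernel_fn) simp
  have T: "T1 / S \<le> tt r" using R0(2)[OF r(2)] by (simp add: S_def powr_minus divide_inverse)
  have "\<mu> \<le> 1 / n / tt r" unfolding \<mu>_def by (rule M[OF r(1)]) (simp add: n_def z_def)
  also have "\<dots> \<le> 1 / n / (T1 / S)"
  proof (rule divide_left_mono[OF T])
   have "0 < T1 / S" using R0 z by simp
   then show "0 < tt r * (T1 / S)" using T by (intro mult_pos_pos) linarith+
  qed (use n in simp)
  finally have \<mu>: "\<mu> \<le> S / (n * T1)" by simp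
  have L: "real (card (ball (2 * r))) \<le> h * D"
   using hi[of "2 * r"] r by (simp add: h_def D_def powr_mult mult.assoc)
  have Lm: "real (card (ball (2 * r))) * \<mu> \<le> K1 * z"
  proof -
   have "real (card (ball (2 * r))) * \<mu> \<le> (h * D) * (S / (n * T1))" using L \<mu> \<mu>0 K z by (intro mult_mono) auto
   also have "\<dots> = K1 * (S * D) / z" by (simp add: K1_def n_def mult_ac)
   also have "\<dots> = K1 * z" using z by (simp flip: z2)
   finally show ?thesis .
  qed
  define m where "m = nat \<lceil>K * z\<rceil>"
  have Kz: "K * z > 0" using K z by simp
  then have m: "K * z \<le> real m" "real m \<le> K * z + 1" "m > 0" by (auto simp: m_def)
  have mz: "real m \<le> (K + 1) * z" using m(2) z by (simp add: algebra_simps)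
  have half: "prw kf E (has_clus (ball (2 * r)) m) \<le> 1 / 2" if E: "E \<in> fins" for E
  proof (rule prb_half_of_big_count[OF wt_kf_nonneg finite_ball])
   have "expw kf E (big_count (ball (2 * r)) n) \<le> card (ball (2 * r)) * (2 * \<mu>)"
    unfolding \<mu>_def by (rule expct_big_count_le[OF kf_kernel_fn E finite_ball n])
   also have "\<dots> \<le> 2 * (K1 * z)" using Lm by simp
   finally have "2 * expw kf E (big_count (ball (2 * r)) n) \<le> (4 * K1) * z" by simp
   also have "\<dots> \<le> K * z" using K z by (intro mult_right_mono) auto
   finally show "2 * expw kf E (big_count (ball (2 * r)) n) \<le> real m" using m by linarith
   have "n \<le> K * z" using K z unfolding n_def by (intro mult_right_mono) auto
   then show "n \<le> real m" using m by linarith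
   show "m > 0" by (rule m)
  qed
  define Q where "Q = z ^ (q - 1)"
  have Q: "Q > 0" "z ^ q = Q * z" using z q power_minus_mult[of q z] by (auto simp: Q_def)
  let ?e = "expw kf E (\<lambda>W. vol (ball r) W ^ q)"
  have "lo * D * ?e \<le> card (ball r) * ?e"
   using lo[OF r(4)] by (intro mult_right_mono expct_nonneg wt_kf_nonneg) (auto simp: D_def)
  also have "\<dots> \<le> 2 * n ^ q * (card (ball (2 * r)) * \<mu>) + moment_const q * real m ^ q * (2 * (card (ball (2 * r)) * \<mu>) + m)"
  proof -
   have "x \<in> ball r \<Longrightarrow> y \<in> ball r \<Longrightarrow> x + y \<in> ball (2 * r)" for x y
    using n_add[of x y] by (simp add: ball_def)
   then show ?thesis
    using expct_ball_moment[OF kf_kernel_fn n q _ finite_ball[of r] finite_ball[of "2 * r"] _ _ half E] m(3) r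
    by (simp add: \<mu>_def mult_ac Suc_le_eq)
  qed
  also have "\<dots> \<le> 2 * (\<epsilon> ^ q * (Q * z)) * (K1 * z) + moment_const q * ((K + 1) ^ q * (Q * z)) * (2 * (K1 * z) + (K + 1) * z)"
  proof (rule add_mono)
   show "2 * n ^ q * (card (ball (2 * r)) * \<mu>) \<le> 2 * (\<epsilon> ^ q * (Q * z)) * (K1 * z)"
    unfolding n_def power_mult_distrib Q(2) using \<epsilon> Q z by (intro mult_left_mono Lm) auto
   have "real m ^ q \<le> ((K + 1) * z) ^ q" by (intro power_mono mz) simp
   then have "real m ^ q \<le> (K + 1) ^ q * (Q * z)" by (simp add: power_mult_distrib Q(2))
   then have 1: "moment_const q * real m ^ q \<le> moment_const q * ((K + 1) ^ q * (Q * z))"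
    using moment_const_pos[of q] by (intro mult_left_mono) auto
   have 2: "2 * (card (ball (2 * r)) * \<mu>) + m \<le> 2 * (K1 * z) + (K + 1) * z" using Lm mz by linarith
   show "moment_const q * real m ^ q * (2 * (card (ball (2 * r)) * \<mu>) + m) \<le>
     moment_const q * ((K + 1) ^ q * (Q * z)) * (2 * (K1 * z) + (K + 1) * z)"
    by (rule mult_mono[OF 1 2]) (use moment_const_pos[of q] K Q z \<mu>0 in auto)
  qed
  also have "\<dots> = G * Q * (z * z)" by (simp add: G_def algebra_simps)
  also have "\<dots> = lo * D * (G / lo * (S * Q))" using pos by (simp add: z2)
  finally have "?e \<le> G / lo * (S * Q)" using pos z by (simp only: mult_le_cancel_left_pos mult_pos_pos)
  then show "?e \<le> G / lo * (r powr \<alpha> * (r powr (p / 2)) ^ (q - 1))" by (simp add: S_def Q_def z_def)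
 qed
qed

text \<open>Of the susceptibility, 1/8 is lost in choosing \<open>E\<close>, 1/4 by leaving the ball
  and 1/8 to clusters below size a s^(p/2); half remains. The last share is at most 2 /
  \<open>tt (l * s)\<close>, and the factor \<open>l\<close> is what makes it small against
  \<open>chi s\<close>.\<close>

lemma mass_lower:
 assumes d3: "real CARD('d) < 3 * \<alpha>"
 obtains B c a s1 where "B \<ge> 1" "c > 0" "a > 0" "s1 \<ge> 1"
  "\<And>s. s1 \<le> s \<Longrightarrow> \<exists>E\<in>fins. c * s powr \<alpha> \<le> expw kf E (\<lambda>W. vol (ball (B * s)) W *
   of_bool (a * s powr (p / 2) \<le> vol (ball (B * s)) W))"
proof -
 obtain \<epsilon> r1 where \<epsilon>: "\<epsilon> > 0" "r1 \<ge> 1" and M: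
  "\<And>r s h. r1 \<le> r \<Longrightarrow> r \<le> s \<Longrightarrow> 1 / (\<epsilon> * r powr (p / 2)) \<le> h \<Longrightarrow> ghost_prob (kc s) h \<le> h / tt r"
  using ghost_prob_bound[OF d3] by metis
 obtain R0 T1 T2 where T: "R0 \<ge> 1" "T1 > 0" "T2 > 0"
  and T1: "\<And>r. R0 \<le> r \<Longrightarrow> T1 * r powr (- \<alpha>) \<le> tt r" and T2: "\<And>r. R0 \<le> r \<Longrightarrow> tt r \<le> T2 * r powr (- \<alpha>)"
  using tt_bounds by metis
 obtain B where B: "B \<ge> 1" and loc: "\<And>r E. r \<ge> 1 \<Longrightarrow> E \<in> fins \<Longrightarrow>
  expw (kc r) E csize0 \<le>
  expw (kc r) E (vol (ball (B * r))) + chi r / 4"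
  using cluster_localized by metis
 define l where "l = min 1 ((T1 / (16 * T2)) powr (1 / \<alpha>))"
 have l: "0 < l" "l \<le> 1" "l powr \<alpha> \<le> T1 / (16 * T2)"
 proof -
  show "0 < l" "l \<le> 1" using T by (auto simp: l_def)
  then have "l powr \<alpha> \<le> ((T1 / (16 * T2)) powr (1 / \<alpha>)) powr \<alpha>" using \<alpha> by (intro powr_mono2) (auto simp: l_def)
  also have "\<dots> = T1 / (16 * T2)" using T \<alpha> by (simp add: powr_powr)
  finally show "l powr \<alpha> \<le> T1 / (16 * T2)" .
 qed
 define s1 where "s1 = max R0 (max r1 R0 / l)"
 define a where "a = \<epsilon> * l powr (p / 2)"
 show ?thesis
 proof (rule that[of B "1 / (2 * T2)" a s1])
  show "1 \<le> B" "0 < 1 / (2 * T2)" "0 < a" "1 \<le> s1" using B T \<epsilon> l by (auto simp: a_def s1_def)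
 next
  fix s assume s: "s1 \<le> s"
  have s0: "R0 \<le> s" "s \<ge> 1" "s > 0" "r1 \<le> l * s" "R0 \<le> l * s" "l * s \<le> s"
  proof -
   show "R0 \<le> s" using s by (simp add: s1_def)
   then show "s \<ge> 1" "s > 0" using T by auto
   have "max r1 R0 / l \<le> s" using s by (simp add: s1_def)
   then have "max r1 R0 \<le> l * s" using l by (simp add: pos_divide_le_eq mult.commute)
   then show "r1 \<le> l * s" "R0 \<le> l * s" by auto
   show "l * s \<le> s" using l \<open>s > 0\<close> by (simp add: mult_left_le_one_le)
  qed
  define S where "S = s powr \<alpha>"
  have S: "S > 0" using s0 by (simp add: S_def)
  have chi: "S / T2 \<le> chi s"
  proof -
   have "1 \<le> tt s * chi s" using chi_tail[OF s0(2)] by (simp add: tt_def)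
   also have "\<dots> \<le> (T2 / S) * chi s"
    using T2[OF s0(1)] chi_ge_1[OF s0(2)]
    by (intro mult_right_mono) (auto simp: S_def powr_minus divide_inverse)
   finally show ?thesis using S T by (simp add: field_simps)
  qed
  have chi0: "chi s > 0" using chi_ge_1[OF s0(2)] by simp
  define n where "n = a * s powr (p / 2)"
  have n: "n > 0" "n = \<epsilon> * (l * s) powr (p / 2)" using \<epsilon> l s0 by (auto simp: n_def a_def powr_mult)
  let ?k = "\<lambda>W. vol (ball (B * s)) W"
  obtain E where E: "E \<in> fins" "7 / 8 * chi s < expw (kc s) E csize0"
   using chi_least[of s "7 / 8 * chi s"] chi0 by force
  have mn: "expw (kc s) E (\<lambda>W. min (csize W 0) n) \<le> chi s / 8"
  proof -
   have lT: "T1 / (l powr \<alpha> * S) \<le> tt (l * s)"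
    using T1[OF s0(5)] l s0 by (simp add: S_def powr_mult powr_minus field_simps)
   have lS: "0 < T1 / (l powr \<alpha> * S)" using T l S by simp
   have "expw (kc s) E (\<lambda>W. min (csize W 0) n) \<le> 2 * n * ghost_prob (kc s) (1 / n)"
    by (rule expct_min_card_le[OF kc_kernel_fn E(1) n(1)])
   also have "\<dots> \<le> 2 * n * (1 / n / tt (l * s))"
    using n by (intro mult_left_mono M s0) auto
   also have "\<dots> = 2 / tt (l * s)" using n(1) by simp
   also have "\<dots> \<le> 2 / (T1 / (l powr \<alpha> * S))" using lT lS by (intro divide_left_mono mult_pos_pos) auto
   also have "\<dots> = l powr \<alpha> * (2 * S / T1)" by simp
   also have "\<dots> \<le> T1 / (16 * T2) * (2 * S / T1)" using l S T by (intro mult_right_mono) auto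
   also have "\<dots> = S / T2 / 8" using T by simp
   also have "\<dots> \<le> chi s / 8" using chi by (intro divide_right_mono) auto
   finally show ?thesis .
  qed
  have inc: "increasing_on E (\<lambda>W. ?k W * of_bool (n \<le> ?k W))"
   unfolding increasing_on_def
  proof (intro allI impI)
   fix A A' :: "(int ^ 'd) set set" assume "A \<subseteq> A'" "A' \<subseteq> E"
   then have "?k A \<le> ?k A'" using card_clus_Int_mono[of "ball (B * s)" A A' 0] by simp
   then show "?k A * of_bool (n \<le> ?k A) \<le> ?k A' * of_bool (n \<le> ?k A')" by auto
  qed
  have "expw (kc s) E ?k \<le> expw (kc s) E (\<lambda>W. ?k W * of_bool (n \<le> ?k W) + min (csize W 0) n)"
  proof (rule expct_mono[OF wt_kc_nonneg])
   fix W assume "W \<subseteq> E"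
   then have "finite (clus W 0)" using finsD[OF E(1)] by (meson finite_clus finite_subset)
   then have "?k W \<le> csize W 0" by (intro of_nat_mono card_mono) auto
   then show "?k W \<le> ?k W * of_bool (n \<le> ?k W) + min (csize W 0) n" using n by (auto simp: min_def)
  qed
  also have "\<dots> \<le> expw (kc s) E (\<lambda>W. ?k W * of_bool (n \<le> ?k W)) + chi s / 8"
   using mn by (simp add: expct_add)
  finally have "expw (kc s) E ?k \<le> expw (kc s) E (\<lambda>W. ?k W * of_bool (n \<le> ?k W)) + chi s / 8" .
  then have "chi s / 2 \<le> expw (kc s) E (\<lambda>W. ?k W * of_bool (n \<le> ?k W))"
   using loc[OF s0(2) E(1)] E(2) by linarith
  also have "\<dots> \<le> expw kf E (\<lambda>W. ?k W * of_bool (n \<le> ?k W))"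
   by (rule expct_kernel_mono[OF kc_kernel_fn kf_kernel_fn kc_le_kf E(1) inc])
  finally have "1 / (2 * T2) * s powr \<alpha> \<le> expw kf E (\<lambda>W. ?k W * of_bool (n \<le> ?k W))"
   using chi by (simp add: S_def)
  then show "\<exists>E\<in>fins. 1 / (2 * T2) * s powr \<alpha> \<le> expw kf E (\<lambda>W. ?k W * of_bool (a * s powr (p / 2) \<le> ?k W))"
   using E(1) unfolding n_def by blast
 qed
qed

lemma tail_lower:
 assumes d3: "real CARD('d) < 3 * \<alpha>"
 obtains c n1 where "c > 0" "n1 \<ge> 1"
  "\<And>m. n1 \<le> real m \<Longrightarrow> c * real m powr (- (real CARD('d) - \<alpha>) / p) \<le> cluster_tail N J m"
proof -
 obtain B c a s1 where pos: "B \<ge> 1" "c > 0" "a > 0" "s1 \<ge> 1" and mass: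
  "\<And>s. s1 \<le> s \<Longrightarrow> \<exists>E\<in>fins. c * s powr \<alpha> \<le> expw kf E (\<lambda>W. vol (ball (B * s)) W *
   of_bool (a * s powr (p / 2) \<le> vol (ball (B * s)) W))"
  by (rule mass_lower[OF d3], rule that)
 obtain C r2 where C: "C > 0" "r2 \<ge> 1" and up:
  "\<And>r E. r2 \<le> r \<Longrightarrow> E \<in> fins \<Longrightarrow> expw kf E (\<lambda>W. vol (ball r) W ^ 2) \<le>
   C * (r powr \<alpha> * (r powr (p / 2)) ^ (2 - 1))"
  by (rule moments_upper[OF d3, of 2], simp, rule that)
 define s2 where "s2 = max s1 r2"
 have s2: "s2 \<ge> 1" using pos by (simp add: s2_def)
 define n1 where "n1 = max 1 (a * s2 powr (p / 2))"
 define b where "b = c\<^sup>2 / (C * (B powr \<alpha> * B powr (p / 2)))"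
 have b: "b > 0" using pos C by (simp add: b_def)
 show ?thesis
 proof (rule that[of "b * (1 / a) powr (2 * \<alpha> / p - 1)" n1])
  show "0 < b * (1 / a) powr (2 * \<alpha> / p - 1)" "1 \<le> n1" using b pos by (auto simp: n1_def)
 next
  fix m :: nat assume m: "n1 \<le> real m"
  have m0: "real m > 0" using m by (auto simp: n1_def)
  define s where "s = (real m / a) powr (2 / p)"
  have sp: "s powr (p / 2) = real m / a" using m0 pos p_pos by (simp add: s_def powr_powr)
  have "s2 \<le> s"
  proof -
   have "s2 = (s2 powr (p / 2)) powr (2 / p)" using s2 p_pos by (simp add: powr_powr)
   also have "\<dots> \<le> s" unfolding s_def using m pos p_pos
    by (intro powr_mono2) (auto simp: n1_def pos_le_divide_eq mult.commute)
   finally show ?thesis .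
  qed
  moreover from this have "s \<le> B * s" using pos s2 mult_right_mono[of 1 B s] by simp
  ultimately have s: "s1 \<le> s" "r2 \<le> B * s" "s > 0" using s2 by (auto simp: s2_def)
  let ?k = "\<lambda>W. vol (ball (B * s)) W"
  obtain E where E: "E \<in> fins" "c * s powr \<alpha> \<le> expw kf E (\<lambda>W. ?k W * of_bool (real m \<le> ?k W))"
   using mass[OF s(1)] pos unfolding sp by auto
  have "prw kf E (\<lambda>W. real m \<le> ?k W) \<le> prw kf E (\<lambda>W. real m \<le> csize W 0)"
  proof (rule prb_mono[OF wt_kf_nonneg])
   fix W assume "W \<subseteq> E" "real m \<le> ?k W"
   moreover have "finite (clus W 0)" using finsD[OF E(1)] \<open>W \<subseteq> E\<close> by (meson finite_clus finite_subset)
   then have "?k W \<le> csize W 0" by (intro of_nat_mono card_mono) auto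
   ultimately show "real m \<le> csize W 0" by linarith
  qed
  also have "\<dots> \<le> cluster_tail N J m" by (rule prb_le_cluster_tail[OF E(1)])
  finally have P: "prw kf E (\<lambda>W. real m \<le> ?k W) \<le> cluster_tail N J m" .
  have P0: "0 \<le> prw kf E (\<lambda>W. real m \<le> ?k W)" by (rule prb_nonneg[OF wt_kf_nonneg])
  have "(c * s powr \<alpha>)\<^sup>2 \<le> (expw kf E (\<lambda>W. ?k W * of_bool (real m \<le> ?k W)))\<^sup>2"
   using E(2) pos by (intro power_mono) auto
  also have "\<dots> \<le> expw kf E (\<lambda>W. (?k W)\<^sup>2) * expw kf E (\<lambda>W. (of_bool (real m \<le> ?k W))\<^sup>2)"
   by (rule expct_Cauchy_Schwarz[OF wt_kf_nonneg])
  also have "\<dots> = expw kf E (\<lambda>W. (?k W)\<^sup>2) * prw kf E (\<lambda>W. real m \<le> ?k W)"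
  proof -
   have "(\<lambda>W. (of_bool (real m \<le> ?k W))\<^sup>2) = (\<lambda>W. of_bool (real m \<le> ?k W) :: real)"
    by (simp add: fun_eq_iff of_bool_def)
   then show ?thesis by (simp only:)
  qed
  also have "\<dots> \<le> (C * ((B * s) powr \<alpha> * (B * s) powr (p / 2))) * cluster_tail N J m"
   using up[OF s(2) E(1)] P P0 C by (intro mult_mono) auto
  also have "\<dots> = (C * (B powr \<alpha> * B powr (p / 2))) * (s powr \<alpha> * s powr (p / 2)) * cluster_tail N J m"
   using pos s by (simp add: powr_mult)
  finally have "(c * s powr \<alpha>)\<^sup>2 / ((C * (B powr \<alpha> * B powr (p / 2))) * (s powr \<alpha> * s powr (p / 2))) \<le> cluster_tail N J m"
   using C pos s by (simp add: pos_divide_le_eq mult.commute)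
  moreover have "(c * s powr \<alpha>)\<^sup>2 / ((C * (B powr \<alpha> * B powr (p / 2))) * (s powr \<alpha> * s powr (p / 2))) = b * (s powr \<alpha> / s powr (p / 2))"
   using C pos s by (simp add: b_def power2_eq_square)
  moreover have "s powr \<alpha> / s powr (p / 2) = (real m / a) powr (2 * \<alpha> / p - 1)"
   unfolding sp using m0 pos by (simp add: s_def powr_powr powr_diff mult.commute)
  moreover have "(real m / a) powr (2 * \<alpha> / p - 1) = (1 / a) powr (2 * \<alpha> / p - 1) * real m powr (2 * \<alpha> / p - 1)"
   using m0 pos by (simp flip: powr_mult)
  moreover have "2 * \<alpha> / p - 1 = - (real CARD('d) - \<alpha>) / p" using p_pos by (simp add: p_def divide_simps)
  ultimately show "b * (1 / a) powr (2 * \<alpha> / p - 1) * real m powr (- (real CARD('d) - \<alpha>) / p) \<le> cluster_tail N J m"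
   by simp
 qed
qed

lemma tail_comparable:
 assumes d3: "real CARD('d) < 3 * \<alpha>"
 shows "comparable_on {1..} (cluster_tail N J) (\<lambda>m. real m powr (- (real CARD('d) - \<alpha>) / p))"
proof -
 let ?\<theta> = "- (real CARD('d) - \<alpha>) / p"
 have \<theta>: "?\<theta> \<le> 0" using alpha_le_dim p_pos by (simp add: divide_nonpos_pos)
 obtain C n1 where C: "C > 0" "n1 \<ge> 1" "\<And>m. n1 \<le> real m \<Longrightarrow> cluster_tail N J m \<le> C * real m powr ?\<theta>"
  using tail_upper[OF d3] by metis
 obtain c n2 where c: "c > 0" "n2 \<ge> 1" "\<And>m. n2 \<le> real m \<Longrightarrow> c * real m powr ?\<theta> \<le> cluster_tail N J m"
  using tail_lower[OF d3] by metis
 define k where "k = nat \<lceil>max n1 n2\<rceil>"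
 have k: "n1 \<le> real k" "n2 \<le> real k" by (auto simp: k_def) linarith+
 have k0: "real k > 0" using k C by linarith
 have "0 < c * real k powr ?\<theta>" using c k0 by simp
 then have tk: "0 < cluster_tail N J k" using c(3)[OF k(2)] by linarith
 show ?thesis
 proof (rule comparable_onI[where P="\<lambda>m. k \<le> m" and a="cluster_tail N J k" and b=1 and gl="real k powr ?\<theta>" and gu=1, OF c(1) C(1) tk])
  fix m :: nat assume "k \<le> m"
  then have "n1 \<le> real m" "n2 \<le> real m" using k by linarith+
  then show "c * real m powr ?\<theta> \<le> cluster_tail N J m \<and> cluster_tail N J m \<le> C * real m powr ?\<theta>" using c C by blast
 next
  fix m :: nat assume m: "m \<in> {1..}" "\<not> k \<le> m"
  have "real k powr ?\<theta> \<le> real m powr ?\<theta>" using m \<theta> by (intro powr_mono2') auto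
  moreover have "real m powr ?\<theta> \<le> real m powr 0" using m \<theta> by (intro powr_mono) auto
  ultimately show "cluster_tail N J k \<le> cluster_tail N J m \<and> cluster_tail N J m \<le> 1 \<and>
    real k powr ?\<theta> \<le> real m powr ?\<theta> \<and> real m powr ?\<theta> \<le> 1"
   using m cluster_tail_antimono[of m k] cluster_tail_le_1[of m] by simp
 qed (use k0 in auto)
qed

lemma moments_comparable:
 assumes d3: "real CARD('d) < 3 * \<alpha>" and q: "1 \<le> q"
 shows "comparable_on {1..} (ball_moment N J q) (\<lambda>r. r powr (\<alpha> + (real q - 1) * p / 2))"
proof -
 let ?e = "\<alpha> + (real q - 1) * p / 2"
 have e: "0 \<le> ?e" using \<alpha> p_pos q by simp
 have eq: "r powr \<alpha> * (r powr (p / 2)) ^ (q - 1) = r powr ?e" if "r > 0" for r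
  using that q by (simp add: powr_power powr_add[symmetric] of_nat_diff mult.commute)
 obtain C r2 where C: "C > 0" "r2 \<ge> 1" and up:
  "\<And>r E. r2 \<le> r \<Longrightarrow> E \<in> fins \<Longrightarrow> expw kf E (\<lambda>W. vol (ball r) W ^ q) \<le>
   C * (r powr \<alpha> * (r powr (p / 2)) ^ (q - 1))"
  by (rule moments_upper[OF d3 q], rule that)
 obtain B c a s1 where pos: "B \<ge> 1" "c > 0" "a > 0" "s1 \<ge> 1" and mass:
  "\<And>s. s1 \<le> s \<Longrightarrow> \<exists>E\<in>fins. c * s powr \<alpha> \<le> expw kf E (\<lambda>W. vol (ball (B * s)) W *
   of_bool (a * s powr (p / 2) \<le> vol (ball (B * s)) W))"
  by (rule mass_lower[OF d3], rule that)
 define r3 where "r3 = max r2 (B * s1)"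
 have r3: "r3 \<ge> 1" using C by (simp add: r3_def)
 define c' where "c' = c * a ^ (q - 1) * (1 / B) powr ?e"
 have c': "c' > 0" using pos by (simp add: c'_def)
 have low: "c' * r powr ?e \<le> ball_moment N J q r" if r: "r3 \<le> r" for r
 proof -
  define s where "s = r / B"
  have rs: "r = B * s" using pos by (simp add: s_def)
  have "B * s1 \<le> B * s" using r by (simp add: r3_def rs)
  then have s: "s1 \<le> s" "s > 0" using pos by auto
  let ?k = "\<lambda>W. vol (ball r) W" and ?n = "a * s powr (p / 2)"
  obtain E where E: "E \<in> fins" "c * s powr \<alpha> \<le> expw kf E (\<lambda>W. ?k W * of_bool (?n \<le> ?k W))"
   using mass[OF s(1)] unfolding rs by blast
  have "c' * r powr ?e = c * a ^ (q - 1) * s powr ?e"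
   using pos s by (simp add: c'_def s_def powr_divide)
  also have "\<dots> = c * s powr \<alpha> * ?n ^ (q - 1)" by (simp add: eq[OF s(2), symmetric] power_mult_distrib)
  also have "\<dots> \<le> expw kf E (\<lambda>W. ?k W * of_bool (?n \<le> ?k W)) * ?n ^ (q - 1)"
   using E(2) pos by (intro mult_right_mono) auto
  also have "\<dots> \<le> expw kf E (\<lambda>W. ?k W ^ q)"
   unfolding expct_multc[symmetric]
  proof (rule expct_mono[OF wt_kf_nonneg])
   fix W
   have "?k W * ?n ^ (q - 1) \<le> ?k W * ?k W ^ (q - 1)" if "?n \<le> ?k W"
    using that pos by (intro mult_left_mono power_mono) auto
   moreover have "?k W * ?k W ^ (q - 1) = ?k W ^ q" using q power_minus_mult[of q "?k W"] by (simp add: mult.commute)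
   ultimately show "?k W * of_bool (?n \<le> ?k W) * ?n ^ (q - 1) \<le> ?k W ^ q" by (cases "?n \<le> ?k W") simp_all
  qed
  also have "\<dots> \<le> ball_moment N J q r"
   unfolding ball_moment_eq by (rule expct_le_integral[where w="wt kf" and z=0, OF wt_kf_nonneg finite_ball q E(1)])
  finally show ?thesis .
 qed
 have high: "ball_moment N J q r \<le> C * r powr ?e" if r: "r3 \<le> r" for r
 proof -
  have "r2 \<le> r" "r > 0" using r r3 by (auto simp: r3_def)
  show ?thesis
   unfolding ball_moment_eq eq[OF \<open>r > 0\<close>, symmetric]
   by (rule integral_least[where w="wt kf" and z=0, OF wt_kf_nonneg finite_ball q up[OF \<open>r2 \<le> r\<close>]])
 qed
 have c3: "0 < real (card (ball r3)) ^ q" using card_ball_pos[of r3] r3 by simp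
 show ?thesis
 proof (rule comparable_onI[where P="\<lambda>r. r3 \<le> r" and a=1 and b="real (card (ball r3)) ^ q" and gl=1 and gu="r3 powr ?e", OF c' C(1) _ c3])
  fix r :: real assume r: "r \<in> {1..}" "\<not> r3 \<le> r"
  have "ball_moment N J q r \<le> real (card (ball r)) ^ q" using r q by (intro ball_moment_bounds) auto
  also have "\<dots> \<le> real (card (ball r3)) ^ q"
   using r ball_mono[of r r3] by (intro power_mono of_nat_mono card_mono) auto
  finally have "ball_moment N J q r \<le> real (card (ball r3)) ^ q" .
  moreover have "1 \<le> ball_moment N J q r" using r q by (intro ball_moment_bounds) auto
  moreover have "1 \<le> r powr ?e" using r e by (intro ge_one_powr_ge_zero) auto
  moreover have "r powr ?e \<le> r3 powr ?e" using r e by (intro powr_mono2) auto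
  ultimately show "1 \<le> ball_moment N J q r \<and> ball_moment N J q r \<le> real (card (ball r3)) ^ q \<and>
    1 \<le> r powr ?e \<and> r powr ?e \<le> r3 powr ?e" by blast
 qed (use low high r3 in auto)
qed

lemma delta_exponent_iff:
 assumes d3: "real CARD('d) < 3 * \<alpha>"
 shows "is_delta_exponent N J \<delta> \<longleftrightarrow> \<delta> = ereal p / ereal (real CARD('d) - \<alpha>)"
proof -
 let ?d = "real CARD('d)"
 let ?\<theta> = "- (?d - \<alpha>) / p"
 obtain c C where c: "c > 0" "C > 0" "\<And>m. m \<ge> 1 \<Longrightarrow> c * real m powr ?\<theta> \<le> cluster_tail N J m \<and> cluster_tail N J m \<le> C * real m powr ?\<theta>"
  using tail_comparable[OF d3] unfolding comparable_on_def by auto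
 have "is_delta_exponent N J \<delta> \<longleftrightarrow> 0 < \<delta> \<and> - real_of_ereal (1 / \<delta>) = ?\<theta>"
  unfolding is_delta_exponent_def
  using exponent_iff[OF filterlim_real_sequentially sequentially_bot c(1,2) eventually_sequentiallyI[of 1, OF c(3)]]
  by (simp only:)
 also have "\<dots> \<longleftrightarrow> \<delta> = ereal p / ereal (?d - \<alpha>)"
 proof (cases "?d = \<alpha>")
  \<comment> \<open>Here the right-hand side is infinite, and the left-hand condition says 1 /
    \<delta> = 0 with \<delta> > 0.\<close>
  case True
  have "ereal p / ereal (?d - \<alpha>) = \<infinity>" using True p_pos by (simp add: divide_ereal_def)
  then show ?thesis using True p_pos by (cases \<delta>) (auto simp: divide_ereal_def)
 next
  case False
  then have d: "?d - \<alpha> > 0" using alpha_le_dim by simp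
  have "ereal p / ereal (?d - \<alpha>) = ereal (p / (?d - \<alpha>))" using d by simp
  moreover have "0 < r \<and> - (1 / r) = ?\<theta> \<longleftrightarrow> r = p / (?d - \<alpha>)" for r
  proof
   assume "r = p / (?d - \<alpha>)"
   then show "0 < r \<and> - (1 / r) = ?\<theta>" using d p_pos minus_divide_left[of "?d - \<alpha>" p] by simp
  qed (use d p_pos in \<open>auto simp: field_simps\<close>)
  moreover have "real_of_ereal (1 / ereal r) = 1 / r" if "0 < r" for r
   using that by (simp add: divide_ereal_def inverse_eq_divide)
  moreover have "?\<theta> \<noteq> 0" using d p_pos by simp
  ultimately show ?thesis using d p_pos
  proof (cases \<delta>)
   case (real r)
   then show ?thesis
    unfolding real \<open>ereal p / ereal (?d - \<alpha>) = ereal (p / (?d - \<alpha>))\<close>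
    using \<open>0 < r \<and> - (1 / r) = ?\<theta> \<longleftrightarrow> r = p / (?d - \<alpha>)\<close> \<open>0 < r \<Longrightarrow> real_of_ereal (1 / ereal r) = 1 / r\<close>
    by auto
  qed (auto simp: divide_ereal_def)
 qed
 finally show ?thesis .
qed

lemma fractal_dimension_iff:
 assumes d3: "real CARD('d) < 3 * \<alpha>"
 shows "is_fractal_dimension N J s \<longleftrightarrow> s = p / 2"
proof -
 obtain c1 C1 where 1: "c1 > 0" "C1 > 0" "\<And>r. r \<ge> 1 \<Longrightarrow> c1 * r powr \<alpha> \<le> ball_moment N J 1 r \<and> ball_moment N J 1 r \<le> C1 * r powr \<alpha>"
  using moments_comparable[OF d3, of 1] unfolding comparable_on_def by auto
 obtain c2 C2 where 2: "c2 > 0" "C2 > 0" "\<And>r. r \<ge> 1 \<Longrightarrow> c2 * r powr (\<alpha> + p / 2) \<le> ball_moment N J 2 r \<and> ball_moment N J 2 r \<le> C2 * r powr (\<alpha> + p / 2)"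
  using moments_comparable[OF d3, of 2] unfolding comparable_on_def by auto
 have "c2 / C1 * r powr (p / 2) \<le> ball_moment N J 2 r / ball_moment N J 1 r \<and>
   ball_moment N J 2 r / ball_moment N J 1 r \<le> C2 / c1 * r powr (p / 2)" if r: "r \<ge> 1" for r
 proof -
  have rp: "r powr \<alpha> > 0" "r powr (\<alpha> + p / 2) = r powr \<alpha> * r powr (p / 2)" using r by (auto simp: powr_add)
  have b: "1 \<le> ball_moment N J 1 r" using r by (intro ball_moment_bounds) auto
  have "c2 / C1 * r powr (p / 2) = (c2 * r powr (\<alpha> + p / 2)) / (C1 * r powr \<alpha>)" using rp by simp
  also have "\<dots> \<le> ball_moment N J 2 r / ball_moment N J 1 r"
   using 1 2 r b by (intro frac_le) (auto intro: order_trans[OF _ conjunct1[OF 2(3)]])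
  finally have l: "c2 / C1 * r powr (p / 2) \<le> ball_moment N J 2 r / ball_moment N J 1 r" .
  have "ball_moment N J 2 r / ball_moment N J 1 r \<le> (C2 * r powr (\<alpha> + p / 2)) / (c1 * r powr \<alpha>)"
   using 1 2 r b by (intro frac_le) auto
  also have "\<dots> = C2 / c1 * r powr (p / 2)" using rp by simp
  finally show ?thesis using l by simp
 qed
 then show ?thesis
  unfolding is_fractal_dimension_def using 1 2
  by (intro exponent_iff[of "\<lambda>r. r" at_top "c2 / C1" "C2 / c1"])
    (auto intro: filterlim_ident eventually_at_top_linorderI[of 1])
qed

end

theorem mainTheorem7:
  fixes N :: "real ^ 'd \<Rightarrow> real" and J :: "real \<Rightarrow> real" and \<alpha> d :: real
  defines "d \<equiv> real CARD('d)"
  assumes "\<alpha> > 0"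
    and "is_norm N"
    and "admissible_profile CARD('d) \<alpha> J"
    and "d < 3 * \<alpha>"
    and "correlation_length_condition N J"
  shows "comparable_on {1..} (cluster_tail N J) (\<lambda>n. real n powr (- (d - \<alpha>) / (d + \<alpha>)))
    \<and> (\<forall>p\<ge>1. comparable_on {1..} (ball_moment N J p)
               (\<lambda>r. r powr (\<alpha> + (real p - 1) * (d + \<alpha>) / 2)))
    \<and> (\<forall>\<delta>. is_delta_exponent N J \<delta> \<longleftrightarrow> \<delta> = ereal (d + \<alpha>) / ereal (d - \<alpha>))
    \<and> (\<forall>s. is_fractal_dimension N J s \<longleftrightarrow> s = (d + \<alpha>) / 2)"
proof -
 interpret crit N J \<alpha> using assms by unfold_locales auto
 have d3: "real CARD('d) < 3 * \<alpha>" using assms by simp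
 have "p = d + \<alpha>" by (simp add: p_def d_def)
 then show ?thesis
  using tail_comparable[OF d3] moments_comparable[OF d3] delta_exponent_iff[OF d3] fractal_dimension_iff[OF d3]
  unfolding d_def by simp
qed

end
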